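(* Let $R$ be a (nonzero) commutative ring with unit and let $G$ be an infinite group. The following are equivalent: 1. $G$ is Bredon--Poincaré duality over $R$, of dimension $1$. 2. $G$ is virtually infinite cyclic. 3. $G$ is virtually Poincaré duality over $R$, of dimension $1$.
   Context: A group $\Gamma$ is Poincaré duality over $R$ of dimension $n$ if it is of type $\mathrm{FP}$ over $R$ (type $\mathrm{FP}_\infty$ over $R$ and $\mathrm{cd}_R\Gamma<\infty$), $H^n(\Gamma,R\Gamma)\cong R$ and $H^i(\Gamma,R\Gamma)=0$ for $i\ne n$. A group is virtually Poincaré duality (virtually infinite cyclic) if it has a finite index subgroup which is Poincaré duality (infinite cyclic). The orbit category $\mathcal{O}_{\mathfrak{Fin}}$ of $G$ has objects $G/H$, $H\le G$ finite, and morphisms $G/H\to G/K$ the free abelian group on the $G$-maps. $\mathcal{O}_{\mathfrak{Fin}}$-modules over $R$ are contravariant additive functors to $R$-modules. Finitely generated means a quotient of a finite direct sum of modules $R\otimes_{\mathbb{Z}}\mathrm{Hom}_{\mathcal{O}_{\mathfrak{Fin}}}(-,G/H)$. $\underline{R}$ is the constant module with value $R$. $\mathcal{O}_{\mathfrak{Fin}}\mathrm{cd}_R\,G$ is the minimal length of a projective resolution of $\underline{R}$. $G$ is of type $\mathcal{O}_{\mathfrak{Fin}}\mathrm{FP}$ over $R$ if this is finite and $\underline{R}$ has a resolution by finitely generated projectives. $G$ is Bredon--Poincaré duality over $R$ if it is of type $\mathcal{O}_{\mathfrak{Fin}}\mathrm{FP}$ over $R$ and for every finite subgroup $H$ there is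 an integer $d_H$ such that, with $WH=N_GH/H$, $H^i(WH,R[WH])\cong R$ for $i=d_H$ and is $0$ for all other $i$. Its dimension is $\mathcal{O}_{\mathfrak{Fin}}\mathrm{cd}_R\,G$. *)

theory Defs
  imports "HOL-Algebra.Free_Abelian_Groups" "HOL-Algebra.Group_Action" "HOL-Algebra.Left_Coset"
    "HOL-Algebra.Module" "HOL-Algebra.AbelCoset" "HOL-Library.Extended_Nat"
begin

section \<open>Modules over a commutative ring\<close>

definition linear_maps ::
    "('r, 'x) ring_scheme \<Rightarrow> ('r, 'a, 'y) module_scheme \<Rightarrow> ('r, 'b, 'z) module_scheme \<Rightarrow> ('a \<Rightarrow> 'b) set"
  where "linear_maps R M N =
    {h. h \<in> carrier M \<rightarrow> carrier N \<and>
        (\<forall>a\<in>carrier M. \<forall>b\<in>carrier M. h (a \<oplus>\<^bsub>M\<^esub> b) = h a \<oplus>\<^bsub>N\<^esub> h b) \<and>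
        (\<forall>r\<in>carrier R. \<forall>a\<in>carrier M. h (r \<odot>\<^bsub>M\<^esub> a) = r \<odot>\<^bsub>N\<^esub> h a)}"

definition mod_isomorphic ::
    "('r, 'x) ring_scheme \<Rightarrow> ('r, 'a, 'y) module_scheme \<Rightarrow> ('r, 'b, 'z) module_scheme \<Rightarrow> bool"
  where "mod_isomorphic R M N \<longleftrightarrow> (\<exists>h\<in>linear_maps R M N. bij_betw h (carrier M) (carrier N))"

definition zero_mod :: "('r, 'a, 'y) module_scheme \<Rightarrow> bool"
  where "zero_mod M \<longleftrightarrow> carrier M = {\<zero>\<^bsub>M\<^esub>}"

text \<open>The multiplicative fields of a \<^verbatim>\<open>module\<close> record play no role for modules,
  hence the \<^term>\<open>undefined\<close> below.\<close>

definition regular_mod :: "('r, 'x) ring_scheme \<Rightarrow> ('r, 'r) module"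
  where "regular_mod R =
    \<lparr>carrier = carrier R, monoid.mult = undefined, one = undefined, ring.zero = \<zero>\<^bsub>R\<^esub>,
     add = add R, smult = monoid.mult R\<rparr>"

text \<open>\<open>R[X]\<close>, the free \<open>R\<close>-module on the set \<open>X\<close>: finitely supported functions.\<close>

definition free_mod :: "('r, 'x) ring_scheme \<Rightarrow> 'k set \<Rightarrow> ('r, 'k \<Rightarrow> 'r) module"
  where "free_mod R X =
    \<lparr>carrier = {f. (\<forall>k. f k \<in> carrier R) \<and> {k. f k \<noteq> \<zero>\<^bsub>R\<^esub>} \<subseteq> X \<and> finite {k. f k \<noteq> \<zero>\<^bsub>R\<^esub>}},
     monoid.mult = undefined, one = undefined, ring.zero = (\<lambda>k. \<zero>\<^bsub>R\<^esub>), add = (\<lambda>f g k. f k \<oplus>\<^bsub>R\<^esub> g k),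
     smult = (\<lambda>r f k. r \<otimes>\<^bsub>R\<^esub> f k)\<rparr>"

definition direct_sum_mod :: "'i set \<Rightarrow> ('i \<Rightarrow> ('r, 'a) module) \<Rightarrow> ('r, 'i \<Rightarrow> 'a) module"
  where "direct_sum_mod I M =
    \<lparr>carrier = {s \<in> (\<Pi>\<^sub>E i\<in>I. carrier (M i)). finite {i\<in>I. s i \<noteq> \<zero>\<^bsub>M i\<^esub>}},
     monoid.mult = undefined, one = undefined, ring.zero = (\<lambda>i\<in>I. \<zero>\<^bsub>M i\<^esub>),
     add = (\<lambda>s t. \<lambda>i\<in>I. s i \<oplus>\<^bsub>M i\<^esub> t i), smult = (\<lambda>r s. \<lambda>i\<in>I. r \<odot>\<^bsub>M i\<^esub> s i)\<rparr>"

definition quotient_mod :: "('r, 'a) module \<Rightarrow> 'a set \<Rightarrow> ('r, 'a set) module"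
  where "quotient_mod M N =
    \<lparr>carrier = a_rcosets\<^bsub>M\<^esub> N, monoid.mult = undefined, one = undefined, ring.zero = N, add = set_add M,
     smult = (\<lambda>r X. \<Union>x\<in>X. N +>\<^bsub>M\<^esub> (r \<odot>\<^bsub>M\<^esub> x))\<rparr>"


section \<open>Group cohomology\<close>

text \<open>\<open>H\<^sup>n(\<Gamma>, M)\<close> is the cohomology of the complex of inhomogeneous cochains
  \<open>\<Gamma>\<^sup>n \<rightarrow> M\<close>, where \<open>act\<close> is an \<open>R\<close>-linear left action of \<open>\<Gamma>\<close> on \<open>M\<close>;
  elements of \<open>\<Gamma>\<^sup>n\<close> are lists of length \<open>n\<close>.\<close>

definition tuples :: "('g, 'y) monoid_scheme \<Rightarrow> nat \<Rightarrow> 'g list set"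
  where "tuples \<Gamma> n = {gs. length gs = n \<and> set gs \<subseteq> carrier \<Gamma>}"

definition cochains ::
    "('g, 'y) monoid_scheme \<Rightarrow> ('r, 'a) module \<Rightarrow> nat \<Rightarrow> ('r, 'g list \<Rightarrow> 'a) module"
  where "cochains \<Gamma> M n =
    \<lparr>carrier = tuples \<Gamma> n \<rightarrow>\<^sub>E carrier M, monoid.mult = undefined, one = undefined,
     ring.zero = (\<lambda>gs\<in>tuples \<Gamma> n. \<zero>\<^bsub>M\<^esub>), add = (\<lambda>f f'. \<lambda>gs\<in>tuples \<Gamma> n. f gs \<oplus>\<^bsub>M\<^esub> f' gs),
     smult = (\<lambda>r f. \<lambda>gs\<in>tuples \<Gamma> n. r \<odot>\<^bsub>M\<^esub> f gs)\<rparr>"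

definition signed :: "('r, 'a) module \<Rightarrow> nat \<Rightarrow> 'a \<Rightarrow> 'a"
  where "signed M j a = (if even j then a else \<ominus>\<^bsub>M\<^esub> a)"

definition merge :: "('g, 'y) monoid_scheme \<Rightarrow> nat \<Rightarrow> 'g list \<Rightarrow> 'g list"
  where "merge \<Gamma> j gs = take j gs @ [gs ! j \<otimes>\<^bsub>\<Gamma>\<^esub> gs ! Suc j] @ drop (j + 2) gs"

definition coboundary ::
    "('g, 'y) monoid_scheme \<Rightarrow> ('r, 'a) module \<Rightarrow> ('g \<Rightarrow> 'a \<Rightarrow> 'a) \<Rightarrow> nat \<Rightarrow>
     ('g list \<Rightarrow> 'a) \<Rightarrow> 'g list \<Rightarrow> 'a"
  where "coboundary \<Gamma> M act n f =
    (\<lambda>gs\<in>tuples \<Gamma> (Suc n).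
       act (hd gs) (f (tl gs)) \<oplus>\<^bsub>M\<^esub>
       (\<Oplus>\<^bsub>M\<^esub>j\<in>{..<n}. signed M (Suc j) (f (merge \<Gamma> j gs))) \<oplus>\<^bsub>M\<^esub>
       signed M (Suc n) (f (butlast gs)))"

definition cocycles ::
    "('g, 'y) monoid_scheme \<Rightarrow> ('r, 'a) module \<Rightarrow> ('g \<Rightarrow> 'a \<Rightarrow> 'a) \<Rightarrow> nat \<Rightarrow> ('g list \<Rightarrow> 'a) set"
  where "cocycles \<Gamma> M act n =
    {f \<in> carrier (cochains \<Gamma> M n). coboundary \<Gamma> M act n f = \<zero>\<^bsub>cochains \<Gamma> M (Suc n)\<^esub>}"

fun coboundaries ::
    "('g, 'y) monoid_scheme \<Rightarrow> ('r, 'a) module \<Rightarrow> ('g \<Rightarrow> 'a \<Rightarrow> 'a) \<Rightarrow> nat \<Rightarrow> ('g list \<Rightarrow> 'a) set"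
  where
    "coboundaries \<Gamma> M act 0 = {\<zero>\<^bsub>cochains \<Gamma> M 0\<^esub>}"
  | "coboundaries \<Gamma> M act (Suc n) = coboundary \<Gamma> M act n ` carrier (cochains \<Gamma> M n)"

definition group_cohomology ::
    "('g, 'y) monoid_scheme \<Rightarrow> ('r, 'a) module \<Rightarrow> ('g \<Rightarrow> 'a \<Rightarrow> 'a) \<Rightarrow> nat \<Rightarrow>
     ('r, ('g list \<Rightarrow> 'a) set) module"
  where "group_cohomology \<Gamma> M act n =
    quotient_mod ((cochains \<Gamma> M n)\<lparr>carrier := cocycles \<Gamma> M act n\<rparr>) (coboundaries \<Gamma> M act n)"

text \<open>Left multiplication on the group ring \<open>R\<Gamma> = R[\<Gamma>]\<close>.\<close>

definition group_ring_act ::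
    "('r, 'x) ring_scheme \<Rightarrow> ('g, 'y) monoid_scheme \<Rightarrow> 'g \<Rightarrow> ('g \<Rightarrow> 'r) \<Rightarrow> 'g \<Rightarrow> 'r"
  where "group_ring_act R \<Gamma> g a =
    (\<lambda>x. if x \<in> carrier \<Gamma> then a (inv\<^bsub>\<Gamma>\<^esub> g \<otimes>\<^bsub>\<Gamma>\<^esub> x) else \<zero>\<^bsub>R\<^esub>)"

definition cohomology_group_ring ::
    "('r, 'x) ring_scheme \<Rightarrow> ('g, 'y) monoid_scheme \<Rightarrow> nat \<Rightarrow> ('r, ('g list \<Rightarrow> 'g \<Rightarrow> 'r) set) module"
  where "cohomology_group_ring R \<Gamma> n =
    group_cohomology \<Gamma> (free_mod R (carrier \<Gamma>)) (group_ring_act R \<Gamma>) n"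


section \<open>Modules over a category\<close>

text \<open>\<open>Comp C x g f\<close> is the composite of \<open>f\<close>, a morphism with domain \<open>x\<close>, followed by \<open>g\<close>.\<close>

record ('o, 'k) cat =
  Obj :: "'o set"
  Hom :: "'o \<Rightarrow> 'o \<Rightarrow> 'k set"
  Id :: "'o \<Rightarrow> 'k"
  Comp :: "'o \<Rightarrow> 'k \<Rightarrow> 'k \<Rightarrow> 'k"

text \<open>The preadditive category generated by \<open>C\<close>: its morphisms \<open>x \<rightarrow> y\<close> form the free abelian
  group on \<open>Hom C x y\<close>, and composition is extended bilinearly.\<close>

definition lin_hom :: "('o, 'k) cat \<Rightarrow> 'o \<Rightarrow> 'o \<Rightarrow> ('k \<Rightarrow>\<^sub>0 int) set"
  where "lin_hom C x y = carrier (free_Abelian_group (Hom C x y))"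

definition lin_comp :: "('o, 'k) cat \<Rightarrow> 'o \<Rightarrow> ('k \<Rightarrow>\<^sub>0 int) \<Rightarrow> ('k \<Rightarrow>\<^sub>0 int) \<Rightarrow> ('k \<Rightarrow>\<^sub>0 int)"
  where "lin_comp C x d c =
    frag_extend (\<lambda>g. frag_extend (\<lambda>f. frag_of (Comp C x g f)) c) d"

text \<open>A \<open>C\<close>-module over \<open>R\<close> is a contravariant additive functor from this preadditive category to
  \<open>R\<close>-modules: \<open>Fib M x\<close> is its value at \<open>x\<close>, and a morphism \<open>c : x \<rightarrow> y\<close> induces
  \<open>Act M x y c : Fib M y \<rightarrow> Fib M x\<close>.\<close>

record ('o, 'k, 'r, 'a) cat_module =
  Fib :: "'o \<Rightarrow> ('r, 'a) module"
  Act :: "'o \<Rightarrow> 'o \<Rightarrow> ('k \<Rightarrow>\<^sub>0 int) \<Rightarrow> 'a \<Rightarrow> 'a"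

definition is_cat_module ::
    "('r, 'x) ring_scheme \<Rightarrow> ('o, 'k) cat \<Rightarrow> ('o, 'k, 'r, 'a) cat_module \<Rightarrow> bool"
  where "is_cat_module R C M \<longleftrightarrow>
    (\<forall>x\<in>Obj C. Module.module R (Fib M x)) \<and>
    (\<forall>x\<in>Obj C. \<forall>y\<in>Obj C. \<forall>c\<in>lin_hom C x y. Act M x y c \<in> linear_maps R (Fib M y) (Fib M x)) \<and>
    (\<forall>x\<in>Obj C. \<forall>y\<in>Obj C. \<forall>c\<in>lin_hom C x y. \<forall>c'\<in>lin_hom C x y. \<forall>a\<in>carrier (Fib M y).
       Act M x y (c + c') a = Act M x y c a \<oplus>\<^bsub>Fib M x\<^esub> Act M x y c' a) \<and>
    (\<forall>x\<in>Obj C. \<forall>a\<in>carrier (Fib M x). Act M x x (frag_of (Id C x)) a = a) \<and>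
    (\<forall>x\<in>Obj C. \<forall>y\<in>Obj C. \<forall>z\<in>Obj C. \<forall>c\<in>lin_hom C x y. \<forall>d\<in>lin_hom C y z.
       \<forall>a\<in>carrier (Fib M z). Act M x z (lin_comp C x d c) a = Act M x y c (Act M y z d a))"

definition cat_module_hom ::
    "('r, 'x) ring_scheme \<Rightarrow> ('o, 'k) cat \<Rightarrow> ('o, 'k, 'r, 'a) cat_module \<Rightarrow>
     ('o, 'k, 'r, 'b) cat_module \<Rightarrow> ('o \<Rightarrow> 'a \<Rightarrow> 'b) set"
  where "cat_module_hom R C M N =
    {t. (\<forall>x\<in>Obj C. t x \<in> linear_maps R (Fib M x) (Fib N x)) \<and>
        (\<forall>x\<in>Obj C. \<forall>y\<in>Obj C. \<forall>c\<in>lin_hom C x y. \<forall>a\<in>carrier (Fib M y).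
           t x (Act M x y c a) = Act N x y c (t y a))}"

text \<open>The constant module: every morphism of \<open>C\<close> acts as the identity of \<open>R\<close>, so a formal sum
  acts as multiplication by the sum of its coefficients.\<close>

definition const_module :: "('r, 'x) ring_scheme \<Rightarrow> ('o, 'k, 'r, 'r) cat_module"
  where "const_module R =
    \<lparr>Fib = (\<lambda>x. regular_mod R),
     Act = (\<lambda>x y c a. [(\<Sum>f\<in>Poly_Mapping.keys c. Poly_Mapping.lookup c f)] \<cdot>\<^bsub>R\<^esub> a)\<rparr>"

text \<open>The module \<open>R \<otimes> Hom(-, z)\<close>. Its value at \<open>x\<close>, the tensor product over the integers of \<open>R\<close>
  with the free abelian group on \<open>Hom C x z\<close>, is \<open>R[Hom C x z]\<close>.\<close>

definition rep_module ::
    "('r, 'x) ring_scheme \<Rightarrow> ('o, 'k) cat \<Rightarrow> 'o \<Rightarrow> ('o, 'k, 'r, 'k \<Rightarrow> 'r) cat_module"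
  where "rep_module R C z =
    \<lparr>Fib = (\<lambda>x. free_mod R (Hom C x z)),
     Act = (\<lambda>x y c a k.
       \<Oplus>\<^bsub>R\<^esub>p\<in>{p. a (fst p) \<noteq> \<zero>\<^bsub>R\<^esub> \<and> snd p \<in> Poly_Mapping.keys c \<and> Comp C x (fst p) (snd p) = k}.
         [Poly_Mapping.lookup c (snd p)] \<cdot>\<^bsub>R\<^esub> a (fst p))\<rparr>"

definition direct_sum ::
    "'i set \<Rightarrow> ('i \<Rightarrow> ('o, 'k, 'r, 'a) cat_module) \<Rightarrow> ('o, 'k, 'r, 'i \<Rightarrow> 'a) cat_module"
  where "direct_sum I M =
    \<lparr>Fib = (\<lambda>x. direct_sum_mod I (\<lambda>i. Fib (M i) x)),
     Act = (\<lambda>x y c s. \<lambda>i\<in>I. Act (M i) x y c (s i))\<rparr>"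

definition fin_generated ::
    "('r, 'x) ring_scheme \<Rightarrow> ('o, 'k) cat \<Rightarrow> ('o, 'k, 'r, 'a) cat_module \<Rightarrow> bool"
  where "fin_generated R C M \<longleftrightarrow>
    (\<exists>(n::nat) z. z \<in> {..<n} \<rightarrow> Obj C \<and>
       (\<exists>t\<in>cat_module_hom R C (direct_sum {..<n} (\<lambda>i. rep_module R C (z i))) M.
          \<forall>x\<in>Obj C. t x ` carrier (Fib (direct_sum {..<n} (\<lambda>i. rep_module R C (z i))) x)
                      = carrier (Fib M x)))"

text \<open>Projective: a direct summand of a free module, i.e. of a direct sum of modules
  \<open>R \<otimes> Hom(-, z)\<close>. Index sets of type \<open>'o \<times> 'a\<close> are large enough, since the elements of \<open>P\<close>
  themselves generate \<open>P\<close>.\<close>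

definition projective ::
    "('r, 'x) ring_scheme \<Rightarrow> ('o, 'k) cat \<Rightarrow> ('o, 'k, 'r, 'a) cat_module \<Rightarrow> bool"
  where "projective R C P \<longleftrightarrow> is_cat_module R C P \<and>
    (\<exists>(I :: ('o \<times> 'a) set) z. z \<in> I \<rightarrow> Obj C \<and>
       (\<exists>s\<in>cat_module_hom R C P (direct_sum I (\<lambda>i. rep_module R C (z i))).
        \<exists>r\<in>cat_module_hom R C (direct_sum I (\<lambda>i. rep_module R C (z i))) P.
          \<forall>x\<in>Obj C. \<forall>a\<in>carrier (Fib P x). r x (s x a) = a))"

text \<open>\<open>P\<close> with differentials \<open>d i : P (Suc i) \<rightarrow> P i\<close> and augmentation \<open>e\<close> is a projective
  resolution of the constant module.\<close>

definition proj_resolution ::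
    "('r, 'x) ring_scheme \<Rightarrow> ('o, 'k) cat \<Rightarrow> (nat \<Rightarrow> ('o, 'k, 'r, 'a) cat_module) \<Rightarrow>
     (nat \<Rightarrow> 'o \<Rightarrow> 'a \<Rightarrow> 'a) \<Rightarrow> ('o \<Rightarrow> 'a \<Rightarrow> 'r) \<Rightarrow> bool"
  where "proj_resolution R C P d e \<longleftrightarrow>
    (\<forall>i. projective R C (P i)) \<and>
    (\<forall>i. d i \<in> cat_module_hom R C (P (Suc i)) (P i)) \<and>
    e \<in> cat_module_hom R C (P 0) (const_module R) \<and>
    (\<forall>x\<in>Obj C.
       e x ` carrier (Fib (P 0) x) = carrier R \<and>
       d 0 x ` carrier (Fib (P 1) x) = {a \<in> carrier (Fib (P 0) x). e x a = \<zero>\<^bsub>R\<^esub>} \<and>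
       (\<forall>i. d (Suc i) x ` carrier (Fib (P (i + 2)) x)
              = {a \<in> carrier (Fib (P (Suc i)) x). d i x a = \<zero>\<^bsub>Fib (P i) x\<^esub>}))"

text \<open>Resolutions are sought among modules with elements in \<open>'k list \<Rightarrow> 'r\<close>. For the two kinds of
  categories below this is no restriction: \<open>R\<close>, the hom sets and the set of objects have
  cardinality at most that of this type, and by Schanuel's lemma a resolution of minimal length
  can be cut out of the free resolution on all strings of composable morphisms. The value is
  \<open>\<infinity>\<close> if there is no resolution of finite length.\<close>

definition cat_cd :: "('r, 'x) ring_scheme \<Rightarrow> ('o, 'k) cat \<Rightarrow> enat"
  where "cat_cd R C =
    Inf {enat n | n. \<exists>(P :: nat \<Rightarrow> ('o, 'k, 'r, 'k list \<Rightarrow> 'r) cat_module) d e.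
      proj_resolution R C P d e \<and> (\<forall>i>n. \<forall>x\<in>Obj C. zero_mod (Fib (P i) x))}"

definition type_FP :: "('r, 'x) ring_scheme \<Rightarrow> ('o, 'k) cat \<Rightarrow> bool"
  where "type_FP R C \<longleftrightarrow> cat_cd R C < \<infinity> \<and>
    (\<exists>(P :: nat \<Rightarrow> ('o, 'k, 'r, 'k list \<Rightarrow> 'r) cat_module) d e.
      proj_resolution R C P d e \<and> (\<forall>i. fin_generated R C (P i)))"


section \<open>Poincare duality groups\<close>

text \<open>The group as a category with one object. Modules over it are (right) \<open>R\<Gamma>\<close>-modules, the
  module \<open>R \<otimes> Hom(-, ())\<close> is \<open>R\<Gamma>\<close> and the constant module is the trivial module \<open>R\<close>. Hence
  \<open>type_FP R (group_cat \<Gamma>)\<close> says that \<open>\<Gamma>\<close> is of type \<open>FP\<close> over \<open>R\<close>.\<close>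

definition group_cat :: "('g, 'y) monoid_scheme \<Rightarrow> (unit, 'g) cat"
  where "group_cat \<Gamma> =
    \<lparr>Obj = {()}, Hom = (\<lambda>_ _. carrier \<Gamma>), Id = (\<lambda>_. \<one>\<^bsub>\<Gamma>\<^esub>), Comp = (\<lambda>_ g f. g \<otimes>\<^bsub>\<Gamma>\<^esub> f)\<rparr>"

definition cohomology_concentrated ::
    "('r, 'x) ring_scheme \<Rightarrow> ('g, 'y) monoid_scheme \<Rightarrow> nat \<Rightarrow> bool"
  where "cohomology_concentrated R \<Gamma> n \<longleftrightarrow>
    mod_isomorphic R (cohomology_group_ring R \<Gamma> n) (regular_mod R) \<and>
    (\<forall>i. i \<noteq> n \<longrightarrow> zero_mod (cohomology_group_ring R \<Gamma> i))"

definition poincare_duality ::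
    "('r, 'x) ring_scheme \<Rightarrow> ('g, 'y) monoid_scheme \<Rightarrow> nat \<Rightarrow> bool"
  where "poincare_duality R \<Gamma> n \<longleftrightarrow>
    type_FP R (group_cat \<Gamma>) \<and> cohomology_concentrated R \<Gamma> n"

definition virtually ::
    "(('g, 'y) monoid_scheme \<Rightarrow> bool) \<Rightarrow> ('g, 'y) monoid_scheme \<Rightarrow> bool"
  where "virtually \<P> G \<longleftrightarrow>
    (\<exists>H. subgroup H G \<and> finite (rcosets\<^bsub>G\<^esub> H) \<and> \<P> (G\<lparr>carrier := H\<rparr>))"

definition infinite_cyclic :: "('g, 'y) monoid_scheme \<Rightarrow> bool"
  where "infinite_cyclic G \<longleftrightarrow> cyclic_group G \<and> infinite (carrier G)"


section \<open>Bredon--Poincare duality groups\<close>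

text \<open>The coset space \<open>G/H\<close> is \<open>lcosets H\<close>, with \<open>G\<close> acting by left translation.\<close>

definition orbit_cat :: "('g, 'y) monoid_scheme \<Rightarrow> ('g set set, 'g set \<Rightarrow> 'g set) cat"
  where "orbit_cat G =
    \<lparr>Obj = {lcosets\<^bsub>G\<^esub> H | H. subgroup H G \<and> finite H},
     Hom = (\<lambda>X Y. {f \<in> X \<rightarrow>\<^sub>E Y. \<forall>g\<in>carrier G. \<forall>A\<in>X. f (g <#\<^bsub>G\<^esub> A) = g <#\<^bsub>G\<^esub> f A}),
     Id = (\<lambda>X. \<lambda>A\<in>X. A),
     Comp = (\<lambda>X g f. compose X g f)\<rparr>"

definition weyl_group :: "('g, 'y) monoid_scheme \<Rightarrow> 'g set \<Rightarrow> 'g set monoid"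
  where "weyl_group G H = G\<lparr>carrier := normalizer G H\<rparr> Mod H"

definition bredon_cd :: "('r, 'x) ring_scheme \<Rightarrow> ('g, 'y) monoid_scheme \<Rightarrow> enat"
  where "bredon_cd R G = cat_cd R (orbit_cat G)"

definition bredon_poincare_duality ::
    "('r, 'x) ring_scheme \<Rightarrow> ('g, 'y) monoid_scheme \<Rightarrow> bool"
  where "bredon_poincare_duality R G \<longleftrightarrow>
    type_FP R (orbit_cat G) \<and>
    (\<forall>H. subgroup H G \<and> finite H \<longrightarrow> (\<exists>d. cohomology_concentrated R (weyl_group G H) d))"

end

(*
  If R is the only nonzero cohomology group of WH with H = 1 and sits in degree 1, then almost
  invariant functions on G modulo constants form a free R-module of rank one. Their transformation
  under right translations yields an element of infinite order whose powers have finite index: a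
  group with two ends is virtually infinite cyclic. For a Bredon duality group of dimension 1 the degree
  of H = 1 must be 1: otherwise almost invariant functions are almost constant, so the derivation
  from G to the first module of a resolution of length 1 is inner, and a section of the augmentation
  at the free orbit can be made invariant, which is impossible for infinite G.

  Conversely, a virtually infinite cyclic group acts on the line with finite stabilisers (the
  translation part is the transfer to a normal infinite cyclic subgroup), finite subgroups fix the
  whole line or a vertex, and the cellular chains are a resolution of length 1 by finitely
  generated free modules over the orbit category.
*)

theory Submission
 imports Defs "HOL-Algebra.Zassenhaus"
begin

section \<open>Almost invariant functions and virtually infinite cyclic groups\<close>

text \<open>Two obstacles shape the proof: \<open>R\<close> is an arbitrary commutative ring, so
  there is no division, and \<open>G\<close> is not known to be finitely generated. Rank one is used
  through one generator \<open>f0\<close>: right translation by \<open>h\<close> turns it into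
  \<open>mu h\<close> times \<open>f0\<close> plus a constant, up to finitely many points, and
  \<open>mu h\<close> is a unit. Hence the behaviour of \<open>f0\<close> on one coset determines it
  on all others, which yields finite generation, finitely many values, and an infinite level set
  with infinite complement. The element of infinite order comes from the flux through that set: the
  number of points that a right translation moves out minus the number that it moves in. In the
  Cayley graph, an element that moves the boundary far away makes the set and its translate nested,
  so flux zero occurs only finitely often. On the line, levels are taken modulo 4 because
  reflections then preserve the orientation of edges and fix a vertex, never the midpoint of an
  edge. So no sign representation appears and the chain modules are free.\<close>

definition cofin :: "('g, 'y) monoid_scheme => 'g filter"
 where "cofin G = inf cofinite (principal (carrier G))"

lemma eventually_cofin:
 "eventually P (cofin G) \<longleftrightarrow> finite {x : carrier G. \<not> P x}"
 unfolding cofin_def eventually_inf_principal eventually_cofinite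
 by (rule arg_cong[where f = finite]) auto

lemma eventually_cofin_happens:
 "[|infinite X; X \<subseteq> carrier G; eventually P (cofin G)|] ==> \<exists>x\<in>X. P x"
 unfolding eventually_cofin using finite_subset[of X "{x : carrier G. \<not> P x}"] by blast

lemma eventually_cofin_carrier: "eventually (%x. x : carrier G) (cofin G)"
 by (simp add: eventually_cofin)

lemma (in group) eventually_cofin_inj:
 assumes "eventually P (cofin G)" "inj_on u (carrier G)" "u : carrier G \<rightarrow> carrier G"
 shows "eventually (%x. P (u x)) (cofin G)"
proof -
 have "u ` {x : carrier G. \<not> P (u x)} \<subseteq> {x : carrier G. \<not> P x}"
  using assms(3) by auto
 then have "finite (u ` {x : carrier G. \<not> P (u x)})"
  using assms(1) finite_subset unfolding eventually_cofin by blast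
 then show ?thesis
  unfolding eventually_cofin by (rule finite_imageD) (rule inj_on_subset[OF assms(2)], auto)
qed

lemma (in group) eventually_cofin_left:
 "[|eventually P (cofin G); g : carrier G|] ==> eventually (%x. P (g \<otimes> x)) (cofin G)"
 by (rule eventually_cofin_inj) (auto simp: inj_on_def)

lemma (in group) eventually_cofin_right:
 "[|eventually P (cofin G); g : carrier G|] ==> eventually (%x. P (x \<otimes> g)) (cofin G)"
 by (rule eventually_cofin_inj) (auto simp: inj_on_def)

text \<open>The working form of virtual cyclicity: an element of infinite order and a finite set
  \<open>F\<close> that meets every right coset of its powers.
  \<open>virtually_infinite_cyclic_iff\<close> identifies it with condition 2.\<close>

definition virt_cyclic :: "('g, 'y) monoid_scheme => bool"
 where "virt_cyclic G \<longleftrightarrow>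
  (\<exists>t\<in>carrier G. EX F. finite F & F \<subseteq> carrier G & (\<forall>n::int. t [^]\<^bsub>G\<^esub> n = \<one>\<^bsub>G\<^esub> --> n = 0) &
  (\<forall>x\<in>carrier G. \<exists>n::int. \<exists>f\<in>F. x = t [^]\<^bsub>G\<^esub> n \<otimes>\<^bsub>G\<^esub> f))"

section \<open>Almost invariant sets in the Cayley graph of a finitely generated group\<close>

lemma (in group) generate_closed_set:
 assumes S: "S \<subseteq> carrier G" and V: "V \<subseteq> carrier G"
  and cl: "!!s x. [|s : S; x : V|] ==> s \<otimes> x : V & inv s \<otimes> x : V"
  and g: "g : generate G S" and x: "x : V"
 shows "g \<otimes> x : V"
 using g x
proof (induction arbitrary: x rule: generate.induct)
 case one
 then show ?case using V by auto
next
 case (incl h)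
 then show ?case using cl by auto
next
 case (inv h)
 then show ?case using cl by auto
next
 case (eng h1 h2)
 have "h1 : carrier G" "h2 : carrier G" using eng.hyps generate_in_carrier[OF S] by auto
 moreover have "h1 \<otimes> (h2 \<otimes> x) : V" using eng by blast
 ultimately show ?case using eng.prems V by (auto simp: m_assoc)
qed

text \<open>Left translations move only finitely many points across the border of \<open>A\<close>.
  The assumption \<open>two_ended\<close> is what rank one leaves of the right action: a right
  translate is, up to finitely many points, \<open>A\<close> or its complement.\<close>

locale almost_invariant_set = group +
 fixes S A
 assumes fin_S: "finite S" and S_carr: "S \<subseteq> carrier G" and S_inv: "s : S ==> inv s : S"
  and gen: "generate G S = carrier G"
  and A_carr: "A \<subseteq> carrier G" and inf_A: "infinite A" and coinf_A: "infinite (carrier G - A)"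
  and almost: "g : carrier G ==> eventually (%x. g \<otimes> x : A \<longleftrightarrow> x : A) (cofin G)"
  and two_ended: "h : carrier G ==> eventually (%x. x \<otimes> h : A \<longleftrightarrow> x : A) (cofin G) \<or>
  eventually (%x. x \<otimes> h : A \<longleftrightarrow> x \<notin> A) (cofin G)"
begin

text \<open>This is connectedness of the Cayley graph with edges from \<open>x\<close> to
  \<open>s \<otimes> x\<close>; steps along inverse generators are covered because \<open>S\<close>
  is symmetric.\<close>

lemma connected:
 assumes "V \<subseteq> carrier G" "V ~= {}" "!!s x. [|s : S; x : V|] ==> s \<otimes> x : V"
 shows "V = carrier G"
proof -
 obtain x where x: "x : V" using assms(2) by auto
 have "y : V" if y: "y : carrier G" for y
 proof -
  have "y \<otimes> inv x : generate G S" using gen x y assms(1) by auto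
  then have "(y \<otimes> inv x) \<otimes> x : V"
  using generate_closed_set[OF S_carr assms(1) _ _ x] assms(3) S_inv by blast
  then show ?thesis using x y assms(1) by (simp add: m_assoc subsetD)
 qed
 then show ?thesis using assms(1) by auto
qed

text \<open>The vertex boundary in this graph. Right multiplications are graph automorphisms, so the
  boundary of the translate \<open>shift h\<close> is the translated boundary
  (\<open>bd_shift\<close>).\<close>

definition bd where "bd B = {x : carrier G. \<exists>s\<in>S. (s \<otimes> x : B) ~= (x : B)}"

definition shift where "shift h = {x : carrier G. x \<otimes> h : A}"

lemma fin_bd: "finite (bd A)"
proof -
 have "eventually (%x. \<forall>s\<in>S. s \<otimes> x : A \<longleftrightarrow> x : A) (cofin G)"
  using fin_S S_carr almost by (intro eventually_ball_finite) auto
 then show ?thesis unfolding eventually_cofin bd_def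
  by (rule rev_finite_subset) auto
qed

lemma bd_shift: "h : carrier G ==> bd (shift h) = {x : carrier G. x \<otimes> h : bd A}"
 using S_carr by (auto simp: bd_def shift_def m_assoc subset_iff)

lemma bd_nonempty: "bd A ~= {}"
proof
 assume "bd A = {}"
 then have "A = carrier G"
  using connected[of A] A_carr inf_A by (fastforce simp: bd_def)
 then show False using coinf_A by auto
qed

text \<open>\<open>P\<close> collects the vertices, short of the last one, of a path from the
  identity to \<open>c\<close>: membership in \<open>B\<close> changes along the path only at a
  boundary point of \<open>B\<close>.\<close>

lemma linked:
 assumes c: "c : carrier G"
 shows "EX P. finite P & P \<subseteq> carrier G & (ALL B. bd B \<inter> P = {} --> (c : B \<longleftrightarrow> \<one> : B))"
proof -
 define V where "V = {c : carrier G. EX P. finite P & P \<subseteq> carrier G & (ALL B. bd B \<inter> P = {} --> (c : B \<longleftrightarrow> \<one> : B))}"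
 have "V = carrier G"
 proof (rule connected)
  show "V ~= {}" unfolding V_def by (auto intro!: exI[of _ \<one>] exI[of _ "{}"])
  fix s x assume s: "s : S" and x: "x : V"
  then obtain P where P: "finite P" "P \<subseteq> carrier G" "ALL B. bd B \<inter> P = {} --> (x : B \<longleftrightarrow> \<one> : B)" "x : carrier G"
  unfolding V_def by auto
  have "s \<otimes> x : B \<longleftrightarrow> \<one> : B" if B: "bd B \<inter> insert x P = {}" for B
  proof -
  have "x \<notin> bd B" "bd B \<inter> P = {}" using B by auto
  then have "s \<otimes> x : B \<longleftrightarrow> x : B" using P(4) s unfolding bd_def by simp
  then show ?thesis using P(3) \<open>bd B \<inter> P = {}\<close> by simp
  qed
  moreover have "finite (insert x P)" "insert x P \<subseteq> carrier G" using P by auto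
  moreover have "s \<otimes> x : carrier G" using s S_carr P(4) by auto
  ultimately show "s \<otimes> x : V" unfolding V_def by blast
 qed (auto simp: V_def)
 then show ?thesis using c unfolding V_def by auto
qed

text \<open>\<open>C\<close> is the boundary of \<open>A\<close> together with paths from the
  identity to its points, so a set whose boundary avoids \<open>C\<close> cannot separate the
  boundary of \<open>A\<close>.\<close>

lemma link_set:
 obtains C where "finite C" "C \<subseteq> carrier G" "bd A \<subseteq> C"
  "!!B. bd B \<inter> C = {} ==> bd A \<subseteq> B \<or> bd A \<inter> B = {}"
proof -
 have bA: "bd A \<subseteq> carrier G" by (auto simp: bd_def)
 obtain P where P: "!!c. c : carrier G ==> finite (P c) & P c \<subseteq> carrier G & (ALL B. bd B \<inter> P c = {} --> (c : B \<longleftrightarrow> \<one> : B))"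
  using linked by metis
 let ?C = "bd A \<union> (\<Union>c\<in>bd A. P c)"
 show ?thesis
 proof (rule that[of ?C])
  show "finite ?C" using fin_bd P bA by auto
  show "?C \<subseteq> carrier G" using P bA by blast
  fix B assume B: "bd B \<inter> ?C = {}"
  have "\<forall>c\<in>bd A. c : B \<longleftrightarrow> \<one> : B" using P bA B by blast
  then show "bd A \<subseteq> B \<or> bd A \<inter> B = {}" by blast
 qed auto
qed

definition stab where "stab = {h : carrier G. eventually (%x. x \<otimes> h : A \<longleftrightarrow> x : A) (cofin G)}"

text \<open>Points that right translation by \<open>h\<close> moves out of \<open>A\<close>, minus
  points that it moves into \<open>A\<close>. Both numbers are finite on \<open>stab\<close>, and
  the difference is a homomorphism to the integers (\<open>flux_mult\<close>).\<close>

definition flux :: "_ => int"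
 where "flux h = int (card (A - shift h)) - int (card (shift h - A))"

lemma fin_diff:
 assumes "h : stab" shows "finite (A - shift h)" "finite (shift h - A)"
proof -
 have "finite {x : carrier G. \<not> (x \<otimes> h : A \<longleftrightarrow> x : A)}"
  using assms by (simp add: stab_def eventually_cofin)
 moreover have "A - shift h \<subseteq> {x : carrier G. \<not> (x \<otimes> h : A \<longleftrightarrow> x : A)}"
  "shift h - A \<subseteq> {x : carrier G. \<not> (x \<otimes> h : A \<longleftrightarrow> x : A)}"
  using A_carr by (auto simp: shift_def)
 ultimately show "finite (A - shift h)" "finite (shift h - A)"
  using finite_subset by blast+
qed

text \<open>For \<open>h\<close> outside \<open>K\<close>, right multiplication by \<open>h\<close>
  moves \<open>C\<close> off itself. Then neither of \<open>A\<close> and \<open>shift h\<close>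
  separates the boundary of the other, which makes them nested. Nested sets with flux zero are
  equal, and then the boundary of \<open>A\<close> is invariant under \<open>h\<close>, contrary to
  \<open>h \<notin> K\<close>.\<close>

lemma flux_nonzero:
 obtains K where "finite K" "!!h. [|h : stab; flux h = 0|] ==> h : K"
proof -
 obtain C where C: "finite C" "C \<subseteq> carrier G" "bd A \<subseteq> C"
  "!!B. bd B \<inter> C = {} ==> bd A \<subseteq> B \<or> bd A \<inter> B = {}" using link_set by blast
 let ?K = "(\<lambda>(x, y). inv x \<otimes> y) ` (C \<times> C)"
 show ?thesis
 proof (rule that[of ?K])
  show "finite ?K" using C by auto
  fix h assume h: "h : stab" and f0: "flux h = 0"
  show "h : ?K"
  proof (rule ccontr)
  assume nK: "h \<notin> ?K"
  have hG: "h : carrier G" using h by (auto simp: stab_def)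
  have no: False if "x : C" "x \<otimes> h : C" for x
  proof -
  have "h = inv x \<otimes> (x \<otimes> h)" using that C(2) hG by (simp add: m_assoc[symmetric] subsetD)
  then show False using nK that by (auto simp: image_iff)
  qed
  have no': False if "x : C" "x \<otimes> inv h : C" for x
  using no[of "x \<otimes> inv h"] that C(2) hG by (simp add: m_assoc subsetD)
  have "bd (shift h) \<inter> C = {}" using bd_shift[OF hG] no C(3) by blast
  then have 1: "bd A \<subseteq> shift h \<or> bd A \<inter> shift h = {}" by (rule C(4))
  then obtain \<alpha> where \<alpha>: "!!x. x : bd A ==> (x : shift h) ~= \<alpha>" by blast
  have "bd (shift (inv h)) \<inter> C = {}" using bd_shift[of "inv h"] hG no' C(3) by blast
  then have "bd A \<subseteq> shift (inv h) \<or> bd A \<inter> shift (inv h) = {}" by (rule C(4))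
  moreover have "x : A \<longleftrightarrow> x \<otimes> h : shift (inv h)" if "x : carrier G" for x
  using that hG by (simp add: shift_def m_assoc)
  ultimately have "(\<forall>x\<in>bd (shift h). x : A) \<or> (\<forall>x\<in>bd (shift h). x \<notin> A)"
  using bd_shift[OF hG] by blast
  then obtain \<beta> where \<beta>: "!!x. x : bd (shift h) ==> (x : A) ~= \<beta>" by blast
  \<comment> \<open>The corner of the two partitions that contains no point of either boundary: no
    edge leaves it, so it is empty.\<close>
  define Y where "Y = {x : carrier G. (x : shift h) = \<alpha> & (x : A) = \<beta>}"
  have Ycl: "s \<otimes> x : Y" if s: "s : S" and x: "x : Y" for s x
  proof -
  have xG: "x : carrier G" and "x \<notin> bd A" "x \<notin> bd (shift h)" using x \<alpha> \<beta> unfolding Y_def by auto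
  then have "s \<otimes> x : A \<longleftrightarrow> x : A" "s \<otimes> x : shift h \<longleftrightarrow> x : shift h" using s unfolding bd_def by blast+
  then show ?thesis using x xG s S_carr by (auto simp: Y_def)
  qed
  have Ye: "Y = {}"
  proof (rule ccontr)
  assume "Y ~= {}"
  then have "Y = carrier G" using Ycl by (intro connected) (auto simp: Y_def)
  then have "\<forall>x\<in>carrier G. (x : A) = \<beta>" unfolding Y_def by blast
  then show False using inf_A coinf_A A_carr by (cases \<beta>) (metis finite.emptyI Diff_eq_empty_iff subsetI, metis finite.emptyI subset_empty subsetI subsetD)
  qed
  have ev: "eventually (%x. x \<otimes> h : A \<longleftrightarrow> x : A) (cofin G)" using h by (simp add: stab_def)
  \<comment> \<open>Membership of almost all points is preserved by \<open>h\<close>, so some point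
    lies in both sets and some point in neither. This excludes equal \<open>\<alpha>\<close> and
    \<open>\<beta>\<close>, and the empty corner becomes one of the two differences.\<close>
  obtain a where a: "a : A" "a \<otimes> h : A" using eventually_cofin_happens[OF inf_A A_carr ev] by blast
  obtain b where b: "b : carrier G" "b \<notin> A" "b \<otimes> h \<notin> A" using eventually_cofin_happens[OF coinf_A _ ev] by blast
  have "a : A" "a : shift h" "b : carrier G" "b \<notin> A" "b \<notin> shift h" "a : carrier G"
  using a b A_carr by (auto simp: shift_def)
  then have "\<alpha> ~= \<beta>" using Ye unfolding Y_def by blast
  then have "A - shift h = {} \<or> shift h - A = {}" using Ye A_carr unfolding Y_def shift_def by blast
  moreover have "card (A - shift h) = card (shift h - A)" using f0 by (simp add: flux_def)
  ultimately have "A - shift h = {}" "shift h - A = {}" using fin_diff[OF h]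
  by (metis card_eq_0_iff)+
  then have eq: "shift h = A" by auto
  obtain p where p: "p : bd A" using bd_nonempty by auto
  then have "p \<otimes> h : bd A" using bd_shift[OF hG] eq by auto
  then show False using no p C(3) by blast
  qed
 qed
qed

text \<open>The flux can be counted in any finite window that contains the symmetric difference,
  because the remaining part of the window cancels.\<close>

lemma flux_eq:
 assumes h: "h : stab" and U: "finite U" "A - shift h \<subseteq> U" "shift h - A \<subseteq> U"
 shows "flux h = int (card (A \<inter> U)) - int (card (shift h \<inter> U))"
proof -
 have "A \<inter> U = (A - shift h) \<union> (A \<inter> shift h \<inter> U)" "shift h \<inter> U = (shift h - A) \<union> (A \<inter> shift h \<inter> U)"
  using U by auto
 moreover have "card ((A - shift h) \<union> (A \<inter> shift h \<inter> U)) = card (A - shift h) + card (A \<inter> shift h \<inter> U)"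
  by (rule card_Un_disjoint) (use U fin_diff[OF h] in auto)
 moreover have "card ((shift h - A) \<union> (A \<inter> shift h \<inter> U)) = card (shift h - A) + card (A \<inter> shift h \<inter> U)"
  by (rule card_Un_disjoint) (use U fin_diff[OF h] in auto)
 ultimately show ?thesis by (simp add: flux_def)
qed

lemma stab_mult:
 assumes "h : stab" "k : stab" shows "h \<otimes> k : stab"
proof -
 have c: "h : carrier G" "k : carrier G" using assms by (auto simp: stab_def)
 have "eventually (%x. x \<otimes> h \<otimes> k : A \<longleftrightarrow> x \<otimes> h : A) (cofin G)"
  using eventually_cofin_right[of "%x. x \<otimes> k : A \<longleftrightarrow> x : A" h] assms by (auto simp: stab_def)
 moreover have "eventually (%x. x \<otimes> h : A \<longleftrightarrow> x : A) (cofin G)" using assms by (auto simp: stab_def)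
 ultimately have "eventually (%x. x \<otimes> (h \<otimes> k) : A \<longleftrightarrow> x : A) (cofin G)"
  using eventually_cofin_carrier by eventually_elim (use c in "auto simp: m_assoc")
 then show ?thesis using c by (simp add: stab_def)
qed

lemma stab_inv:
 assumes "h : stab" shows "inv h : stab"
proof -
 have c: "h : carrier G" using assms by (auto simp: stab_def)
 have "eventually (%x. x \<otimes> inv h \<otimes> h : A \<longleftrightarrow> x \<otimes> inv h : A) (cofin G)"
  using eventually_cofin_right[of "%x. x \<otimes> h : A \<longleftrightarrow> x : A" "inv h"] assms by (auto simp: stab_def)
 then have "eventually (%x. x \<otimes> inv h : A \<longleftrightarrow> x : A) (cofin G)"
  using eventually_cofin_carrier by eventually_elim (use c in "auto simp: m_assoc")
 then show ?thesis using c by (simp add: stab_def)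
qed

lemma shift_card:
 assumes "h : carrier G" "U \<subseteq> carrier G"
 shows "card ({x : carrier G. x \<otimes> h : B} \<inter> {x : carrier G. x \<otimes> h : U}) = card (B \<inter> U)"
proof (rule bij_betw_same_card)
 show "bij_betw (%x. x \<otimes> h) ({x : carrier G. x \<otimes> h : B} \<inter> {x : carrier G. x \<otimes> h : U}) (B \<inter> U)"
  by (rule bij_betwI[where g = "%y. y \<otimes> inv h"]) (use assms in "auto simp: m_assoc subset_iff")
qed

text \<open>\<open>U\<close> is a window for \<open>k\<close>, and its preimage \<open>W\<close>
  under right multiplication by \<open>h\<close> is a window for \<open>h\<close> and for
  \<open>h \<otimes> k\<close>. This multiplication carries \<open>shift h\<close> in
  \<open>W\<close> to \<open>A\<close> in \<open>U\<close>, so the middle terms cancel.\<close>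

lemma flux_mult:
 assumes h: "h : stab" and k: "k : stab"
 shows "flux (h \<otimes> k) = flux h + flux k"
proof -
 have c: "h : carrier G" "k : carrier G" using assms by (auto simp: stab_def)
 define U where "U = (A - shift k) \<union> (shift k - A) \<union>
  (%x. x \<otimes> h) ` ((A - shift h) \<union> (shift h - A) \<union> (A - shift (h \<otimes> k)) \<union> (shift (h \<otimes> k) - A))"
 define W where "W = {x : carrier G. x \<otimes> h : U}"
 have UG: "U \<subseteq> carrier G" using A_carr c by (auto simp: U_def shift_def)
 have finU: "finite U" using fin_diff[OF h] fin_diff[OF k] fin_diff[OF stab_mult[OF h k]]
  by (simp add: U_def)
 have "bij_betw (%x. x \<otimes> h) W U"
  by (rule bij_betwI[where g = "%y. y \<otimes> inv h"]) (use c UG in "auto simp: m_assoc subset_iff W_def")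
 then have finW: "finite W" using finU bij_betw_finite by blast
 have sub: "A - shift h \<subseteq> W" "shift h - A \<subseteq> W" "A - shift (h \<otimes> k) \<subseteq> W" "shift (h \<otimes> k) - A \<subseteq> W"
  using A_carr by (auto simp: W_def U_def shift_def)
 have s1: "shift h = {x : carrier G. x \<otimes> h : A}" by (simp add: shift_def)
 have s2: "shift (h \<otimes> k) = {x : carrier G. x \<otimes> h : shift k}" using c by (auto simp: shift_def m_assoc)
 have "flux (h \<otimes> k) = int (card (A \<inter> W)) - int (card (shift (h \<otimes> k) \<inter> W))"
  by (rule flux_eq[OF stab_mult[OF h k] finW sub(3,4)])
 moreover have "flux h = int (card (A \<inter> W)) - int (card (shift h \<inter> W))"
  by (rule flux_eq[OF h finW sub(1,2)])
 moreover have "flux k = int (card (A \<inter> U)) - int (card (shift k \<inter> U))"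
  by (rule flux_eq[OF k finU]) (auto simp: U_def)
 moreover have "card (shift h \<inter> W) = card (A \<inter> U)" "card (shift (h \<otimes> k) \<inter> W) = card (shift k \<inter> U)"
  unfolding s1 s2 W_def by (rule shift_card[OF c(1) UG])+
 ultimately show ?thesis by simp
qed

lemma one_stab: "\<one> : stab"
proof -
 have "{x : carrier G. \<not> (x \<otimes> \<one> : A \<longleftrightarrow> x : A)} = {}" by auto
 then show ?thesis unfolding stab_def eventually_cofin by (simp only: finite.emptyI mem_Collect_eq one_closed)
qed

lemma flux_one: "flux \<one> = 0"
 using flux_mult[OF one_stab one_stab] by simp

lemma flux_inv: "h : stab ==> flux (inv h) = - flux h"
 using flux_mult[of h "inv h"] stab_inv flux_one by (auto simp: stab_def)

lemma flux_pow:
 assumes "h : stab" shows "h [^] (n::int) : stab & flux (h [^] n) = n * flux h"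
proof -
 have c: "h : carrier G" using assms by (auto simp: stab_def)
 have nat: "h [^] (m::nat) : stab & flux (h [^] m) = int m * flux h" for m
  by (induction m) (auto simp: one_stab flux_one stab_mult flux_mult assms algebra_simps)
 show ?thesis
 proof (cases "n >= 0")
  case True
  then show ?thesis using nat[of "nat n"] by (metis int_nat_eq int_pow_int)
 next
  case False
  then have "h [^] n = inv (h [^] nat (- n))" by (subst int_pow_def2) auto
  moreover have "h [^] nat (- n) : stab" "flux (h [^] nat (- n)) = - n * flux h"
  using nat[of "nat (- n)"] False by auto
  ultimately show ?thesis by (simp add: stab_inv flux_inv)
 qed
qed

text \<open>The subgroup \<open>stab\<close> has index at most two and \<open>flux\<close> has
  finite fibres on it. Hence some \<open>t\<close> has nonzero flux, and division of fluxes by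
  \<open>flux t\<close> leaves finitely many remainders, each with finitely many elements.\<close>

theorem virt_cyclic: "virt_cyclic G"
proof -
 obtain K where K: "finite K" "!!h. [|h : stab; flux h = 0|] ==> h : K" using flux_nonzero by blast
 have sG: "stab \<subseteq> carrier G" by (auto simp: stab_def)
 \<comment> \<open>Two elements that both interchange \<open>A\<close> and its complement have a
   product in \<open>stab\<close>, so one such \<open>g1\<close> carries all the others into
   \<open>stab\<close>.\<close>
 have coset: "\<exists>g1\<in>carrier G. \<forall>g\<in>carrier G. g : stab \<or> g \<otimes> g1 : stab"
 proof (cases "stab = carrier G")
  case False
  then obtain g1 where g1: "g1 : carrier G" "g1 \<notin> stab" using sG by auto
  have flip: "eventually (%x. x \<otimes> g1 : A \<longleftrightarrow> x \<notin> A) (cofin G)" using g1 two_ended by (auto simp: stab_def)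
  have "g \<otimes> g1 : stab" if g: "g : carrier G" "g \<notin> stab" for g
  proof -
  have "eventually (%x. x \<otimes> g : A \<longleftrightarrow> x \<notin> A) (cofin G)" using g two_ended by (auto simp: stab_def)
  moreover have "eventually (%x. x \<otimes> g \<otimes> g1 : A \<longleftrightarrow> x \<otimes> g \<notin> A) (cofin G)"
  using eventually_cofin_right[OF flip g(1)] .
  ultimately have "eventually (%x. x \<otimes> (g \<otimes> g1) : A \<longleftrightarrow> x : A) (cofin G)"
  using eventually_cofin_carrier by eventually_elim (use g g1 in "auto simp: m_assoc")
  then show ?thesis using g g1 by (simp add: stab_def)
  qed
  then show ?thesis using g1 by blast
 qed auto
 then obtain g1 where g1: "g1 : carrier G" "!!g. g : carrier G ==> g : stab \<or> g \<otimes> g1 : stab" by blast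
 have inf_stab: "infinite stab"
 proof
  assume fs: "finite stab"
  have "x : stab \<union> (%y. y \<otimes> inv g1) ` stab" if x: "x : carrier G" for x
  proof (cases "x : stab")
  case False
  then have "x \<otimes> g1 : stab" using g1 x by blast
  moreover have "x = x \<otimes> g1 \<otimes> inv g1" using x g1 by (simp add: m_assoc)
  ultimately show ?thesis by blast
  qed auto
  then have "carrier G \<subseteq> stab \<union> (%y. y \<otimes> inv g1) ` stab" by blast
  then have "finite (carrier G)" by (rule finite_subset) (use fs in simp)
  then show False using inf_A A_carr finite_subset by blast
 qed
 obtain t where t: "t : stab" "flux t ~= 0"
  using inf_stab K by (metis finite_subset subsetI)
 have tG: "t : carrier G" using t sG by auto
 have fibre: "finite {h : stab. flux h = r}" for r
 proof (cases "\<exists>h0\<in>stab. flux h0 = r")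
  case True
  then obtain h0 where h0: "h0 : stab" "flux h0 = r" by auto
  have "h : (%x. h0 \<otimes> x) ` K" if h: "h : stab" "flux h = r" for h
  proof -
  have "inv h0 \<otimes> h : K" using K(2) h h0 by (simp add: stab_mult stab_inv flux_mult flux_inv)
  moreover have "h = h0 \<otimes> (inv h0 \<otimes> h)" using h h0 sG by (simp add: m_assoc[symmetric] subset_iff)
  ultimately show ?thesis by blast
  qed
  then have "{h : stab. flux h = r} \<subseteq> (%x. h0 \<otimes> x) ` K" by blast
  then show ?thesis by (rule finite_subset) (use K in simp)
 next
  case False
  then have "{h : stab. flux h = r} = {}" by auto
  then show ?thesis by (simp only: finite.emptyI)
 qed
 define F1 where "F1 = (\<Union>r\<in>{- \<bar>flux t\<bar>..\<bar>flux t\<bar>}. {h : stab. flux h = r})"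
 have finF1: "finite F1" unfolding F1_def using fibre by auto
 have F1G: "F1 \<subseteq> carrier G" using sG by (auto simp: F1_def)
 have dec: "\<exists>n::int. \<exists>f\<in>F1. h = t [^] n \<otimes> f" if h: "h : stab" for h
 proof -
  define q where "q = flux h div flux t"
  have p: "t [^] (-q) : stab" "flux (t [^] (-q)) = - q * flux t" using flux_pow[OF t(1)] by auto
  have "flux (t [^] (-q) \<otimes> h) = flux h mod flux t"
  using p h flux_mult by (simp add: q_def minus_div_mult_eq_mod[symmetric])
  moreover have "\<bar>flux h mod flux t\<bar> <= \<bar>flux t\<bar>" using t(2) abs_mod_less less_imp_le by blast
  ultimately have "t [^] (-q) \<otimes> h : F1" using p h by (auto simp: F1_def stab_mult abs_le_iff)
  moreover have "h = t [^] q \<otimes> (t [^] (-q) \<otimes> h)"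
  using tG h sG by (simp add: m_assoc[symmetric] int_pow_mult[symmetric] subset_iff)
  ultimately show ?thesis by blast
 qed
 define F where "F = F1 \<union> (%f. f \<otimes> inv g1) ` F1"
 have "\<exists>n::int. \<exists>f\<in>F. x = t [^] n \<otimes> f" if x: "x : carrier G" for x
 proof (cases "x : stab")
  case True then show ?thesis using dec unfolding F_def by blast
 next
  case False
  then have "x \<otimes> g1 : stab" using g1 x by blast
  then obtain n :: int and f where nf: "f : F1" "x \<otimes> g1 = t [^] n \<otimes> f" using dec by blast
  have "x = x \<otimes> g1 \<otimes> inv g1" using x g1 by (simp add: m_assoc)
  also have "... = t [^] n \<otimes> (f \<otimes> inv g1)" using nf tG g1 F1G by (simp add: m_assoc subset_iff)
  finally show ?thesis using nf by (auto simp: F_def)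
 qed
 moreover have "n = 0" if "t [^] (n::int) = \<one>" for n using flux_pow[OF t(1), of n] that t(2) flux_one by auto
 moreover have "finite F" "F \<subseteq> carrier G" using finF1 F1G g1 by (auto simp: F_def)
 ultimately show ?thesis unfolding virt_cyclic_def using tG by blast
qed

end

section \<open>Almost invariant functions with values in a ring\<close>

definition almost_inv :: "('r, 'x) ring_scheme => ('g, 'y) monoid_scheme => ('g => 'r) set"
 where "almost_inv R G =
  {f. (\<forall>x\<in>carrier G. f x : carrier R) & (\<forall>g\<in>carrier G. eventually (%x. f (g \<otimes>\<^bsub>G\<^esub> x) = f x) (cofin G))}"

text \<open>Functions of finite support are the case \<open>c = \<zero>\<close>. The quotient of
  \<open>almost_inv\<close> by \<open>almost_const\<close> is first cohomology with coefficients in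
  the group ring, by \<open>df_hcob\<close> and \<open>hcocycle_df\<close>.\<close>

definition almost_const :: "('r, 'x) ring_scheme => ('g, 'y) monoid_scheme => ('g => 'r) => bool"
 where "almost_const R G f \<longleftrightarrow> (\<exists>c\<in>carrier R. eventually (%x. f x = c) (cofin G))"

locale ring_group = R: cring R + group G
 for R :: "('r, 'x) ring_scheme" and G :: "('g, 'y) monoid_scheme" (structure)
begin

lemma AI_closed: "f : almost_inv R G ==> x : carrier G ==> f x : carrier R"
 by (simp add: almost_inv_def)

lemma AI_ev: "f : almost_inv R G ==> g : carrier G ==> eventually (%x. f (g \<otimes> x) = f x) (cofin G)"
 by (simp add: almost_inv_def)

lemma AI_I:
 assumes "!!x. x : carrier G ==> f x : carrier R"
  "!!g. g : carrier G ==> eventually (%x. f (g \<otimes> x) = f x) (cofin G)"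
 shows "f : almost_inv R G"
 using assms by (simp add: almost_inv_def)

lemma AI_add:
 assumes "f : almost_inv R G" "k : almost_inv R G"
 shows "(%x. f x \<oplus>\<^bsub>R\<^esub> k x) : almost_inv R G"
proof (rule AI_I)
 fix g assume g: "g : carrier G"
 show "eventually (%x. f (g \<otimes> x) \<oplus>\<^bsub>R\<^esub> k (g \<otimes> x) = f x \<oplus>\<^bsub>R\<^esub> k x) (cofin G)"
  using AI_ev[OF assms(1) g] AI_ev[OF assms(2) g] by eventually_elim simp
qed (use assms AI_closed in auto)

lemma AI_smult:
 assumes "f : almost_inv R G" "r : carrier R"
 shows "(%x. r \<otimes>\<^bsub>R\<^esub> f x) : almost_inv R G"
proof (rule AI_I)
 fix g assume g: "g : carrier G"
 show "eventually (%x. r \<otimes>\<^bsub>R\<^esub> f (g \<otimes> x) = r \<otimes>\<^bsub>R\<^esub> f x) (cofin G)"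
  using AI_ev[OF assms(1) g] by eventually_elim simp
qed (use assms AI_closed in auto)

lemma AI_right:
 assumes "f : almost_inv R G" "h : carrier G"
 shows "(%x. f (x \<otimes> h)) : almost_inv R G"
proof (rule AI_I)
 fix g assume g: "g : carrier G"
 show "eventually (%x. f (g \<otimes> x \<otimes> h) = f (x \<otimes> h)) (cofin G)"
  using eventually_cofin_right[OF AI_ev[OF assms(1) g] assms(2)] eventually_cofin_carrier
  by eventually_elim (use assms g in "auto simp: m_assoc")
qed (use assms AI_closed in auto)

lemma AI_cong:
 assumes "f : almost_inv R G" "eventually (%x. f x = k x) (cofin G)" "!!x. x : carrier G ==> k x : carrier R"
 shows "k : almost_inv R G"
proof (rule AI_I)
 fix g assume g: "g : carrier G"
 show "eventually (%x. k (g \<otimes> x) = k x) (cofin G)"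
  using AI_ev[OF assms(1) g] assms(2) eventually_cofin_left[OF assms(2) g] by eventually_elim auto
qed (use assms AI_closed in auto)

lemma AI_indicator:
 assumes "!!g. g : carrier G ==> eventually (%x. P (g \<otimes> x) \<longleftrightarrow> P x) (cofin G)"
 shows "(%x. if P x then \<one>\<^bsub>R\<^esub> else \<zero>\<^bsub>R\<^esub>) : almost_inv R G"
proof (rule AI_I)
 fix g assume g: "g : carrier G"
 show "eventually (%x. (if P (g \<otimes> x) then \<one>\<^bsub>R\<^esub> else \<zero>\<^bsub>R\<^esub>) = (if P x then \<one>\<^bsub>R\<^esub> else \<zero>\<^bsub>R\<^esub>)) (cofin G)"
  using assms[OF g] by eventually_elim simp
qed auto

text \<open>On an increasing union of finite subgroups every function of the level at which an element
  appears is almost invariant.\<close>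

lemma AI_level:
 assumes fin: "!!n::nat. finite (D n)" and sub: "!!n. subgroup (D n) G"
  and mono: "!!n. D n \<subseteq> D (Suc n)" and un: "(\<Union>n. D n) = carrier G"
 shows "\<exists>l :: 'g => nat. infinite (carrier G) --> infinite (l ` carrier G) &
  (ALL P. (%x. if P (l x) then \<one>\<^bsub>R\<^esub> else \<zero>\<^bsub>R\<^esub>) : almost_inv R G)"
proof -
 define l where "l x = (LEAST n. x : D n)" for x
 have mon: "D m \<subseteq> D n" if "m <= n" for m n using mono that by (rule lift_Suc_mono_le)
 have lD: "x : D (l x)" if "x : carrier G" for x
  unfolding l_def using that un by (auto intro: LeastI)
 have le: "x : D n ==> l x <= n" for x n unfolding l_def by (rule Least_le)
 have "infinite (l ` carrier G)" if inf: "infinite (carrier G)"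
 proof
  assume "finite (l ` carrier G)"
  then obtain N where N: "!!x. x : carrier G ==> l x <= N" by (meson finite_nat_set_iff_bounded_le imageI)
  then have "carrier G \<subseteq> D N" using lD mon by blast
  then show False using fin inf finite_subset by blast
 qed
 moreover have "(%x. if P (l x) then \<one>\<^bsub>R\<^esub> else \<zero>\<^bsub>R\<^esub>) : almost_inv R G" for P
 proof (rule AI_indicator)
  fix g assume g: "g : carrier G"
  \<comment> \<open>The level is ultrametric: multiplication by an element of smaller level keeps
    the level of \<open>x\<close>.\<close>
  have "l (g \<otimes> x) = l x" if x: "x : carrier G" "x \<notin> D (l g)" for x
  proof -
  have lt: "l g < l x" using lD[OF x(1)] x(2) mon by (meson linorder_not_less subsetD)
  have "g \<otimes> x : D (l x)"
  using subgroup.m_closed[OF sub] lD[OF x(1)] lD[OF g] mon lt by (meson less_imp_le subsetD)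
  then have a: "l (g \<otimes> x) <= l x" by (rule le)
  have "x = inv g \<otimes> (g \<otimes> x)" using g x by (simp add: m_assoc[symmetric])
  moreover have "inv g \<otimes> (g \<otimes> x) : D (max (l g) (l (g \<otimes> x)))"
  proof -
  have "g : D (max (l g) (l (g \<otimes> x)))" using lD[OF g] mon[of "l g"] by (meson max.cobounded1 subsetD)
  moreover have "g \<otimes> x : D (max (l g) (l (g \<otimes> x)))"
  using lD[of "g \<otimes> x"] mon[of "l (g \<otimes> x)"] g x by (meson m_closed max.cobounded2 subsetD)
  ultimately show ?thesis using sub subgroup.m_closed subgroup.m_inv_closed by metis
  qed
  ultimately have "l x <= max (l g) (l (g \<otimes> x))" using le by metis
  then show ?thesis using a lt by auto
  qed
  note same = this
  have "{x : carrier G. \<not> (P (l (g \<otimes> x)) \<longleftrightarrow> P (l x))} \<subseteq> D (l g)"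
  proof
  fix x assume "x : {x : carrier G. \<not> (P (l (g \<otimes> x)) \<longleftrightarrow> P (l x))}"
  then show "x : D (l g)" using same[of x] by (cases "x : D (l g)") simp_all
  qed
  then show "eventually (%x. P (l (g \<otimes> x)) \<longleftrightarrow> P (l x)) (cofin G)"
  unfolding eventually_cofin by (rule finite_subset) (rule fin)
 qed
 ultimately show ?thesis by blast
qed

end

section \<open>Groups whose first cohomology with group ring coefficients is free of rank
  one\<close>

locale rank_one = ring_group +
 fixes lam
 assumes inf: "infinite (carrier G)" and one_neq: "\<one>\<^bsub>R\<^esub> ~= \<zero>\<^bsub>R\<^esub>"
  and lam_closed: "f : almost_inv R G ==> lam f : carrier R"
  and lam_add: "[|f : almost_inv R G; k : almost_inv R G|] ==> lam (%x. f x \<oplus>\<^bsub>R\<^esub> k x) = lam f \<oplus>\<^bsub>R\<^esub> lam k"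
  and lam_smult: "[|f : almost_inv R G; r : carrier R|] ==> lam (%x. r \<otimes>\<^bsub>R\<^esub> f x) = r \<otimes>\<^bsub>R\<^esub> lam f"
  and lam_zero: "f : almost_inv R G ==> lam f = \<zero>\<^bsub>R\<^esub> \<longleftrightarrow> almost_const R G f"
  and lam_one: "\<exists>f\<in>almost_inv R G. lam f = \<one>\<^bsub>R\<^esub>"
begin

lemma ev_ex: "eventually P (cofin G) ==> \<exists>x\<in>carrier G. P x"
 using eventually_cofin_happens[OF inf order_refl] .

text \<open>Here \<open>lam\<close> identifies \<open>almost_inv\<close> modulo
  \<open>almost_const\<close> with \<open>R\<close>. The combination of \<open>lam k\<close> times
  \<open>f\<close> and minus \<open>lam f\<close> times \<open>k\<close> lies in its kernel, and no
  division is involved.\<close>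

lemma proportional:
 assumes f: "f : almost_inv R G" and k: "k : almost_inv R G"
 shows "\<exists>c\<in>carrier R. eventually (%x. lam k \<otimes>\<^bsub>R\<^esub> f x = lam f \<otimes>\<^bsub>R\<^esub> k x \<oplus>\<^bsub>R\<^esub> c) (cofin G)"
proof -
 note cl = lam_closed[OF f] lam_closed[OF k]
 let ?p = "%x. lam k \<otimes>\<^bsub>R\<^esub> f x" and ?q = "%x. (\<ominus>\<^bsub>R\<^esub> lam f) \<otimes>\<^bsub>R\<^esub> k x"
 have p: "?p : almost_inv R G" and q: "?q : almost_inv R G" using AI_smult f k cl by auto
 have "lam (%x. ?p x \<oplus>\<^bsub>R\<^esub> ?q x) = lam k \<otimes>\<^bsub>R\<^esub> lam f \<oplus>\<^bsub>R\<^esub> (\<ominus>\<^bsub>R\<^esub> lam f) \<otimes>\<^bsub>R\<^esub> lam k"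
  using lam_add[OF p q] lam_smult f k cl by simp
 also have "... = \<zero>\<^bsub>R\<^esub>" using cl by algebra
 finally obtain c where c: "c : carrier R" "eventually (%x. ?p x \<oplus>\<^bsub>R\<^esub> ?q x = c) (cofin G)"
  using lam_zero[OF AI_add[OF p q]] by (auto simp: almost_const_def)
 from c(2) have "eventually (%x. lam k \<otimes>\<^bsub>R\<^esub> f x = lam f \<otimes>\<^bsub>R\<^esub> k x \<oplus>\<^bsub>R\<^esub> c) (cofin G)"
  using eventually_cofin_carrier
 proof eventually_elim
  case (elim x)
  have "f x : carrier R" "k x : carrier R" using f k elim AI_closed by auto
  then have "lam f \<otimes>\<^bsub>R\<^esub> k x \<oplus>\<^bsub>R\<^esub> (?p x \<oplus>\<^bsub>R\<^esub> ?q x) = lam k \<otimes>\<^bsub>R\<^esub> f x" using cl by algebra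
  then show ?case using elim by simp
 qed
 then show ?thesis using c by blast
qed

definition f0 where "f0 = (SOME f. f : almost_inv R G & lam f = \<one>\<^bsub>R\<^esub>)"

lemma f0: "f0 : almost_inv R G" "lam f0 = \<one>\<^bsub>R\<^esub>"
 using someI_ex[of "%f. f : almost_inv R G & lam f = \<one>\<^bsub>R\<^esub>"] lam_one unfolding f0_def by auto

text \<open>The character by which right translations act on the rank one quotient, of which
  \<open>f0\<close> is a generator.\<close>

definition mu where "mu h = lam (%x. f0 (x \<otimes> h))"

lemma mu_closed: "h : carrier G ==> mu h : carrier R"
 unfolding mu_def by (intro lam_closed AI_right f0)

lemma f0_right:
 assumes h: "h : carrier G"
 shows "\<exists>c\<in>carrier R. eventually (%x. f0 (x \<otimes> h) = mu h \<otimes>\<^bsub>R\<^esub> f0 x \<oplus>\<^bsub>R\<^esub> c) (cofin G)"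
proof -
 obtain c where c: "c : carrier R" "eventually (%x. lam f0 \<otimes>\<^bsub>R\<^esub> f0 (x \<otimes> h) = mu h \<otimes>\<^bsub>R\<^esub> f0 x \<oplus>\<^bsub>R\<^esub> c) (cofin G)"
  using proportional[OF AI_right[OF f0(1) h] f0(1)] unfolding mu_def by blast
 from c(2) eventually_cofin_carrier have "eventually (%x. f0 (x \<otimes> h) = mu h \<otimes>\<^bsub>R\<^esub> f0 x \<oplus>\<^bsub>R\<^esub> c) (cofin G)"
  by eventually_elim (use h AI_closed[OF f0(1)] f0(2) in simp)
 then show ?thesis using c by blast
qed

text \<open>Translating \<open>f0\<close> by \<open>h\<close> and back gives \<open>f0\<close>
  again, so one minus the product of the two values makes \<open>f0\<close> almost constant.
  Applying \<open>lam\<close> to this multiple shows that the factor is zero.\<close>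

lemma mu_unit:
 assumes h: "h : carrier G"
 shows "mu (inv h) \<otimes>\<^bsub>R\<^esub> mu h = \<one>\<^bsub>R\<^esub>"
proof -
 obtain c where c: "c : carrier R" "eventually (%x. f0 (x \<otimes> h) = mu h \<otimes>\<^bsub>R\<^esub> f0 x \<oplus>\<^bsub>R\<^esub> c) (cofin G)"
  using f0_right[OF h] by blast
 obtain d where d: "d : carrier R" "eventually (%x. f0 (x \<otimes> inv h) = mu (inv h) \<otimes>\<^bsub>R\<^esub> f0 x \<oplus>\<^bsub>R\<^esub> d) (cofin G)"
  using f0_right[of "inv h"] h by auto
 note cl = mu_closed[OF h] mu_closed[OF inv_closed[OF h]] c(1) d(1)
 let ?r = "\<one>\<^bsub>R\<^esub> \<ominus>\<^bsub>R\<^esub> mu (inv h) \<otimes>\<^bsub>R\<^esub> mu h"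
 let ?c = "mu (inv h) \<otimes>\<^bsub>R\<^esub> c \<oplus>\<^bsub>R\<^esub> d"
 have r: "?r : carrier R" using cl by simp
 have "eventually (%x. f0 (x \<otimes> h \<otimes> inv h) = mu (inv h) \<otimes>\<^bsub>R\<^esub> f0 (x \<otimes> h) \<oplus>\<^bsub>R\<^esub> d) (cofin G)"
  by (rule eventually_cofin_right[OF d(2) h])
 with c(2) eventually_cofin_carrier have "eventually (%x. ?r \<otimes>\<^bsub>R\<^esub> f0 x = ?c) (cofin G)"
 proof eventually_elim
  case (elim x)
  have x: "f0 x : carrier R" using elim AI_closed f0 by auto
  have "f0 x = mu (inv h) \<otimes>\<^bsub>R\<^esub> (mu h \<otimes>\<^bsub>R\<^esub> f0 x \<oplus>\<^bsub>R\<^esub> c) \<oplus>\<^bsub>R\<^esub> d"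
  using elim h by (simp add: m_assoc)
  moreover have "?r \<otimes>\<^bsub>R\<^esub> f0 x = f0 x \<ominus>\<^bsub>R\<^esub> mu (inv h) \<otimes>\<^bsub>R\<^esub> mu h \<otimes>\<^bsub>R\<^esub> f0 x" using x cl by algebra
  moreover have "(mu (inv h) \<otimes>\<^bsub>R\<^esub> (mu h \<otimes>\<^bsub>R\<^esub> f0 x \<oplus>\<^bsub>R\<^esub> c) \<oplus>\<^bsub>R\<^esub> d) \<ominus>\<^bsub>R\<^esub> mu (inv h) \<otimes>\<^bsub>R\<^esub> mu h \<otimes>\<^bsub>R\<^esub> f0 x = ?c"
  using x cl by algebra
  ultimately show ?case by metis
 qed
 then have "almost_const R G (%x. ?r \<otimes>\<^bsub>R\<^esub> f0 x)" unfolding almost_const_def using cl by blast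
 then have "lam (%x. ?r \<otimes>\<^bsub>R\<^esub> f0 x) = \<zero>\<^bsub>R\<^esub>" using lam_zero[OF AI_smult[OF f0(1) r]] by blast
 then have "?r = \<zero>\<^bsub>R\<^esub>" using lam_smult[OF f0(1) r] f0(2) r by simp
 moreover have "mu (inv h) \<otimes>\<^bsub>R\<^esub> mu h = \<one>\<^bsub>R\<^esub> \<ominus>\<^bsub>R\<^esub> ?r" using cl by algebra
 ultimately show ?thesis by (simp add: R.minus_eq)
qed

lemma mu_cancel:
 assumes h: "h : carrier G" and a: "a : carrier R" and b: "b : carrier R" and eq: "mu h \<otimes>\<^bsub>R\<^esub> a = mu h \<otimes>\<^bsub>R\<^esub> b"
 shows "a = b"
proof -
 have "mu (inv h) \<otimes>\<^bsub>R\<^esub> mu h \<otimes>\<^bsub>R\<^esub> a = mu (inv h) \<otimes>\<^bsub>R\<^esub> mu h \<otimes>\<^bsub>R\<^esub> b"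
  using eq mu_closed h a b by (simp add: R.m_assoc)
 then show ?thesis using mu_unit h a b by simp
qed

lemma f0_not_almost_const: "\<not> almost_const R G f0"
 using lam_zero[OF f0(1)] f0(2) one_neq by simp

text \<open>Right translates of an exactly invariant function satisfy the affine relation exactly, because
  it holds somewhere on every coset.\<close>

lemma not_invariant:
 assumes D: "subgroup D G" "infinite D" and k: "eventually (%x. f0 x = k x) (cofin G)"
  and k_inv: "!!d x. [|d : D; x : carrier G|] ==> k (d \<otimes> x) = k x"
  and k_cl: "!!x. x : carrier G ==> k x : carrier R"
 shows False
proof -
 have DG: "D \<subseteq> carrier G" using D subgroup.subset by blast
 have kAI: "k : almost_inv R G" using AI_cong[OF f0(1) k k_cl] .
 have exact: "\<exists>c\<in>carrier R. \<forall>x\<in>carrier G. k (x \<otimes> h) = mu h \<otimes>\<^bsub>R\<^esub> k x \<oplus>\<^bsub>R\<^esub> c" if h: "h : carrier G" for h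
 proof -
  obtain c where c: "c : carrier R" "eventually (%x. f0 (x \<otimes> h) = mu h \<otimes>\<^bsub>R\<^esub> f0 x \<oplus>\<^bsub>R\<^esub> c) (cofin G)"
  using f0_right[OF h] by blast
  have ev: "eventually (%x. k (x \<otimes> h) = mu h \<otimes>\<^bsub>R\<^esub> k x \<oplus>\<^bsub>R\<^esub> c) (cofin G)"
  using c(2) k eventually_cofin_right[OF k h] by eventually_elim simp
  have "k (x \<otimes> h) = mu h \<otimes>\<^bsub>R\<^esub> k x \<oplus>\<^bsub>R\<^esub> c" if x: "x : carrier G" for x
  proof -
  have "infinite ((%d. d \<otimes> x) ` D)" using D(2) finite_imageD[of "%d. d \<otimes> x" D] DG x
  by (auto simp: inj_on_def subset_iff)
  moreover have "(%d. d \<otimes> x) ` D \<subseteq> carrier G" using DG x by auto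
  ultimately obtain d where d: "d : D" "k (d \<otimes> x \<otimes> h) = mu h \<otimes>\<^bsub>R\<^esub> k (d \<otimes> x) \<oplus>\<^bsub>R\<^esub> c"
  using eventually_cofin_happens[OF _ _ ev] by blast
  then show ?thesis using k_inv x h DG by (simp add: m_assoc subset_iff)
  qed
  then show ?thesis using c by blast
 qed
 \<comment> \<open>Almost invariance provides some \<open>x\<close> with
   \<open>k (g \<otimes> x) = k x\<close>. The exact relation for right translation by this
   \<open>x\<close>, taken at \<open>g\<close> and at the identity, then lets the unit
   \<open>mu x\<close> cancel.\<close>
 have "k g = k \<one>" if g: "g : carrier G" for g
 proof -
  obtain x where x: "x : carrier G" "k (g \<otimes> x) = k x" using ev_ex[OF AI_ev[OF kAI g]] by blast
  obtain c where c: "c : carrier R" "!!y. y : carrier G ==> k (y \<otimes> x) = mu x \<otimes>\<^bsub>R\<^esub> k y \<oplus>\<^bsub>R\<^esub> c"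
  using exact[OF x(1)] by blast
  have "mu x \<otimes>\<^bsub>R\<^esub> k g \<oplus>\<^bsub>R\<^esub> c = mu x \<otimes>\<^bsub>R\<^esub> k \<one> \<oplus>\<^bsub>R\<^esub> c" using c(2)[OF g] c(2)[OF one_closed] x by simp
  then have "mu x \<otimes>\<^bsub>R\<^esub> k g = mu x \<otimes>\<^bsub>R\<^esub> k \<one>"
  using c(1) mu_closed[OF x(1)] k_cl g by (simp add: R.add.right_cancel)
  then show ?thesis using mu_cancel[OF x(1)] k_cl g by auto
 qed
 then have k1: "!!x. x : carrier G ==> k x = k \<one>" by blast
 have "eventually (%x. f0 x = k \<one>) (cofin G)" using k eventually_cofin_carrier
  by eventually_elim (metis k1)
 then show False using f0_not_almost_const k_cl unfolding almost_const_def by blast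
qed

text \<open>On every coset of \<open>D\<close> replace \<open>f0\<close> by the value that it takes
  at almost all points. Only cosets that meet the finite set \<open>B\<close> change, each at
  finitely many points, so the result is an exactly invariant function that almost equals
  \<open>f0\<close>, which \<open>not_invariant\<close> excludes.\<close>

lemma not_const_on_cosets:
 assumes D: "subgroup D G" "infinite D" and B: "finite B" "B \<subseteq> carrier G"
  and good: "!!x. [|x : carrier G; !!d. d : D ==> d \<otimes> x \<notin> B|] ==> \<forall>d\<in>D. f0 (d \<otimes> x) = f0 x"
  and ac: "!!x. x : B ==> \<exists>c\<in>carrier R. finite {d : D. f0 (d \<otimes> x) ~= c}"
 shows False
proof -
 have DG: "D \<subseteq> carrier G" using D subgroup.subset by blast
 have fx: "EX c. c : carrier R & finite {d : D. f0 (d \<otimes> x) ~= c} & ((\<forall>d\<in>D. d \<otimes> x \<notin> B) --> c = f0 x)" if x: "x : carrier G" for x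
 proof (cases "\<exists>d\<in>D. d \<otimes> x : B")
  case False
  then have "{d : D. f0 (d \<otimes> x) ~= f0 x} = {}" using good[OF x] by auto
  then show ?thesis using AI_closed[OF f0(1) x] by (metis finite.emptyI)
 next
  case True
  \<comment> \<open>The coset is rewritten with its base point in \<open>B\<close>, where
    \<open>ac\<close> supplies the value.\<close>
  then obtain e where e: "e : D" "e \<otimes> x : B" by auto
  obtain c where c: "c : carrier R" "finite {d : D. f0 (d \<otimes> (e \<otimes> x)) ~= c}" using ac[OF e(2)] by blast
  have "{d : D. f0 (d \<otimes> x) ~= c} \<subseteq> (%d. d \<otimes> e) ` {d : D. f0 (d \<otimes> (e \<otimes> x)) ~= c}"
  proof
  fix d assume d: "d : {d : D. f0 (d \<otimes> x) ~= c}"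
  have "d \<otimes> inv e : D" using d e D(1) by (simp add: subgroup.m_closed subgroup.m_inv_closed)
  moreover have "d \<otimes> inv e \<otimes> (e \<otimes> x) = d \<otimes> x" "d = d \<otimes> inv e \<otimes> e"
  using d e DG x by (auto simp: m_assoc subset_iff) (simp add: m_assoc[symmetric])
  ultimately show "d : (%d. d \<otimes> e) ` {d : D. f0 (d \<otimes> (e \<otimes> x)) ~= c}" using d by auto
  qed
  then show ?thesis using c True finite_surj by blast
 qed
 define k where "k x = (SOME c. c : carrier R & finite {d : D. f0 (d \<otimes> x) ~= c} & ((\<forall>d\<in>D. d \<otimes> x \<notin> B) --> c = f0 x))" for x
 have k: "k x : carrier R" "finite {d : D. f0 (d \<otimes> x) ~= k x}" "(\<forall>d\<in>D. d \<otimes> x \<notin> B) ==> k x = f0 x"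
  if "x : carrier G" for x
  using someI_ex[OF fx[OF that]] unfolding k_def by auto
 have kinv: "k (e \<otimes> x) = k x" if e: "e : D" and x: "x : carrier G" for e x
 proof -
  have "e \<otimes> x : carrier G" using e x DG by auto
  note k1 = k(2)[OF this] and k2 = k(2)[OF x]
  have inj: "inj_on (%d. d \<otimes> e) D" using DG e by (auto simp: inj_on_def subset_iff)
  have "{d : D. f0 (d \<otimes> e \<otimes> x) ~= k x} = (%d. d \<otimes> e) -` {d : D. f0 (d \<otimes> x) ~= k x} \<inter> D"
  using e D(1) by (auto simp: subgroup.m_closed)
  then have "finite {d : D. f0 (d \<otimes> e \<otimes> x) ~= k x}" using finite_vimage_IntI[OF k2 inj] by simp
  then have "finite ({d : D. f0 (d \<otimes> (e \<otimes> x)) ~= k (e \<otimes> x)} \<union> {d : D. f0 (d \<otimes> e \<otimes> x) ~= k x})" using k1 by simp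
  then obtain d where d: "d : D" "d \<notin> {d : D. f0 (d \<otimes> (e \<otimes> x)) ~= k (e \<otimes> x)} \<union> {d : D. f0 (d \<otimes> e \<otimes> x) ~= k x}"
  using D(2) by (meson finite_subset subsetI)
  then show ?thesis using e x DG by (auto simp: m_assoc subset_iff)
 qed
 have "{x : carrier G. \<not> f0 x = k x} \<subseteq> (\<Union>b\<in>B. (%d. d \<otimes> b) ` {d : D. f0 (d \<otimes> b) ~= k b})"
 proof
  fix x assume "x : {x : carrier G. \<not> f0 x = k x}"
  then have x: "x : carrier G" "f0 x ~= k x" by auto
  then obtain d where d: "d : D" "d \<otimes> x : B" using k(3) by metis
  have i: "inv d : D" using d D(1) by (simp add: subgroup.m_inv_closed)
  have "x = inv d \<otimes> (d \<otimes> x)" using d x DG by (simp add: m_assoc[symmetric] subset_iff)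
  moreover have "k (d \<otimes> x) = k x" using kinv d x by simp
  ultimately have "inv d : {e : D. f0 (e \<otimes> (d \<otimes> x)) ~= k (d \<otimes> x)}" using i x by simp
  then have "x : (%e. e \<otimes> (d \<otimes> x)) ` {e : D. f0 (e \<otimes> (d \<otimes> x)) ~= k (d \<otimes> x)}"
  using \<open>x = inv d \<otimes> (d \<otimes> x)\<close> by (rule rev_image_eqI)
  then show "x : (\<Union>b\<in>B. (%d. d \<otimes> b) ` {d : D. f0 (d \<otimes> b) ~= k b})" using d(2) by blast
 qed
 moreover have "finite (\<Union>b\<in>B. (%d. d \<otimes> b) ` {d : D. f0 (d \<otimes> b) ~= k b})" using B k(2) by blast
 ultimately have "eventually (%x. f0 x = k x) (cofin G)" unfolding eventually_cofin by (rule finite_subset)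
 then show False using not_invariant[OF D] kinv k(1) by blast
qed

text \<open>Let \<open>D\<close> be the infinite subgroup generated by \<open>S\<close>. On cosets
  that avoid a finite set \<open>B\<close> the function \<open>f0\<close> is constant, while on some
  coset through \<open>b \<in> B\<close> it is not almost constant. Right translation carries the
  latter coset to any other one by an affine relation with unit slope, so no coset avoids
  \<open>B\<close>, and \<open>S\<close> together with \<open>B\<close> generates
  \<open>G\<close>.\<close>

lemma fg_case:
 assumes S: "finite S" "S \<subseteq> carrier G" and inf_D: "infinite (generate G S)"
 shows "EX S'. finite S' & S' \<subseteq> carrier G & generate G S' = carrier G"
proof -
 let ?D = "generate G S"
 have D: "subgroup ?D G" using generate_is_subgroup[OF S(2)] .
 have DG: "?D \<subseteq> carrier G" using D subgroup.subset by blast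
 define B0 where "B0 = {x : carrier G. \<exists>s\<in>S. f0 (s \<otimes> x) ~= f0 x}"
 \<comment> \<open>The translates of \<open>B0\<close> are added for the inverse generators:
   \<open>f0 (inv s \<otimes> y) = f0 y\<close> requires that \<open>inv s \<otimes> y\<close> avoid
   \<open>B0\<close>, that is, that \<open>y\<close> avoid the translate of \<open>B0\<close> by
   \<open>s\<close>.\<close>
 define B where "B = B0 \<union> (\<Union>s\<in>S. (%x. s \<otimes> x) ` B0)"
 have "eventually (%x. \<forall>s\<in>S. f0 (s \<otimes> x) = f0 x) (cofin G)"
  using S AI_ev[OF f0(1)] by (intro eventually_ball_finite) auto
 moreover have "{x : carrier G. \<not> (\<forall>s\<in>S. f0 (s \<otimes> x) = f0 x)} = B0" unfolding B0_def by auto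
 ultimately have finB0: "finite B0" unfolding eventually_cofin by simp
 have finB: "finite B" unfolding B_def using finB0 S by auto
 have BG: "B \<subseteq> carrier G" using S unfolding B_def B0_def by auto
 have good: "\<forall>d\<in>?D. f0 (d \<otimes> x) = f0 x" if x: "x : carrier G" and nB: "!!d. d : ?D ==> d \<otimes> x \<notin> B" for x
 proof
  fix d assume d: "d : ?D"
  define V where "V = {y : carrier G. f0 y = f0 x & (\<exists>e\<in>?D. y = e \<otimes> x)}"
  have one: "\<one> : ?D" by (rule generate.one)
  have xV: "x : V" unfolding V_def using x one l_one[OF x, symmetric] by blast
  have "d \<otimes> x : V"
  proof (rule generate_closed_set[OF S(2) _ _ d xV])
  show "V \<subseteq> carrier G" by (auto simp: V_def)
  fix s y assume s: "s : S" and y: "y : V"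
  then obtain e where e: "e : ?D" "y = e \<otimes> x" and yG: "y : carrier G" and fy: "f0 y = f0 x" by (auto simp: V_def)
  have sG: "s : carrier G" using s S by auto
  have se: "s \<otimes> e : ?D" "inv s \<otimes> e : ?D" using s e by (auto intro: generate.intros)
  have eq: "s \<otimes> y = (s \<otimes> e) \<otimes> x" "inv s \<otimes> y = (inv s \<otimes> e) \<otimes> x" using e DG sG x by (auto simp: m_assoc subset_iff)
  have "y \<notin> B" "s \<otimes> y \<notin> B" "inv s \<otimes> y \<notin> B" using nB e se eq by auto
  then have "y \<notin> B0" "inv s \<otimes> y \<notin> B0" unfolding B_def by auto
  then have "f0 (s \<otimes> y) = f0 y" "f0 (s \<otimes> (inv s \<otimes> y)) = f0 (inv s \<otimes> y)" using s sG yG unfolding B0_def by auto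
  then have "f0 (s \<otimes> y) = f0 x" "f0 (inv s \<otimes> y) = f0 x" using fy sG yG by (auto simp: m_assoc[symmetric])
  then show "s \<otimes> y : V & inv s \<otimes> y : V" unfolding V_def using eq se sG yG by blast
  qed
  then show "f0 (d \<otimes> x) = f0 x" by (simp add: V_def)
 qed
 obtain b where b: "b : B" "!!c. c : carrier R ==> infinite {d : ?D. f0 (d \<otimes> b) ~= c}"
  using not_const_on_cosets[OF D inf_D finB BG good] by blast
 have bG: "b : carrier G" using b BG by auto
 have meet: "\<exists>d\<in>?D. d \<otimes> y : B" if y: "y : carrier G" for y
 proof (rule ccontr)
  assume "\<not> (\<exists>d\<in>?D. d \<otimes> y : B)"
  then have cy: "\<forall>d\<in>?D. f0 (d \<otimes> y) = f0 y" using good[OF y] by blast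
  define h where "h = inv b \<otimes> y"
  have h: "h : carrier G" "b \<otimes> h = y" using bG y by (auto simp: h_def m_assoc[symmetric])
  obtain c where c: "c : carrier R" "eventually (%x. f0 (x \<otimes> h) = mu h \<otimes>\<^bsub>R\<^esub> f0 x \<oplus>\<^bsub>R\<^esub> c) (cofin G)"
  using f0_right[OF h(1)] by blast
  \<comment> \<open>The affine relation solved for \<open>f0 (d \<otimes> b)\<close>, given that
    \<open>f0\<close> has the constant value \<open>f0 y\<close> on the translated coset.\<close>
  define a where "a = mu (inv h) \<otimes>\<^bsub>R\<^esub> (f0 y \<ominus>\<^bsub>R\<^esub> c)"
  note cl = mu_closed[OF h(1)] mu_closed[OF inv_closed[OF h(1)]] c(1) AI_closed[OF f0(1) y]
  have "a : carrier R" using cl by (simp add: a_def)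
  have "(%d. d \<otimes> b) ` {d : ?D. f0 (d \<otimes> b) ~= a} \<subseteq> {x : carrier G. \<not> f0 (x \<otimes> h) = mu h \<otimes>\<^bsub>R\<^esub> f0 x \<oplus>\<^bsub>R\<^esub> c}"
  proof (rule image_subsetI, rule CollectI, rule conjI, goal_cases)
  case (1 d) then show ?case using DG bG by auto
  next
  case (2 d)
  have dG: "d : carrier G" using 2 DG by auto
  have f0c: "f0 (d \<otimes> b) : carrier R" using AI_closed[OF f0(1)] dG bG by auto
  show ?case
  proof
  assume "f0 (d \<otimes> b \<otimes> h) = mu h \<otimes>\<^bsub>R\<^esub> f0 (d \<otimes> b) \<oplus>\<^bsub>R\<^esub> c"
  moreover have "f0 (d \<otimes> b \<otimes> h) = f0 y" using cy 2 dG bG h by (simp add: m_assoc)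
  ultimately have "a = mu (inv h) \<otimes>\<^bsub>R\<^esub> (mu h \<otimes>\<^bsub>R\<^esub> f0 (d \<otimes> b) \<oplus>\<^bsub>R\<^esub> c \<ominus>\<^bsub>R\<^esub> c)" by (simp add: a_def)
  also have "... = mu (inv h) \<otimes>\<^bsub>R\<^esub> mu h \<otimes>\<^bsub>R\<^esub> f0 (d \<otimes> b)" using cl f0c by algebra
  also have "... = f0 (d \<otimes> b)" using mu_unit[OF h(1)] f0c by simp
  finally show False using 2 by simp
  qed
  qed
  then have "finite ((%d. d \<otimes> b) ` {d : ?D. f0 (d \<otimes> b) ~= a})" using c(2) finite_subset unfolding eventually_cofin by blast
  moreover have "inj_on (%d. d \<otimes> b) {d : ?D. f0 (d \<otimes> b) ~= a}" using DG bG by (auto simp: inj_on_def subset_iff)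
  ultimately have "finite {d : ?D. f0 (d \<otimes> b) ~= a}" by (rule finite_imageD)
  then show False using b(2) \<open>a : carrier R\<close> by blast
 qed
 have SB: "S \<union> B \<subseteq> carrier G" using S BG by auto
 have "y : generate G (S \<union> B)" if y: "y : carrier G" for y
 proof -
  obtain d where d: "d : ?D" "d \<otimes> y : B" using meet[OF y] by blast
  have sub: "subgroup (generate G (S \<union> B)) G" using generate_is_subgroup[OF SB] .
  have "d : generate G (S \<union> B)" using d mono_generate[of S "S \<union> B"] by auto
  moreover have "d \<otimes> y : generate G (S \<union> B)" using d by (auto intro: generate.incl)
  moreover have "y = inv d \<otimes> (d \<otimes> y)" using d y DG by (simp add: m_assoc[symmetric] subset_iff)
  ultimately show ?thesis using sub by (metis subgroup.m_closed subgroup.m_inv_closed)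
 qed
 then have "generate G (S \<union> B) = carrier G" using generate_incl[OF SB] by auto
 then show ?thesis using S finB SB by blast
qed

text \<open>A sequence of distinct levels is split by its index modulo 3. The indicators of two
  classes are independent modulo constants: points of the third class give
  \<open>r = \<zero>\<close>, points of class 0 then give \<open>lam (u 1) = \<zero>\<close>, yet
  \<open>u 1\<close> takes both values infinitely often.\<close>

lemma not_union_of_finite:
 assumes fin: "!!n::nat. finite (D n)" and sub: "!!n. subgroup (D n) G"
  and mono: "!!n. D n \<subseteq> D (Suc n)" and un: "(\<Union>n. D n) = carrier G"
 shows False
proof -
 obtain l :: "_ => nat" where l: "infinite (l ` carrier G)"
  "!!P. (%x. if P (l x) then \<one>\<^bsub>R\<^esub> else \<zero>\<^bsub>R\<^esub>) : almost_inv R G"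
  using AI_level[OF assms] inf by blast
 obtain e :: "nat => nat" where e: "inj e" "range e \<subseteq> l ` carrier G"
  using infinite_countable_subset[OF l(1)] by blast
 define c where "c i = {x : carrier G. EX k. l x = e (3 * k + i)}" for i
 have inf_c: "infinite (c i)" for i
 proof
  assume "finite (c i)"
  moreover have "range (%k. e (3 * k + i)) \<subseteq> l ` c i"
  proof
  fix y assume "y : range (%k. e (3 * k + i))"
  then obtain k where k: "y = e (3 * k + i)" by auto
  then obtain x where "x : carrier G" "y = l x" using e(2) by blast
  then show "y : l ` c i" using k unfolding c_def by blast
  qed
  ultimately have "finite (range (%k. e (3 * k + i)))" using finite_surj by blast
  moreover have "inj (%k. e (3 * k + i))" by (rule injI) (use injD[OF e(1)] in fastforce)
  ultimately show False using finite_imageD by blast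
 qed
 have cG: "c i \<subseteq> carrier G" for i by (auto simp: c_def)
 define P where "P i = (%m. EX k. m = e (3 * k + i))" for i
 have Pc: "P j (l x) \<longleftrightarrow> i = j" if xc: "x : c i" and "i < 3" "j < 3" for i j x
 proof -
  obtain k where k: "l x = e (3 * k + i)" using xc unfolding c_def by blast
  have "(e (3 * k + i) = e (3 * k' + j)) = (3 * k + i = 3 * k' + j)" for k' using inj_eq[OF e(1)] .
  moreover have "(EX k'. 3 * k + i = 3 * k' + j) \<longleftrightarrow> i = j" using that by presburger
  ultimately show ?thesis using k by (simp add: P_def)
 qed
 define u where "u i = (%x. if P i (l x) then \<one>\<^bsub>R\<^esub> else \<zero>\<^bsub>R\<^esub>)" for i
 have u: "u i : almost_inv R G" for i unfolding u_def by (rule l(2))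
 obtain r where r: "r : carrier R"
  "eventually (%x. lam (u 1) \<otimes>\<^bsub>R\<^esub> u 0 x = lam (u 0) \<otimes>\<^bsub>R\<^esub> u 1 x \<oplus>\<^bsub>R\<^esub> r) (cofin G)"
  using proportional[OF u u] by blast
 note cl = lam_closed[OF u]
 obtain x where x: "x : c 2" "lam (u 1) \<otimes>\<^bsub>R\<^esub> u 0 x = lam (u 0) \<otimes>\<^bsub>R\<^esub> u 1 x \<oplus>\<^bsub>R\<^esub> r"
  using eventually_cofin_happens[OF inf_c cG r(2)] by blast
 then have "r = \<zero>\<^bsub>R\<^esub>" using cl r(1) Pc[OF x(1)] by (simp add: u_def)
 moreover obtain y where y: "y : c 0" "lam (u 1) \<otimes>\<^bsub>R\<^esub> u 0 y = lam (u 0) \<otimes>\<^bsub>R\<^esub> u 1 y \<oplus>\<^bsub>R\<^esub> r"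
  using eventually_cofin_happens[OF inf_c cG r(2)] by blast
 ultimately have "lam (u 1) = \<zero>\<^bsub>R\<^esub>" using cl r(1) Pc[OF y(1)] by (simp add: u_def)
 then obtain a where a: "a : carrier R" "eventually (%x. u 1 x = a) (cofin G)"
  using lam_zero[OF u] by (auto simp: almost_const_def)
 obtain v where "v : c 0" "u 1 v = a" using eventually_cofin_happens[OF inf_c cG a(2)] by blast
 moreover obtain w where "w : c 1" "u 1 w = a" using eventually_cofin_happens[OF inf_c cG a(2)] by blast
 ultimately show False using Pc[of v 0 1] Pc[of w 1 1] one_neq by (auto simp: u_def)
qed

end

context rank_one begin

text \<open>A locally finite \<open>G\<close> contains an infinite union \<open>D\<close> of an
  increasing sequence of finite subgroups that also absorbs the exceptional points of
  \<open>f0\<close>, so \<open>f0\<close> is \<open>D\<close>-invariant outside \<open>D\<close>. If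
  \<open>D\<close> is all of \<open>G\<close>, \<open>not_union_of_finite\<close> applies. Otherwise
  right translation by some \<open>h\<close> outside \<open>D\<close> carries \<open>D\<close> to a
  coset where \<open>f0\<close> is constant, which makes \<open>f0\<close> almost constant on
  \<open>D\<close>.\<close>

lemma not_locally_finite:
 assumes lf: "!!S. [|finite S; S \<subseteq> carrier G|] ==> finite (generate G S)"
 shows False
proof -
 define F where "F g = {x : carrier G. f0 (g \<otimes> x) ~= f0 x}" for g
 have finF: "finite (F g)" if "g : carrier G" for g
  using AI_ev[OF f0(1) that] unfolding eventually_cofin F_def .
 \<comment> \<open>A point outside the subgroup, added at every stage so that the union is
   infinite.\<close>
 define nw where "nw D = (SOME x. x : carrier G & x \<notin> D)" for D
 define step where "step D = generate G (D \<union> (\<Union>g\<in>D. F g) \<union> {nw D})" for D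
 define Ds where "Ds n = (step ^^ n) (generate G {})" for n
 have nw: "nw D : carrier G" "nw D \<notin> D" if "finite D" for D
 proof -
  have "\<not> carrier G \<subseteq> D"
  proof
  assume "carrier G \<subseteq> D"
  then have "finite (carrier G)" using that by (rule finite_subset)
  then show False using inf by simp
  qed
  then have "EX x. x : carrier G & x \<notin> D" by blast
  then have "nw D : carrier G & nw D \<notin> D" unfolding nw_def by (rule someI_ex)
  then show "nw D : carrier G" "nw D \<notin> D" by auto
 qed
 have step: "finite (step D)" "subgroup (step D) G" "D \<union> (\<Union>g\<in>D. F g) \<union> {nw D} \<subseteq> step D"
  if D: "finite D" "subgroup D G" for D
 proof -
  have DG: "D \<subseteq> carrier G" using D subgroup.subset by blast
  have cG: "D \<union> (\<Union>g\<in>D. F g) \<union> {nw D} \<subseteq> carrier G" using DG nw[OF D(1)] by (auto simp: F_def)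
  have "finite (D \<union> (\<Union>g\<in>D. F g) \<union> {nw D})" using D finF DG by auto
  then show "finite (step D)" unfolding step_def using cG by (rule lf)
  show "subgroup (step D) G" unfolding step_def using cG by (rule generate_is_subgroup)
  show "D \<union> (\<Union>g\<in>D. F g) \<union> {nw D} \<subseteq> step D" unfolding step_def by (rule subsetI) (rule generate.incl)
 qed
 have Ds: "finite (Ds n) & subgroup (Ds n) G" for n
 proof (induction n)
  case 0
  then show ?case using lf[of "{}"] generate_is_subgroup[of "{}"] by (simp add: Ds_def)
 next
  case (Suc n)
  then show ?case using step[of "Ds n"] by (simp add: Ds_def)
 qed
 have DsS: "Ds n \<union> (\<Union>g\<in>Ds n. F g) \<union> {nw (Ds n)} \<subseteq> Ds (Suc n)" for n
  using step(3)[of "Ds n"] Ds[of n] by (simp add: Ds_def)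
 have Ds_Suc: "Ds n \<subseteq> Ds (Suc n)" "g : Ds n ==> F g \<subseteq> Ds (Suc n)" "nw (Ds n) : Ds (Suc n)" for n g
  using DsS[of n] by blast+
 have mono: "Ds m \<subseteq> Ds n" if "m <= n" for m n using Ds_Suc(1) that by (rule lift_Suc_mono_le)
 define D where "D = (\<Union>n. Ds n)"
 have subD: "subgroup D G"
 proof (rule subgroup.intro)
  have subDs: "subgroup (Ds n) G" for n using Ds[of n] ..
  have "Ds n \<subseteq> carrier G" for n using subDs by (rule subgroup.subset)
  then show "D \<subseteq> carrier G" unfolding D_def by blast
  have "\<one> : Ds 0" using subDs by (rule subgroup.one_closed)
  then show "\<one> : D" unfolding D_def by blast
  fix x assume "x : D"
  then obtain n where "x : Ds n" unfolding D_def by blast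
  with subDs have "inv x : Ds n" by (rule subgroup.m_inv_closed)
  then show "inv x : D" unfolding D_def by blast
  fix y assume "y : D"
  then obtain m n where "x : Ds m" "y : Ds n" using \<open>x : D\<close> unfolding D_def by blast
  moreover have "Ds m \<subseteq> Ds (max m n)" "Ds n \<subseteq> Ds (max m n)" by (rule mono, simp)+
  ultimately have "x : Ds (max m n)" "y : Ds (max m n)" by blast+
  with subDs have "x \<otimes> y : Ds (max m n)" by (rule subgroup.m_closed)
  then show "x \<otimes> y : D" unfolding D_def by blast
 qed
 have DG: "D \<subseteq> carrier G" using subD subgroup.subset by blast
 have infD: "infinite D"
 proof
  assume fD: "finite D"
  have "EX n. D \<subseteq> Ds n"
  proof -
  have "\<forall>x\<in>D. EX n. x : Ds n" unfolding D_def by blast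
  then obtain m where m: "!!x. x : D ==> x : Ds (m x)" by metis
  have "D \<subseteq> Ds (Max (m ` D))"
  proof
  fix x assume x: "x : D"
  then have "m x <= Max (m ` D)" using fD by simp
  then show "x : Ds (Max (m ` D))" using m[OF x] mono by blast
  qed
  then show ?thesis by blast
  qed
  then obtain n where "D \<subseteq> Ds n" by blast
  moreover have "nw (Ds n) : D" using Ds_Suc(3) unfolding D_def by blast
  ultimately show False using nw(2)[of "Ds n"] Ds[of n] by blast
 qed
 have out: "f0 (g \<otimes> x) = f0 x" if gD: "g : D" and "x : carrier G" "x \<notin> D" for g x
 proof (rule ccontr)
  assume "f0 (g \<otimes> x) ~= f0 x"
  then have "x : F g" using that by (simp add: F_def)
  obtain n where "g : Ds n" using gD unfolding D_def by blast
  then have "x : D" using Ds_Suc(2) \<open>x : F g\<close> unfolding D_def by blast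
  then show False using that(3) by simp
 qed
 show False
 proof (cases "D = carrier G")
  case True
  show False
  by (rule not_union_of_finite[of Ds]) (use Ds Ds_Suc(1) True in "auto simp: D_def")
 next
  case False
  then obtain h where h: "h : carrier G" "h \<notin> D" using DG by auto
  obtain c where c: "c : carrier R" "eventually (%x. f0 (x \<otimes> h) = mu h \<otimes>\<^bsub>R\<^esub> f0 x \<oplus>\<^bsub>R\<^esub> c) (cofin G)"
  using f0_right[OF h(1)] by blast
  define a where "a = mu (inv h) \<otimes>\<^bsub>R\<^esub> (f0 h \<ominus>\<^bsub>R\<^esub> c)"
  note cl = mu_closed[OF h(1)] mu_closed[OF inv_closed[OF h(1)]] c(1) AI_closed[OF f0(1) h(1)]
  have aR: "a : carrier R" using cl by (simp add: a_def)
  have "{d : D. f0 d ~= a} \<subseteq> {x : carrier G. \<not> f0 (x \<otimes> h) = mu h \<otimes>\<^bsub>R\<^esub> f0 x \<oplus>\<^bsub>R\<^esub> c}"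
  proof (intro subsetI CollectI conjI notI, goal_cases)
  case (1 d) then show ?case using DG by auto
  next
  case (2 d)
  have f0d: "f0 d : carrier R" using AI_closed[OF f0(1)] 2 DG by auto
  have "f0 (d \<otimes> h) = f0 h" using out h 2 by auto
  with 2 have "a = mu (inv h) \<otimes>\<^bsub>R\<^esub> (mu h \<otimes>\<^bsub>R\<^esub> f0 d \<oplus>\<^bsub>R\<^esub> c \<ominus>\<^bsub>R\<^esub> c)" by (simp add: a_def)
  also have "... = mu (inv h) \<otimes>\<^bsub>R\<^esub> mu h \<otimes>\<^bsub>R\<^esub> f0 d" using cl f0d by algebra
  also have "... = f0 d" using mu_unit[OF h(1)] f0d by simp
  finally show ?case using 2 by simp
  qed
  then have fin: "finite {d : D. f0 d ~= a}" using c(2) finite_subset unfolding eventually_cofin by blast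
  show False
  \<comment> \<open>With the identity as only exceptional point, the single coset that meets the
    exceptional set is \<open>D\<close> itself.\<close>
  proof (rule not_const_on_cosets[OF subD infD, of "{\<one>}"])
  fix x assume "x : carrier G" and nB: "!!d. d : D ==> d \<otimes> x \<notin> {\<one>}"
  moreover have "x \<notin> D" using nB[of "inv x"] subD \<open>x : carrier G\<close> subgroup.m_inv_closed by fastforce
  ultimately show "\<forall>d\<in>D. f0 (d \<otimes> x) = f0 x" using out by blast
  next
  fix x assume "x : {\<one>}"
  moreover have "{d : D. f0 (d \<otimes> \<one>) ~= a} = {d : D. f0 d ~= a}" using DG by auto
  ultimately have "finite {d : D. f0 (d \<otimes> x) ~= a}" using fin by simp
  then show "\<exists>c\<in>carrier R. finite {d : D. f0 (d \<otimes> x) ~= c}" using aR by blast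
  qed auto
 qed
qed

lemma finitely_generated:
 "EX S. finite S & S \<subseteq> carrier G & (\<forall>s\<in>S. inv s : S) & generate G S = carrier G"
proof -
 obtain S0 where S0: "finite S0" "S0 \<subseteq> carrier G" "infinite (generate G S0)"
  using not_locally_finite by blast
 obtain S where S: "finite S" "S \<subseteq> carrier G" "generate G S = carrier G" using fg_case[OF S0] by blast
 let ?S = "S \<union> (%s. inv s) ` S"
 have sG: "?S \<subseteq> carrier G" using S by auto
 have "carrier G \<subseteq> generate G ?S" using S(3) mono_generate[of S ?S] by auto
 then have 1: "generate G ?S = carrier G" using generate_incl[OF sG] by (rule subset_antisym[rotated])
 have 2: "\<forall>s\<in>?S. inv s : ?S" using S(2) by (auto simp: subset_iff)
 have 3: "finite ?S" using S by simp
 show ?thesis by (intro exI[of _ ?S] conjI 1 2 3 sG)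
qed

text \<open>Along an edge of the Cayley graph the value changes only at the finite set
  \<open>B\<close>. A value not attained on \<open>C\<close> would therefore be attained on a set
  closed under the generators, hence at the identity, which lies in \<open>C\<close>.\<close>

lemma finitely_many_values: "finite (f0 ` carrier G)"
proof -
 obtain S where S: "finite S" "S \<subseteq> carrier G" "\<forall>s\<in>S. inv s : S" "generate G S = carrier G"
  using finitely_generated by blast
 define B where "B = {x : carrier G. \<not> (\<forall>s\<in>S. f0 (s \<otimes> x) = f0 x)}"
 define C where "C = insert \<one> (B \<union> (\<Union>s\<in>S. (%x. s \<otimes> x) ` B))"
 have "eventually (%x. \<forall>s\<in>S. f0 (s \<otimes> x) = f0 x) (cofin G)"
  using S AI_ev[OF f0(1)] by (intro eventually_ball_finite) auto
 then have finB: "finite B" unfolding B_def eventually_cofin .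
 have finC: "finite C" using finB S by (simp add: C_def)
 define V where "V = {x : carrier G. f0 x \<notin> f0 ` C}"
 have cl: "s \<otimes> x : V" if s: "s : S" and x: "x : V" for s x
 proof -
  have "x \<notin> B" using x unfolding V_def C_def by auto
  then have "f0 (s \<otimes> x) = f0 x" using s x unfolding B_def V_def by auto
  then show ?thesis using x s S unfolding V_def by auto
 qed
 have "V = {}"
 proof (rule ccontr)
  assume "V ~= {}"
  then obtain x where x: "x : V" by auto
  have xG: "x : carrier G" using x by (simp add: V_def)
  have "inv x \<otimes> x : V"
  by (rule generate_closed_set[OF S(2) _ _ _ x]) (use cl S xG in "auto simp: V_def")
  then show False using xG by (simp add: V_def C_def)
 qed
 then have "f0 ` carrier G \<subseteq> f0 ` C" unfolding V_def by blast
 then show ?thesis using finC finite_subset by blast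
qed

text \<open>The indicator of \<open>P\<close> and its right translate are proportional modulo
  constants, with nonzero factors. Each of the four cells of pairs of truth values, if infinite,
  gives one equation, and two cells that differ in one coordinate would force a factor to vanish. So
  the cells of one diagonal are finite.\<close>

lemma two_ended_set:
 assumes "!!g. g : carrier G ==> eventually (%x. P (g \<otimes> x) \<longleftrightarrow> P x) (cofin G)"
  and infP: "infinite {x : carrier G. P x}" "infinite {x : carrier G. \<not> P x}"
  and h: "h : carrier G"
 shows "eventually (%x. P (x \<otimes> h) \<longleftrightarrow> P x) (cofin G) \<or> eventually (%x. P (x \<otimes> h) \<longleftrightarrow> \<not> P x) (cofin G)"
proof -
 let ?u = "%x. if P x then \<one>\<^bsub>R\<^esub> else \<zero>\<^bsub>R\<^esub>" and ?v = "%x. if P (x \<otimes> h) then \<one>\<^bsub>R\<^esub> else \<zero>\<^bsub>R\<^esub>"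
 have u: "?u : almost_inv R G" by (rule AI_indicator) (rule assms(1))
 have v: "?v : almost_inv R G" using AI_right[OF u h] .
 have infQ: "infinite {x : carrier G. P (x \<otimes> h)}" "infinite {x : carrier G. \<not> P (x \<otimes> h)}"
 proof -
  have eq: "{x : carrier G. Q (x \<otimes> h)} = (%y. y \<otimes> inv h) ` {x : carrier G. Q x}" for Q
  proof (intro equalityI subsetI)
  fix x assume "x : {x : carrier G. Q (x \<otimes> h)}"
  then show "x : (%y. y \<otimes> inv h) ` {x : carrier G. Q x}" using h by (intro image_eqI[of _ _ "x \<otimes> h"]) (auto simp: m_assoc)
  qed (use h in "auto simp: m_assoc")
  have inj: "inj_on (%y. y \<otimes> inv h) X" if "X \<subseteq> carrier G" for X using that h by (auto simp: inj_on_def subset_iff)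
  show "infinite {x : carrier G. P (x \<otimes> h)}" unfolding eq
  using infP(1) finite_imageD[OF _ inj[of "{x : carrier G. P x}"]] by blast
  show "infinite {x : carrier G. \<not> P (x \<otimes> h)}" unfolding eq[of "%x. \<not> P x"]
  using infP(2) finite_imageD[OF _ inj[of "{x : carrier G. \<not> P x}"]] by blast
 qed
 have nz: "lam (%x. if Q x then \<one>\<^bsub>R\<^esub> else \<zero>\<^bsub>R\<^esub>) ~= \<zero>\<^bsub>R\<^esub>"
  if Q: "(%x. if Q x then \<one>\<^bsub>R\<^esub> else \<zero>\<^bsub>R\<^esub>) : almost_inv R G" "infinite {x : carrier G. Q x}" "infinite {x : carrier G. \<not> Q x}" for Q
 proof
  assume "lam (%x. if Q x then \<one>\<^bsub>R\<^esub> else \<zero>\<^bsub>R\<^esub>) = \<zero>\<^bsub>R\<^esub>"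
  then obtain c where c: "eventually (%x. (if Q x then \<one>\<^bsub>R\<^esub> else \<zero>\<^bsub>R\<^esub>) = c) (cofin G)"
  using lam_zero[OF Q(1)] unfolding almost_const_def by blast
  have "\<exists>x\<in>{x : carrier G. Q x}. (if Q x then \<one>\<^bsub>R\<^esub> else \<zero>\<^bsub>R\<^esub>) = c"
  by (rule eventually_cofin_happens[OF Q(2) _ c]) auto
  moreover have "\<exists>x\<in>{x : carrier G. \<not> Q x}. (if Q x then \<one>\<^bsub>R\<^esub> else \<zero>\<^bsub>R\<^esub>) = c"
  by (rule eventually_cofin_happens[OF Q(3) _ c]) auto
  ultimately show False using one_neq by auto
 qed
 obtain c where c: "c : carrier R" "eventually (%x. lam ?v \<otimes>\<^bsub>R\<^esub> ?u x = lam ?u \<otimes>\<^bsub>R\<^esub> ?v x \<oplus>\<^bsub>R\<^esub> c) (cofin G)"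
  using proportional[OF u v] by blast
 have a: "lam ?u ~= \<zero>\<^bsub>R\<^esub>" "lam ?v ~= \<zero>\<^bsub>R\<^esub>" using nz[OF u infP] nz[OF v infQ] .
 note cl = lam_closed[OF u] lam_closed[OF v] c(1)
 define cell where "cell \<alpha> \<beta> = {x : carrier G. P x = \<alpha> & P (x \<otimes> h) = \<beta>}" for \<alpha> \<beta>
 have val: "(if \<alpha> then lam ?v else \<zero>\<^bsub>R\<^esub>) = (if \<beta> then lam ?u else \<zero>\<^bsub>R\<^esub>) \<oplus>\<^bsub>R\<^esub> c" if "infinite (cell \<alpha> \<beta>)" for \<alpha> \<beta>
 proof -
  have "\<exists>x\<in>cell \<alpha> \<beta>. lam ?v \<otimes>\<^bsub>R\<^esub> ?u x = lam ?u \<otimes>\<^bsub>R\<^esub> ?v x \<oplus>\<^bsub>R\<^esub> c"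
  by (rule eventually_cofin_happens[OF that _ c(2)]) (auto simp: cell_def)
  then show ?thesis using cl by (auto simp: cell_def split: if_splits)
 qed
 have flip1: "finite (cell \<alpha> True) \<or> finite (cell \<alpha> False)" for \<alpha>
 proof (rule ccontr)
  assume "\<not> ?thesis"
  then have "lam ?u \<oplus>\<^bsub>R\<^esub> c = \<zero>\<^bsub>R\<^esub> \<oplus>\<^bsub>R\<^esub> c" using val[of \<alpha> True] val[of \<alpha> False] by simp
  then show False using a cl by (simp add: R.add.right_cancel)
 qed
 have flip2: "finite (cell True \<beta>) \<or> finite (cell False \<beta>)" for \<beta>
 proof (rule ccontr)
  assume "\<not> ?thesis"
  then have "lam ?v = \<zero>\<^bsub>R\<^esub>" using val[of True \<beta>] val[of False \<beta>] by simp
  then show False using a by simp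
 qed
 have "{x : carrier G. \<not> (P (x \<otimes> h) \<longleftrightarrow> P x)} = cell True False \<union> cell False True"
  "{x : carrier G. \<not> (P (x \<otimes> h) \<longleftrightarrow> \<not> P x)} = cell True True \<union> cell False False"
  unfolding cell_def by auto
 then show ?thesis unfolding eventually_cofin using flip1[of True] flip1[of False] flip2[of True] flip2[of False]
  by (simp only: finite_Un) blast
qed

text \<open>Finitely many values force an infinite level set of \<open>f0\<close>, and its
  complement is infinite because \<open>f0\<close> is not almost constant. This is the set to which
  the flux argument applies.\<close>

theorem virt_cyclic: "virt_cyclic G"
proof -
 obtain S where S: "finite S" "S \<subseteq> carrier G" "\<forall>s\<in>S. inv s : S" "generate G S = carrier G"
  using finitely_generated by blast
 have "\<exists>v\<in>f0 ` carrier G. infinite {x : carrier G. f0 x = v}"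
 proof (rule ccontr)
  assume "\<not> ?thesis"
  then have "finite (\<Union>v\<in>f0 ` carrier G. {x : carrier G. f0 x = v})" using finitely_many_values by blast
  moreover have "(\<Union>v\<in>f0 ` carrier G. {x : carrier G. f0 x = v}) = carrier G" by auto
  ultimately show False using inf by simp
 qed
 then obtain v where v: "v : f0 ` carrier G" "infinite {x : carrier G. f0 x = v}" by blast
 have vR: "v : carrier R" using v AI_closed[OF f0(1)] by auto
 have v': "infinite {x : carrier G. \<not> f0 x = v}"
  using f0_not_almost_const vR unfolding almost_const_def eventually_cofin by blast
 let ?A = "{x : carrier G. f0 x = v}"
 have alm: "eventually (%x. f0 (g \<otimes> x) = v \<longleftrightarrow> f0 x = v) (cofin G)" if g: "g : carrier G" for g
  using AI_ev[OF f0(1) g] by eventually_elim simp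
 interpret almost_invariant_set G S ?A
 proof unfold_locales
  have "carrier G - ?A = {x : carrier G. \<not> f0 x = v}" by auto
  then show "infinite (carrier G - ?A)" using v' by simp
  fix g assume g: "g : carrier G"
  show "eventually (%x. g \<otimes> x : ?A \<longleftrightarrow> x : ?A) (cofin G)"
  using alm[OF g] eventually_cofin_carrier by eventually_elim (use g in auto)
  have "eventually (%x. f0 (x \<otimes> g) = v \<longleftrightarrow> f0 x = v) (cofin G) \<or>
  eventually (%x. f0 (x \<otimes> g) = v \<longleftrightarrow> \<not> f0 x = v) (cofin G)"
  by (rule two_ended_set[OF _ v(2) v' g]) (rule alm)
  then show "eventually (%x. x \<otimes> g : ?A \<longleftrightarrow> x : ?A) (cofin G) \<or>
  eventually (%x. x \<otimes> g : ?A \<longleftrightarrow> x \<notin> ?A) (cofin G)"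
  proof (elim disj_forward)
  assume "eventually (%x. f0 (x \<otimes> g) = v \<longleftrightarrow> f0 x = v) (cofin G)"
  then show "eventually (%x. x \<otimes> g : ?A \<longleftrightarrow> x : ?A) (cofin G)"
  using eventually_cofin_carrier by eventually_elim (use g in auto)
  next
  assume "eventually (%x. f0 (x \<otimes> g) = v \<longleftrightarrow> \<not> f0 x = v) (cofin G)"
  then show "eventually (%x. x \<otimes> g : ?A \<longleftrightarrow> x \<notin> ?A) (cofin G)"
  using eventually_cofin_carrier by eventually_elim (use g in auto)
  qed
 qed (use S v in auto)
 show ?thesis by (rule virt_cyclic)
qed

end

section \<open>Cohomology with coefficients in the group ring\<close>

lemma (in cring) module_free_mod: "Module.module R (free_mod R X)"
proof (rule moduleI)
 show "abelian_group (free_mod R X)"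
 proof (rule abelian_groupI)
  fix f g assume "f : carrier (free_mod R X)" "g : carrier (free_mod R X)"
  then have fg: "!!k. f k : carrier R" "!!k. g k : carrier R" "{k. f k ~= \<zero>} \<subseteq> X" "{k. g k ~= \<zero>} \<subseteq> X"
  "finite {k. f k ~= \<zero>}" "finite {k. g k ~= \<zero>}" by (auto simp: free_mod_def)
  have sub: "{k. f k \<oplus> g k ~= \<zero>} \<subseteq> {k. f k ~= \<zero>} \<union> {k. g k ~= \<zero>}" by auto
  moreover have "finite {k. f k \<oplus> g k ~= \<zero>}" by (rule finite_subset[OF sub]) (use fg in simp)
  ultimately show "f \<oplus>\<^bsub>free_mod R X\<^esub> g : carrier (free_mod R X)"
  using fg by (simp add: free_mod_def) blast
 next
  fix f assume "f : carrier (free_mod R X)"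
  then have f: "!!k. f k : carrier R" "{k. f k ~= \<zero>} \<subseteq> X" "finite {k. f k ~= \<zero>}" by (auto simp: free_mod_def)
  have "{k. \<ominus> f k ~= \<zero>} = {k. f k ~= \<zero>}" using f(1) by auto
  then have "(%k. \<ominus> f k) : carrier (free_mod R X)" using f by (simp add: free_mod_def)
  moreover have "(%k. \<ominus> f k) \<oplus>\<^bsub>free_mod R X\<^esub> f = \<zero>\<^bsub>free_mod R X\<^esub>" using f(1) by (simp add: free_mod_def l_neg)
  ultimately show "\<exists>y\<in>carrier (free_mod R X). y \<oplus>\<^bsub>free_mod R X\<^esub> f = \<zero>\<^bsub>free_mod R X\<^esub>" by blast
 qed (auto simp: free_mod_def a_ac)
next
 fix a f assume a: "a : carrier R" and "f : carrier (free_mod R X)"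
 then have f: "!!k. f k : carrier R" "{k. f k ~= \<zero>} \<subseteq> X" "finite {k. f k ~= \<zero>}" by (auto simp: free_mod_def)
 have sub: "{k. a \<otimes> f k ~= \<zero>} \<subseteq> {k. f k ~= \<zero>}" using a by auto
 moreover have "finite {k. a \<otimes> f k ~= \<zero>}" by (rule finite_subset[OF sub f(3)])
 ultimately show "a \<odot>\<^bsub>free_mod R X\<^esub> f : carrier (free_mod R X)" using f a by (auto simp: free_mod_def)
qed (auto simp: free_mod_def l_distr r_distr m_assoc is_cring)

lemma (in cring) free_mod_minus:
 assumes "f : carrier (free_mod R X)"
 shows "\<ominus>\<^bsub>free_mod R X\<^esub> f = (%k. \<ominus> f k)"
proof -
 interpret M: Module.module R "free_mod R X" by (rule module_free_mod)
 have f: "!!k. f k : carrier R" "{k. f k ~= \<zero>} \<subseteq> X" "finite {k. f k ~= \<zero>}" using assms by (auto simp: free_mod_def)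
 have "{k. \<ominus> f k ~= \<zero>} = {k. f k ~= \<zero>}" using f(1) by auto
 then have "(%k. \<ominus> f k) : carrier (free_mod R X)" using f by (simp add: free_mod_def)
 moreover have "(%k. \<ominus> f k) \<oplus>\<^bsub>free_mod R X\<^esub> f = \<zero>\<^bsub>free_mod R X\<^esub>" using f(1) by (simp add: free_mod_def l_neg)
 ultimately show ?thesis using assms by (simp add: M.minus_equality)
qed

lemma (in cring) free_mod_finsum:
 assumes "finite A" "!!i. i : A ==> f i : carrier (free_mod R X)"
 shows "finsum (free_mod R X) f A k = (\<Oplus>i\<in>A. f i k)"
proof -
 interpret M: Module.module R "free_mod R X" by (rule module_free_mod)
 have cl: "h k : carrier R" if "h : carrier (free_mod R X)" for h using that by (simp add: free_mod_def)
 show ?thesis using assms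
 proof (induction A)
  case empty then show ?case unfolding M.finsum_empty finsum_empty by (simp add: free_mod_def)
 next
  case (insert a A)
  have "finsum (free_mod R X) f (insert a A) = f a \<oplus>\<^bsub>free_mod R X\<^esub> finsum (free_mod R X) f A"
  using insert by (intro M.finsum_insert) auto
  then have "finsum (free_mod R X) f (insert a A) k = f a k \<oplus> finsum (free_mod R X) f A k"
  by (simp add: free_mod_def)
  also have "... = f a k \<oplus> (\<Oplus>i\<in>A. f i k)" using insert by simp
  also have "... = (\<Oplus>i\<in>insert a A. f i k)" using insert cl by (subst finsum_insert) auto
  finally show ?case .
 qed
qed

lemma module_cochains:
 fixes R (structure) and M :: "('r, 'a) module"
 assumes "Module.module R M"
 shows "Module.module R (cochains \<Gamma> M n)"
proof -
 interpret Module.module R M by fact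
 show ?thesis
proof (rule moduleI)
 show "abelian_group (cochains \<Gamma> M n)"
 proof (rule abelian_groupI)
  fix f assume f: "f : carrier (cochains \<Gamma> M n)"
  let ?g = "\<lambda>gs\<in>tuples \<Gamma> n. \<ominus>\<^bsub>M\<^esub> f gs"
  have "?g : carrier (cochains \<Gamma> M n)" using f by (auto simp: cochains_def PiE_iff)
  moreover have "?g \<oplus>\<^bsub>cochains \<Gamma> M n\<^esub> f = \<zero>\<^bsub>cochains \<Gamma> M n\<^esub>"
  using f by (auto simp: cochains_def PiE_iff M.l_neg)
  ultimately show "\<exists>y\<in>carrier (cochains \<Gamma> M n). y \<oplus>\<^bsub>cochains \<Gamma> M n\<^esub> f = \<zero>\<^bsub>cochains \<Gamma> M n\<^esub>" by blast
 next
  fix f assume f: "f : carrier (cochains \<Gamma> M n)"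
  show "\<zero>\<^bsub>cochains \<Gamma> M n\<^esub> \<oplus>\<^bsub>cochains \<Gamma> M n\<^esub> f = f"
  using f by (auto simp: cochains_def PiE_iff extensional_def fun_eq_iff)
 next
  fix f g assume f: "f : carrier (cochains \<Gamma> M n)" "g : carrier (cochains \<Gamma> M n)"
  then show "f \<oplus>\<^bsub>cochains \<Gamma> M n\<^esub> g = g \<oplus>\<^bsub>cochains \<Gamma> M n\<^esub> f"
  by (auto simp: cochains_def PiE_iff M.a_comm restrict_def fun_eq_iff)
  fix h assume "h : carrier (cochains \<Gamma> M n)"
  with f show "f \<oplus>\<^bsub>cochains \<Gamma> M n\<^esub> g \<oplus>\<^bsub>cochains \<Gamma> M n\<^esub> h = f \<oplus>\<^bsub>cochains \<Gamma> M n\<^esub> (g \<oplus>\<^bsub>cochains \<Gamma> M n\<^esub> h)"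
  by (auto simp: cochains_def PiE_iff M.a_assoc restrict_def fun_eq_iff)
 qed (auto simp: cochains_def PiE_iff)
next
 fix x assume x: "x : carrier (cochains \<Gamma> M n)"
 show "\<one> \<odot>\<^bsub>cochains \<Gamma> M n\<^esub> x = x"
  using x by (auto simp: cochains_def PiE_iff extensional_def fun_eq_iff)
 fix a b assume ab: "a : carrier R" "b : carrier R"
 show "(a \<oplus> b) \<odot>\<^bsub>cochains \<Gamma> M n\<^esub> x = a \<odot>\<^bsub>cochains \<Gamma> M n\<^esub> x \<oplus>\<^bsub>cochains \<Gamma> M n\<^esub> b \<odot>\<^bsub>cochains \<Gamma> M n\<^esub> x"
  using x ab by (auto simp: cochains_def PiE_iff smult_l_distr restrict_def fun_eq_iff)
 show "(a \<otimes> b) \<odot>\<^bsub>cochains \<Gamma> M n\<^esub> x = a \<odot>\<^bsub>cochains \<Gamma> M n\<^esub> (b \<odot>\<^bsub>cochains \<Gamma> M n\<^esub> x)"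
  using x ab by (auto simp: cochains_def PiE_iff smult_assoc1 restrict_def fun_eq_iff)
 show "a \<odot>\<^bsub>cochains \<Gamma> M n\<^esub> x : carrier (cochains \<Gamma> M n)"
  using x ab by (auto simp: cochains_def PiE_iff)
 fix y assume y: "y : carrier (cochains \<Gamma> M n)"
 show "a \<odot>\<^bsub>cochains \<Gamma> M n\<^esub> (x \<oplus>\<^bsub>cochains \<Gamma> M n\<^esub> y) = a \<odot>\<^bsub>cochains \<Gamma> M n\<^esub> x \<oplus>\<^bsub>cochains \<Gamma> M n\<^esub> a \<odot>\<^bsub>cochains \<Gamma> M n\<^esub> y"
  using x y ab by (auto simp: cochains_def PiE_iff smult_r_distr restrict_def fun_eq_iff)
qed (rule R.is_cring)
qed

text \<open>The simplicial coboundary on homogeneous cochains, with the sign recursion unfolded along the list.\<close>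

primrec hD :: "('r, 'x) ring_scheme => 'a list => ('a list => 'r) => 'r" where
 "hD R [] phi = \<zero>\<^bsub>R\<^esub>"
| "hD R (x # L) phi = phi L \<ominus>\<^bsub>R\<^esub> hD R L (%L'. phi (x # L'))"

section \<open>The simplicial differential\<close>

context cring
begin

lemma hD_closed:
 assumes "!!L'. [|set L' \<subseteq> set L; Suc (length L') = length L|] ==> phi L' : carrier R"
 shows "hD R L phi : carrier R"
 using assms
proof (induction L arbitrary: phi)
 case (Cons x L)
 have "hD R L (%L'. phi (x # L')) : carrier R" by (rule Cons.IH, rule Cons.prems) auto
 moreover have "phi L : carrier R" by (rule Cons.prems) auto
 ultimately show ?case by simp
qed simp

lemma hD_cong:
 assumes "!!L'. [|set L' \<subseteq> set L; Suc (length L') = length L|] ==> phi L' = psi L'"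
 shows "hD R L phi = hD R L psi"
 using assms
proof (induction L arbitrary: phi psi)
 case (Cons x L)
 have "hD R L (%L'. phi (x # L')) = hD R L (%L'. psi (x # L'))" by (rule Cons.IH, rule Cons.prems) auto
 moreover have "phi L = psi L" by (rule Cons.prems) auto
 ultimately show ?case by simp
qed simp

lemma hD_add:
 assumes "!!L'. [|set L' \<subseteq> set L; Suc (length L') = length L|] ==> phi L' : carrier R"
  "!!L'. [|set L' \<subseteq> set L; Suc (length L') = length L|] ==> psi L' : carrier R"
 shows "hD R L (%L'. phi L' \<oplus> psi L') = hD R L phi \<oplus> hD R L psi"
 using assms
proof (induction L arbitrary: phi psi)
 case (Cons x L)
 have "hD R L (%L'. phi (x # L') \<oplus> psi (x # L')) = hD R L (%L'. phi (x # L')) \<oplus> hD R L (%L'. psi (x # L'))"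
  by (rule Cons.IH; rule Cons.prems) auto
 moreover have "phi L : carrier R" "psi L : carrier R" by (rule Cons.prems; auto)+
 moreover have "hD R L (%L'. phi (x # L')) : carrier R" "hD R L (%L'. psi (x # L')) : carrier R"
  by (rule hD_closed, rule Cons.prems; auto)+
 ultimately show ?case by (simp add: minus_eq minus_add a_ac)
qed simp

lemma hD_smult:
 assumes "!!L'. [|set L' \<subseteq> set L; Suc (length L') = length L|] ==> phi L' : carrier R" and r: "r : carrier R"
 shows "hD R L (%L'. r \<otimes> phi L') = r \<otimes> hD R L phi"
 using assms(1)
proof (induction L arbitrary: phi)
 case (Cons x L)
 have "hD R L (%L'. r \<otimes> phi (x # L')) = r \<otimes> hD R L (%L'. phi (x # L'))"
  by (rule Cons.IH; rule Cons.prems) auto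
 moreover have "phi L : carrier R" by (rule Cons.prems; auto)
 moreover have "hD R L (%L'. phi (x # L')) : carrier R" by (rule hD_closed, rule Cons.prems; auto)
 ultimately show ?case using r by (simp add: minus_eq r_distr r_minus)
qed (simp add: r)

lemma hD_minus:
 assumes "!!L'. [|set L' \<subseteq> set L; Suc (length L') = length L|] ==> phi L' : carrier R"
  "!!L'. [|set L' \<subseteq> set L; Suc (length L') = length L|] ==> psi L' : carrier R"
 shows "hD R L (%L'. phi L' \<ominus> psi L') = hD R L phi \<ominus> hD R L psi"
proof -
 have "hD R L (%L'. phi L' \<ominus> psi L') = hD R L (%L'. phi L' \<oplus> (\<ominus> \<one>) \<otimes> psi L')"
  by (rule hD_cong) (use assms in "simp add: minus_eq l_minus")
 also have "... = hD R L phi \<oplus> (\<ominus> \<one>) \<otimes> hD R L psi"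
  using assms by (subst hD_add) (auto simp: hD_smult)
 also have "... = hD R L phi \<ominus> hD R L psi"
  using hD_closed[of L psi] assms by (simp add: minus_eq l_minus)
 finally show ?thesis .
qed

text \<open>Unfolding the head \<open>x\<close> of the list leaves the differential of the tail
  twice with opposite signs, plus the same identity for the tail.\<close>

lemma hD_hD:
 assumes "!!L'. [|set L' \<subseteq> set L; Suc (Suc (length L')) = length L|] ==> phi L' : carrier R"
 shows "hD R L (%L'. hD R L' phi) = \<zero>"
 using assms
proof (induction L arbitrary: phi)
 case (Cons x L)
 have cl1: "phi L' : carrier R" if "set L' \<subseteq> set L" "Suc (length L') = length L" for L'
  using that by (intro Cons.prems) auto
 have cl2: "hD R L' (%L''. phi (x # L'')) : carrier R" if "set L' \<subseteq> set L" "Suc (length L') = length L" for L'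
  using that by (intro hD_closed Cons.prems) auto
 have "hD R L (%L'. hD R (x # L') phi) = hD R L phi \<ominus> hD R L (%L'. hD R L' (%L''. phi (x # L'')))"
  using hD_minus[OF cl1 cl2] by simp
 also have "hD R L (%L'. hD R L' (%L''. phi (x # L''))) = \<zero>"
  by (rule Cons.IH, rule Cons.prems) auto
 finally have "hD R L (%L'. hD R (x # L') phi) = hD R L phi \<ominus> \<zero>" .
 moreover have "hD R L phi : carrier R" by (rule hD_closed) (rule cl1)
 ultimately show ?case by (simp add: minus_eq r_neg)
qed simp

lemma finsum_lessThan_Suc:
 assumes "!!i. i <= n ==> g i : carrier R"
 shows "(\<Oplus>i\<in>{..<Suc n}. g i) = (\<Oplus>i\<in>{..<n}. g (Suc i)) \<oplus> g 0"
proof (cases n)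
 case 0
 then show ?thesis using assms by (simp add: lessThan_Suc)
next
 case (Suc m)
 then show ?thesis using assms finsum_Suc2[of g m] by (simp add: lessThan_Suc_atMost Pi_def)
qed

text \<open>The alternating sum over faces, needed only to compare the recursion with the indexed
  sum in \<open>coboundary\<close>.\<close>

lemma hD_sum:
 assumes "!!L'. [|set L' \<subseteq> set L; Suc (length L') = length L|] ==> phi L' : carrier R"
 shows "hD R L phi = (\<Oplus>i\<in>{..<length L}. if even i then phi (take i L @ drop (Suc i) L) else \<ominus> phi (take i L @ drop (Suc i) L))"
 using assms
proof (induction L arbitrary: phi)
 case (Cons x L)
 let ?f = "%phi L i. if even i then phi (take i L @ drop (Suc i) L) else \<ominus> phi (take i L @ drop (Suc i) L)"
 have IH: "hD R L (%L'. phi (x # L')) = (\<Oplus>i\<in>{..<length L}. ?f (%L'. phi (x # L')) L i)"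
  by (rule Cons.IH, rule Cons.prems) auto
 have cl: "?f phi (x # L) i : carrier R" if "i < Suc (length L)" for i
 proof -
  have "phi (take i (x # L) @ drop (Suc i) (x # L)) : carrier R"
  using that by (intro Cons.prems) (auto dest: in_set_takeD in_set_dropD simp: take_Cons' split: if_splits)
  then show ?thesis by auto
 qed
 have cl0: "phi (x # take i L @ drop (Suc i) L) : carrier R" if "i < length L" for i
  using that by (intro Cons.prems) (auto dest: in_set_takeD in_set_dropD)
 have cl': "?f (%L'. phi (x # L')) L i : carrier R" if "i < length L" for i
  using cl0[OF that] by auto
 have "(\<Oplus>i\<in>{..<Suc (length L)}. ?f phi (x # L) i) = (\<Oplus>i\<in>{..<length L}. ?f phi (x # L) (Suc i)) \<oplus> ?f phi (x # L) 0"
  by (rule finsum_lessThan_Suc) (use cl in auto)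
 also have "(\<Oplus>i\<in>{..<length L}. ?f phi (x # L) (Suc i)) = (\<Oplus>i\<in>{..<length L}. (\<ominus> \<one>) \<otimes> ?f (%L'. phi (x # L')) L i)"
  using cl0 by (intro finsum_cong') (auto simp: l_minus minus_minus)
 also have "... = (\<ominus> \<one>) \<otimes> (\<Oplus>i\<in>{..<length L}. ?f (%L'. phi (x # L')) L i)"
  using cl' by (subst finsum_rdistr) auto
 also have "... \<oplus> ?f phi (x # L) 0 = phi L \<ominus> hD R L (%L'. phi (x # L'))"
  using cl[of 0] cl' IH by (simp add: l_minus minus_eq a_comm)
 finally show ?case by simp
qed simp

end

section \<open>Inhomogeneous tuples and the vertices of simplices\<close>

primrec pp :: "('g, 'y) monoid_scheme => 'g list => 'g => 'g list" where
 "pp G [] y = [y]"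
| "pp G (h # hs) y = y # pp G hs (y \<otimes>\<^bsub>G\<^esub> h)"

text \<open>Inverse to \<open>pp\<close> once the first vertex is given: \<open>pp\<close> forms
  partial products from a base point, \<open>diffs\<close> recovers the successive
  quotients.\<close>

fun diffs :: "('g, 'y) monoid_scheme => 'g list => 'g list" where
 "diffs G (x # y # L) = (inv\<^bsub>G\<^esub> x \<otimes>\<^bsub>G\<^esub> y) # diffs G (y # L)"
| "diffs G L = []"

lemma length_pp [simp]: "length (pp G hs y) = Suc (length hs)"
 by (induction hs arbitrary: y) auto

lemma pp_neq_Nil [simp]: "pp G hs y ~= []"
 by (cases hs) auto

lemma hd_pp [simp]: "hd (pp G hs y) = y"
 by (cases hs) auto

context group
begin

lemma set_pp: "[|set hs \<subseteq> carrier G; y : carrier G|] ==> set (pp G hs y) \<subseteq> carrier G"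
 by (induction hs arbitrary: y) auto

lemma diffs_pp: "[|set hs \<subseteq> carrier G; y : carrier G|] ==> diffs G (pp G hs y) = hs"
proof (induction hs arbitrary: y)
 case (Cons h hs)
 obtain L where L: "pp G hs (y \<otimes> h) = (y \<otimes> h) # L" by (cases hs) auto
 show ?case using Cons.IH[of "y \<otimes> h"] Cons.prems L by (simp add: m_assoc[symmetric])
qed simp

lemma pp_diffs: "[|set L \<subseteq> carrier G; L ~= []|] ==> pp G (diffs G L) (hd L) = L"
proof (induction G\<equiv>G L rule: diffs.induct)
 case (1 x y L)
 then show ?case by (simp add: m_assoc[symmetric])
qed auto

lemma set_diffs: "set L \<subseteq> carrier G ==> set (diffs G L) \<subseteq> carrier G"
 by (induction G\<equiv>G L rule: diffs.induct) auto

lemma length_diffs: "length (diffs G L) = length L - 1"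
 by (induction G\<equiv>G L rule: diffs.induct) auto

lemma map_pp: "[|set hs \<subseteq> carrier G; x : carrier G; y : carrier G|] ==> map ((\<otimes>) x) (pp G hs y) = pp G hs (x \<otimes> y)"
 by (induction hs arbitrary: y) (auto simp: m_assoc)

text \<open>The inner faces of the bar complex: multiplying two neighbouring entries skips the
  vertex between them.\<close>

lemma pp_merge:
 "[|set gs \<subseteq> carrier G; y : carrier G; Suc j < length gs|] ==>
  pp G (merge G j gs) y = take (Suc j) (pp G gs y) @ drop (Suc (Suc j)) (pp G gs y)"
proof (induction j arbitrary: gs y)
 case 0
 then obtain a b L where "gs = a # b # L" by (cases gs; cases "tl gs") auto
 then show ?case using 0 by (auto simp: merge_def m_assoc)
next
 case (Suc j)
 then obtain a L where gs: "gs = a # L" by (cases gs) auto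
 have "merge G (Suc j) gs = a # merge G j L" using gs by (simp add: merge_def)
 then show ?case using Suc gs by simp
qed

lemma pp_butlast: "gs ~= [] ==> pp G (butlast gs) y = take (length gs) (pp G gs y)"
proof (induction gs arbitrary: y)
 case (Cons a gs)
 then show ?case by (cases "gs = []") auto
qed simp

lemma set_merge: "[|set gs \<subseteq> carrier G; Suc j < length gs|] ==> set (merge G j gs) \<subseteq> carrier G"
 unfolding merge_def by (auto dest: in_set_takeD in_set_dropD intro!: m_closed subsetD[OF _ nth_mem])

lemma length_merge: "Suc j < length gs ==> length (merge G j gs) = length gs - 1"
 by (simp add: merge_def)

lemma tuples_pp: "[|hs : tuples G n; y : carrier G|] ==> pp G hs y : tuples G (Suc n)"
 using set_pp by (auto simp: tuples_def)

lemma tuples_pp_ex: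
 assumes "L : tuples G (Suc n)"
 shows "\<exists>hs\<in>tuples G n. \<exists>y\<in>carrier G. L = pp G hs y"
proof -
 have "set L \<subseteq> carrier G" "L ~= []" using assms by (auto simp: tuples_def)
 then have "L = pp G (diffs G L) (hd L)" "diffs G L : tuples G n" "hd L : carrier G"
  using pp_diffs set_diffs length_diffs assms hd_in_set by (auto simp: tuples_def)
 then show ?thesis by blast
qed

end

text \<open>An isomorphism from the quotient to \<open>R\<close> amounts to a linear functional on
  \<open>M\<close> onto \<open>R\<close> with kernel \<open>N\<close>. This removes cosets from the
  cohomology computations.\<close>

lemma quotient_mod_iff:
 fixes M :: "('r, 'a) module"
 assumes M: "Module.module R M" and N: "submodule N R M"
 shows "zero_mod (quotient_mod M N) \<longleftrightarrow> carrier M \<subseteq> N"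
  and "mod_isomorphic R (quotient_mod M N) (regular_mod R) \<longleftrightarrow>
  (EX l. l : carrier M \<rightarrow> carrier R &
  (\<forall>x\<in>carrier M. \<forall>y\<in>carrier M. l (x \<oplus>\<^bsub>M\<^esub> y) = l x \<oplus>\<^bsub>R\<^esub> l y) &
  (\<forall>r\<in>carrier R. \<forall>x\<in>carrier M. l (r \<odot>\<^bsub>M\<^esub> x) = r \<otimes>\<^bsub>R\<^esub> l x) &
  (\<forall>x\<in>carrier M. l x = \<zero>\<^bsub>R\<^esub> \<longleftrightarrow> x : N) & l ` carrier M = carrier R)"
proof -
 interpret M: Module.module R M by fact
 interpret N: submodule N R M by fact
 have NM: "N \<subseteq> carrier M" using N.subset by simp
 interpret A: abelian_subgroup N M
  by (rule abelian_subgroupI3) (use N.subgroup_axioms M.abelian_group_axioms in "simp_all add: additive_subgroup_def")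
 let ?c = "%x. N +>\<^bsub>M\<^esub> x"
 have carr: "carrier (quotient_mod M N) = ?c ` carrier M"
  by (auto simp: quotient_mod_def A_RCOSETS_def')
 have zero: "\<zero>\<^bsub>quotient_mod M N\<^esub> = N" by (simp add: quotient_mod_def)
 have eqN: "?c x = N \<longleftrightarrow> x : N" if "x : carrier M" for x
  using that A.a_rcos_self A.a_rcos_const by blast
 have self: "x : ?c x" if "x : carrier M" for x using that A.a_rcos_self by blast
 have add: "?c x \<oplus>\<^bsub>quotient_mod M N\<^esub> ?c y = ?c (x \<oplus>\<^bsub>M\<^esub> y)" if "x : carrier M" "y : carrier M" for x y
  using that A.a_rcos_sum by (simp add: quotient_mod_def)
 have elem: "y : ?c x \<longleftrightarrow> y : carrier M & y \<ominus>\<^bsub>M\<^esub> x : N" if "x : carrier M" for x y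
 proof
  assume "y : ?c x"
  then obtain n where n: "n : N" "y = n \<oplus>\<^bsub>M\<^esub> x" by (auto simp: a_r_coset_def')
  then have "n : carrier M" using NM by auto
  then show "y : carrier M & y \<ominus>\<^bsub>M\<^esub> x : N" using n that by (simp add: M.minus_eq M.a_assoc M.r_neg)
 next
  assume y: "y : carrier M & y \<ominus>\<^bsub>M\<^esub> x : N"
  then have "y = (y \<ominus>\<^bsub>M\<^esub> x) \<oplus>\<^bsub>M\<^esub> x" using that by (simp add: M.minus_eq M.a_assoc M.l_neg)
  then show "y : ?c x" using y by (auto simp: a_r_coset_def')
 qed
 have ceq: "?c x = ?c y \<longleftrightarrow> x \<ominus>\<^bsub>M\<^esub> y : N" if "x : carrier M" "y : carrier M" for x y
 proof
  assume "?c x = ?c y"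
  then show "x \<ominus>\<^bsub>M\<^esub> y : N" using self[OF that(1)] elem[OF that(2)] by simp
 next
  assume "x \<ominus>\<^bsub>M\<^esub> y : N"
  then have "x : ?c y" using elem that by simp
  then show "?c x = ?c y" using M.a_repr_independence[OF _ that(2) N.subgroup_axioms] by simp
 qed
 have smult: "r \<odot>\<^bsub>quotient_mod M N\<^esub> ?c x = ?c (r \<odot>\<^bsub>M\<^esub> x)" if r: "r : carrier R" and x: "x : carrier M" for r x
 proof -
  have "?c (r \<odot>\<^bsub>M\<^esub> y) = ?c (r \<odot>\<^bsub>M\<^esub> x)" if "y : ?c x" for y
  proof -
  have y: "y : carrier M" "y \<ominus>\<^bsub>M\<^esub> x : N" using that elem x by auto
  have "r \<odot>\<^bsub>M\<^esub> y \<ominus>\<^bsub>M\<^esub> r \<odot>\<^bsub>M\<^esub> x = r \<odot>\<^bsub>M\<^esub> (y \<ominus>\<^bsub>M\<^esub> x)"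
  using r x y by (simp add: M.minus_eq M.smult_r_distr M.smult_r_minus)
  then have "r \<odot>\<^bsub>M\<^esub> y \<ominus>\<^bsub>M\<^esub> r \<odot>\<^bsub>M\<^esub> x : N" using r y by simp
  then show ?thesis using ceq r x y by simp
  qed
  then have "(\<Union>y\<in>?c x. ?c (r \<odot>\<^bsub>M\<^esub> y)) = (\<Union>y\<in>?c x. ?c (r \<odot>\<^bsub>M\<^esub> x))" by (intro SUP_cong) auto
  also have "... = ?c (r \<odot>\<^bsub>M\<^esub> x)" using self[OF x] by blast
  finally show ?thesis by (simp add: quotient_mod_def)
 qed
 show "zero_mod (quotient_mod M N) \<longleftrightarrow> carrier M \<subseteq> N"
 proof
  assume "zero_mod (quotient_mod M N)"
  then show "carrier M \<subseteq> N" using eqN unfolding zero_mod_def carr zero by blast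
 next
  assume "carrier M \<subseteq> N"
  then have "?c ` carrier M \<subseteq> {N}" using eqN by blast
  moreover have "N : ?c ` carrier M" using eqN[of "\<zero>\<^bsub>M\<^esub>"] A.zero_closed by blast
  ultimately show "zero_mod (quotient_mod M N)" unfolding zero_mod_def carr zero by blast
 qed
 show "mod_isomorphic R (quotient_mod M N) (regular_mod R) \<longleftrightarrow>
  (EX l. l : carrier M \<rightarrow> carrier R &
  (\<forall>x\<in>carrier M. \<forall>y\<in>carrier M. l (x \<oplus>\<^bsub>M\<^esub> y) = l x \<oplus>\<^bsub>R\<^esub> l y) &
  (\<forall>r\<in>carrier R. \<forall>x\<in>carrier M. l (r \<odot>\<^bsub>M\<^esub> x) = r \<otimes>\<^bsub>R\<^esub> l x) &
  (\<forall>x\<in>carrier M. l x = \<zero>\<^bsub>R\<^esub> \<longleftrightarrow> x : N) & l ` carrier M = carrier R)" (is "?L \<longleftrightarrow> (EX l. ?P l)")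
 proof
  assume ?L
  then obtain h where h: "h : linear_maps R (quotient_mod M N) (regular_mod R)"
  "bij_betw h (carrier (quotient_mod M N)) (carrier (regular_mod R))" unfolding mod_isomorphic_def by blast
  have hc: "h (?c x) : carrier R" if "x : carrier M" for x
  using h(1) that carr by (auto simp: linear_maps_def regular_mod_def)
  have ha: "h (?c (x \<oplus>\<^bsub>M\<^esub> y)) = h (?c x) \<oplus>\<^bsub>R\<^esub> h (?c y)" if "x : carrier M" "y : carrier M" for x y
  proof -
  have "h (?c x \<oplus>\<^bsub>quotient_mod M N\<^esub> ?c y) = h (?c x) \<oplus>\<^bsub>R\<^esub> h (?c y)"
  using h(1) that carr unfolding linear_maps_def by (auto simp: regular_mod_def)
  then show ?thesis using add that by simp
  qed
  have hs: "h (?c (r \<odot>\<^bsub>M\<^esub> x)) = r \<otimes>\<^bsub>R\<^esub> h (?c x)" if "r : carrier R" "x : carrier M" for r x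
  proof -
  have "h (r \<odot>\<^bsub>quotient_mod M N\<^esub> ?c x) = r \<otimes>\<^bsub>R\<^esub> h (?c x)"
  using h(1) that carr unfolding linear_maps_def by (auto simp: regular_mod_def)
  then show ?thesis using smult that by simp
  qed
  have h0: "h (?c \<zero>\<^bsub>M\<^esub>) = \<zero>\<^bsub>R\<^esub>"
  using hs[of "\<zero>\<^bsub>R\<^esub>" "\<zero>\<^bsub>M\<^esub>"] hc by simp
  have inj: "h (?c x) = \<zero>\<^bsub>R\<^esub> \<longleftrightarrow> x : N" if x: "x : carrier M" for x
  proof -
  have "h (?c x) = h (?c \<zero>\<^bsub>M\<^esub>) \<longleftrightarrow> ?c x = ?c \<zero>\<^bsub>M\<^esub>"
  using bij_betw_imp_inj_on[OF h(2)] x carr by (auto simp: inj_on_def)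
  moreover have "?c \<zero>\<^bsub>M\<^esub> = N" using eqN A.zero_closed by simp
  ultimately show ?thesis using h0 eqN[OF x] by simp
  qed
  have im: "(%x. h (?c x)) ` carrier M = carrier R"
  using bij_betw_imp_surj_on[OF h(2)] carr by (simp add: image_image regular_mod_def)
  show "EX l. ?P l"
  by (rule exI[of _ "%x. h (?c x)"]) (use hc ha hs inj im in simp)
 next
  assume "EX l. ?P l"
  then obtain l where l: "l : carrier M \<rightarrow> carrier R"
  "!!x y. x : carrier M ==> y : carrier M ==> l (x \<oplus>\<^bsub>M\<^esub> y) = l x \<oplus>\<^bsub>R\<^esub> l y"
  "!!r x. r : carrier R ==> x : carrier M ==> l (r \<odot>\<^bsub>M\<^esub> x) = r \<otimes>\<^bsub>R\<^esub> l x"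
  "!!x. x : carrier M ==> l x = \<zero>\<^bsub>R\<^esub> \<longleftrightarrow> x : N" "l ` carrier M = carrier R" by blast
  have lm: "l (x \<ominus>\<^bsub>M\<^esub> y) = l x \<ominus>\<^bsub>R\<^esub> l y" if "x : carrier M" "y : carrier M" for x y
  proof -
  have "l (x \<ominus>\<^bsub>M\<^esub> y) \<oplus>\<^bsub>R\<^esub> l y = l x"
  using l(2)[of "x \<ominus>\<^bsub>M\<^esub> y" y] that by (simp add: M.minus_eq M.a_assoc M.l_neg)
  moreover have "l (x \<ominus>\<^bsub>M\<^esub> y) : carrier R" "l y : carrier R" using l(1) that by auto
  ultimately show ?thesis by (metis M.R.add.m_assoc M.R.add.inv_closed M.R.minus_eq M.R.r_neg M.R.r_zero)
  qed
  have lc: "l x = l y \<longleftrightarrow> ?c x = ?c y" if "x : carrier M" "y : carrier M" for x y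
  proof -
  have "l x : carrier R" "l y : carrier R" using l(1) that by auto
  then have "l x = l y \<longleftrightarrow> l (x \<ominus>\<^bsub>M\<^esub> y) = \<zero>\<^bsub>R\<^esub>" using lm[OF that]
  by (metis M.R.add.inv_solve_right M.R.l_zero M.R.minus_eq M.R.r_neg M.R.zero_closed)
  also have "... \<longleftrightarrow> x \<ominus>\<^bsub>M\<^esub> y : N" using l(4) that by simp
  finally show ?thesis using ceq[OF that] by simp
  qed
  \<comment> \<open>Any element of the coset may be chosen, since by \<open>lc\<close> the
    functional is constant on cosets.\<close>
  define h where "h X = l (SOME x. x : X)" for X
  have h: "h (?c x) = l x" if x: "x : carrier M" for x
  proof -
  have "(SOME y. y : ?c x) : ?c x" using self[OF x] by (rule someI)
  then have y: "(SOME y. y : ?c x) : carrier M" "(SOME y. y : ?c x) \<ominus>\<^bsub>M\<^esub> x : N" using elem[OF x] by auto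
  then show ?thesis using lc[OF y(1) x] ceq[OF y(1) x] by (simp add: h_def)
  qed
  have "h : linear_maps R (quotient_mod M N) (regular_mod R)"
  unfolding linear_maps_def carr using h l add smult by (auto simp: regular_mod_def)
  moreover have "bij_betw h (carrier (quotient_mod M N)) (carrier (regular_mod R))"
  unfolding bij_betw_def
  proof
  show "inj_on h (carrier (quotient_mod M N))"
  proof (rule inj_onI)
  fix X Y assume "X : carrier (quotient_mod M N)" "Y : carrier (quotient_mod M N)" and e: "h X = h Y"
  then obtain x y where "x : carrier M" "y : carrier M" "X = ?c x" "Y = ?c y" unfolding carr by (auto simp only: image_iff)
  then show "X = Y" using e h lc by simp
  qed
  have "h ` carrier (quotient_mod M N) = (%x. h (?c x)) ` carrier M" using carr by (simp add: image_image)
  also have "... = l ` carrier M" using h by (intro image_cong) auto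
  finally show "h ` carrier (quotient_mod M N) = carrier (regular_mod R)" using l(5) by (simp add: regular_mod_def)
  qed
  ultimately show ?L unfolding mod_isomorphic_def by blast
 qed
qed

text \<open>An inhomogeneous cochain \<open>f\<close> with values in the group ring corresponds to the homogeneous one
  \<open>\<phi>(g\<^sub>0,\<dots>,g\<^sub>n) = f(g\<^sub>0\<inverse>g\<^sub>1, \<dots>)(g\<^sub>0\<inverse>)\<close>, the value at \<open>1\<close> of \<open>g\<^sub>0 f(\<dots>)\<close>; equivariance is then
  absorbed, and only finiteness along diagonal orbits remains.\<close>

definition hcochains :: "('r, 'x) ring_scheme => ('g, 'y) monoid_scheme => nat => ('g list => 'r) set"
 where "hcochains R G n =
  {phi. (\<forall>L\<in>tuples G (Suc n). phi L : carrier R & finite {x : carrier G. phi (map ((\<otimes>\<^bsub>G\<^esub>) x) L) ~= \<zero>\<^bsub>R\<^esub>})}"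

definition hom_cochain :: "('r, 'x) ring_scheme => ('g, 'y) monoid_scheme => nat => ('g list => 'g => 'r) => 'g list => 'r"
 where "hom_cochain R G n f = (%L. if L : tuples G (Suc n) then f (diffs G L) (inv\<^bsub>G\<^esub> hd L) else \<zero>\<^bsub>R\<^esub>)"

definition inh_cochain :: "('r, 'x) ring_scheme => ('g, 'y) monoid_scheme => nat => ('g list => 'r) => 'g list => 'g => 'r"
 where "inh_cochain R G n phi = (\<lambda>hs\<in>tuples G n. %x. if x : carrier G then phi (pp G hs (inv\<^bsub>G\<^esub> x)) else \<zero>\<^bsub>R\<^esub>)"

section \<open>The passage between inhomogeneous and homogeneous cochains\<close>

context ring_group
begin

abbreviation RG where "RG \<equiv> free_mod R (carrier G)"
abbreviation CC where "CC n \<equiv> cochains G RG n"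
abbreviation dd where "dd n \<equiv> coboundary G RG (group_ring_act R G) n"
abbreviation ZZ where "ZZ n \<equiv> cocycles G RG (group_ring_act R G) n"
abbreviation BB where "BB n \<equiv> coboundaries G RG (group_ring_act R G) n"

sublocale RGM: Module.module R RG by (rule R.module_free_mod)

lemma CC_module: "Module.module R (CC n)"
 by (rule module_cochains) (rule RGM.module_axioms)

lemma RG_D: "a : carrier RG ==> a k : carrier R" "a : carrier RG ==> finite {k. a k ~= \<zero>\<^bsub>R\<^esub>}"
  "a : carrier RG ==> k \<notin> carrier G ==> a k = \<zero>\<^bsub>R\<^esub>"
 by (auto simp: free_mod_def)

lemma CC_D: "f : carrier (CC n) ==> hs : tuples G n ==> f hs : carrier RG"
 by (auto simp: cochains_def)

lemma hom_cochain_pp: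
 "[|hs : tuples G n; y : carrier G|] ==> hom_cochain R G n f (pp G hs y) = f hs (inv y)"
 using tuples_pp[of hs n y] diffs_pp[of hs y] by (simp add: hom_cochain_def tuples_def)

lemma hom_in:
 assumes f: "f : carrier (CC n)" shows "hom_cochain R G n f : hcochains R G n"
 unfolding hcochains_def
proof (intro CollectI ballI conjI)
 fix L assume L: "L : tuples G (Suc n)"
 obtain hs y where hs: "hs : tuples G n" "y : carrier G" "L = pp G hs y" using tuples_pp_ex[OF L] by blast
 have fh: "f hs : carrier RG" using CC_D[OF f hs(1)] .
 show "hom_cochain R G n f L : carrier R" using hs hom_cochain_pp RG_D(1)[OF fh] by simp
 have eq: "hom_cochain R G n f (map ((\<otimes>) x) L) = f hs (inv (x \<otimes> y))" if "x : carrier G" for x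
  using that hs by (subst hs(3), subst map_pp) (auto simp: tuples_def hom_cochain_pp)
 have "{x : carrier G. hom_cochain R G n f (map ((\<otimes>) x) L) ~= \<zero>\<^bsub>R\<^esub>} \<subseteq> (%z. inv z \<otimes> inv y) ` {z. f hs z ~= \<zero>\<^bsub>R\<^esub>}"
 proof
  fix x assume "x : {x : carrier G. hom_cochain R G n f (map ((\<otimes>) x) L) ~= \<zero>\<^bsub>R\<^esub>}"
  then have x: "x : carrier G" "f hs (inv (x \<otimes> y)) ~= \<zero>\<^bsub>R\<^esub>" using eq by auto
  have "x = inv (inv (x \<otimes> y)) \<otimes> inv y" using x(1) hs(2) by (simp add: m_assoc)
  then show "x : (%z. inv z \<otimes> inv y) ` {z. f hs z ~= \<zero>\<^bsub>R\<^esub>}" using x(2) by blast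
 qed
 then show "finite {x : carrier G. hom_cochain R G n f (map ((\<otimes>) x) L) ~= \<zero>\<^bsub>R\<^esub>}"
  by (rule finite_subset) (use RG_D(2)[OF fh] in simp)
qed

lemma inh_in:
 assumes phi: "phi : hcochains R G n" shows "inh_cochain R G n phi : carrier (CC n)"
proof -
 have "(%x. if x : carrier G then phi (pp G hs (inv x)) else \<zero>\<^bsub>R\<^esub>) : carrier RG" if hs: "hs : tuples G n" for hs
 proof -
  have one: "pp G hs \<one> : tuples G (Suc n)" using tuples_pp[OF hs] by simp
  have fin: "finite {x : carrier G. phi (map ((\<otimes>) x) (pp G hs \<one>)) ~= \<zero>\<^bsub>R\<^esub>}"
  using phi one unfolding hcochains_def by blast
  have eq: "map ((\<otimes>) x) (pp G hs \<one>) = pp G hs x" if "x : carrier G" for x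
  using that hs by (subst map_pp) (auto simp: tuples_def)
  have "{x. (if x : carrier G then phi (pp G hs (inv x)) else \<zero>\<^bsub>R\<^esub>) ~= \<zero>\<^bsub>R\<^esub>}
  \<subseteq> (%x. inv x) ` {x : carrier G. phi (map ((\<otimes>) x) (pp G hs \<one>)) ~= \<zero>\<^bsub>R\<^esub>}"
  proof
  fix x assume x: "x : {x. (if x : carrier G then phi (pp G hs (inv x)) else \<zero>\<^bsub>R\<^esub>) ~= \<zero>\<^bsub>R\<^esub>}"
  then have xG: "x : carrier G" by (auto split: if_splits)
  then have "inv x : {x : carrier G. phi (map ((\<otimes>) x) (pp G hs \<one>)) ~= \<zero>\<^bsub>R\<^esub>}" using x eq[of "inv x"] by auto
  then show "x : (%x. inv x) ` {x : carrier G. phi (map ((\<otimes>) x) (pp G hs \<one>)) ~= \<zero>\<^bsub>R\<^esub>}"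
  by (rule rev_image_eqI) (simp add: xG)
  qed
  then have "finite {x. (if x : carrier G then phi (pp G hs (inv x)) else \<zero>\<^bsub>R\<^esub>) ~= \<zero>\<^bsub>R\<^esub>}"
  using fin finite_surj by blast
  moreover have "phi (pp G hs (inv x)) : carrier R" if "x : carrier G" for x
  using phi tuples_pp[OF hs, of "inv x"] that unfolding hcochains_def by auto
  ultimately show ?thesis by (auto simp: free_mod_def)
 qed
 then show ?thesis by (simp add: cochains_def inh_cochain_def PiE_iff)
qed

lemma inh_hom:
 assumes f: "f : carrier (CC n)" shows "inh_cochain R G n (hom_cochain R G n f) = f"
proof
 fix hs
 show "inh_cochain R G n (hom_cochain R G n f) hs = f hs"
 proof (cases "hs : tuples G n")
  case True
  have "(if x : carrier G then hom_cochain R G n f (pp G hs (inv x)) else \<zero>\<^bsub>R\<^esub>) = f hs x" for x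
  using hom_cochain_pp[OF True, of "inv x"] RG_D(3)[OF CC_D[OF f True]] by simp
  then show ?thesis using True by (simp add: inh_cochain_def)
 next
  case False
  then show ?thesis using f by (auto simp: inh_cochain_def cochains_def PiE_iff extensional_def)
 qed
qed

lemma hom_inh:
 assumes "phi : hcochains R G n" "L : tuples G (Suc n)"
 shows "hom_cochain R G n (inh_cochain R G n phi) L = phi L"
proof -
 obtain hs y where "hs : tuples G n" "y : carrier G" "L = pp G hs y" using tuples_pp_ex[OF assms(2)] by blast
 then show ?thesis by (simp add: hom_cochain_pp inh_cochain_def)
qed

lemma CC_eqI:
 assumes "f : carrier (CC n)" "g : carrier (CC n)"
  "!!L. L : tuples G (Suc n) ==> hom_cochain R G n f L = hom_cochain R G n g L"
 shows "f = g"
proof -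
 have "f hs = g hs" if hs: "hs : tuples G n" for hs
 proof
  fix x
  show "f hs x = g hs x"
  proof (cases "x : carrier G")
  case True
  then show ?thesis using assms(3)[OF tuples_pp[OF hs, of "inv x"]] hom_cochain_pp[OF hs, of "inv x"] by simp
  next
  case False
  then show ?thesis using RG_D(3)[OF CC_D[OF assms(1) hs]] RG_D(3)[OF CC_D[OF assms(2) hs]] by simp
  qed
 qed
 moreover have "f : tuples G n \<rightarrow>\<^sub>E carrier RG" "g : tuples G n \<rightarrow>\<^sub>E carrier RG"
  using assms(1,2) by (simp_all add: cochains_def)
 ultimately show ?thesis using PiE_ext[of f "tuples G n" _ g] by blast
qed

lemma hcochains_D:
 "[|phi : hcochains R G n; L : tuples G (Suc n)|] ==> phi L : carrier R"
 by (simp add: hcochains_def)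

lemma tuples_sub: "[|set L' \<subseteq> set L; Suc (length L') = length L; L : tuples G (Suc n)|] ==> L' : tuples G n"
 by (auto simp: tuples_def)

text \<open>Deleting the first vertex of the simplex \<open>pp G gs (inv x)\<close> gives the term
  with the group action, deleting an inner vertex gives a merged tuple, and deleting the last vertex
  gives \<open>butlast gs\<close>; the signs agree face by face.\<close>

lemma dd_eq:
 assumes f: "f : carrier (CC n)" and gs: "gs : tuples G (Suc n)" and x: "x : carrier G"
 shows "dd n f gs x = hD R (pp G gs (inv x)) (hom_cochain R G n f)"
proof -
 let ?psi = "hom_cochain R G n f" and ?y = "inv x"
 have gsG: "set gs \<subseteq> carrier G" and len: "length gs = Suc n" and ne: "gs ~= []" using gs by (auto simp: tuples_def)
 obtain h hs where ghs: "gs = h # hs" using ne by (cases gs) auto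
 have y: "?y : carrier G" using x by simp
 have hG: "h : carrier G" and hs: "hs : tuples G n" using gs ghs by (auto simp: tuples_def)
 have mt: "merge G j gs : tuples G n" if "j < n" for j
  using set_merge[OF gsG, of j] length_merge[of j gs] that len by (simp add: tuples_def)
 have bt: "butlast gs : tuples G n" using gs by (auto simp: tuples_def dest: in_set_butlastD)
 \<comment> \<open>The signed contribution of face \<open>i\<close>. It is identified below with the
   three kinds of terms of \<open>coboundary\<close>.\<close>
 define g where "g = (%i. if even i then ?psi (take i (pp G gs ?y) @ drop (Suc i) (pp G gs ?y)) else \<ominus>\<^bsub>R\<^esub> ?psi (take i (pp G gs ?y) @ drop (Suc i) (pp G gs ?y)))"
 have sgn: "signed RG j a x = (if even j then a x else \<ominus>\<^bsub>R\<^esub> a x)" if "a : carrier RG" for j a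
  using R.free_mod_minus[OF that] by (simp add: signed_def)
 have sgn_cl: "signed RG j a : carrier RG" if "a : carrier RG" for j a using that by (simp add: signed_def)
 have g0: "g 0 = group_ring_act R G (hd gs) (f (tl gs)) x"
  using hom_cochain_pp[OF hs, of "?y \<otimes> h" f] hG x ghs by (simp add: g_def group_ring_act_def inv_mult_group)
 have gS: "g (Suc j) = signed RG (Suc j) (f (merge G j gs)) x" if "j < n" for j
 proof -
  have "?psi (take (Suc j) (pp G gs ?y) @ drop (Suc (Suc j)) (pp G gs ?y)) = f (merge G j gs) (inv ?y)"
  using pp_merge[OF gsG y, of j] that len hom_cochain_pp[OF mt[OF that] y] by simp
  then show ?thesis using sgn[OF CC_D[OF f mt[OF that]]] x by (simp add: g_def)
 qed
 have gL: "g (Suc n) = signed RG (Suc n) (f (butlast gs)) x"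
 proof -
  have "?psi (take (Suc n) (pp G gs ?y) @ drop (Suc (Suc n)) (pp G gs ?y)) = f (butlast gs) (inv ?y)"
  using pp_butlast[OF ne, of ?y] len hom_cochain_pp[OF bt y] by simp
  then show ?thesis using sgn[OF CC_D[OF f bt]] x by (simp add: g_def)
 qed
 have act_cl: "group_ring_act R G (hd gs) (f (tl gs)) x : carrier R"
  using RG_D(1)[OF CC_D[OF f hs]] ghs by (simp add: group_ring_act_def)
 have g_cl: "g i : carrier R" if i_le: "i <= Suc n" for i
 proof (cases i)
  case 0 then show ?thesis using g0 act_cl by simp
 next
  case (Suc j)
  then consider "j < n" | "j = n" using i_le by linarith
  then show ?thesis
  proof cases
  case 1
  then show ?thesis using gS[OF 1] Suc RG_D(1)[OF sgn_cl[OF CC_D[OF f mt[OF 1]]]] by simp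
  next
  case 2
  then show ?thesis using gL Suc RG_D(1)[OF sgn_cl[OF CC_D[OF f bt]]] by simp
  qed
 qed
 have "hD R (pp G gs ?y) ?psi = (\<Oplus>\<^bsub>R\<^esub>i\<in>{..<Suc (Suc n)}. g i)"
  using hom_in[OF f] hcochains_D tuples_sub tuples_pp[OF gs y] len unfolding g_def by (subst R.hD_sum) auto
 also have "... = (\<Oplus>\<^bsub>R\<^esub>i\<in>{..<Suc n}. g (Suc i)) \<oplus>\<^bsub>R\<^esub> g 0"
  by (rule R.finsum_lessThan_Suc) (rule g_cl)
 also have "(\<Oplus>\<^bsub>R\<^esub>i\<in>{..<Suc n}. g (Suc i)) = g (Suc n) \<oplus>\<^bsub>R\<^esub> (\<Oplus>\<^bsub>R\<^esub>i\<in>{..<n}. g (Suc i))"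
  unfolding lessThan_Suc by (rule R.finsum_insert) (use g_cl in auto)
 also have "(\<Oplus>\<^bsub>R\<^esub>i\<in>{..<n}. g (Suc i)) = (\<Oplus>\<^bsub>R\<^esub>j\<in>{..<n}. signed RG (Suc j) (f (merge G j gs)) x)"
  by (rule R.finsum_cong') (use gS RG_D(1)[OF sgn_cl[OF CC_D[OF f mt]]] in auto)
 also have "... = (\<Oplus>\<^bsub>RG\<^esub>j\<in>{..<n}. signed RG (Suc j) (f (merge G j gs))) x"
  by (rule R.free_mod_finsum[symmetric]) (use sgn_cl[OF CC_D[OF f mt]] in auto)
 finally have eq: "hD R (pp G gs ?y) ?psi = signed RG (Suc n) (f (butlast gs)) x \<oplus>\<^bsub>R\<^esub>
  (\<Oplus>\<^bsub>RG\<^esub>j\<in>{..<n}. signed RG (Suc j) (f (merge G j gs))) x \<oplus>\<^bsub>R\<^esub> group_ring_act R G (hd gs) (f (tl gs)) x"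
  unfolding gL g0 .
 have sum_cl: "(\<Oplus>\<^bsub>RG\<^esub>j\<in>{..<n}. signed RG (Suc j) (f (merge G j gs))) : carrier RG"
  by (rule RGM.M.finsum_closed) (use sgn_cl[OF CC_D[OF f mt]] in auto)
 have RG_add: "(a \<oplus>\<^bsub>RG\<^esub> b) x = a x \<oplus>\<^bsub>R\<^esub> b x" for a b by (simp add: free_mod_def)
 have "dd n f gs x = group_ring_act R G (hd gs) (f (tl gs)) x \<oplus>\<^bsub>R\<^esub>
  (\<Oplus>\<^bsub>RG\<^esub>j\<in>{..<n}. signed RG (Suc j) (f (merge G j gs))) x \<oplus>\<^bsub>R\<^esub> signed RG (Suc n) (f (butlast gs)) x"
  using gs RG_add by (simp add: coboundary_def)
 then show ?thesis unfolding eq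
  using act_cl RG_D(1)[OF sum_cl] RG_D(1)[OF sgn_cl[OF CC_D[OF f bt]]]
  by (simp add: R.a_ac)
qed

end

section \<open>Cohomology groups through homogeneous cocycles\<close>

definition hcocycles :: "('r, 'x) ring_scheme => ('g, 'y) monoid_scheme => nat => ('g list => 'r) set"
 where "hcocycles R G n = {phi : hcochains R G n. \<forall>L\<in>tuples G (Suc (Suc n)). hD R L phi = \<zero>\<^bsub>R\<^esub>}"

text \<open>Homogeneous cochains are total functions that matter only on tuples of the right length,
  so being a coboundary is an equation on those tuples and not an equality of functions.\<close>

definition is_hcob :: "('r, 'x) ring_scheme => ('g, 'y) monoid_scheme => nat => ('g list => 'r) => bool"
 where "is_hcob R G n phi \<longleftrightarrow> (case n of 0 => (\<forall>L\<in>tuples G 1. phi L = \<zero>\<^bsub>R\<^esub>)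
  | Suc m => (\<exists>psi\<in>hcochains R G m. \<forall>L\<in>tuples G (Suc n). phi L = hD R L psi))"

context ring_group
begin

lemma map_tuples: "[|L : tuples G n; x : carrier G|] ==> map ((\<otimes>) x) L : tuples G n"
 by (auto simp: tuples_def)

text \<open>The cochain \<open>\<Phi> x\<close> may depend on \<open>x\<close> because unfolding the
  differential moves the translated first vertex into the cochain.\<close>

lemma hD_support:
 assumes "!!L'. [|set L' \<subseteq> set L; Suc (length L') = length L|] ==> finite {x : carrier G. \<Phi> x (map ((\<otimes>) x) L') ~= \<zero>\<^bsub>R\<^esub>}"
 shows "finite {x : carrier G. hD R (map ((\<otimes>) x) L) (\<Phi> x) ~= \<zero>\<^bsub>R\<^esub>}"
 using assms
proof (induction L arbitrary: \<Phi>)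
 case (Cons y L)
 let ?\<Psi> = "%x L'. \<Phi> x ((x \<otimes> y) # L')"
 have "finite {x : carrier G. hD R (map ((\<otimes>) x) L) (?\<Psi> x) ~= \<zero>\<^bsub>R\<^esub>}"
 proof (rule Cons.IH)
  fix L' assume "set L' \<subseteq> set L" "Suc (length L') = length L"
  then show "finite {x : carrier G. ?\<Psi> x (map ((\<otimes>) x) L') ~= \<zero>\<^bsub>R\<^esub>}"
  using Cons.prems[of "y # L'"] by auto
 qed
 moreover have "finite {x : carrier G. \<Phi> x (map ((\<otimes>) x) L) ~= \<zero>\<^bsub>R\<^esub>}"
  by (rule Cons.prems) auto
 ultimately have fin: "finite ({x : carrier G. \<Phi> x (map ((\<otimes>) x) L) ~= \<zero>\<^bsub>R\<^esub>} \<union> {x : carrier G. hD R (map ((\<otimes>) x) L) (?\<Psi> x) ~= \<zero>\<^bsub>R\<^esub>})"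
  by simp
 have "{x : carrier G. hD R (map ((\<otimes>) x) (y # L)) (\<Phi> x) ~= \<zero>\<^bsub>R\<^esub>} \<subseteq>
  {x : carrier G. \<Phi> x (map ((\<otimes>) x) L) ~= \<zero>\<^bsub>R\<^esub>} \<union> {x : carrier G. hD R (map ((\<otimes>) x) L) (?\<Psi> x) ~= \<zero>\<^bsub>R\<^esub>}"
  by (auto simp: R.minus_eq)
 then show ?case using fin by (rule finite_subset)
qed simp

lemma hcochains_fin:
 "[|phi : hcochains R G n; L : tuples G (Suc n)|] ==> finite {x : carrier G. phi (map ((\<otimes>) x) L) ~= \<zero>\<^bsub>R\<^esub>}"
 by (simp add: hcochains_def)

lemma hcochainsI:
 assumes "!!L. L : tuples G (Suc n) ==> phi L : carrier R"
  "!!L. L : tuples G (Suc n) ==> finite {x : carrier G. phi (map ((\<otimes>) x) L) ~= \<zero>\<^bsub>R\<^esub>}"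
 shows "phi : hcochains R G n"
 using assms by (simp add: hcochains_def)

lemma hD_in:
 assumes "psi : hcochains R G n" shows "(%L. hD R L psi) : hcochains R G (Suc n)"
proof (rule hcochainsI)
 fix L assume L: "L : tuples G (Suc (Suc n))"
 have sub: "L' : tuples G (Suc n)" if "set L' \<subseteq> set L" "Suc (length L') = length L" for L'
  using tuples_sub[OF that L] .
 show "hD R L psi : carrier R" by (rule R.hD_closed) (use hcochains_D[OF assms] sub in auto)
 show "finite {x : carrier G. hD R (map ((\<otimes>) x) L) psi ~= \<zero>\<^bsub>R\<^esub>}"
  by (rule hD_support) (use hcochains_fin[OF assms] sub in auto)
qed

lemma hcochains_add:
 assumes "phi : hcochains R G n" "psi : hcochains R G n"
 shows "(%L. phi L \<oplus>\<^bsub>R\<^esub> psi L) : hcochains R G n"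
proof (rule hcochainsI)
 fix L assume L: "L : tuples G (Suc n)"
 have fin: "finite ({x : carrier G. phi (map ((\<otimes>) x) L) ~= \<zero>\<^bsub>R\<^esub>} \<union> {x : carrier G. psi (map ((\<otimes>) x) L) ~= \<zero>\<^bsub>R\<^esub>})"
  using hcochains_fin[OF _ L] assms by simp
 have "{x : carrier G. phi (map ((\<otimes>) x) L) \<oplus>\<^bsub>R\<^esub> psi (map ((\<otimes>) x) L) ~= \<zero>\<^bsub>R\<^esub>} \<subseteq>
  {x : carrier G. phi (map ((\<otimes>) x) L) ~= \<zero>\<^bsub>R\<^esub>} \<union> {x : carrier G. psi (map ((\<otimes>) x) L) ~= \<zero>\<^bsub>R\<^esub>}" by auto
 then show "finite {x : carrier G. phi (map ((\<otimes>) x) L) \<oplus>\<^bsub>R\<^esub> psi (map ((\<otimes>) x) L) ~= \<zero>\<^bsub>R\<^esub>}" using fin by (rule finite_subset)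
qed (use assms hcochains_D in auto)

lemma hcochains_smult:
 assumes "phi : hcochains R G n" "r : carrier R"
 shows "(%L. r \<otimes>\<^bsub>R\<^esub> phi L) : hcochains R G n"
proof (rule hcochainsI)
 fix L assume L: "L : tuples G (Suc n)"
 have "{x : carrier G. r \<otimes>\<^bsub>R\<^esub> phi (map ((\<otimes>) x) L) ~= \<zero>\<^bsub>R\<^esub>} \<subseteq> {x : carrier G. phi (map ((\<otimes>) x) L) ~= \<zero>\<^bsub>R\<^esub>}"
  using assms by auto
 then show "finite {x : carrier G. r \<otimes>\<^bsub>R\<^esub> phi (map ((\<otimes>) x) L) ~= \<zero>\<^bsub>R\<^esub>}"
  using hcochains_fin[OF assms(1) L] by (rule finite_subset)
qed (use assms hcochains_D in auto)

lemma hcochains_zero: "(%L. \<zero>\<^bsub>R\<^esub>) : hcochains R G n"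
 by (rule hcochainsI) auto

lemma hD_add':
 assumes "phi : hcochains R G n" "psi : hcochains R G n" "L : tuples G (Suc (Suc n))"
 shows "hD R L (%L. phi L \<oplus>\<^bsub>R\<^esub> psi L) = hD R L phi \<oplus>\<^bsub>R\<^esub> hD R L psi"
 by (rule R.hD_add) (use assms hcochains_D tuples_sub in auto)

lemma hD_smult':
 assumes "phi : hcochains R G n" "r : carrier R" "L : tuples G (Suc (Suc n))"
 shows "hD R L (%L. r \<otimes>\<^bsub>R\<^esub> phi L) = r \<otimes>\<^bsub>R\<^esub> hD R L phi"
 by (rule R.hD_smult) (use assms hcochains_D tuples_sub in auto)

lemma hD_closed':
 "[|phi : hcochains R G n; L : tuples G (Suc (Suc n))|] ==> hD R L phi : carrier R"
 by (rule hcochains_D[OF hD_in])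

lemma hD_zero: "hD R L (%L'. \<zero>\<^bsub>R\<^esub>) = \<zero>\<^bsub>R\<^esub>"
 by (induction L) (auto simp: R.minus_eq)

lemma dd_inh:
 assumes f: "f : carrier (CC n)"
 shows "dd n f = inh_cochain R G (Suc n) (%L. hD R L (hom_cochain R G n f))"
proof
 fix gs
 show "dd n f gs = inh_cochain R G (Suc n) (%L. hD R L (hom_cochain R G n f)) gs"
 proof (cases "gs : tuples G (Suc n)")
  case False then show ?thesis by (simp add: coboundary_def inh_cochain_def)
 next
  case True
  have hd: "hd gs : carrier G" using True by (cases gs) (auto simp: tuples_def)
  have mt: "merge G j gs : tuples G n" if "j < n" for j
  using set_merge[of gs j] length_merge[of j gs] that True by (simp add: tuples_def)
  have bt: "butlast gs : tuples G n" using True by (auto simp: tuples_def dest: in_set_butlastD)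
  have sgn_cl: "signed RG j a : carrier RG" if "a : carrier RG" for j a using that by (simp add: signed_def)
  have sum_cl: "(\<Oplus>\<^bsub>RG\<^esub>j\<in>{..<n}. signed RG (Suc j) (f (merge G j gs))) : carrier RG"
  by (rule RGM.M.finsum_closed) (use sgn_cl[OF CC_D[OF f mt]] in auto)
  have RG_add: "(a \<oplus>\<^bsub>RG\<^esub> b) x = a x \<oplus>\<^bsub>R\<^esub> b x" for a b x by (simp add: free_mod_def)
  have out: "dd n f gs x = \<zero>\<^bsub>R\<^esub>" if x: "x \<notin> carrier G" for x
  using True RG_add x RG_D(3)[OF sum_cl x] RG_D(3)[OF sgn_cl[OF CC_D[OF f bt]] x]
  by (simp add: coboundary_def group_ring_act_def)
  show ?thesis using True dd_eq[OF f True] out by (auto simp: inh_cochain_def fun_eq_iff)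
 qed
qed

lemma dd_in: "f : carrier (CC n) ==> dd n f : carrier (CC (Suc n))"
 using dd_inh inh_in[OF hD_in[OF hom_in]] by simp

lemma hom_dd:
 "[|f : carrier (CC n); L : tuples G (Suc (Suc n))|] ==>
  hom_cochain R G (Suc n) (dd n f) L = hD R L (hom_cochain R G n f)"
 using dd_inh hom_inh[OF hD_in[OF hom_in]] by simp

lemma hom_add:
 assumes "f : carrier (CC n)" "g : carrier (CC n)"
 shows "hom_cochain R G n (f \<oplus>\<^bsub>CC n\<^esub> g) = (%L. hom_cochain R G n f L \<oplus>\<^bsub>R\<^esub> hom_cochain R G n g L)"
proof
 fix L
 have "diffs G L : tuples G n" if "L : tuples G (Suc n)"
  using that set_diffs length_diffs by (auto simp: tuples_def)
 then show "hom_cochain R G n (f \<oplus>\<^bsub>CC n\<^esub> g) L = hom_cochain R G n f L \<oplus>\<^bsub>R\<^esub> hom_cochain R G n g L"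
  by (auto simp: hom_cochain_def cochains_def free_mod_def)
qed

lemma hom_smult:
 assumes "f : carrier (CC n)" "r : carrier R"
 shows "hom_cochain R G n (r \<odot>\<^bsub>CC n\<^esub> f) = (%L. r \<otimes>\<^bsub>R\<^esub> hom_cochain R G n f L)"
proof
 fix L
 have "diffs G L : tuples G n" if "L : tuples G (Suc n)"
  using that set_diffs length_diffs by (auto simp: tuples_def)
 then show "hom_cochain R G n (r \<odot>\<^bsub>CC n\<^esub> f) L = r \<otimes>\<^bsub>R\<^esub> hom_cochain R G n f L"
  using assms by (auto simp: hom_cochain_def cochains_def free_mod_def)
qed

lemma hom_zero: "hom_cochain R G n \<zero>\<^bsub>CC n\<^esub> = (%L. \<zero>\<^bsub>R\<^esub>)"
proof
 fix L
 have "diffs G L : tuples G n" if "L : tuples G (Suc n)"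
  using that set_diffs length_diffs by (auto simp: tuples_def)
 then show "hom_cochain R G n \<zero>\<^bsub>CC n\<^esub> L = \<zero>\<^bsub>R\<^esub>"
  by (auto simp: hom_cochain_def cochains_def free_mod_def)
qed

lemma inh_add:
 "inh_cochain R G n (%L. phi L \<oplus>\<^bsub>R\<^esub> psi L) = inh_cochain R G n phi \<oplus>\<^bsub>CC n\<^esub> inh_cochain R G n psi"
 by (auto simp: inh_cochain_def cochains_def free_mod_def fun_eq_iff)

lemma inh_smult:
 "r : carrier R ==> inh_cochain R G n (%L. r \<otimes>\<^bsub>R\<^esub> phi L) = r \<odot>\<^bsub>CC n\<^esub> inh_cochain R G n phi"
 by (auto simp: inh_cochain_def cochains_def free_mod_def fun_eq_iff)

lemma inh_cong:
 "(!!L. L : tuples G (Suc n) ==> phi L = psi L) ==> inh_cochain R G n phi = inh_cochain R G n psi"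
 using tuples_pp by (auto simp: inh_cochain_def fun_eq_iff restrict_def)

lemma ZZ_iff: "f : ZZ n \<longleftrightarrow> f : carrier (CC n) & hom_cochain R G n f : hcocycles R G n"
proof -
 have "dd n f = \<zero>\<^bsub>CC (Suc n)\<^esub> \<longleftrightarrow> (\<forall>L\<in>tuples G (Suc (Suc n)). hD R L (hom_cochain R G n f) = \<zero>\<^bsub>R\<^esub>)"
  if f: "f : carrier (CC n)"
 proof
  assume "dd n f = \<zero>\<^bsub>CC (Suc n)\<^esub>"
  then show "\<forall>L\<in>tuples G (Suc (Suc n)). hD R L (hom_cochain R G n f) = \<zero>\<^bsub>R\<^esub>"
  using hom_dd[OF f] hom_zero by simp
 next
  assume *: "\<forall>L\<in>tuples G (Suc (Suc n)). hD R L (hom_cochain R G n f) = \<zero>\<^bsub>R\<^esub>"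
  have z: "\<zero>\<^bsub>CC (Suc n)\<^esub> : carrier (CC (Suc n))"
  using CC_module[of "Suc n"] by (simp add: abelian_group.axioms Module.module_def abelian_monoid.zero_closed)
  show "dd n f = \<zero>\<^bsub>CC (Suc n)\<^esub>"
  by (rule CC_eqI[OF dd_in[OF f] z]) (use * hom_dd[OF f] hom_zero in simp)
 qed
 then show ?thesis using hom_in by (auto simp: cocycles_def hcocycles_def)
qed

lemma hom_of_cong_hcob:
 assumes "!!L. L : tuples G (Suc n) ==> phi L = psi L"
 shows "is_hcob R G n phi \<longleftrightarrow> is_hcob R G n psi"
 using assms by (cases n) (auto simp: is_hcob_def)

lemma hcocycles_cong:
 assumes eq: "!!L. L : tuples G (Suc n) ==> phi L = psi L"
 shows "phi : hcocycles R G n \<longleftrightarrow> psi : hcocycles R G n"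
proof -
 have "phi : hcochains R G n \<longleftrightarrow> psi : hcochains R G n"
 proof -
  have "{x : carrier G. phi (map ((\<otimes>) x) L) ~= \<zero>\<^bsub>R\<^esub>} = {x : carrier G. psi (map ((\<otimes>) x) L) ~= \<zero>\<^bsub>R\<^esub>}"
  if "L : tuples G (Suc n)" for L using eq map_tuples[OF that] by auto
  then show ?thesis using eq by (simp add: hcochains_def)
 qed
 moreover have "hD R L phi = hD R L psi" if "L : tuples G (Suc (Suc n))" for L
  by (rule R.hD_cong) (use eq tuples_sub that in auto)
 ultimately show ?thesis by (simp add: hcocycles_def)
qed

lemma BB_iff: "f : BB n \<longleftrightarrow> f : carrier (CC n) & is_hcob R G n (hom_cochain R G n f)"
proof (cases n)
 case 0
 have z: "\<zero>\<^bsub>CC 0\<^esub> : carrier (CC 0)"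
  using CC_module[of 0] by (simp add: abelian_group.axioms Module.module_def abelian_monoid.zero_closed)
 have "f = \<zero>\<^bsub>CC 0\<^esub>" if "f : carrier (CC 0)" "\<forall>L\<in>tuples G 1. hom_cochain R G 0 f L = \<zero>\<^bsub>R\<^esub>"
  by (rule CC_eqI[OF that(1) z]) (use that hom_zero in simp)
 then show ?thesis using 0 z hom_zero by (auto simp: is_hcob_def)
next
 case (Suc m)
 show ?thesis
 proof
  assume "f : BB n"
  then obtain g where "g : carrier (CC m)" "f = dd m g" using Suc by auto
  then show "f : carrier (CC n) & is_hcob R G n (hom_cochain R G n f)"
  using Suc dd_in hom_dd hom_in by (auto simp: is_hcob_def)
 next
  assume *: "f : carrier (CC n) & is_hcob R G n (hom_cochain R G n f)"
  then obtain psi where psi: "psi : hcochains R G m" "!!L. L : tuples G (Suc n) ==> hom_cochain R G n f L = hD R L psi"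
  using Suc by (auto simp: is_hcob_def)
  let ?g = "inh_cochain R G m psi"
  have g: "?g : carrier (CC m)" by (rule inh_in[OF psi(1)])
  have "hom_cochain R G n (dd m ?g) L = hom_cochain R G n f L" if L: "L : tuples G (Suc n)" for L
  proof -
  have "hom_cochain R G n (dd m ?g) L = hD R L (hom_cochain R G m ?g)" using hom_dd[OF g] L Suc by simp
  also have "... = hD R L psi" by (rule R.hD_cong) (use hom_inh[OF psi(1)] tuples_sub L Suc in auto)
  finally show ?thesis using psi(2)[OF L] by simp
  qed
  then have "dd m ?g = f" using CC_eqI[of "dd m ?g" n f] dd_in[OF g] * Suc by simp
  then show "f : BB n" using g Suc by auto
 qed
qed

lemma hcob_is_hcocycle:
 assumes "phi : hcochains R G n" "is_hcob R G n phi" shows "phi : hcocycles R G n"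
proof -
 have "hD R L phi = \<zero>\<^bsub>R\<^esub>" if L: "L : tuples G (Suc (Suc n))" for L
 proof (cases n)
  case 0
  have "hD R L phi = hD R L (%L. \<zero>\<^bsub>R\<^esub>)"
  by (rule R.hD_cong) (use assms 0 tuples_sub L in "auto simp: is_hcob_def")
  then show ?thesis using hD_zero by simp
 next
  case (Suc m)
  then obtain psi where psi: "psi : hcochains R G m" "!!L. L : tuples G (Suc n) ==> phi L = hD R L psi"
  using assms(2) by (auto simp: is_hcob_def)
  have "hD R L phi = hD R L (%L'. hD R L' psi)"
  by (rule R.hD_cong) (use psi(2) tuples_sub L in auto)
  also have "... = \<zero>\<^bsub>R\<^esub>"
  by (rule R.hD_hD) (use hcochains_D[OF psi(1)] L Suc in "auto simp: tuples_def")
  finally show ?thesis .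
 qed
 then show ?thesis using assms(1) by (simp add: hcocycles_def)
qed

lemma hcocycles_add: "[|phi : hcocycles R G n; psi : hcocycles R G n|] ==> (%L. phi L \<oplus>\<^bsub>R\<^esub> psi L) : hcocycles R G n"
 using hD_add'[of phi n psi] by (simp add: hcocycles_def hcochains_add)

lemma hcocycles_smult: "[|phi : hcocycles R G n; r : carrier R|] ==> (%L. r \<otimes>\<^bsub>R\<^esub> phi L) : hcocycles R G n"
 using hD_smult'[of phi n r] by (simp add: hcocycles_def hcochains_smult)

lemma hcob_add:
 assumes "is_hcob R G n phi" "is_hcob R G n psi" shows "is_hcob R G n (%L. phi L \<oplus>\<^bsub>R\<^esub> psi L)"
proof (cases n)
 case 0 then show ?thesis using assms by (simp add: is_hcob_def)
next
 case (Suc m)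
 then obtain a b where "a : hcochains R G m" "b : hcochains R G m"
  "\<forall>L\<in>tuples G (Suc n). phi L = hD R L a" "\<forall>L\<in>tuples G (Suc n). psi L = hD R L b"
  using assms by (auto simp: is_hcob_def)
 then show ?thesis using Suc hD_add' hcochains_add by (auto simp: is_hcob_def intro!: bexI[of _ "%L. a L \<oplus>\<^bsub>R\<^esub> b L"])
qed

lemma hcob_smult:
 assumes "is_hcob R G n phi" "r : carrier R" shows "is_hcob R G n (%L. r \<otimes>\<^bsub>R\<^esub> phi L)"
proof (cases n)
 case 0 then show ?thesis using assms by (simp add: is_hcob_def)
next
 case (Suc m)
 then obtain a where "a : hcochains R G m" "\<forall>L\<in>tuples G (Suc n). phi L = hD R L a"
  using assms by (auto simp: is_hcob_def)
 then show ?thesis using Suc assms hD_smult' hcochains_smult by (auto simp: is_hcob_def intro!: bexI[of _ "%L. r \<otimes>\<^bsub>R\<^esub> a L"])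
qed

lemma hcob_zero: "is_hcob R G n (%L. \<zero>\<^bsub>R\<^esub>)"
 using hcochains_zero by (cases n) (auto simp: is_hcob_def hD_zero intro!: bexI[of _ "%L. \<zero>\<^bsub>R\<^esub>"])

lemma neg_smult:
 assumes "Module.module R M" "x : carrier M" shows "\<ominus>\<^bsub>M\<^esub> x = (\<ominus>\<^bsub>R\<^esub> \<one>\<^bsub>R\<^esub>) \<odot>\<^bsub>M\<^esub> x"
proof -
 interpret M: Module.module R M by fact
 show ?thesis using assms(2) by (simp add: M.smult_l_minus)
qed

lemma ZZ_submodule: "submodule (ZZ n) R (CC n)"
proof -
 interpret C: Module.module R "CC n" by (rule CC_module)
 show ?thesis
 proof (rule C.submoduleI)
  show "ZZ n \<subseteq> carrier (CC n)" by (auto simp: ZZ_iff)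
  show "\<zero>\<^bsub>CC n\<^esub> : ZZ n" using hcob_is_hcocycle[OF hcochains_zero hcob_zero] by (simp add: ZZ_iff hom_zero)
  fix a assume a: "a : ZZ n"
  show sm: "r \<odot>\<^bsub>CC n\<^esub> a : ZZ n" if "r : carrier R" for r
  using a that by (simp add: ZZ_iff hom_smult hcocycles_smult)
  show "\<ominus>\<^bsub>CC n\<^esub> a : ZZ n" using sm[of "\<ominus>\<^bsub>R\<^esub> \<one>\<^bsub>R\<^esub>"] a by (simp add: neg_smult[OF CC_module] ZZ_iff)
  fix b assume "b : ZZ n"
  then show "a \<oplus>\<^bsub>CC n\<^esub> b : ZZ n" using a by (simp add: ZZ_iff hom_add hcocycles_add)
 qed
qed

lemma ZZ_module: "Module.module R ((CC n)\<lparr>carrier := ZZ n\<rparr>)"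
 by (rule submodule.submodule_is_module[OF ZZ_submodule CC_module])

lemma BB_sub: "BB n \<subseteq> ZZ n"
 using hcob_is_hcocycle hom_in by (auto simp: BB_iff ZZ_iff)

lemma BB_submodule: "submodule (BB n) R ((CC n)\<lparr>carrier := ZZ n\<rparr>)"
proof -
 interpret C: Module.module R "CC n" by (rule CC_module)
 interpret Z: Module.module R "(CC n)\<lparr>carrier := ZZ n\<rparr>" by (rule ZZ_module)
 show ?thesis
 proof (rule Z.submoduleI)
  show "BB n \<subseteq> carrier ((CC n)\<lparr>carrier := ZZ n\<rparr>)" using BB_sub by simp
  show "\<zero>\<^bsub>(CC n)\<lparr>carrier := ZZ n\<rparr>\<^esub> : BB n" using hcob_zero by (simp add: BB_iff hom_zero)
  fix a assume a: "a : BB n"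
  show sm: "r \<odot>\<^bsub>(CC n)\<lparr>carrier := ZZ n\<rparr>\<^esub> a : BB n" if "r : carrier R" for r
  using a that by (simp add: BB_iff hom_smult hcob_smult)
  show "\<ominus>\<^bsub>(CC n)\<lparr>carrier := ZZ n\<rparr>\<^esub> a : BB n"
  using sm[of "\<ominus>\<^bsub>R\<^esub> \<one>\<^bsub>R\<^esub>"] a BB_sub by (subst neg_smult[OF ZZ_module]) auto
  fix b assume "b : BB n"
  then show "a \<oplus>\<^bsub>(CC n)\<lparr>carrier := ZZ n\<rparr>\<^esub> b : BB n" using a by (simp add: BB_iff hom_add hcob_add)
 qed
qed

theorem cohomology_zero_iff:
 "zero_mod (cohomology_group_ring R G n) \<longleftrightarrow> (\<forall>phi\<in>hcocycles R G n. is_hcob R G n phi)"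
proof -
 have "zero_mod (cohomology_group_ring R G n) \<longleftrightarrow> ZZ n \<subseteq> BB n"
  unfolding cohomology_group_ring_def group_cohomology_def
  using quotient_mod_iff(1)[OF ZZ_module BB_submodule] by simp
 also have "... \<longleftrightarrow> (\<forall>phi\<in>hcocycles R G n. is_hcob R G n phi)"
 proof
  assume sub: "ZZ n \<subseteq> BB n"
  show "\<forall>phi\<in>hcocycles R G n. is_hcob R G n phi"
  proof
  fix phi assume phi: "phi : hcocycles R G n"
  then have c: "phi : hcochains R G n" by (simp add: hcocycles_def)
  have "hom_cochain R G n (inh_cochain R G n phi) : hcocycles R G n"
  using hcocycles_cong[OF hom_inh[OF c]] phi by simp
  then have "inh_cochain R G n phi : BB n" using sub inh_in[OF c] ZZ_iff by blast
  then show "is_hcob R G n phi" using hom_of_cong_hcob[OF hom_inh[OF c]] BB_iff by simp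
  qed
 qed (auto simp: ZZ_iff BB_iff)
 finally show ?thesis .
qed

text \<open>The last clause makes \<open>l\<close> depend on the restriction of a cocycle to tuples
  of length \<open>Suc n\<close>, the only part that the inhomogeneous cochain remembers.\<close>

theorem cohomology_iso_iff:
 "mod_isomorphic R (cohomology_group_ring R G n) (regular_mod R) \<longleftrightarrow>
  (EX l. (\<forall>phi\<in>hcocycles R G n. l phi : carrier R) &
  (\<forall>phi\<in>hcocycles R G n. \<forall>psi\<in>hcocycles R G n. l (%L. phi L \<oplus>\<^bsub>R\<^esub> psi L) = l phi \<oplus>\<^bsub>R\<^esub> l psi) &
  (\<forall>r\<in>carrier R. \<forall>phi\<in>hcocycles R G n. l (%L. r \<otimes>\<^bsub>R\<^esub> phi L) = r \<otimes>\<^bsub>R\<^esub> l phi) &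
  (\<forall>phi\<in>hcocycles R G n. l phi = \<zero>\<^bsub>R\<^esub> \<longleftrightarrow> is_hcob R G n phi) &
  (\<forall>r\<in>carrier R. \<exists>phi\<in>hcocycles R G n. l phi = r) &
  (\<forall>phi\<in>hcocycles R G n. \<forall>psi. (\<forall>L\<in>tuples G (Suc n). phi L = psi L) --> l phi = l psi))"
 (is "?L \<longleftrightarrow> (EX l. ?P l)")
proof -
 let ?Z = "(CC n)\<lparr>carrier := ZZ n\<rparr>"
 have "?L \<longleftrightarrow> (EX l. l : carrier ?Z \<rightarrow> carrier R &
  (\<forall>x\<in>carrier ?Z. \<forall>y\<in>carrier ?Z. l (x \<oplus>\<^bsub>?Z\<^esub> y) = l x \<oplus>\<^bsub>R\<^esub> l y) &
  (\<forall>r\<in>carrier R. \<forall>x\<in>carrier ?Z. l (r \<odot>\<^bsub>?Z\<^esub> x) = r \<otimes>\<^bsub>R\<^esub> l x) &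
  (\<forall>x\<in>carrier ?Z. l x = \<zero>\<^bsub>R\<^esub> \<longleftrightarrow> x : BB n) & l ` carrier ?Z = carrier R)"
  unfolding cohomology_group_ring_def group_cohomology_def
  by (rule quotient_mod_iff(2)[OF ZZ_module BB_submodule])
 also have "... \<longleftrightarrow> (EX l. l : ZZ n \<rightarrow> carrier R &
  (\<forall>x\<in>ZZ n. \<forall>y\<in>ZZ n. l (x \<oplus>\<^bsub>CC n\<^esub> y) = l x \<oplus>\<^bsub>R\<^esub> l y) &
  (\<forall>r\<in>carrier R. \<forall>x\<in>ZZ n. l (r \<odot>\<^bsub>CC n\<^esub> x) = r \<otimes>\<^bsub>R\<^esub> l x) &
  (\<forall>x\<in>ZZ n. l x = \<zero>\<^bsub>R\<^esub> \<longleftrightarrow> x : BB n) & l ` ZZ n = carrier R)" (is "_ \<longleftrightarrow> (EX l. ?Q l)")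
  by simp
 also have "... \<longleftrightarrow> (EX l. ?P l)"
 proof
  assume "EX l. ?Q l"
  then obtain l where Q: "?Q l" ..
  then have l: "l : ZZ n \<rightarrow> carrier R"
  "!!x y. x : ZZ n ==> y : ZZ n ==> l (x \<oplus>\<^bsub>CC n\<^esub> y) = l x \<oplus>\<^bsub>R\<^esub> l y"
  "!!r x. r : carrier R ==> x : ZZ n ==> l (r \<odot>\<^bsub>CC n\<^esub> x) = r \<otimes>\<^bsub>R\<^esub> l x"
  "!!x. x : ZZ n ==> l x = \<zero>\<^bsub>R\<^esub> \<longleftrightarrow> x : BB n" "l ` ZZ n = carrier R" by simp_all
  have inhZ: "inh_cochain R G n phi : ZZ n" if "phi : hcocycles R G n" for phi
  proof -
  have c: "phi : hcochains R G n" using that by (simp add: hcocycles_def)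
  show ?thesis using hcocycles_cong[OF hom_inh[OF c]] that inh_in[OF c] by (simp add: ZZ_iff)
  qed
  have inhB: "inh_cochain R G n phi : BB n \<longleftrightarrow> is_hcob R G n phi" if "phi : hcocycles R G n" for phi
  proof -
  have c: "phi : hcochains R G n" using that by (simp add: hcocycles_def)
  show ?thesis using hom_of_cong_hcob[OF hom_inh[OF c]] inh_in[OF c] by (simp add: BB_iff)
  qed
  have sur: "\<exists>phi\<in>hcocycles R G n. l (inh_cochain R G n phi) = r" if r: "r : carrier R" for r
  proof -
  have "r : l ` ZZ n" using l(5) r by simp
  then obtain f where f: "r = l f" "f : ZZ n" by (rule imageE)
  then have "inh_cochain R G n (hom_cochain R G n f) = f" "hom_cochain R G n f : hcocycles R G n"
  using inh_hom by (auto simp: ZZ_iff)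
  then show ?thesis using f(1) by (intro bexI[of _ "hom_cochain R G n f"]) simp_all
  qed
  show "EX l. ?P l"
  proof (rule exI[of _ "%phi. l (inh_cochain R G n phi)"], intro conjI ballI allI impI)
  fix phi psi assume phi: "phi : hcocycles R G n"
  show "l (inh_cochain R G n phi) = l (inh_cochain R G n psi)" if "\<forall>L\<in>tuples G (Suc n). phi L = psi L"
  using inh_cong[of n phi psi] that by simp
  qed (use l(1) inhZ inhB inh_add inh_smult l(2-4) sur in auto)
 next
  assume "EX l. ?P l"
  then obtain l where P: "?P l" ..
  have l: "!!phi. phi : hcocycles R G n ==> l phi : carrier R"
  "!!phi psi. [|phi : hcocycles R G n; psi : hcocycles R G n|] ==> l (%L. phi L \<oplus>\<^bsub>R\<^esub> psi L) = l phi \<oplus>\<^bsub>R\<^esub> l psi"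
  "!!r phi. [|r : carrier R; phi : hcocycles R G n|] ==> l (%L. r \<otimes>\<^bsub>R\<^esub> phi L) = r \<otimes>\<^bsub>R\<^esub> l phi"
  "!!phi. phi : hcocycles R G n ==> l phi = \<zero>\<^bsub>R\<^esub> \<longleftrightarrow> is_hcob R G n phi"
  "!!r. r : carrier R ==> \<exists>phi\<in>hcocycles R G n. l phi = r"
  "!!phi psi. [|phi : hcocycles R G n; \<forall>L\<in>tuples G (Suc n). phi L = psi L|] ==> l phi = l psi" using P by simp_all
  have sur: "r : (%f. l (hom_cochain R G n f)) ` ZZ n" if r: "r : carrier R" for r
  proof -
  obtain phi where phi: "phi : hcocycles R G n" "l phi = r" using l(5)[OF r] by (rule bexE)
  then have c: "phi : hcochains R G n" by (simp add: hcocycles_def)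
  have "hom_cochain R G n (inh_cochain R G n phi) : hcocycles R G n"
  using hcocycles_cong[OF hom_inh[OF c]] phi by simp
  moreover have "l (hom_cochain R G n (inh_cochain R G n phi)) = r"
  using l(6)[OF phi(1), of "hom_cochain R G n (inh_cochain R G n phi)"] hom_inh[OF c] phi(2) by simp
  ultimately show ?thesis using inh_in[OF c] by (auto simp: ZZ_iff image_iff)
  qed
  show "EX l. ?Q l"
  by (rule exI[of _ "%f. l (hom_cochain R G n f)"])
  (use l(1-4) sur in "auto simp: ZZ_iff BB_iff hom_add hom_smult")
 qed
 finally show ?thesis .
qed

end

section \<open>Degrees zero and one, and finite groups\<close>

lemma tuples_1: "L : tuples G (Suc 0) \<longleftrightarrow> (\<exists>a\<in>carrier G. L = [a])"
 by (auto simp: tuples_def length_Suc_conv)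

lemma tuples_2: "L : tuples G (Suc (Suc 0)) \<longleftrightarrow> (\<exists>a\<in>carrier G. \<exists>b\<in>carrier G. L = [a, b])"
 by (auto simp: tuples_def length_Suc_conv)

lemma tuples_3: "L : tuples G (Suc (Suc (Suc 0))) \<longleftrightarrow>
  (\<exists>a\<in>carrier G. \<exists>b\<in>carrier G. \<exists>c\<in>carrier G. L = [a, b, c])"
 by (auto simp: tuples_def length_Suc_conv)

lemma tuples_Cons: "x # L : tuples G (Suc n) \<longleftrightarrow> x : carrier G & L : tuples G n"
 by (auto simp: tuples_def)

context ring_group
begin

lemma r_minus_zero: "a : carrier R ==> a \<ominus>\<^bsub>R\<^esub> \<zero>\<^bsub>R\<^esub> = a"
 by (simp add: R.minus_eq)

lemma minus_eq_zero_iff: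
 assumes "a : carrier R" "b : carrier R" shows "a \<ominus>\<^bsub>R\<^esub> b = \<zero>\<^bsub>R\<^esub> \<longleftrightarrow> a = b"
proof
 assume "a \<ominus>\<^bsub>R\<^esub> b = \<zero>\<^bsub>R\<^esub>"
 moreover have "a = (a \<ominus>\<^bsub>R\<^esub> b) \<oplus>\<^bsub>R\<^esub> b" using assms by algebra
 ultimately show "a = b" using assms by simp
qed (use assms in "simp add: R.minus_eq R.r_neg")

lemma hcocyclesD: "[|phi : hcocycles R G n; L : tuples G (Suc (Suc n))|] ==> hD R L phi = \<zero>\<^bsub>R\<^esub>"
 by (simp add: hcocycles_def)

text \<open>The difference cochain of \<open>f\<close>, read through inversion. Inversion turns
  almost invariance under left translation into finiteness of the support along diagonal
  orbits.\<close>

definition df :: "('g => 'r) => 'g list => 'r"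
 where "df f = (%L. f (inv (L ! 1)) \<ominus>\<^bsub>R\<^esub> f (inv (L ! 0)))"

lemma df_hcocycle:
 assumes f: "f : almost_inv R G" shows "df f : hcocycles R G 1"
proof -
 have "df f : hcochains R G 1"
 proof (rule hcochainsI)
  fix L assume "L : tuples G (Suc 1)"
  then obtain a b where ab: "a : carrier G" "b : carrier G" "L = [a, b]" by (auto simp: tuples_2)
  then show "df f L : carrier R" using AI_closed[OF f] by (simp add: df_def)
  \<comment> \<open>In terms of \<open>y = inv (x \<otimes> a)\<close> the other vertex gives
    \<open>inv (x \<otimes> b) = (inv b \<otimes> a) \<otimes> y\<close>, so almost invariance under
    \<open>inv b \<otimes> a\<close> applies.\<close>
  have "eventually (%x. f ((inv b \<otimes> a) \<otimes> (inv a \<otimes> inv x)) = f (inv a \<otimes> inv x)) (cofin G)"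
  by (rule eventually_cofin_inj[OF AI_ev[OF f, of "inv b \<otimes> a"], of "%x. inv a \<otimes> inv x"])
  (use ab in "auto simp: inj_on_def")
  then have "eventually (%x. df f (map ((\<otimes>) x) L) = \<zero>\<^bsub>R\<^esub>) (cofin G)"
  using eventually_cofin_carrier
  proof eventually_elim
  case (elim x)
  have "inv b \<otimes> a \<otimes> (inv a \<otimes> inv x) = inv (x \<otimes> b)" "inv a \<otimes> inv x = inv (x \<otimes> a)"
  using ab elim by (simp_all add: inv_mult_group m_assoc) (simp add: m_assoc[symmetric])
  then show ?case using elim ab AI_closed[OF f] by (simp add: df_def R.minus_eq R.r_neg)
  qed
  then show "finite {x : carrier G. df f (map ((\<otimes>) x) L) ~= \<zero>\<^bsub>R\<^esub>}" by (simp add: eventually_cofin)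
 qed
 moreover have "hD R L (df f) = \<zero>\<^bsub>R\<^esub>" if "L : tuples G (Suc (Suc 1))" for L
 proof -
  obtain a b c where abc: "a : carrier G" "b : carrier G" "c : carrier G" "L = [a, b, c]" using \<open>L : _\<close> by (auto simp: tuples_3)
  have "f (inv a) : carrier R" "f (inv b) : carrier R" "f (inv c) : carrier R" using AI_closed[OF f] abc by auto
  then show ?thesis using abc(4) unfolding df_def by simp algebra
 qed
 ultimately show ?thesis by (simp add: hcocycles_def)
qed

text \<open>If \<open>psi\<close> bounds \<open>df f\<close>, then \<open>f x\<close> and
  \<open>psi [inv x]\<close> differ by a constant, and \<open>psi\<close> has finite support.
  Conversely \<open>f\<close> minus its almost constant value is such a \<open>psi\<close>, after
  inversion.\<close>

lemma df_hcob:
 assumes f: "f : almost_inv R G" shows "is_hcob R G 1 (df f) \<longleftrightarrow> almost_const R G f"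
proof
 assume "is_hcob R G 1 (df f)"
 then obtain psi where psi: "psi : hcochains R G 0" "!!L. L : tuples G (Suc (Suc 0)) ==> df f L = hD R L psi"
  by (auto simp: is_hcob_def)
 have psic: "psi [a] : carrier R" if "a : carrier G" for a using hcochains_D[OF psi(1)] that by (simp add: tuples_1)
 let ?c = "f \<one> \<ominus>\<^bsub>R\<^esub> psi [\<one>]"
 have "finite {x : carrier G. psi (map ((\<otimes>) x) [\<one>]) ~= \<zero>\<^bsub>R\<^esub>}" by (rule hcochains_fin[OF psi(1)]) (simp add: tuples_1)
 then have "eventually (%x. psi [x \<otimes> \<one>] = \<zero>\<^bsub>R\<^esub>) (cofin G)" by (simp add: eventually_cofin)
 then have "eventually (%x. psi [inv x \<otimes> \<one>] = \<zero>\<^bsub>R\<^esub>) (cofin G)"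
  by (rule eventually_cofin_inj) (auto simp: inj_on_def)
 then have "eventually (%x. f x = ?c) (cofin G)" using eventually_cofin_carrier
 proof eventually_elim
  case (elim x)
  have cl: "f x : carrier R" "f \<one> : carrier R" "psi [\<one>] : carrier R" "psi [inv x] : carrier R"
  using elim AI_closed[OF f] psic by auto
  have "f x \<ominus>\<^bsub>R\<^esub> f \<one> = psi [inv x] \<ominus>\<^bsub>R\<^esub> psi [\<one>]"
  using psi(2)[of "[\<one>, inv x]"] elim cl by (simp add: tuples_2 df_def r_minus_zero)
  moreover have "psi [inv x] = \<zero>\<^bsub>R\<^esub>" using elim by simp
  moreover have "f x = (f x \<ominus>\<^bsub>R\<^esub> f \<one>) \<oplus>\<^bsub>R\<^esub> f \<one>" using cl by algebra
  ultimately have "f x = (\<zero>\<^bsub>R\<^esub> \<ominus>\<^bsub>R\<^esub> psi [\<one>]) \<oplus>\<^bsub>R\<^esub> f \<one>" by simp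
  then show ?case using cl by (simp add: R.minus_eq R.a_comm)
 qed
 moreover have "?c : carrier R" using AI_closed[OF f] psic by simp
 ultimately show "almost_const R G f" unfolding almost_const_def by blast
next
 assume "almost_const R G f"
 then obtain c where c: "c : carrier R" "eventually (%x. f x = c) (cofin G)" by (auto simp: almost_const_def)
 let ?psi = "%L. f (inv (hd L)) \<ominus>\<^bsub>R\<^esub> c"
 have "?psi : hcochains R G 0"
 proof (rule hcochainsI)
  fix L assume "L : tuples G (Suc 0)"
  then obtain a where a: "a : carrier G" "L = [a]" by (auto simp: tuples_1)
  then show "?psi L : carrier R" using AI_closed[OF f] c by simp
  have "eventually (%x. f (inv (x \<otimes> a)) = c) (cofin G)"
  by (rule eventually_cofin_inj[OF c(2)]) (use a in "auto simp: inj_on_def")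
  then have "eventually (%x. ?psi (map ((\<otimes>) x) L) = \<zero>\<^bsub>R\<^esub>) (cofin G)"
  by eventually_elim (use a c in "simp add: R.minus_eq R.r_neg")
  then show "finite {x : carrier G. ?psi (map ((\<otimes>) x) L) ~= \<zero>\<^bsub>R\<^esub>}" by (simp add: eventually_cofin)
 qed
 moreover have "df f L = hD R L ?psi" if "L : tuples G (Suc (Suc 0))" for L
 proof -
  obtain a b where ab: "a : carrier G" "b : carrier G" "L = [a, b]" using \<open>L : _\<close> by (auto simp: tuples_2)
  have "f (inv a) : carrier R" "f (inv b) : carrier R" using AI_closed[OF f] ab by auto
  then show ?thesis using ab(3) c(1) unfolding df_def by simp algebra
 qed
 ultimately show "is_hcob R G 1 (df f)" by (auto simp: is_hcob_def)
qed

lemma hcocycle_1: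
 assumes phi: "phi : hcocycles R G 1" and abc: "a : carrier G" "b : carrier G" "c : carrier G"
 shows "phi [a, c] = phi [a, b] \<oplus>\<^bsub>R\<^esub> phi [b, c]"
proof -
 have cl: "phi [x, y] : carrier R" if "x : carrier G" "y : carrier G" for x y
  using hcochains_D[of phi 1 "[x, y]"] phi that by (simp add: hcocycles_def tuples_2)
 note c3 = cl[OF abc(1,2)] cl[OF abc(2,3)] cl[OF abc(1,3)]
 have "[a, b, c] : tuples G (Suc (Suc 1))" using abc by (simp add: tuples_3)
 then have "hD R [a, b, c] phi = \<zero>\<^bsub>R\<^esub>" by (rule hcocyclesD[OF phi])
 then have "phi [b, c] \<ominus>\<^bsub>R\<^esub> (phi [a, c] \<ominus>\<^bsub>R\<^esub> phi [a, b]) = \<zero>\<^bsub>R\<^esub>" using c3 by (simp add: r_minus_zero)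
 then have "phi [b, c] = phi [a, c] \<ominus>\<^bsub>R\<^esub> phi [a, b]" using c3 by (subst (asm) minus_eq_zero_iff) auto
 moreover have "phi [a, c] = phi [a, b] \<oplus>\<^bsub>R\<^esub> (phi [a, c] \<ominus>\<^bsub>R\<^esub> phi [a, b])" using c3 by algebra
 ultimately show ?thesis by simp
qed

text \<open>Integrate the cocycle from the identity. Its finite support along the diagonal orbit of
  the edge from the identity to \<open>inv g\<close> is almost invariance under
  \<open>g\<close>.\<close>

lemma hcocycle_df:
 assumes phi: "phi : hcocycles R G 1"
 shows "\<exists>f\<in>almost_inv R G. \<forall>L\<in>tuples G (Suc (Suc 0)). phi L = df f L"
proof -
 have phic: "phi : hcochains R G 1" using phi by (simp add: hcocycles_def)
 have cl: "phi [x, y] : carrier R" if "x : carrier G" "y : carrier G" for x y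
  using hcochains_D[OF phic, of "[x, y]"] that by (simp add: tuples_2)
 let ?f = "%y. phi [\<one>, inv y]"
 have eq: "phi [a, b] = ?f (inv b) \<ominus>\<^bsub>R\<^esub> ?f (inv a)" if "a : carrier G" "b : carrier G" for a b
 proof -
  have "phi [\<one>, b] = phi [\<one>, a] \<oplus>\<^bsub>R\<^esub> phi [a, b]" by (rule hcocycle_1[OF phi one_closed that])
  moreover have "phi [\<one>, a] : carrier R" "phi [a, b] : carrier R" using cl that by auto
  moreover have "phi [a, b] = (phi [\<one>, a] \<oplus>\<^bsub>R\<^esub> phi [a, b]) \<ominus>\<^bsub>R\<^esub> phi [\<one>, a]" using calculation(2,3) by algebra
  ultimately show ?thesis using that by simp
 qed
 have "?f : almost_inv R G"
 proof (rule AI_I)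
  fix g assume g: "g : carrier G"
  have "finite {x : carrier G. phi (map ((\<otimes>) x) [\<one>, inv g]) ~= \<zero>\<^bsub>R\<^esub>}"
  by (rule hcochains_fin[OF phic]) (use g in "simp add: tuples_2")
  then have "eventually (%x. phi [x \<otimes> \<one>, x \<otimes> inv g] = \<zero>\<^bsub>R\<^esub>) (cofin G)" by (simp add: eventually_cofin)
  then have "eventually (%x. phi [inv x \<otimes> \<one>, inv x \<otimes> inv g] = \<zero>\<^bsub>R\<^esub>) (cofin G)"
  by (rule eventually_cofin_inj) (auto simp: inj_on_def)
  then show "eventually (%x. ?f (g \<otimes> x) = ?f x) (cofin G)" using eventually_cofin_carrier
  proof eventually_elim
  case (elim x)
  then have "phi [inv x, inv (g \<otimes> x)] = \<zero>\<^bsub>R\<^esub>" using g by (simp add: inv_mult_group)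
  then show ?case using eq[of "inv x" "inv (g \<otimes> x)"] elim g cl by (simp add: minus_eq_zero_iff)
  qed
 qed (use cl in auto)
 moreover have "phi L = df ?f L" if "L : tuples G (Suc (Suc 0))" for L
 proof -
  obtain a b where "a : carrier G" "b : carrier G" "L = [a, b]" using \<open>L : _\<close> by (auto simp: tuples_2)
  then show ?thesis using eq[of a b] by (simp add: df_def)
 qed
 ultimately show ?thesis by blast
qed

lemma AI_trivial:
 assumes "zero_mod (cohomology_group_ring R G 1)" "f : almost_inv R G"
 shows "almost_const R G f"
proof -
 have "is_hcob R G 1 (df f)" using assms(1) df_hcocycle[OF assms(2)] unfolding cohomology_zero_iff by (rule bspec)
 then show ?thesis by (simp only: df_hcob[OF assms(2)])
qed

text \<open>The functional on cocycles, composed with \<open>df\<close>, is the functional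
  \<open>lam\<close> that \<open>rank_one\<close> requires.\<close>

theorem virt_cyclic_if_H1_free:
 assumes inf: "infinite (carrier G)" and one: "\<one>\<^bsub>R\<^esub> ~= \<zero>\<^bsub>R\<^esub>"
  and iso: "mod_isomorphic R (cohomology_group_ring R G 1) (regular_mod R)"
 shows "virt_cyclic G"
proof -
 let ?P = "%l. (\<forall>phi\<in>hcocycles R G 1. l phi : carrier R) &
  (\<forall>phi\<in>hcocycles R G 1. \<forall>psi\<in>hcocycles R G 1. l (%L. phi L \<oplus>\<^bsub>R\<^esub> psi L) = l phi \<oplus>\<^bsub>R\<^esub> l psi) &
  (\<forall>r\<in>carrier R. \<forall>phi\<in>hcocycles R G 1. l (%L. r \<otimes>\<^bsub>R\<^esub> phi L) = r \<otimes>\<^bsub>R\<^esub> l phi) &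
  (\<forall>phi\<in>hcocycles R G 1. l phi = \<zero>\<^bsub>R\<^esub> \<longleftrightarrow> is_hcob R G 1 phi) &
  (\<forall>r\<in>carrier R. \<exists>phi\<in>hcocycles R G 1. l phi = r) &
  (\<forall>phi\<in>hcocycles R G 1. \<forall>psi. (\<forall>L\<in>tuples G (Suc 1). phi L = psi L) --> l phi = l psi)"
 obtain l where "?P l" using iso unfolding cohomology_iso_iff ..
 then have l: "!!phi. phi : hcocycles R G 1 ==> l phi : carrier R"
  "!!phi psi. [|phi : hcocycles R G 1; psi : hcocycles R G 1|] ==> l (%L. phi L \<oplus>\<^bsub>R\<^esub> psi L) = l phi \<oplus>\<^bsub>R\<^esub> l psi"
  "!!r phi. [|r : carrier R; phi : hcocycles R G 1|] ==> l (%L. r \<otimes>\<^bsub>R\<^esub> phi L) = r \<otimes>\<^bsub>R\<^esub> l phi"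
  "!!phi. phi : hcocycles R G 1 ==> l phi = \<zero>\<^bsub>R\<^esub> \<longleftrightarrow> is_hcob R G 1 phi"
  "!!r. r : carrier R ==> \<exists>phi\<in>hcocycles R G 1. l phi = r"
  "!!phi psi. [|phi : hcocycles R G 1; \<forall>L\<in>tuples G (Suc 1). phi L = psi L|] ==> l phi = l psi" by simp_all
 have closedL: "f (inv (L ! 0)) : carrier R & f (inv (L ! 1)) : carrier R"
  if "f : almost_inv R G" "L : tuples G (Suc 1)" for f L
  using that AI_closed by (auto simp: tuples_2)
 interpret rank_one R G "%f. l (df f)"
 proof unfold_locales
  show "infinite (carrier G)" "\<one>\<^bsub>R\<^esub> ~= \<zero>\<^bsub>R\<^esub>" by fact+
  fix f assume f: "f : almost_inv R G"
  show "l (df f) : carrier R" by (rule l(1)[OF df_hcocycle[OF f]])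
  show "l (df f) = \<zero>\<^bsub>R\<^esub> \<longleftrightarrow> almost_const R G f" using l(4)[OF df_hcocycle[OF f]] df_hcob[OF f] by simp
  fix r assume r: "r : carrier R"
  have "df (%x. r \<otimes>\<^bsub>R\<^esub> f x) L = r \<otimes>\<^bsub>R\<^esub> df f L" if "L : tuples G (Suc 1)" for L
  using closedL[OF f that] r unfolding df_def by (auto simp: R.minus_eq R.r_distr R.r_minus)
  then show "l (df (%x. r \<otimes>\<^bsub>R\<^esub> f x)) = r \<otimes>\<^bsub>R\<^esub> l (df f)"
  using l(6)[OF df_hcocycle[OF AI_smult[OF f r]], of "%L. r \<otimes>\<^bsub>R\<^esub> df f L"] l(3)[OF r df_hcocycle[OF f]] by simp
 next
  fix f k assume f: "f : almost_inv R G" and k: "k : almost_inv R G"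
  have "df (%x. f x \<oplus>\<^bsub>R\<^esub> k x) L = df f L \<oplus>\<^bsub>R\<^esub> df k L" if "L : tuples G (Suc 1)" for L
  using closedL[OF f that] closedL[OF k that] unfolding df_def by (auto simp: R.minus_eq R.minus_add R.a_ac)
  then show "l (df (%x. f x \<oplus>\<^bsub>R\<^esub> k x)) = l (df f) \<oplus>\<^bsub>R\<^esub> l (df k)"
  using l(6)[OF df_hcocycle[OF AI_add[OF f k]], of "%L. df f L \<oplus>\<^bsub>R\<^esub> df k L"] l(2)[OF df_hcocycle[OF f] df_hcocycle[OF k]] by simp
 next
  obtain phi where phi: "phi : hcocycles R G 1" "l phi = \<one>\<^bsub>R\<^esub>" using l(5)[OF R.one_closed] by (rule bexE)
  obtain f where f: "f : almost_inv R G" "\<forall>L\<in>tuples G (Suc (Suc 0)). phi L = df f L" using hcocycle_df[OF phi(1)] by (rule bexE)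
  then have "l phi = l (df f)" using l(6)[OF phi(1)] by simp
  then show "\<exists>f\<in>almost_inv R G. l (df f) = \<one>\<^bsub>R\<^esub>" using f(1) phi(2) by auto
 qed
 show ?thesis by (rule virt_cyclic)
qed

text \<open>Cocycles of degree zero are constant, and finite support on an infinite group makes the
  constant zero.\<close>

lemma H0_infinite:
 assumes inf: "infinite (carrier G)" shows "zero_mod (cohomology_group_ring R G 0)"
 unfolding cohomology_zero_iff
proof
 fix phi assume phi: "phi : hcocycles R G 0"
 then have phic: "phi : hcochains R G 0" by (simp add: hcocycles_def)
 have cl: "phi [x] : carrier R" if "x : carrier G" for x using hcochains_D[OF phic] that by (simp add: tuples_1)
 have const: "phi [a] = phi [b]" if ab: "a : carrier G" "b : carrier G" for a b
 proof -
  have "[b, a] : tuples G (Suc (Suc 0))" using ab by (simp add: tuples_2)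
  then have "hD R [b, a] phi = \<zero>\<^bsub>R\<^esub>" by (rule hcocyclesD[OF phi])
  then show ?thesis using cl ab by (simp add: r_minus_zero minus_eq_zero_iff)
 qed
 have "finite {x : carrier G. phi (map ((\<otimes>) x) [\<one>]) ~= \<zero>\<^bsub>R\<^esub>}" by (rule hcochains_fin[OF phic]) (simp add: tuples_1)
 then have "eventually (%x. phi [x \<otimes> \<one>] = \<zero>\<^bsub>R\<^esub>) (cofin G)" by (simp add: eventually_cofin)
 then obtain x where "x : carrier G" "phi [x \<otimes> \<one>] = \<zero>\<^bsub>R\<^esub>" using eventually_cofin_happens[OF inf order_refl] by blast
 then have "phi [a] = \<zero>\<^bsub>R\<^esub>" if "a : carrier G" for a using const[OF that, of x] by simp
 then show "is_hcob R G 0 phi" by (auto simp: is_hcob_def tuples_1)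
qed

text \<open>All support conditions hold in a finite group, so coning with the identity contracts the
  complex. In degree zero only the constants remain, and evaluation at the identity identifies them
  with \<open>R\<close>.\<close>

theorem finite_concentrated:
 assumes fin: "finite (carrier G)" shows "cohomology_concentrated R G 0"
proof -
 have finS: "finite {x : carrier G. P x}" for P using fin by simp
 have "mod_isomorphic R (cohomology_group_ring R G 0) (regular_mod R)"
  unfolding cohomology_iso_iff
 proof (intro exI[of _ "%phi. phi [\<one>]"] conjI ballI allI impI)
  have one1: "[\<one>] : tuples G (Suc 0)" by (simp add: tuples_1)
  show "phi [\<one>] : carrier R" if "phi : hcocycles R G 0" for phi
  using that one1 by (auto simp: hcocycles_def intro: hcochains_D)
  show "\<exists>phi\<in>hcocycles R G 0. phi [\<one>] = r" if r: "r : carrier R" for r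
  proof
  show "(%_. r) : hcocycles R G 0"
  using r finS by (auto simp: hcocycles_def tuples_2 r_minus_zero minus_eq_zero_iff intro!: hcochainsI)
  qed simp
  show "phi [\<one>] = psi [\<one>]" if "\<forall>L\<in>tuples G (Suc 0). phi L = psi L" for phi psi using that one1 by blast
  fix phi assume phi: "phi : hcocycles R G 0"
  then have cl: "phi [x] : carrier R" if "x : carrier G" for x
  using hcochains_D[of phi 0] that by (simp add: tuples_1 hcocycles_def)
  have const: "phi [a] = phi [\<one>]" if ab: "a : carrier G" for a
  proof -
  have "[\<one>, a] : tuples G (Suc (Suc 0))" using ab by (simp add: tuples_2)
  then have "hD R [\<one>, a] phi = \<zero>\<^bsub>R\<^esub>" by (rule hcocyclesD[OF phi])
  then show ?thesis using cl ab by (simp add: r_minus_zero minus_eq_zero_iff)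
  qed
  show "phi [\<one>] = \<zero>\<^bsub>R\<^esub> \<longleftrightarrow> is_hcob R G 0 phi"
  proof
  assume z: "phi [\<one>] = \<zero>\<^bsub>R\<^esub>"
  have "phi [a] = \<zero>\<^bsub>R\<^esub>" if "a : carrier G" for a using const[OF that] z by simp
  then show "is_hcob R G 0 phi" by (auto simp: is_hcob_def tuples_1)
  qed (use one1 in "simp add: is_hcob_def")
 qed auto
 moreover have "zero_mod (cohomology_group_ring R G i)" if i: "i ~= 0" for i
 proof -
  obtain m where m: "i = Suc m" using i by (cases i) auto
  show ?thesis unfolding cohomology_zero_iff m
  proof
  fix phi assume phi: "phi : hcocycles R G (Suc m)"
  then have phic: "phi : hcochains R G (Suc m)" by (simp add: hcocycles_def)
  have "(%L. phi (\<one> # L)) : hcochains R G m"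
  using hcochains_D[OF phic] finS by (auto intro!: hcochainsI simp: tuples_Cons)
  moreover have "phi L = hD R L (%L. phi (\<one> # L))" if L: "L : tuples G (Suc (Suc m))" for L
  proof -
  have "\<one> # L : tuples G (Suc (Suc (Suc m)))" using L by (simp add: tuples_Cons)
  then have "hD R (\<one> # L) phi = \<zero>\<^bsub>R\<^esub>" by (rule hcocyclesD[OF phi])
  moreover have "hD R L (%L. phi (\<one> # L)) : carrier R"
  by (rule R.hD_closed) (use hcochains_D[OF phic] tuples_sub L in "auto simp: tuples_Cons")
  ultimately show ?thesis using hcochains_D[OF phic L] by (simp add: minus_eq_zero_iff)
  qed
  ultimately show "is_hcob R G (Suc m) phi" by (auto simp: is_hcob_def)
  qed
 qed
 ultimately show ?thesis by (simp add: cohomology_concentrated_def)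
qed

end

section \<open>Cohomology of virtually infinite cyclic groups\<close>

locale inf_cyclic = group +
 fixes t
 assumes t_in [simp]: "t : carrier G" and t_inf: "t [^] (n::int) = \<one> ==> n = 0"
begin

abbreviation pw :: "int => 'a" where "pw k \<equiv> t [^] k"

lemma pw_in [simp]: "pw k : carrier G" by (rule int_pow_closed) (rule t_in)

lemma pw_add: "pw (i + j) = pw i \<otimes> pw j" by (rule int_pow_mult) (rule t_in)

lemma pw_inj: assumes "x : carrier G" "pw j \<otimes> x = pw k \<otimes> x" shows "j = k"
proof -
 have "pw j = pw k" using assms by simp
 then have "pw (j + - k) = pw k \<otimes> pw (- k)" by (simp only: pw_add)
 also have "... = \<one>" by (simp add: pw_add[symmetric])
 finally show ?thesis using t_inf by fastforce
qed

lemma pw_pw: "x : carrier G ==> pw i \<otimes> (pw j \<otimes> x) = pw (i + j) \<otimes> x"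
 by (simp add: pw_add m_assoc)

text \<open>The choice is made from the whole coset of powers of \<open>t\<close>, so it depends on
  the coset alone (\<open>rep_pw\<close>).\<close>

definition rep where "rep g = (SOME y. y : range (%k. pw k \<otimes> g))"

lemma rep_ex: "EX k. rep g = pw k \<otimes> g"
proof -
 have "rep g : range (%k. pw k \<otimes> g)" unfolding rep_def by (rule someI[of _ "pw 0 \<otimes> g"]) (rule rangeI)
 then show ?thesis by auto
qed

lemma rep_in [simp]: "g : carrier G ==> rep g : carrier G"
 using rep_ex[of g] by auto

lemma rep_pw [simp]: assumes "g : carrier G" shows "rep (pw k \<otimes> g) = rep g"
proof -
 have "range (%j. pw j \<otimes> (pw k \<otimes> g)) = range (%j. pw j \<otimes> g)"
 proof (intro equalityI subsetI)
  fix x assume "x : range (%j. pw j \<otimes> (pw k \<otimes> g))"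
  then show "x : range (%j. pw j \<otimes> g)" using pw_pw[OF assms] by auto
 next
  fix x assume "x : range (%j. pw j \<otimes> g)"
  then obtain j where "x = pw j \<otimes> g" by auto
  then have "x = pw (j - k) \<otimes> (pw k \<otimes> g)" using pw_pw[OF assms, of "j - k" k] by simp
  then show "x : range (%j. pw j \<otimes> (pw k \<otimes> g))" by blast
 qed
 then show ?thesis by (simp add: rep_def)
qed

text \<open>The coordinate of \<open>g\<close> along the line: multiplication by a power of
  \<open>t\<close> translates it (\<open>nu_pw\<close>), which makes \<open>pw (nu g)\<close> an
  equivariant projection to the powers of \<open>t\<close>.\<close>

definition nu :: "'a => int" where "nu g = (THE k. g = pw k \<otimes> rep g)"

lemma nu_eqI: assumes "g : carrier G" "g = pw k \<otimes> rep g" shows "nu g = k"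
 unfolding nu_def
proof (rule the_equality)
 fix j assume "g = pw j \<otimes> rep g"
 then have "pw j \<otimes> rep g = pw k \<otimes> rep g" using assms(2) by simp
 then show "j = k" using pw_inj[of "rep g" j k] assms(1) by simp
qed (rule assms(2))

lemma nu_rep: assumes "g : carrier G" shows "pw (nu g) \<otimes> rep g = g"
proof -
 obtain k where k: "rep g = pw k \<otimes> g" using rep_ex by blast
 then have "pw (- k) \<otimes> rep g = g" using pw_pw[OF assms, of "- k" k] assms by simp
 then show ?thesis using nu_eqI[OF assms, of "- k"] by simp
qed

lemma nu_pw [simp]: assumes "g : carrier G" shows "nu (pw k \<otimes> g) = k + nu g"
proof (rule nu_eqI)
 show "pw k \<otimes> g = pw (k + nu g) \<otimes> rep (pw k \<otimes> g)"
  using nu_rep[OF assms] assms by (simp add: pw_add m_assoc)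
qed (use assms in simp)

end

lemma eventually_int_top: "finite {k::int. \<not> P k} ==> eventually P at_top"
 unfolding eventually_at_top_linorder
 by (rule exI[of _ "Max (insert 0 {k. \<not> P k}) + 1"]) (metis (mono_tags, lifting) Max_ge finite.insertI insertI2 le_imp_less_Suc linorder_not_less mem_Collect_eq zless_add1_eq order.strict_trans1 add_le_cancel_right zle_add1_eq_le)

lemma eventually_int_bot: "finite {k::int. \<not> P k} ==> eventually P at_bot"
 unfolding eventually_at_bot_linorder
 by (rule exI[of _ "Min (insert 0 {k. \<not> P k}) - 1"]) (metis (mono_tags, lifting) Min_le finite.insertI insertI2 mem_Collect_eq zle_diff1_eq linorder_not_less)

lemma int_limits:
 fixes u :: "int => 'b"
 assumes "finite {k. u (k + 1) ~= u k}"
 shows "EX c. eventually (%k. u k = c) at_top" "EX c. eventually (%k. u k = c) at_bot"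
proof -
 have "eventually (%k. u (k + 1) = u k) at_top" by (rule eventually_int_top) (use assms in simp)
 then obtain K where K: "!!k. k >= K ==> u (k + 1) = u k" unfolding eventually_at_top_linorder by blast
 have "u k = u K" if "k >= K" for k using that by (induction k rule: int_ge_induct) (use K in auto)
 then have "eventually (%k. u k = u K) at_top" unfolding eventually_at_top_linorder by blast
 then show "EX c. eventually (%k. u k = c) at_top" ..
 have "eventually (%k. u (k + 1) = u k) at_bot" by (rule eventually_int_bot) (use assms in simp)
 then obtain K where K: "!!k. k <= K ==> u (k + 1) = u k" unfolding eventually_at_bot_linorder by blast
 have "u k = u K" if "k <= K" for k using that
 proof (induction k rule: int_le_induct)
  case (step i)
  then show ?case using K[of "i - 1"] by simp
 qed simp
 then have "eventually (%k. u k = u K) at_bot" unfolding eventually_at_bot_linorder by blast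
 then show "EX c. eventually (%k. u k = c) at_bot" ..
qed

lemma int_const:
 fixes u :: "int => 'b"
 assumes "!!k. u (k + 1) = u k" shows "u j = u k"
proof -
 have "u i = u 0" for i :: int
 proof (induction i rule: int_induct[of _ 0])
  case (step2 i)
  then show ?case using assms[of "i - 1"] by simp
 qed (use assms in simp_all)
 then show ?thesis by metis
qed

context cring
begin

text \<open>Stated for ring variables so that the long differentials in \<open>H_vanish\<close> can
  be substituted as they stand.\<close>

lemma telescope_identities:
 assumes "a : carrier R" "b : carrier R" "c : carrier R" "d : carrier R"
 shows "c = (b \<ominus> a) \<oplus> (a \<ominus> (b \<ominus> c))"
  and "(c \<oplus> (b \<ominus> a)) \<ominus> b = c \<ominus> a"
  and "a \<ominus> b = (a \<ominus> c) \<ominus> (b \<ominus> d) \<oplus> (c \<ominus> d)"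
  and "a \<ominus> a \<oplus> b = b"
  and "a = b \<ominus> (b \<ominus> a)"
 using assms by algebra+

text \<open>In its application the last bracket vanishes by telescoping, and \<open>f\<close>, the
  value of the cocycle, remains.\<close>

lemma line_contraction_identity:
 assumes "f : carrier R" "p : carrier R" "p' : carrier R" "q : carrier R" "q' : carrier R" "Q : carrier R" "Q' : carrier R"
 shows "(q' \<ominus> (p' \<ominus> p)) \<ominus> ((q \<ominus> f) \<ominus> (Q \<ominus> (p \<ominus> (p' \<ominus> Q')))) = f \<oplus> ((q' \<ominus> q) \<ominus> (Q' \<ominus> Q))"
 using assms by algebra

text \<open>The discrete integral from 0 to \<open>v\<close>; the sign for negative \<open>v\<close>
  makes \<open>prim_step\<close> hold on all integers.\<close>

definition prim :: "(int => 'a) => int => 'a"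
 where "prim h v = (if v >= 0 then \<Oplus>e\<in>{0..<v}. h e else \<ominus> (\<Oplus>e\<in>{v..<0}. h e))"

lemma prim_closed: "(!!e. h e : carrier R) ==> prim h v : carrier R"
 by (simp add: prim_def Pi_def)

lemma prim_step:
 assumes h: "!!e. h e : carrier R" shows "prim h (v + 1) = prim h v \<oplus> h v"
proof -
 consider "v >= 0" | "v = -1" | "v < -1" by linarith
 then show ?thesis
 proof cases
  case 1
  have "{0..<v + 1} = insert v {0..<v}" using 1 by auto
  then show ?thesis using 1 h by (simp add: prim_def Pi_def a_comm)
 next
  case 2
  have "{-1..<0::int} = {-1}" by auto
  then show ?thesis using 2 h by (simp add: prim_def l_neg)
 next
  case 3
  have "{v..<0} = insert v {v + 1..<0}" using 3 by auto
  then have "(\<Oplus>e\<in>{v..<0}. h e) = h v \<oplus> (\<Oplus>e\<in>{v+1..<0}. h e)" using h by (simp add: Pi_def)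
  moreover have "(\<Oplus>e\<in>{v+1..<0}. h e) : carrier R" using h by (simp add: Pi_def)
  ultimately show ?thesis using 3 h[of v] by (simp add: prim_def) algebra
 qed
qed

lemma prim_const_le:
 assumes h: "!!e. h e : carrier R" and uv: "u <= v" and z: "!!e. u <= e ==> e < v ==> h e = \<zero>"
 shows "prim h v = prim h u"
 using uv z
proof (induction v rule: int_ge_induct)
 case (step i)
 then show ?case using prim_step[of h i, OF h] prim_closed[of h, OF h] by simp
qed simp

lemma prim_const:
 assumes h: "!!e. h e : carrier R" and z: "!!e. min u v <= e ==> e < max u v ==> h e = \<zero>"
 shows "prim h v = prim h u"
 using prim_const_le[of h u v, OF h] prim_const_le[of h v u, OF h] z by (cases "u <= v") auto

end

section \<open>Vanishing above degree one\<close>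

locale virt_cyclic_group = ring_group R G + inf_cyclic G t
 for R :: "('r, 'x) ring_scheme" and G :: "('g, 'y) monoid_scheme" (structure) and t +
 fixes F
 assumes F_fin: "finite F" and F_sub: "F \<subseteq> carrier G"
  and F_cover: "x : carrier G ==> \<exists>n::int. \<exists>f\<in>F. x = t [^] n \<otimes> f"
begin

lemma inf: "infinite (carrier G)"
proof
 assume "finite (carrier G)"
 then have "finite (range pw)" by (rule rev_finite_subset) auto
 moreover have "inj pw"
 proof (rule injI)
  fix i j :: int assume "pw i = pw j"
  then show "i = j" using pw_inj[of \<one> i j] by simp
 qed
 ultimately show False using finite_imageD[of pw UNIV] by simp
qed

lemma finite_pw:
 assumes "finite {x : carrier G. P x}" shows "finite {k. P (pw k)}"
proof (rule finite_imageD)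
 have "pw ` {k. P (pw k)} \<subseteq> {x : carrier G. P x}" by auto
 then show "finite (pw ` {k. P (pw k)})" using assms by (rule finite_subset)
 show "inj_on pw {k. P (pw k)}"
 proof (rule inj_onI)
  fix i j :: int assume "pw i = pw j"
  then show "i = j" using pw_inj[of \<one> i j] by simp
 qed
qed

text \<open>Finitely many cosets of the powers of \<open>t\<close> cover \<open>G\<close>, so
  supports can be tested along powers of \<open>t\<close> alone.\<close>

lemma finite_pw_conv:
 assumes "!!f. f : F ==> finite {k. P (pw k \<otimes> f)}" shows "finite {x : carrier G. P x}"
proof -
 have "{x : carrier G. P x} \<subseteq> (\<Union>f\<in>F. (%k. pw k \<otimes> f) ` {k. P (pw k \<otimes> f)})"
 proof
  fix x assume x: "x : {x : carrier G. P x}"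
  then obtain n f where nf: "f : F" "x = pw n \<otimes> f" using F_cover by blast
  then have "n : {k. P (pw k \<otimes> f)}" using x by simp
  then show "x : (\<Union>f\<in>F. (%k. pw k \<otimes> f) ` {k. P (pw k \<otimes> f)})" using nf by blast
 qed
 moreover have "finite (\<Union>f\<in>F. (%k. pw k \<otimes> f) ` {k. P (pw k \<otimes> f)})" using F_fin assms by simp
 ultimately show ?thesis by (rule finite_subset)
qed

lemma map_comp_tuple:
 assumes "L : tuples G n" "x : carrier G" "y : carrier G"
 shows "map ((\<otimes>) (x \<otimes> y)) L = map ((\<otimes>) x) (map ((\<otimes>) y) L)"
 using assms by (auto simp: tuples_def m_assoc)

lemma hcochains_pw:
 assumes "phi : hcochains R G n" "L : tuples G (Suc n)"
 shows "finite {k. phi (map ((\<otimes>) (pw k)) L) ~= \<zero>\<^bsub>R\<^esub>}"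
 using finite_pw[OF hcochains_fin[OF assms]] .

lemma hcochains_pwI:
 assumes "!!L. L : tuples G (Suc n) ==> phi L : carrier R"
  "!!L. L : tuples G (Suc n) ==> finite {k. phi (map ((\<otimes>) (pw k)) L) ~= \<zero>\<^bsub>R\<^esub>}"
 shows "phi : hcochains R G n"
proof (rule hcochainsI)
 fix L assume L: "L : tuples G (Suc n)"
 show "finite {x : carrier G. phi (map ((\<otimes>) x) L) ~= \<zero>\<^bsub>R\<^esub>}"
 proof (rule finite_pw_conv)
  fix f assume f: "f : F"
  then have fG: "f : carrier G" using F_sub by auto
  have "finite {k. phi (map ((\<otimes>) (pw k)) (map ((\<otimes>) f) L)) ~= \<zero>\<^bsub>R\<^esub>}"
  by (rule assms(2)) (rule map_tuples[OF L fG])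
  then show "finite {k. phi (map ((\<otimes>) (pw k \<otimes> f)) L) ~= \<zero>\<^bsub>R\<^esub>}"
  by (simp only: map_comp_tuple[OF L pw_in fG])
 qed
qed (rule assms(1))

text \<open>A simplex is coned off at the point \<open>pw (nu x)\<close> of the line below its first
  vertex \<open>x\<close>. Faces with another first vertex have another apex, so a correction
  integrates \<open>phi\<close> over the segment of the line between the apices of the first two
  vertices, joined with the tail of the simplex. This requires two vertices, hence a cocycle of
  degree at least two. The apex moves equivariantly under powers of \<open>t\<close>, which keeps
  supports finite.\<close>

lemma H_vanish:
 assumes phi: "phi : hcocycles R G (Suc (Suc m))" shows "is_hcob R G (Suc (Suc m)) phi"
proof -
 have phic: "phi : hcochains R G (Suc (Suc m))" using phi by (simp add: hcocycles_def)
 have cl: "phi L : carrier R" if "L : tuples G (Suc (Suc (Suc m)))" for L using hcochains_D[OF phic that] .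
 \<comment> \<open>The cocycle on the join of the edge from \<open>e\<close> to \<open>e + 1\<close>
   with \<open>M\<close>. The default zero keeps the integrals inside \<open>R\<close> for every
   argument.\<close>
 define h where "h M e = (if M : tuples G (Suc m) then phi (pw (e + 1) # pw e # M) else \<zero>\<^bsub>R\<^esub>)" for M e
 have hc: "h M e : carrier R" for M e using cl by (simp add: h_def tuples_Cons)
 have pc: "R.prim (h M) v : carrier R" for M v by (rule R.prim_closed) (rule hc)
 have ps: "R.prim (h M) (v + 1) = R.prim (h M) v \<oplus>\<^bsub>R\<^esub> h M v" for M v by (rule R.prim_step) (rule hc)
 define a where "a L = phi (pw (nu (hd L)) # L) \<ominus>\<^bsub>R\<^esub> (R.prim (h (tl L)) (nu (hd L)) \<ominus>\<^bsub>R\<^esub> R.prim (h (tl L)) (nu (hd (tl L))))" for L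
 have a_eq: "a (x # y # K) = phi (pw (nu x) # x # y # K) \<ominus>\<^bsub>R\<^esub> (R.prim (h (y # K)) (nu x) \<ominus>\<^bsub>R\<^esub> R.prim (h (y # K)) (nu y))" for x y K
  by (simp add: a_def)
  text \<open>The vertical differential of the correction telescopes along the line of powers of \<open>t\<close>.\<close>
 have telescope: "hD R N (%M. R.prim (h M) u) \<ominus>\<^bsub>R\<^esub> hD R N (%M. R.prim (h M) v) = phi (pw u # N) \<ominus>\<^bsub>R\<^esub> phi (pw v # N)"
  if N: "N : tuples G (Suc (Suc m))" for N u v
 proof -
  have sub: "M : tuples G (Suc m)" if "set M \<subseteq> set N" "Suc (length M) = length N" for M
  using tuples_sub[OF that N] .
  have Qc: "hD R N (%M. R.prim (h M) w) : carrier R" for w by (rule R.hD_closed) (rule pc)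
  have Hc: "hD R N (%M. h M w) : carrier R" for w by (rule R.hD_closed) (rule hc)
  have Nc: "phi (pw w # N) : carrier R" for w using cl N by (simp add: tuples_Cons)
  have stp: "hD R N (%M. R.prim (h M) (w + 1)) = hD R N (%M. R.prim (h M) w) \<oplus>\<^bsub>R\<^esub> hD R N (%M. h M w)" for w
  unfolding ps by (rule R.hD_add) (rule pc hc)+
  have hh: "hD R N (%M. h M w) = phi (pw (w + 1) # N) \<ominus>\<^bsub>R\<^esub> phi (pw w # N)" for w
  proof -
  have "hD R N (%M. h M w) = hD R N (%M. phi (pw (w + 1) # pw w # M))"
  by (rule R.hD_cong) (use sub in "simp add: h_def")
  moreover have "hD R (pw (w + 1) # pw w # N) phi = \<zero>\<^bsub>R\<^esub>"
  by (rule hcocyclesD[OF phi]) (use N in "simp add: tuples_Cons")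
  ultimately have "phi (pw w # N) \<ominus>\<^bsub>R\<^esub> (phi (pw (w + 1) # N) \<ominus>\<^bsub>R\<^esub> hD R N (%M. h M w)) = \<zero>\<^bsub>R\<^esub>" by simp
  moreover have "hD R N (%M. h M w) = (phi (pw (w + 1) # N) \<ominus>\<^bsub>R\<^esub> phi (pw w # N)) \<oplus>\<^bsub>R\<^esub>
  (phi (pw w # N) \<ominus>\<^bsub>R\<^esub> (phi (pw (w + 1) # N) \<ominus>\<^bsub>R\<^esub> hD R N (%M. h M w)))"
  by (rule R.telescope_identities(1)[OF Nc Nc Hc R.zero_closed])
  ultimately show ?thesis using Nc by simp
  qed
  have "hD R N (%M. R.prim (h M) (w + 1)) \<ominus>\<^bsub>R\<^esub> phi (pw (w + 1) # N) = hD R N (%M. R.prim (h M) w) \<ominus>\<^bsub>R\<^esub> phi (pw w # N)" for w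
  unfolding stp hh by (rule R.telescope_identities(2)[OF Nc Nc Qc R.zero_closed])
  then have eq: "hD R N (%M. R.prim (h M) u) \<ominus>\<^bsub>R\<^esub> phi (pw u # N) = hD R N (%M. R.prim (h M) v) \<ominus>\<^bsub>R\<^esub> phi (pw v # N)"
  by (rule int_const[of "%w. hD R N (%M. R.prim (h M) w) \<ominus>\<^bsub>R\<^esub> phi (pw w # N)"])
  have "hD R N (%M. R.prim (h M) u) \<ominus>\<^bsub>R\<^esub> hD R N (%M. R.prim (h M) v)
  = (hD R N (%M. R.prim (h M) u) \<ominus>\<^bsub>R\<^esub> phi (pw u # N)) \<ominus>\<^bsub>R\<^esub> (hD R N (%M. R.prim (h M) v) \<ominus>\<^bsub>R\<^esub> phi (pw v # N)) \<oplus>\<^bsub>R\<^esub> (phi (pw u # N) \<ominus>\<^bsub>R\<^esub> phi (pw v # N))"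
  by (rule R.telescope_identities(3)[OF Qc Qc Nc Nc])
  also have "... = phi (pw u # N) \<ominus>\<^bsub>R\<^esub> phi (pw v # N)"
  unfolding eq by (rule R.telescope_identities(4)) (use Qc Nc in simp_all)
  finally show ?thesis .
 qed
 have "a : hcochains R G (Suc m)"
 proof (rule hcochains_pwI)
  fix L assume L: "L : tuples G (Suc (Suc m))"
  then obtain x y K where xyK: "L = x # y # K" by (auto simp: tuples_def length_Suc_conv)
  have xG: "x : carrier G" and yG: "y : carrier G" and M: "y # K : tuples G (Suc m)"
  using L xyK by (auto simp: tuples_Cons)
  show "a L : carrier R" using pc cl L xG unfolding xyK a_eq by (simp add: tuples_Cons)
  let ?T = "%k. map ((\<otimes>) (pw k))"
  define A where "A = {k. phi (?T k (pw (nu x) # L)) ~= \<zero>\<^bsub>R\<^esub>}"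
  define B where "B e = {k. phi (?T k (pw (e + 1) # pw e # y # K)) ~= \<zero>\<^bsub>R\<^esub>}" for e
  have finA: "finite A" unfolding A_def by (rule hcochains_pw[OF phic]) (use L in "simp add: tuples_Cons")
  have finB: "finite (B e)" for e unfolding B_def by (rule hcochains_pw[OF phic]) (use M in "simp add: tuples_Cons")
  \<comment> \<open>The edges between the apices of \<open>x\<close> and \<open>y\<close>.
    Translation by \<open>pw k\<close> shifts them by \<open>k\<close>, so only the finitely many
    sets \<open>B e\<close> with \<open>e\<close> in this interval matter.\<close>
  let ?I = "{min (nu x) (nu y)..<max (nu x) (nu y)}"
  have "a (?T k L) = \<zero>\<^bsub>R\<^esub>" if k: "k \<notin> A \<union> (\<Union>e\<in>?I. B e)" for k
  proof -
  have pwT: "pw (nu (pw k \<otimes> x)) = pw k \<otimes> pw (nu x)" using xG by (simp add: pw_add)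
  have "phi (pw (nu (pw k \<otimes> x)) # ?T k L) = \<zero>\<^bsub>R\<^esub>"
  using k unfolding A_def pwT by simp
  moreover have "R.prim (h (?T k (y # K))) (nu (pw k \<otimes> x)) = R.prim (h (?T k (y # K))) (nu (pw k \<otimes> y))"
  proof (rule R.prim_const[OF hc])
  fix e assume e: "min (nu (pw k \<otimes> y)) (nu (pw k \<otimes> x)) <= e" "e < max (nu (pw k \<otimes> y)) (nu (pw k \<otimes> x))"
  then have "e - k : ?I" using xG yG by auto
  then have "k \<notin> B (e - k)" using k by blast
  moreover have "pw k \<otimes> pw (e - k) = pw e" "pw k \<otimes> pw (e - k + 1) = pw (e + 1)"
  by (simp_all add: pw_add[symmetric])
  ultimately have "phi (pw (e + 1) # pw e # ?T k (y # K)) = \<zero>\<^bsub>R\<^esub>" unfolding B_def by simp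
  then show "h (?T k (y # K)) e = \<zero>\<^bsub>R\<^esub>" by (simp add: h_def)
  qed
  ultimately show ?thesis using pc unfolding xyK by (simp add: a_eq R.minus_eq R.r_neg)
  qed
  then have "{k. a (?T k L) ~= \<zero>\<^bsub>R\<^esub>} \<subseteq> A \<union> (\<Union>e\<in>?I. B e)" by blast
  moreover have "finite (A \<union> (\<Union>e\<in>?I. B e))" using finA finB by simp
  ultimately show "finite {k. a (?T k L) ~= \<zero>\<^bsub>R\<^esub>}" by (rule finite_subset)
 qed
 moreover have "phi L = hD R L a" if L: "L : tuples G (Suc (Suc (Suc m)))" for L
 proof -
  obtain x y z K where xyz: "L = x # y # z # K" using L by (auto simp: tuples_def length_Suc_conv)
  have G: "x : carrier G" "y : carrier G" "z : carrier G" and K: "K : tuples G m"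
  using L xyz by (auto simp: tuples_Cons)
  let ?N = "y # z # K"
  have N: "?N : tuples G (Suc (Suc m))" using G K by (simp add: tuples_Cons)
  have sub: "M : tuples G (Suc m)" if "set M \<subseteq> set ?N" "Suc (length M) = length ?N" for M
  using tuples_sub[OF that N] .
  have Qc: "hD R ?N (%M. R.prim (h M) w) : carrier R" for w by (rule R.hD_closed) (rule pc)
  have Nc: "phi (pw w # ?N) : carrier R" for w using cl N by (simp add: tuples_Cons)
  have T1c: "hD R ?N (%N'. phi (pw (nu x) # x # N')) : carrier R"
  by (rule R.hD_closed) (use cl sub G in "simp add: tuples_Cons")
  have T3c: "hD R ?N (%N'. R.prim (h N') (nu (hd N'))) : carrier R" by (rule R.hD_closed) (rule pc)
  have T1: "hD R ?N (%N'. phi (pw (nu x) # x # N')) = phi (pw (nu x) # ?N) \<ominus>\<^bsub>R\<^esub> phi L"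
  proof -
  have "hD R (pw (nu x) # L) phi = \<zero>\<^bsub>R\<^esub>" by (rule hcocyclesD[OF phi]) (use L in "simp add: tuples_Cons")
  then have "phi L \<ominus>\<^bsub>R\<^esub> (phi (pw (nu x) # ?N) \<ominus>\<^bsub>R\<^esub> hD R ?N (%N'. phi (pw (nu x) # x # N'))) = \<zero>\<^bsub>R\<^esub>"
  unfolding xyz by (simp only: hD.simps)
  then have "phi L = phi (pw (nu x) # ?N) \<ominus>\<^bsub>R\<^esub> hD R ?N (%N'. phi (pw (nu x) # x # N'))"
  using cl[OF L] Nc T1c by (subst (asm) minus_eq_zero_iff) simp_all
  moreover have "hD R ?N (%N'. phi (pw (nu x) # x # N')) = phi (pw (nu x) # ?N) \<ominus>\<^bsub>R\<^esub> (phi (pw (nu x) # ?N) \<ominus>\<^bsub>R\<^esub> hD R ?N (%N'. phi (pw (nu x) # x # N')))"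
  by (rule R.telescope_identities(5)[OF T1c Nc R.zero_closed R.zero_closed])
  ultimately show ?thesis by simp
  qed
  have exp: "hD R ?N (%N'. R.prim (h N') v) = R.prim (h (z # K)) v \<ominus>\<^bsub>R\<^esub> hD R (z # K) (%M. R.prim (h (y # M)) v)" for v
  by (simp only: hD.simps)
  have T3: "hD R ?N (%N'. R.prim (h N') (nu (hd N'))) = R.prim (h (z # K)) (nu z) \<ominus>\<^bsub>R\<^esub> (R.prim (h (z # K)) (nu y) \<ominus>\<^bsub>R\<^esub> hD R ?N (%N'. R.prim (h N') (nu y)))"
  proof -
  have c1: "hD R (z # K) (%M. R.prim (h (y # M)) (nu y)) : carrier R" by (rule R.hD_closed) (rule pc)
  have "R.prim (h (z # K)) (nu y) \<ominus>\<^bsub>R\<^esub> (R.prim (h (z # K)) (nu y) \<ominus>\<^bsub>R\<^esub> hD R (z # K) (%M. R.prim (h (y # M)) (nu y))) = hD R (z # K) (%M. R.prim (h (y # M)) (nu y))"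
  by (rule R.telescope_identities(5)[OF c1 pc R.zero_closed R.zero_closed, symmetric])
  then show ?thesis unfolding exp by (simp only: hD.simps list.sel)
  qed
  have "hD R ?N (%N'. a (x # N')) = hD R ?N (%N'. phi (pw (nu x) # x # N') \<ominus>\<^bsub>R\<^esub> (R.prim (h N') (nu x) \<ominus>\<^bsub>R\<^esub> R.prim (h N') (nu (hd N'))))"
  by (simp only: a_def list.sel)
  also have "... = hD R ?N (%N'. phi (pw (nu x) # x # N')) \<ominus>\<^bsub>R\<^esub> hD R ?N (%N'. R.prim (h N') (nu x) \<ominus>\<^bsub>R\<^esub> R.prim (h N') (nu (hd N')))"
  by (rule R.hD_minus) (use cl sub G pc in "auto simp: tuples_Cons")
  also have "hD R ?N (%N'. R.prim (h N') (nu x) \<ominus>\<^bsub>R\<^esub> R.prim (h N') (nu (hd N'))) = hD R ?N (%N'. R.prim (h N') (nu x)) \<ominus>\<^bsub>R\<^esub> hD R ?N (%N'. R.prim (h N') (nu (hd N')))"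
  by (rule R.hD_minus) (rule pc)+
  finally have e1: "hD R L a = a ?N \<ominus>\<^bsub>R\<^esub> (hD R ?N (%N'. phi (pw (nu x) # x # N')) \<ominus>\<^bsub>R\<^esub> (hD R ?N (%N'. R.prim (h N') (nu x)) \<ominus>\<^bsub>R\<^esub> hD R ?N (%N'. R.prim (h N') (nu (hd N')))))"
  unfolding xyz by (simp only: hD.simps(2)[of R x])
  define Q where "Q w = hD R ?N (%M. R.prim (h M) w)" for w
  define p where "p w = R.prim (h (z # K)) w" for w
  define q where "q w = phi (pw w # ?N)" for w
  have cQ: "Q w : carrier R" "p w : carrier R" "q w : carrier R" for w using Qc pc Nc by (simp_all add: Q_def p_def q_def)
  have tel: "Q (nu y) \<ominus>\<^bsub>R\<^esub> Q (nu x) = q (nu y) \<ominus>\<^bsub>R\<^esub> q (nu x)" unfolding Q_def q_def by (rule telescope[OF N])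
  have "hD R L a = (q (nu y) \<ominus>\<^bsub>R\<^esub> (p (nu y) \<ominus>\<^bsub>R\<^esub> p (nu z))) \<ominus>\<^bsub>R\<^esub> ((q (nu x) \<ominus>\<^bsub>R\<^esub> phi L) \<ominus>\<^bsub>R\<^esub> (Q (nu x) \<ominus>\<^bsub>R\<^esub> (p (nu z) \<ominus>\<^bsub>R\<^esub> (p (nu y) \<ominus>\<^bsub>R\<^esub> Q (nu y)))))"
  unfolding e1 T1 T3 a_eq Q_def p_def q_def ..
  also have "... = phi L \<oplus>\<^bsub>R\<^esub> ((q (nu y) \<ominus>\<^bsub>R\<^esub> q (nu x)) \<ominus>\<^bsub>R\<^esub> (Q (nu y) \<ominus>\<^bsub>R\<^esub> Q (nu x)))"
  by (rule R.line_contraction_identity[OF cl[OF L]]) (rule cQ)+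
  also have "... = phi L" unfolding tel using cQ cl[OF L] by (simp add: R.minus_eq R.r_neg)
  finally show ?thesis by simp
 qed
 ultimately show ?thesis by (auto simp: is_hcob_def)
qed

end

section \<open>First cohomology through the two ends of the line\<close>

context virt_cyclic_group
begin

text \<open>A cocycle integrated from the identity along the line has a limit at each end; the
  difference of the two limits will detect its class.\<close>

definition lim_along :: "int filter => ('g list => 'r) => 'r"
 where "lim_along A phi = (THE c. eventually (%k. phi [\<one>, pw k] = c) A)"

lemma lim_along_eqI:
 assumes "A ~= bot" "eventually (%k. phi [\<one>, pw k] = c) A" shows "lim_along A phi = c"
 unfolding lim_along_def
proof (rule the_equality)
 fix d assume "eventually (%k. phi [\<one>, pw k] = d) A"
 with assms(2) have "eventually (%k. d = c) A" by eventually_elim simp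
 then show "d = c" using assms(1) by simp
qed (rule assms(2))

abbreviation ends :: "int filter set" where "ends \<equiv> {at_top, at_bot}"

lemma ends_nontrivial: "A : ends ==> A ~= bot"
 by (elim insertE emptyE) simp_all

lemma hcocycle_closed: "[|phi : hcocycles R G 1; a : carrier G; b : carrier G|] ==> phi [a, b] : carrier R"
 using hcochains_D[of phi 1 "[a, b]"] by (simp add: hcocycles_def tuples_2)

lemma hcocycle_fin:
 assumes "phi : hcocycles R G 1" "a : carrier G" "b : carrier G"
 shows "finite {k. phi [pw k \<otimes> a, pw k \<otimes> b] ~= \<zero>\<^bsub>R\<^esub>}"
 using hcochains_pw[of phi 1 "[a, b]"] assms by (simp add: hcocycles_def tuples_2)

text \<open>The integral jumps from \<open>k\<close> to \<open>k + 1\<close> by the value of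
  \<open>phi\<close> on that edge, and the edges form one orbit of the powers of \<open>t\<close>,
  on which the support is finite.\<close>

lemma lim_along:
 assumes phi: "phi : hcocycles R G 1" and A: "A : ends"
 shows "eventually (%k. phi [\<one>, pw k] = lim_along A phi) A" "lim_along A phi : carrier R"
proof -
 have "phi [\<one>, pw (k + 1)] = phi [\<one>, pw k]" if "phi [pw k \<otimes> \<one>, pw k \<otimes> pw 1] = \<zero>\<^bsub>R\<^esub>" for k
 proof -
  have "phi [\<one>, pw (k + 1)] = phi [\<one>, pw k] \<oplus>\<^bsub>R\<^esub> phi [pw k, pw (k + 1)]"
  by (rule hcocycle_1[OF phi]) simp_all
  moreover have "phi [pw k, pw (k + 1)] = \<zero>\<^bsub>R\<^esub>" using that by (simp only: pw_add pw_in r_one)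
  ultimately show ?thesis using hcocycle_closed[OF phi] by simp
 qed
 then have sub: "{k. phi [\<one>, pw (k + 1)] ~= phi [\<one>, pw k]} \<subseteq> {k. phi [pw k \<otimes> \<one>, pw k \<otimes> pw 1] ~= \<zero>\<^bsub>R\<^esub>}" by blast
 have fin: "finite {k. phi [\<one>, pw (k + 1)] ~= phi [\<one>, pw k]}"
  by (rule finite_subset[OF sub hcocycle_fin[OF phi]]) simp_all
 have "EX c. eventually (%k. phi [\<one>, pw k] = c) A" using int_limits[OF fin] A by auto
 then obtain c where c: "eventually (%k. phi [\<one>, pw k] = c) A" ..
 then show ev: "eventually (%k. phi [\<one>, pw k] = lim_along A phi) A"
  using lim_along_eqI[OF ends_nontrivial[OF A] c] by simp
 obtain k where "phi [\<one>, pw k] = lim_along A phi"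
  using eventually_happens[OF ev] ends_nontrivial[OF A] by auto
 then show "lim_along A phi : carrier R" using hcocycle_closed[OF phi, of \<one> "pw k"] by simp
qed

lemma lim_along_add:
 assumes "phi : hcocycles R G 1" "psi : hcocycles R G 1" "A : ends"
 shows "lim_along A (%L. phi L \<oplus>\<^bsub>R\<^esub> psi L) = lim_along A phi \<oplus>\<^bsub>R\<^esub> lim_along A psi"
 by (rule lim_along_eqI[OF ends_nontrivial[OF assms(3)]])
  (use lim_along(1)[OF assms(1,3)] lim_along(1)[OF assms(2,3)] in "eventually_elim, simp")

lemma lim_along_smult:
 assumes "phi : hcocycles R G 1" "A : ends"
 shows "lim_along A (%L. r \<otimes>\<^bsub>R\<^esub> phi L) = r \<otimes>\<^bsub>R\<^esub> lim_along A phi"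
 by (rule lim_along_eqI[OF ends_nontrivial[OF assms(2)]])
  (use lim_along(1)[OF assms(1,2)] in "eventually_elim, simp")

text \<open>A potential is determined up to a constant by integration from the identity. It can be
  given finite support exactly when one constant removes the limits at both ends.\<close>

lemma hcob_iff_lim:
 assumes phi: "phi : hcocycles R G 1"
 shows "is_hcob R G 1 phi \<longleftrightarrow> lim_along at_top phi = lim_along at_bot phi"
proof
 assume "is_hcob R G 1 phi"
 then obtain psi where psi: "psi : hcochains R G 0" "!!L. L : tuples G (Suc (Suc 0)) ==> phi L = hD R L psi"
  by (auto simp: is_hcob_def)
 have psic: "psi [a] : carrier R" if "a : carrier G" for a using hcochains_D[OF psi(1)] that by (simp add: tuples_1)
 have "finite {k. psi (map ((\<otimes>) (pw k)) [\<one>]) ~= \<zero>\<^bsub>R\<^esub>}" by (rule hcochains_pw[OF psi(1)]) (simp add: tuples_1)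
 then have fin: "finite {k. \<not> psi [pw k] = \<zero>\<^bsub>R\<^esub>}" by simp
 have lim: "lim_along A phi = \<zero>\<^bsub>R\<^esub> \<ominus>\<^bsub>R\<^esub> psi [\<one>]" if A: "A : ends" for A
 proof (rule lim_along_eqI[OF ends_nontrivial[OF A]])
  have "eventually (%k. psi [pw k] = \<zero>\<^bsub>R\<^esub>) A"
  using eventually_int_top[OF fin] eventually_int_bot[OF fin] A by auto
  then show "eventually (%k. phi [\<one>, pw k] = \<zero>\<^bsub>R\<^esub> \<ominus>\<^bsub>R\<^esub> psi [\<one>]) A"
  proof eventually_elim
  case (elim k)
  have "phi [\<one>, pw k] = psi [pw k] \<ominus>\<^bsub>R\<^esub> psi [\<one>]"
  using psi(2)[of "[\<one>, pw k]"] psic by (simp add: tuples_2 r_minus_zero)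
  then show ?case using elim by simp
  qed
 qed
 show "lim_along at_top phi = lim_along at_bot phi" using lim[of at_top] lim[of at_bot] by simp
next
 assume eq: "lim_along at_top phi = lim_along at_bot phi"
 define c where "c = lim_along at_top phi"
 have cR: "c : carrier R" unfolding c_def by (rule lim_along(2)[OF phi]) simp
 have "eventually (%k. phi [\<one>, pw k] = c) at_top" "eventually (%k. phi [\<one>, pw k] = c) at_bot"
  using lim_along(1)[OF phi, of at_top] lim_along(1)[OF phi, of at_bot] eq by (simp_all add: c_def)
 then obtain K1 K2 where K: "!!k. k >= K1 ==> phi [\<one>, pw k] = c" "!!k. k <= K2 ==> phi [\<one>, pw k] = c"
  unfolding eventually_at_top_linorder eventually_at_bot_linorder by blast
 have subK: "{k. phi [\<one>, pw k] ~= c} \<subseteq> {K2..K1}"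
 proof
  fix k assume "k : {k. phi [\<one>, pw k] ~= c}"
  then have "\<not> k >= K1" "\<not> k <= K2" using K by auto
  then show "k : {K2..K1}" by simp
 qed
 have finc: "finite {k. phi [\<one>, pw k] ~= c}" by (rule finite_subset[OF subK]) simp
 let ?psi = "%L. phi [\<one>, hd L] \<ominus>\<^bsub>R\<^esub> c"
 have "?psi : hcochains R G 0"
 proof (rule hcochains_pwI)
  fix L assume "L : tuples G (Suc 0)"
  then obtain a where a: "a : carrier G" "L = [a]" by (auto simp: tuples_1)
  show "?psi L : carrier R" using hcocycle_closed[OF phi] a cR by simp
  have "?psi (map ((\<otimes>) (pw k)) L) = \<zero>\<^bsub>R\<^esub>" if k: "phi [\<one>, pw k] = c" "phi [pw k \<otimes> \<one>, pw k \<otimes> a] = \<zero>\<^bsub>R\<^esub>" for k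
  proof -
  have "phi [\<one>, pw k \<otimes> a] = phi [\<one>, pw k] \<oplus>\<^bsub>R\<^esub> phi [pw k, pw k \<otimes> a]"
  by (rule hcocycle_1[OF phi]) (use a in simp_all)
  then show ?thesis using k a cR by (simp add: R.minus_eq R.r_neg)
  qed
  then have sub: "{k. ?psi (map ((\<otimes>) (pw k)) L) ~= \<zero>\<^bsub>R\<^esub>} \<subseteq> {k. phi [\<one>, pw k] ~= c} \<union> {k. phi [pw k \<otimes> \<one>, pw k \<otimes> a] ~= \<zero>\<^bsub>R\<^esub>}"
  by blast
  show "finite {k. ?psi (map ((\<otimes>) (pw k)) L) ~= \<zero>\<^bsub>R\<^esub>}"
  by (rule finite_subset[OF sub]) (use finc hcocycle_fin[OF phi one_closed a(1)] in simp)
 qed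
 moreover have "phi L = hD R L ?psi" if "L : tuples G (Suc (Suc 0))" for L
 proof -
  obtain a b where ab: "a : carrier G" "b : carrier G" "L = [a, b]" using \<open>L : _\<close> by (auto simp: tuples_2)
  define u v w where "u = phi [\<one>, a]" and "v = phi [\<one>, b]" and "w = phi [a, b]"
  have cl: "u : carrier R" "w : carrier R" using hcocycle_closed[OF phi] ab by (simp_all add: u_def w_def)
  have "v = u \<oplus>\<^bsub>R\<^esub> w" unfolding u_def v_def w_def by (rule hcocycle_1[OF phi one_closed ab(1,2)])
  moreover have "w = (u \<oplus>\<^bsub>R\<^esub> w) \<ominus>\<^bsub>R\<^esub> c \<ominus>\<^bsub>R\<^esub> (u \<ominus>\<^bsub>R\<^esub> c \<ominus>\<^bsub>R\<^esub> \<zero>\<^bsub>R\<^esub>)" using cl cR by algebra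
  ultimately show ?thesis using ab(3) by (simp add: u_def v_def w_def)
 qed
 ultimately show "is_hcob R G 1 phi" by (auto simp: is_hcob_def)
qed

text \<open>The witness is the difference cochain of \<open>r\<close> times the indicator of a half
  line. The indicator has infinite support, but along the translates of a given edge both ends lie
  on the same side, with finitely many exceptions.\<close>

lemma lim_surj:
 assumes r: "r : carrier R"
 shows "\<exists>phi\<in>hcocycles R G 1. lim_along at_top phi \<ominus>\<^bsub>R\<^esub> lim_along at_bot phi = r"
proof -
 define \<theta> where "\<theta> a = (if nu a >= 0 then r else \<zero>\<^bsub>R\<^esub>)" for a
 have \<theta>c: "\<theta> a : carrier R" for a using r by (simp add: \<theta>_def)
 define phi where "phi L = \<theta> (L ! 1) \<ominus>\<^bsub>R\<^esub> \<theta> (L ! 0)" for L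
 have "phi : hcochains R G 1"
 proof (rule hcochains_pwI)
  fix L assume "L : tuples G (Suc 1)"
  then obtain a b where ab: "a : carrier G" "b : carrier G" "L = [a, b]" by (auto simp: tuples_2)
  show "phi L : carrier R" using \<theta>c by (simp add: phi_def)
  have "phi (map ((\<otimes>) (pw k)) L) = \<zero>\<^bsub>R\<^esub>" if "k \<notin> {- \<bar>nu a\<bar> - \<bar>nu b\<bar>..\<bar>nu a\<bar> + \<bar>nu b\<bar>}" for k
  proof -
  have "k + nu a >= 0 \<longleftrightarrow> k + nu b >= 0" using that by auto
  then have "\<theta> (pw k \<otimes> a) = \<theta> (pw k \<otimes> b)" using ab by (simp add: \<theta>_def)
  then show ?thesis using ab \<theta>c by (simp add: phi_def R.minus_eq R.r_neg)
  qed
  then have sub: "{k. phi (map ((\<otimes>) (pw k)) L) ~= \<zero>\<^bsub>R\<^esub>} \<subseteq> {- \<bar>nu a\<bar> - \<bar>nu b\<bar>..\<bar>nu a\<bar> + \<bar>nu b\<bar>}" by blast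
  show "finite {k. phi (map ((\<otimes>) (pw k)) L) ~= \<zero>\<^bsub>R\<^esub>}" by (rule finite_subset[OF sub]) simp
 qed
 moreover have "hD R L phi = \<zero>\<^bsub>R\<^esub>" if "L : tuples G (Suc (Suc 1))" for L
 proof -
  obtain a b c where abc: "L = [a, b, c]" using \<open>L : _\<close> by (auto simp: tuples_3)
  define u v w where "u = \<theta> a" and "v = \<theta> b" and "w = \<theta> c"
  have cl: "u : carrier R" "v : carrier R" "w : carrier R" using \<theta>c by (simp_all add: u_def v_def w_def)
  have "w \<ominus>\<^bsub>R\<^esub> v \<ominus>\<^bsub>R\<^esub> (w \<ominus>\<^bsub>R\<^esub> u \<ominus>\<^bsub>R\<^esub> (v \<ominus>\<^bsub>R\<^esub> u \<ominus>\<^bsub>R\<^esub> \<zero>\<^bsub>R\<^esub>)) = \<zero>\<^bsub>R\<^esub>" using cl by algebra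
  then show ?thesis using abc by (simp add: phi_def u_def v_def w_def)
 qed
 ultimately have phi: "phi : hcocycles R G 1" by (simp add: hcocycles_def)
 have nu1: "nu (pw k) = k + nu \<one>" for k using nu_pw[OF one_closed, of k] by simp
 have val: "phi [\<one>, pw k] = (if k + nu \<one> >= 0 then r else \<zero>\<^bsub>R\<^esub>) \<ominus>\<^bsub>R\<^esub> \<theta> \<one>" for k
  by (simp add: phi_def \<theta>_def nu1)
 have "lim_along at_top phi = r \<ominus>\<^bsub>R\<^esub> \<theta> \<one>"
 proof (rule lim_along_eqI)
  show "eventually (%k. phi [\<one>, pw k] = r \<ominus>\<^bsub>R\<^esub> \<theta> \<one>) at_top"
  unfolding eventually_at_top_linorder by (rule exI[of _ "- nu \<one>"]) (simp add: val)
 qed simp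
 moreover have "lim_along at_bot phi = \<zero>\<^bsub>R\<^esub> \<ominus>\<^bsub>R\<^esub> \<theta> \<one>"
 proof (rule lim_along_eqI)
  show "eventually (%k. phi [\<one>, pw k] = \<zero>\<^bsub>R\<^esub> \<ominus>\<^bsub>R\<^esub> \<theta> \<one>) at_bot"
  unfolding eventually_at_bot_linorder by (rule exI[of _ "- nu \<one> - 1"]) (simp add: val)
 qed simp
 moreover have "(r \<ominus>\<^bsub>R\<^esub> \<theta> \<one>) \<ominus>\<^bsub>R\<^esub> (\<zero>\<^bsub>R\<^esub> \<ominus>\<^bsub>R\<^esub> \<theta> \<one>) = r"
  using r \<theta>c[of \<one>] by (simp add: R.minus_eq R.a_assoc R.l_neg)
 ultimately have "lim_along at_top phi \<ominus>\<^bsub>R\<^esub> lim_along at_bot phi = r" by simp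
 then show ?thesis using phi by (rule bexI)
qed

theorem concentrated: "cohomology_concentrated R G 1"
proof -
 have "mod_isomorphic R (cohomology_group_ring R G 1) (regular_mod R)"
  unfolding cohomology_iso_iff
 proof (intro exI[of _ "%phi. lim_along at_top phi \<ominus>\<^bsub>R\<^esub> lim_along at_bot phi"] conjI ballI allI impI)
  fix phi assume phi: "phi : hcocycles R G 1"
  note cl = lim_along(2)[OF phi, of at_top] lim_along(2)[OF phi, of at_bot]
  show "lim_along at_top phi \<ominus>\<^bsub>R\<^esub> lim_along at_bot phi : carrier R" using cl by simp
  show "(lim_along at_top phi \<ominus>\<^bsub>R\<^esub> lim_along at_bot phi = \<zero>\<^bsub>R\<^esub>) \<longleftrightarrow> is_hcob R G 1 phi"
  using cl hcob_iff_lim[OF phi] by (simp add: minus_eq_zero_iff)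
  show "lim_along at_top (%L. r \<otimes>\<^bsub>R\<^esub> phi L) \<ominus>\<^bsub>R\<^esub> lim_along at_bot (%L. r \<otimes>\<^bsub>R\<^esub> phi L) = r \<otimes>\<^bsub>R\<^esub> (lim_along at_top phi \<ominus>\<^bsub>R\<^esub> lim_along at_bot phi)"
  if r: "r : carrier R" for r
  using cl r lim_along_smult[OF phi] by (simp add: R.minus_eq R.r_distr R.r_minus)
  fix psi assume psi: "psi : hcocycles R G 1"
  note cl' = lim_along(2)[OF psi, of at_top] lim_along(2)[OF psi, of at_bot]
  show "lim_along at_top (%L. phi L \<oplus>\<^bsub>R\<^esub> psi L) \<ominus>\<^bsub>R\<^esub> lim_along at_bot (%L. phi L \<oplus>\<^bsub>R\<^esub> psi L) =
  lim_along at_top phi \<ominus>\<^bsub>R\<^esub> lim_along at_bot phi \<oplus>\<^bsub>R\<^esub> (lim_along at_top psi \<ominus>\<^bsub>R\<^esub> lim_along at_bot psi)"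
  using cl cl' lim_along_add[OF phi psi] by (simp add: R.minus_eq R.minus_add R.a_ac)
 next
  fix phi psi :: "'g list => 'r" assume eq: "\<forall>L\<in>tuples G (Suc 1). phi L = psi L"
  have "phi [\<one>, pw k] = psi [\<one>, pw k]" for k using eq by (simp add: tuples_2)
  then have "lim_along A phi = lim_along A psi" for A by (simp add: lim_along_def)
  then show "lim_along at_top phi \<ominus>\<^bsub>R\<^esub> lim_along at_bot phi = lim_along at_top psi \<ominus>\<^bsub>R\<^esub> lim_along at_bot psi" by simp
 qed (rule lim_surj)
 moreover have "zero_mod (cohomology_group_ring R G i)" if i: "i ~= 1" for i
 proof (cases i)
  case 0 then show ?thesis using H0_infinite[OF inf] by simp
 next
  case (Suc j)
  then obtain m where "i = Suc (Suc m)" using i by (cases j) auto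
  then show ?thesis using H_vanish cohomology_zero_iff by simp
 qed
 ultimately show ?thesis by (simp add: cohomology_concentrated_def)
qed

end

lemma (in ring_group) virt_cyclic_concentrated:
 assumes "virt_cyclic G" shows "cohomology_concentrated R G 1"
proof -
 obtain t F where tF: "t : carrier G" "finite F" "F \<subseteq> carrier G" "\<forall>n::int. t [^] n = \<one> --> n = 0"
  "\<forall>x\<in>carrier G. \<exists>n::int. \<exists>f\<in>F. x = t [^] n \<otimes> f" using assms unfolding virt_cyclic_def by (elim bexE exE conjE)
 interpret virt_cyclic_group R G t F
  by unfold_locales (use tF in simp_all)
 show ?thesis by (rule concentrated)
qed

section \<open>Finite index subgroups and Weyl groups\<close>

lemma virt_cyclicD:
 assumes "virt_cyclic G"
 obtains t F where "t : carrier G" "finite F" "F \<subseteq> carrier G" "\<forall>n::int. t [^]\<^bsub>G\<^esub> n = \<one>\<^bsub>G\<^esub> --> n = 0"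
  "\<forall>x\<in>carrier G. \<exists>n::int. \<exists>f\<in>F. x = t [^]\<^bsub>G\<^esub> n \<otimes>\<^bsub>G\<^esub> f"
 using assms unfolding virt_cyclic_def by (elim bexE exE conjE)

lemma virt_cyclicI:
 assumes "t : carrier G" "finite F" "F \<subseteq> carrier G" "!!n::int. t [^]\<^bsub>G\<^esub> n = \<one>\<^bsub>G\<^esub> ==> n = 0"
  "!!x. x : carrier G ==> \<exists>n::int. \<exists>f\<in>F. x = t [^]\<^bsub>G\<^esub> n \<otimes>\<^bsub>G\<^esub> f"
 shows "virt_cyclic G"
 unfolding virt_cyclic_def
 by (rule bexI[OF _ assms(1)], rule exI[of _ F]) (use assms in simp)

context group
begin

lemma infinite_order:
 assumes x: "x : carrier G" and inf: "infinite (range (\<lambda>n::int. x [^] n))" and n: "x [^] (n::int) = \<one>"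
 shows "n = 0"
proof (rule ccontr)
 assume n0: "n ~= 0"
 have "x [^] (k::int) : (%j. x [^] j) ` {- \<bar>n\<bar>..\<bar>n\<bar>}" for k
 proof -
  have "x [^] k = x [^] (n * (k div n) + k mod n)" by simp
  also have "... = (x [^] n) [^] (k div n) \<otimes> x [^] (k mod n)"
  using x by (simp only: int_pow_mult int_pow_pow)
  also have "... = x [^] (k mod n)" using n x by simp
  finally have "x [^] k = x [^] (k mod n)" .
  moreover have "\<bar>k mod n\<bar> <= \<bar>n\<bar>" using n0 abs_mod_less less_imp_le by blast
  ultimately show ?thesis by (intro image_eqI[of _ _ "k mod n"]) auto
 qed
 then have "range (\<lambda>k::int. x [^] k) \<subseteq> (%j. x [^] j) ` {- \<bar>n\<bar>..\<bar>n\<bar>}" by blast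
 then show False using inf finite_subset by blast
qed

lemma inj_pow:
 assumes "x : carrier G" "!!n::int. x [^] n = \<one> ==> n = 0" shows "inj (\<lambda>n::int. x [^] n)"
proof (rule injI)
 fix m n :: int assume "x [^] m = x [^] n"
 then have "x [^] (m - n) = \<one>" using assms(1) by (simp add: int_pow_diff)
 then show "m = n" using assms(2) by fastforce
qed

lemma cyclic_subgroup: assumes "t : carrier G" shows "subgroup (range (\<lambda>n::int. t [^] n)) G"
proof
 fix x y assume "x : range (\<lambda>n::int. t [^] n)" "y : range (\<lambda>n::int. t [^] n)"
 then obtain i j :: int where "x = t [^] i" "y = t [^] j" by auto
 then have "x \<otimes> y = t [^] (i + j)" using assms by (simp add: int_pow_mult)
 then show "x \<otimes> y : range (\<lambda>n::int. t [^] n)" by simp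
next
 fix x assume "x : range (\<lambda>n::int. t [^] n)"
 then obtain i :: int where "x = t [^] i" by auto
 then have "inv x = t [^] (- i)" using assms by (simp add: int_pow_neg)
 then show "inv x : range (\<lambda>n::int. t [^] n)" by simp
next
 have "\<one> = t [^] (0::int)" by simp
 then show "\<one> : range (\<lambda>n::int. t [^] n)" by (rule range_eqI)
qed (use assms in auto)

lemma finite_rcosets_reps:
 assumes H: "subgroup H G" and fin: "finite (rcosets H)"
 obtains T where "finite T" "T \<subseteq> carrier G" "!!x. x : carrier G ==> \<exists>h\<in>H. \<exists>f\<in>T. x = h \<otimes> f"
proof -
 have HG: "H \<subseteq> carrier G" using H by (rule subgroup.subset)
 define T where "T = (%X. SOME x. x : carrier G & X = H #> x) ` (rcosets H)"
 have ex: "(SOME y. y : carrier G & X = H #> y) : carrier G & X = H #> (SOME y. y : carrier G & X = H #> y)"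
  if "X : rcosets H" for X
  by (rule someI_ex) (use that in "auto simp: RCOSETS_def")
 show ?thesis
 proof (rule that[of T])
  show "finite T" using fin by (simp add: T_def)
  show "T \<subseteq> carrier G" using ex by (auto simp: T_def)
  fix x assume x: "x : carrier G"
  define f where "f = (SOME y. y : carrier G & H #> x = H #> y)"
  have X: "H #> x : rcosets H" using x by (auto simp: RCOSETS_def)
  have f: "f : carrier G" "H #> x = H #> f" "f : T" using ex[OF X] X unfolding f_def T_def by auto
  have "x : H #> f" using rcos_self[OF x H] f(2) by simp
  then show "\<exists>h\<in>H. \<exists>f\<in>T. x = h \<otimes> f" using f(3) by (auto simp: r_coset_def)
 qed
qed

lemma virt_cyclic_finite_index:
 assumes H: "subgroup H G" and fin: "finite (rcosets H)" and vc: "virt_cyclic (G\<lparr>carrier := H\<rparr>)"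
 shows "virt_cyclic G"
proof -
 have HG: "H \<subseteq> carrier G" using H by (rule subgroup.subset)
 obtain T where T: "finite T" "T \<subseteq> carrier G" "!!x. x : carrier G ==> \<exists>h\<in>H. \<exists>f\<in>T. x = h \<otimes> f"
  using finite_rcosets_reps[OF H fin] by metis
 obtain t F where "t : carrier (G\<lparr>carrier := H\<rparr>)" "finite F" "F \<subseteq> carrier (G\<lparr>carrier := H\<rparr>)"
  "\<forall>n::int. t [^]\<^bsub>G\<lparr>carrier := H\<rparr>\<^esub> n = \<one>\<^bsub>G\<lparr>carrier := H\<rparr>\<^esub> --> n = 0"
  "\<forall>x\<in>carrier (G\<lparr>carrier := H\<rparr>). \<exists>n::int. \<exists>f\<in>F. x = t [^]\<^bsub>G\<lparr>carrier := H\<rparr>\<^esub> n \<otimes>\<^bsub>G\<lparr>carrier := H\<rparr>\<^esub> f"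
  using vc by (rule virt_cyclicD)
 then have tF: "t : H" "finite F" "F \<subseteq> H" "\<forall>n::int. t [^]\<^bsub>G\<lparr>carrier := H\<rparr>\<^esub> n = \<one> --> n = 0"
  "\<forall>x\<in>H. \<exists>n::int. \<exists>f\<in>F. x = t [^]\<^bsub>G\<lparr>carrier := H\<rparr>\<^esub> n \<otimes> f" by simp_all
 have pw: "t [^]\<^bsub>G\<lparr>carrier := H\<rparr>\<^esub> (n::int) = t [^] n" for n using int_pow_consistent[OF H tF(1)] by simp
 have tG: "t : carrier G" using tF HG by auto
 show ?thesis
 proof (rule virt_cyclicI[OF tG])
  let ?F = "(\<lambda>(a, b). a \<otimes> b) ` (F \<times> T)"
  show "finite ?F" using tF T by simp
  have "F \<subseteq> carrier G" using tF(3) HG by (rule subset_trans)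
  then show "?F \<subseteq> carrier G" using T(2) by (auto intro!: m_closed)
  show "n = 0" if "t [^] (n::int) = \<one>" for n using tF(4) that pw by simp
  fix x assume "x : carrier G"
  then obtain h f where hf: "h : H" "f : T" "x = h \<otimes> f" using T(3) by blast
  then obtain n :: int and g where g: "g : F" "h = t [^] n \<otimes> g" using tF(5) pw by metis
  have "g : carrier G" "f : carrier G" using g hf tF T HG by auto
  then have "x = t [^] n \<otimes> (g \<otimes> f)" using g hf tG by (simp add: m_assoc)
  then show "\<exists>n::int. \<exists>f\<in>?F. x = t [^] n \<otimes> f" using g(1) hf(2) by force
 qed
qed

lemma virtually_infinite_cyclic_iff: "virtually infinite_cyclic G \<longleftrightarrow> virt_cyclic G"
proof
 assume "virtually infinite_cyclic G"
 then obtain H where H: "subgroup H G" "finite (rcosets H)" "infinite_cyclic (G\<lparr>carrier := H\<rparr>)"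
  unfolding virtually_def by blast
 interpret HG: group "G\<lparr>carrier := H\<rparr>" by (rule subgroup_imp_group[OF H(1)])
 obtain x where x: "x : H" "H = range (\<lambda>n::int. x [^]\<^bsub>G\<lparr>carrier := H\<rparr>\<^esub> n)" "infinite H"
  using H(3) HG.cyclic_group by (auto simp: infinite_cyclic_def)
 have "virt_cyclic (G\<lparr>carrier := H\<rparr>)"
 proof (rule virt_cyclicI[of x _ "{\<one>}"])
  have "infinite (range (\<lambda>n::int. x [^]\<^bsub>G\<lparr>carrier := H\<rparr>\<^esub> n))" using x(2,3) by simp
  then show "n = 0" if "x [^]\<^bsub>G\<lparr>carrier := H\<rparr>\<^esub> (n::int) = \<one>\<^bsub>G\<lparr>carrier := H\<rparr>\<^esub>" for n
  using HG.infinite_order[of x n] x(1) that by simp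
  fix y assume y: "y : carrier (G\<lparr>carrier := H\<rparr>)"
  then have "y : range (\<lambda>n::int. x [^]\<^bsub>G\<lparr>carrier := H\<rparr>\<^esub> n)" using x(2) by simp
  then obtain n :: int where "y = x [^]\<^bsub>G\<lparr>carrier := H\<rparr>\<^esub> n" by blast
  moreover have "y \<otimes> \<one> = y" using y subgroup.subset[OF H(1)] by auto
  ultimately show "\<exists>n::int. \<exists>f\<in>{\<one>}. y = x [^]\<^bsub>G\<lparr>carrier := H\<rparr>\<^esub> n \<otimes>\<^bsub>G\<lparr>carrier := H\<rparr>\<^esub> f"
  by (intro exI[of _ n]) simp
 qed (use x H(1) subgroup.one_closed in auto)
 then show "virt_cyclic G" by (rule virt_cyclic_finite_index[OF H(1,2)])
next
 assume "virt_cyclic G"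
 then obtain t F where tF: "t : carrier G" "finite F" "F \<subseteq> carrier G" "\<forall>n::int. t [^] n = \<one> --> n = 0"
  "\<forall>x\<in>carrier G. \<exists>n::int. \<exists>f\<in>F. x = t [^] n \<otimes> f" by (rule virt_cyclicD)
 let ?H = "range (\<lambda>n::int. t [^] n)"
 have H: "subgroup ?H G" by (rule cyclic_subgroup[OF tF(1)])
 interpret HG: group "G\<lparr>carrier := ?H\<rparr>" by (rule subgroup_imp_group[OF H])
 have "t [^] (1::int) : ?H" by (rule rangeI)
 then have tH: "t : ?H" using tF(1) by simp
 have "infinite ?H" using inj_pow[OF tF(1)] tF(4) finite_imageD[of "\<lambda>n::int. t [^] n" UNIV] by auto
 moreover have "?H = range (\<lambda>n::int. t [^]\<^bsub>G\<lparr>carrier := ?H\<rparr>\<^esub> n)"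
  by (rule image_cong[OF refl]) (rule int_pow_consistent[OF H tH])
 moreover have "t : carrier (G\<lparr>carrier := ?H\<rparr>)" using tH by simp
 moreover have "carrier (G\<lparr>carrier := ?H\<rparr>) = ?H" by simp
 ultimately have "cyclic_group (G\<lparr>carrier := ?H\<rparr>)"
  by (intro iffD2[OF HG.cyclic_group] bexI[of _ t]) (auto simp only:)
 then have "infinite_cyclic (G\<lparr>carrier := ?H\<rparr>)" using \<open>infinite ?H\<close> by (simp add: infinite_cyclic_def)
 moreover have "finite (rcosets ?H)"
 proof -
  have "rcosets ?H \<subseteq> (%f. ?H #> f) ` F"
  proof
  fix X assume "X : rcosets ?H"
  then obtain x where x: "x : carrier G" "X = ?H #> x" by (auto simp: RCOSETS_def)
  then obtain n :: int and f where f: "f : F" "x = t [^] n \<otimes> f" using tF(5) by blast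
  then have "x : ?H #> f" by (auto simp: r_coset_def)
  then have "?H #> f = ?H #> x" using repr_independence[OF _ _ H, of x f] f(1) tF(3) by auto
  then show "X : (%f. ?H #> f) ` F" using x f by blast
  qed
  then show ?thesis using tF(2) finite_surj by blast
 qed
 ultimately show "virtually infinite_cyclic G" unfolding virtually_def using H by blast
qed

lemma infinite_finite_index:
 assumes "infinite (carrier G)" "subgroup H G" "finite (rcosets H)" shows "infinite H"
proof
 assume fH: "finite H"
 obtain T where T: "finite T" "!!x. x : carrier G ==> \<exists>h\<in>H. \<exists>f\<in>T. x = h \<otimes> f"
  using finite_rcosets_reps[OF assms(2,3)] by metis
 have "carrier G \<subseteq> (\<lambda>(h, f). h \<otimes> f) ` (H \<times> T)"
 proof
  fix x assume "x : carrier G"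
  then obtain h f where "h : H" "f : T" "x = h \<otimes> f" using T(2) by blast
  then show "x : (\<lambda>(h, f). h \<otimes> f) ` (H \<times> T)" by force
 qed
 then show False using assms(1) fH T(1) finite_subset by (metis finite_SigmaI finite_imageI)
qed

text \<open>Infinitely many elements of \<open>N\<close> share one representative in
  \<open>F\<close>. The quotient of two of them is a nontrivial power of \<open>t\<close> inside
  \<open>N\<close>.\<close>

lemma virt_cyclic_subgroup:
 assumes vc: "virt_cyclic G" and N: "subgroup N G" "infinite N"
 shows "virt_cyclic (G\<lparr>carrier := N\<rparr>)"
proof -
 have NG: "N \<subseteq> carrier G" using N(1) by (rule subgroup.subset)
 obtain t F where tF: "t : carrier G" "finite F" "F \<subseteq> carrier G" "\<forall>n::int. t [^] n = \<one> --> n = 0"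
  "\<forall>x\<in>carrier G. \<exists>n::int. \<exists>f\<in>F. x = t [^] n \<otimes> f" using vc by (rule virt_cyclicD)
 have "\<exists>m::int. m > 0 & t [^] m : N"
 proof -
  define X where "X f = {x : N. \<exists>n::int. x = t [^] n \<otimes> f}" for f
  have "N \<subseteq> (\<Union>f\<in>F. X f)" using tF(5) NG unfolding X_def by blast
  then have "\<exists>f\<in>F. infinite (X f)" using N(2) tF(2) by (meson finite_UN_I finite_subset)
  then obtain f where f: "f : F" "infinite (X f)" by blast
  have fG: "f : carrier G" using f tF by auto
  obtain x where x: "x : X f" using f(2) by fastforce
  have "X f - {x} ~= {}" using f(2) by (metis finite.emptyI finite_insert infinite_remove)
  then obtain y where y: "y : X f - {x}" by blast
  have xyN: "x : N" "y : N" using x y by (auto simp: X_def)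
  obtain i :: int where i: "x = t [^] i \<otimes> f" using x unfolding X_def by blast
  obtain j :: int where j: "y = t [^] j \<otimes> f" using y unfolding X_def by blast
  note ij = i j
  have "x \<otimes> inv y = t [^] i \<otimes> f \<otimes> (inv f \<otimes> inv (t [^] j))" using ij tF(1) fG by (simp add: inv_mult_group)
  also have "... = t [^] i \<otimes> inv (t [^] j)" using tF(1) fG by (simp add: m_assoc) (simp add: m_assoc[symmetric])
  also have "... = t [^] (i - j)" using tF(1) by (simp add: int_pow_diff)
  finally have 1: "t [^] (i - j) : N" using xyN N(1) by (metis subgroup.m_closed subgroup.m_inv_closed)
  then have "inv (t [^] (i - j)) : N" using N(1) by (simp add: subgroup.m_inv_closed)
  then have 2: "t [^] (j - i) : N" using tF(1) int_pow_neg[of t "i - j"] by simp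
  have "i ~= j" using ij y by auto
  then show ?thesis using 1 2 by (cases "i < j") (auto intro: exI[of _ "i - j"] exI[of _ "j - i"])
 qed
 then obtain m :: int where m: "m > 0" "t [^] m : N" by blast
 let ?s = "t [^] m"
 have pw: "?s [^]\<^bsub>G\<lparr>carrier := N\<rparr>\<^esub> (n::int) = t [^] (m * n)" for n
  using int_pow_consistent[OF N(1) m(2)] int_pow_pow[OF tF(1)] by simp
 have pwN: "t [^] (m * n) : N" for n :: int
 proof -
  interpret NGr: group "G\<lparr>carrier := N\<rparr>" by (rule subgroup_imp_group[OF N(1)])
  show ?thesis using NGr.int_pow_closed[of ?s n] m(2) pw by simp
 qed
 \<comment> \<open>Replacing \<open>t\<close> by its power \<open>?s\<close> leaves the remainders
   of the exponents modulo \<open>m\<close>; \<open>N\<close> contains the remainder term because it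
   contains the powers of \<open>?s\<close>.\<close>
 let ?F = "N \<inter> (\<lambda>(i, f). t [^] (i::int) \<otimes> f) ` ({0..m} \<times> F)"
 show ?thesis
 proof (rule virt_cyclicI[of ?s _ ?F])
  show "finite ?F" using tF(2) by simp
  show "n = 0" if "?s [^]\<^bsub>G\<lparr>carrier := N\<rparr>\<^esub> (n::int) = \<one>\<^bsub>G\<lparr>carrier := N\<rparr>\<^esub>" for n
  using that tF(4) m(1) pw by auto
  fix x assume "x : carrier (G\<lparr>carrier := N\<rparr>)"
  then have xN: "x : N" and xG: "x : carrier G" using NG by auto
  obtain n :: int and f where f: "f : F" "x = t [^] n \<otimes> f" using tF(5) xG by blast
  have fG: "f : carrier G" using f tF by auto
  let ?y = "t [^] (n mod m) \<otimes> f"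
  have "x = t [^] (m * (n div m) + n mod m) \<otimes> f" using f by simp
  also have "... = t [^] (m * (n div m)) \<otimes> ?y" using tF(1) fG by (simp only: int_pow_mult) (simp add: m_assoc)
  finally have xy: "x = t [^] (m * (n div m)) \<otimes> ?y" .
  have "?y = inv (t [^] (m * (n div m))) \<otimes> (t [^] (m * (n div m)) \<otimes> ?y)"
  using tF(1) fG by (simp add: m_assoc[symmetric])
  then have "?y = inv (t [^] (m * (n div m))) \<otimes> x" unfolding xy[symmetric] .
  then have "?y : N" using pwN xN N(1) by (simp add: subgroup.m_closed subgroup.m_inv_closed)
  moreover have "n mod m : {0..m}" using m(1) by (simp add: less_imp_le)
  ultimately have "?y : ?F" using f(1) by force
  then show "\<exists>n::int. \<exists>f\<in>?F. x = ?s [^]\<^bsub>G\<lparr>carrier := N\<rparr>\<^esub> n \<otimes>\<^bsub>G\<lparr>carrier := N\<rparr>\<^esub> f"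
  using xy pw by (intro exI[of _ "n div m"] bexI[of _ ?y]) simp_all
 qed (use m in auto)
qed

end

text \<open>If a nonzero power of \<open>p t\<close> were trivial, infinitely many powers of
  \<open>t\<close> would lie in the finite kernel.\<close>

lemma virt_cyclic_image:
 assumes hom: "group_hom G W p" and surj: "p ` carrier G = carrier W" and ker: "finite (kernel G W p)" and vc: "virt_cyclic G"
 shows "virt_cyclic W"
proof -
 interpret group_hom G W p by fact
 obtain t F where tF: "t : carrier G" "finite F" "F \<subseteq> carrier G" "\<forall>n::int. t [^]\<^bsub>G\<^esub> n = \<one>\<^bsub>G\<^esub> --> n = 0"
  "\<forall>x\<in>carrier G. \<exists>n::int. \<exists>f\<in>F. x = t [^]\<^bsub>G\<^esub> n \<otimes>\<^bsub>G\<^esub> f" using vc by (rule virt_cyclicD)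
 show ?thesis
 proof (rule virt_cyclicI[of "p t" _ "p ` F"])
  show "n = 0" if n: "p t [^]\<^bsub>W\<^esub> (n::int) = \<one>\<^bsub>W\<^esub>" for n
  proof (rule ccontr)
  assume n0: "n ~= 0"
  have "p (t [^]\<^bsub>G\<^esub> (n * k)) = \<one>\<^bsub>W\<^esub>" for k :: int
  using n tF(1) by (simp add: hom_int_pow H.int_pow_pow[symmetric])
  then have "(\<lambda>k::int. t [^]\<^bsub>G\<^esub> (n * k)) ` UNIV \<subseteq> kernel G W p"
  using tF(1) by (auto simp: kernel_def)
  then have "finite (range (\<lambda>k::int. t [^]\<^bsub>G\<^esub> (n * k)))" using ker finite_subset by blast
  moreover have "inj (\<lambda>k::int. t [^]\<^bsub>G\<^esub> (n * k))"
  by (rule injI) (use injD[OF G.inj_pow[OF tF(1)]] tF(4) n0 in fastforce)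
  ultimately show False using finite_imageD infinite_UNIV_int by blast
  qed
  fix y assume "y : carrier W"
  then obtain x where x: "x : carrier G" "y = p x" using surj by blast
  then obtain n :: int and f where f: "f : F" "x = t [^]\<^bsub>G\<^esub> n \<otimes>\<^bsub>G\<^esub> f" using tF(5) by blast
  then have "y = p t [^]\<^bsub>W\<^esub> n \<otimes>\<^bsub>W\<^esub> p f" using x tF by (simp add: hom_int_pow subset_iff)
  then show "\<exists>n::int. \<exists>f\<in>p ` F. y = p t [^]\<^bsub>W\<^esub> n \<otimes>\<^bsub>W\<^esub> f" using f(1) by blast
 qed (use tF in auto)
qed

section \<open>Weyl groups of finite subgroups\<close>

context group
begin

lemma group_weyl_group: "subgroup H G ==> group (weyl_group G H)"
 unfolding weyl_group_def by (rule normal.factorgroup_is_group) (rule subgroup_in_normalizer)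

text \<open>The normalizer is finite, or it is an infinite subgroup and thus virtually cyclic;
  passing to the quotient by the finite group \<open>H\<close> preserves either property.\<close>

lemma weyl_group_cases:
 assumes vc: "virt_cyclic G" and H: "subgroup H G" "finite H"
 shows "virt_cyclic (weyl_group G H) \<or> finite (carrier (weyl_group G H))"
proof -
 let ?N = "normalizer G H"
 have N: "subgroup ?N G" using H(1) normalizer_imp_subgroup subgroup.subset by blast
 interpret nor: normal H "G\<lparr>carrier := ?N\<rparr>" by (rule subgroup_in_normalizer[OF H(1)])
 let ?p = "%x. H #>\<^bsub>G\<lparr>carrier := ?N\<rparr>\<^esub> x"
 have surj: "?p ` carrier (G\<lparr>carrier := ?N\<rparr>) = carrier (weyl_group G H)"
  unfolding weyl_group_def carrier_FactGroup ..
 show ?thesis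
 proof (cases "finite ?N")
  case True
  then show ?thesis using surj by (metis finite_imageI partial_object.select_convs(1) partial_object.update_convs(1) simps(1) partial_object.surjective)
 next
  case False
  have "group_hom (G\<lparr>carrier := ?N\<rparr>) (weyl_group G H) ?p"
  unfolding group_hom_def group_hom_axioms_def weyl_group_def
  by (intro conjI) (rule nor.is_group nor.factorgroup_is_group nor.r_coset_hom_Mod)+
  moreover have "kernel (G\<lparr>carrier := ?N\<rparr>) (weyl_group G H) ?p \<subseteq> H"
  proof
  fix x assume "x : kernel (G\<lparr>carrier := ?N\<rparr>) (weyl_group G H) ?p"
  then have x: "x : carrier (G\<lparr>carrier := ?N\<rparr>)" "?p x = H" by (auto simp: kernel_def weyl_group_def)
  then show "x : H" using nor.rcos_self[OF x(1) nor.subgroup_axioms] by simp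
  qed
  ultimately have "virt_cyclic (weyl_group G H)"
  using virt_cyclic_image[OF _ surj] virt_cyclic_subgroup[OF vc N False] H(2) finite_subset by blast
  then show ?thesis ..
 qed
qed

text \<open>The duality condition at the trivial subgroup speaks about this group of singletons, and
  this isomorphism brings it back to \<open>G\<close>.\<close>

lemma weyl_group_trivial: "(%x. {x}) : iso G (weyl_group G {\<one>})"
proof -
 have N: "normalizer G {\<one>} = carrier G"
  by (auto simp: normalizer_def stabilizer_def l_coset_def r_coset_def)
 have "weyl_group G {\<one>} = G Mod {\<one>}" unfolding weyl_group_def N by simp
 moreover have "carrier (G Mod {\<one>}) = (%x. {x}) ` carrier G"
  unfolding carrier_FactGroup by (rule image_cong) (auto simp: r_coset_def)
 ultimately show ?thesis by (auto simp: iso_def hom_def bij_betw_def set_mult_def)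
qed

end

section \<open>Free modules over a category\<close>

text \<open>Formal sums supported in \<open>S\<close> are generated by single elements of
  \<open>S\<close> under differences; the additivity hypotheses are confined to that support because
  actions are controlled only on hom sets.\<close>

lemma frag_additive_eq:
 fixes N (structure) and c :: "'k \<Rightarrow>\<^sub>0 int"
 assumes N: "abelian_group N" and c: "Poly_Mapping.keys c \<subseteq> S"
  and u: "!!c c'. [|Poly_Mapping.keys c \<subseteq> S; Poly_Mapping.keys c' \<subseteq> S|] ==> u (c + c') = u c \<oplus> u c'"
  "!!c. Poly_Mapping.keys c \<subseteq> S ==> u c : carrier N"
  and v: "!!c c'. [|Poly_Mapping.keys c \<subseteq> S; Poly_Mapping.keys c' \<subseteq> S|] ==> v (c + c') = v c \<oplus> v c'"
  "!!c. Poly_Mapping.keys c \<subseteq> S ==> v c : carrier N"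
  and eq: "!!f. f : S ==> u (frag_of f) = v (frag_of f)"
 shows "u c = v c"
proof -
 interpret abelian_group N by fact
 have z0: "w 0 = \<zero>" if w: "!!c c'. [|Poly_Mapping.keys c \<subseteq> S; Poly_Mapping.keys c' \<subseteq> S|] ==> w (c + c') = w c \<oplus> w c'"
  "!!c. Poly_Mapping.keys c \<subseteq> S ==> w c : carrier N" for w :: "('k \<Rightarrow>\<^sub>0 int) => _"
  using w(1)[of 0 0] w(2)[of 0] by simp
 have "Poly_Mapping.keys c \<subseteq> S & u c = v c" using c
 proof (induction rule: frag_induction)
  case zero then show ?case using z0[OF u] z0[OF v] by simp
 next
  case (one x) then show ?case using eq by simp
 next
  case (diff a b)
  have k: "Poly_Mapping.keys (a - b) \<subseteq> S" using diff keys_diff[of a b] by blast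
  have "u a = u (a - b) \<oplus> u b" "v a = v (a - b) \<oplus> v b" using u(1)[OF k, of b] v(1)[OF k, of b] diff by auto
  then have "u (a - b) \<oplus> u b = v (a - b) \<oplus> u b" using diff by simp
  then show ?case using k u(2)[OF k] v(2)[OF k] u(2)[of b] diff by simp
 qed
 then show ?thesis by simp
qed

lemma lookup_sum_additive:
 "(\<Sum>f\<in>Poly_Mapping.keys (c + c'). Poly_Mapping.lookup (c + c') f) =
  (\<Sum>f\<in>Poly_Mapping.keys c. Poly_Mapping.lookup c f) + (\<Sum>f\<in>Poly_Mapping.keys c'. Poly_Mapping.lookup (c' :: 'a \<Rightarrow>\<^sub>0 int) f)"
proof -
 let ?A = "Poly_Mapping.keys c \<union> Poly_Mapping.keys c'"
 have "(\<Sum>f\<in>Poly_Mapping.keys d. Poly_Mapping.lookup d f) = (\<Sum>f\<in>?A. Poly_Mapping.lookup d f)"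
  if "Poly_Mapping.keys d \<subseteq> ?A" for d :: "'a \<Rightarrow>\<^sub>0 int"
  by (rule sum.mono_neutral_left) (use that in "auto simp: in_keys_iff")
 then have "(\<Sum>f\<in>Poly_Mapping.keys (c + c'). Poly_Mapping.lookup (c + c') f) = (\<Sum>f\<in>?A. Poly_Mapping.lookup (c + c') f)"
  "(\<Sum>f\<in>Poly_Mapping.keys c. Poly_Mapping.lookup c f) = (\<Sum>f\<in>?A. Poly_Mapping.lookup c f)"
  "(\<Sum>f\<in>Poly_Mapping.keys c'. Poly_Mapping.lookup c' f) = (\<Sum>f\<in>?A. Poly_Mapping.lookup c' f)"
  using Poly_Mapping.keys_add[of c c'] by blast+
 then show ?thesis by (simp add: lookup_add sum.distrib)
qed

definition single :: "('r, 'x) ring_scheme => 'k => 'k => 'r"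
 where "single R k = (%l. if l = k then \<one>\<^bsub>R\<^esub> else \<zero>\<^bsub>R\<^esub>)"

text \<open>The bilinear extension of a right action \<open>pre\<close> on basis elements to formal
  sums, in the shape of which \<open>Act\<close> of \<open>rep_module\<close> is an instance
  (\<open>rep_module_eq\<close>).\<close>

definition gen_act ::
  "('r, 'x) ring_scheme => ('b => 'k => 'c) => ('k \<Rightarrow>\<^sub>0 int) => ('b => 'r) => 'c => 'r"
 where "gen_act R pre c a l = (\<Oplus>\<^bsub>R\<^esub>p\<in>{p. a (fst p) ~= \<zero>\<^bsub>R\<^esub> & snd p : Poly_Mapping.keys c & pre (fst p) (snd p) = l}.
  [Poly_Mapping.lookup c (snd p)] \<cdot>\<^bsub>R\<^esub> a (fst p))"

context cring
begin

lemma finsum_superset: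
 assumes "finite B" "A \<subseteq> B" "!!i. i : B - A ==> h i = \<zero>" "!!i. i : B ==> h i : carrier R"
 shows "(\<Oplus>i\<in>A. h i) = (\<Oplus>i\<in>B. h i)"
 by (rule add.finprod_mono_neutral_cong_left) (use assms in auto)

lemma free_modD:
 assumes "a : carrier (free_mod R X)"
 shows "a k : carrier R" "finite {k. a k ~= \<zero>}" "{k. a k ~= \<zero>} \<subseteq> X" "k \<notin> X ==> a k = \<zero>"
 using assms by (auto simp: free_mod_def)

lemma free_modI:
 assumes "!!k. a k : carrier R" "finite A" "A \<subseteq> X" "!!k. k \<notin> A ==> a k = \<zero>"
 shows "a : carrier (free_mod R X)"
proof -
 have sub: "{k. a k ~= \<zero>} \<subseteq> A" using assms(4) by auto
 then have "finite {k. a k ~= \<zero>}" using assms(2) by (rule finite_subset)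
 then show ?thesis using assms(1) subset_trans[OF sub assms(3)] by (simp add: free_mod_def)
qed

lemma free_mod_add: "(a \<oplus>\<^bsub>free_mod R X\<^esub> b) k = a k \<oplus> b k" by (simp add: free_mod_def)
lemma free_mod_smult: "(r \<odot>\<^bsub>free_mod R X\<^esub> b) k = r \<otimes> b k" by (simp add: free_mod_def)
lemma free_mod_zero: "\<zero>\<^bsub>free_mod R X\<^esub> k = \<zero>" by (simp add: free_mod_def)

lemma single_in: "k : X ==> single R k : carrier (free_mod R X)"
 by (rule free_modI[of _ "{k}"]) (auto simp: single_def)

lemma free_mod_induct [consumes 1, case_names zero step]:
 assumes "a : carrier (free_mod R X)"
  and zero: "P \<zero>\<^bsub>free_mod R X\<^esub>"
  and step: "!!a r k. [|a : carrier (free_mod R X); P a; r : carrier R; k : X|]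
  ==> P (a \<oplus>\<^bsub>free_mod R X\<^esub> r \<odot>\<^bsub>free_mod R X\<^esub> single R k)"
 shows "P a"
proof -
 have "finite A ==> A \<subseteq> X ==> (!!k. a k : carrier R) ==> (!!k. k \<notin> A ==> a k = \<zero>) ==> P a" for A a
 proof (induction A arbitrary: a rule: finite_induct)
  case empty
  then have "a = \<zero>\<^bsub>free_mod R X\<^esub>" by (auto simp: free_mod_def)
  then show ?case using zero by simp
 next
  case (insert k A)
  let ?b = "%l. if l = k then \<zero> else a l"
  have b: "?b : carrier (free_mod R X)" by (rule free_modI[of _ A]) (use insert in auto)
  have "P ?b" by (rule insert.IH) (use insert in auto)
  then have "P (?b \<oplus>\<^bsub>free_mod R X\<^esub> a k \<odot>\<^bsub>free_mod R X\<^esub> single R k)" using b insert by (intro step) auto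
  moreover have "?b \<oplus>\<^bsub>free_mod R X\<^esub> a k \<odot>\<^bsub>free_mod R X\<^esub> single R k = a"
  by (rule ext) (use insert in "auto simp: free_mod_def single_def")
  ultimately show ?case by simp
 qed
 then show ?thesis using free_modD[OF assms(1)] by blast
qed

lemma linear_mapsD:
 assumes "h : linear_maps R M N"
 shows "x : carrier M ==> h x : carrier N"
  and "[|x : carrier M; y : carrier M|] ==> h (x \<oplus>\<^bsub>M\<^esub> y) = h x \<oplus>\<^bsub>N\<^esub> h y"
  and "[|r : carrier R; x : carrier M|] ==> h (r \<odot>\<^bsub>M\<^esub> x) = r \<odot>\<^bsub>N\<^esub> h x"
 using assms by (auto simp: linear_maps_def)

lemma linear_mapsI:
 assumes "!!x. x : carrier M ==> h x : carrier N"
  and "!!x y. [|x : carrier M; y : carrier M|] ==> h (x \<oplus>\<^bsub>M\<^esub> y) = h x \<oplus>\<^bsub>N\<^esub> h y"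
  and "!!r x. [|r : carrier R; x : carrier M|] ==> h (r \<odot>\<^bsub>M\<^esub> x) = r \<odot>\<^bsub>N\<^esub> h x"
 shows "h : linear_maps R M N"
 using assms by (auto simp: linear_maps_def)

lemma linear_maps_comp:
 assumes "h : linear_maps R M N" "k : linear_maps R N P" shows "(%x. k (h x)) : linear_maps R M P"
 using assms by (auto simp: linear_maps_def Pi_iff)

lemma linear_maps_zero:
 assumes "Module.module R M" "Module.module R N" "h : linear_maps R M N" shows "h \<zero>\<^bsub>M\<^esub> = \<zero>\<^bsub>N\<^esub>"
proof -
 interpret M: Module.module R M by fact
 interpret N: Module.module R N by fact
 have "h (\<zero> \<odot>\<^bsub>M\<^esub> \<zero>\<^bsub>M\<^esub>) = \<zero> \<odot>\<^bsub>N\<^esub> h \<zero>\<^bsub>M\<^esub>" by (rule linear_mapsD(3)[OF assms(3)]) auto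
 then show ?thesis using linear_mapsD(1)[OF assms(3), of "\<zero>\<^bsub>M\<^esub>"] by simp
qed

lemma linear_maps_minus:
 assumes "Module.module R M" "Module.module R N" "h : linear_maps R M N" "x : carrier M" "y : carrier M"
 shows "h (x \<ominus>\<^bsub>M\<^esub> y) = h x \<ominus>\<^bsub>N\<^esub> h y"
proof -
 interpret M: Module.module R M by fact
 interpret N: Module.module R N by fact
 have "\<ominus>\<^bsub>M\<^esub> y = (\<ominus> \<one>) \<odot>\<^bsub>M\<^esub> y" using assms(5) by (simp add: M.smult_l_minus)
 then have "h (\<ominus>\<^bsub>M\<^esub> y) = (\<ominus> \<one>) \<odot>\<^bsub>N\<^esub> h y" using linear_mapsD(3)[OF assms(3), of "\<ominus> \<one>" y] assms(5) by simp
 also have "... = \<ominus>\<^bsub>N\<^esub> h y" using linear_mapsD(1)[OF assms(3,5)] by (simp add: N.smult_l_minus)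
 finally show ?thesis using linear_mapsD(2)[OF assms(3,4), of "\<ominus>\<^bsub>M\<^esub> y"] assms(5) by (simp add: M.minus_eq N.minus_eq)
qed

lemma linear_maps_free_eq:
 assumes M: "Module.module R M"
  and h: "h : linear_maps R (free_mod R X) M" "k : linear_maps R (free_mod R X) M"
  and eq: "!!x. x : X ==> h (single R x) = k (single R x)"
  and a: "a : carrier (free_mod R X)"
 shows "h a = k a"
 using a
proof (induction rule: free_mod_induct)
 case zero
 then show ?case using linear_maps_zero[OF module_free_mod M h(1)] linear_maps_zero[OF module_free_mod M h(2)] by simp
next
 case (step a r x)
 interpret F: Module.module R "free_mod R X" by (rule module_free_mod)
 have s: "single R x : carrier (free_mod R X)" using step by (simp add: single_in)
 show ?case using step s eq linear_mapsD[OF h(1)] linear_mapsD[OF h(2)] by simp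
qed

text \<open>Linear extension of a map on basis elements; summing over the support of
  \<open>a\<close> avoids naming the basis.\<close>

definition lext :: "('k => 'l => 'a) => ('k => 'a) => 'l => 'a"
 where "lext phi a = (%l. \<Oplus>k\<in>{k. a k ~= \<zero>}. a k \<otimes> phi k l)"

lemma lext_superset:
 assumes "a : carrier (free_mod R X)" "finite A" "{k. a k ~= \<zero>} \<subseteq> A" "!!k. k : A ==> phi k l : carrier R"
 shows "lext phi a l = (\<Oplus>k\<in>A. a k \<otimes> phi k l)"
 unfolding lext_def by (rule finsum_superset) (use assms free_modD(1)[OF assms(1)] in auto)

lemma lext_linear:
 assumes phi: "!!k. k : X ==> phi k : carrier (free_mod R Y)"
 shows "lext phi : linear_maps R (free_mod R X) (free_mod R Y)"
proof (rule linear_mapsI)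
 have phic: "phi k l : carrier R" if "k : X" for k l using free_modD(1)[OF phi[OF that]] .
 fix a assume a: "a : carrier (free_mod R X)"
 note aD = free_modD[OF a]
 have kX: "k : X" if "a k ~= \<zero>" for k using aD(3) that by auto
 show "lext phi a : carrier (free_mod R Y)"
 proof (rule free_modI)
  show "lext phi a l : carrier R" for l unfolding lext_def using aD(1) phic kX by (intro finsum_closed) auto
  show "finite (\<Union>k\<in>{k. a k ~= \<zero>}. {l. phi k l ~= \<zero>})" using aD(2) free_modD(2)[OF phi] kX by simp
  show "(\<Union>k\<in>{k. a k ~= \<zero>}. {l. phi k l ~= \<zero>}) \<subseteq> Y" using free_modD(3)[OF phi] kX by blast
  fix l assume "l \<notin> (\<Union>k\<in>{k. a k ~= \<zero>}. {l. phi k l ~= \<zero>})"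
  then have "phi k l = \<zero>" if "a k ~= \<zero>" for k using that by blast
  then show "lext phi a l = \<zero>" unfolding lext_def by (intro add.finprod_one_eqI) (auto simp: aD(1))
 qed
 fix b assume b: "b : carrier (free_mod R X)"
 note bD = free_modD[OF b]
 interpret F: Module.module R "free_mod R X" by (rule module_free_mod)
 show "lext phi (a \<oplus>\<^bsub>free_mod R X\<^esub> b) = lext phi a \<oplus>\<^bsub>free_mod R Y\<^esub> lext phi b"
 proof
  fix l
  let ?A = "{k. a k ~= \<zero>} \<union> {k. b k ~= \<zero>}"
  have ab: "a \<oplus>\<^bsub>free_mod R X\<^esub> b : carrier (free_mod R X)" using a b by simp
  have fA: "finite ?A" using aD(2) bD(2) by simp
  have cA: "phi k l : carrier R" if "k : ?A" for k using phic aD(3) bD(3) that by blast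
  have "lext phi (a \<oplus>\<^bsub>free_mod R X\<^esub> b) l = (\<Oplus>k\<in>?A. (a \<oplus>\<^bsub>free_mod R X\<^esub> b) k \<otimes> phi k l)"
  by (rule lext_superset[OF ab fA]) (use cA in "auto simp: free_mod_add")
  also have "... = (\<Oplus>k\<in>?A. a k \<otimes> phi k l \<oplus> b k \<otimes> phi k l)"
  by (rule finsum_cong') (use cA aD(1) bD(1) in "auto simp: free_mod_add l_distr")
  also have "... = (\<Oplus>k\<in>?A. a k \<otimes> phi k l) \<oplus> (\<Oplus>k\<in>?A. b k \<otimes> phi k l)"
  by (rule finsum_addf) (use cA aD(1) bD(1) in auto)
  also have "(\<Oplus>k\<in>?A. a k \<otimes> phi k l) = lext phi a l"
  by (rule lext_superset[OF a fA, symmetric]) (use cA in auto)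
  also have "(\<Oplus>k\<in>?A. b k \<otimes> phi k l) = lext phi b l"
  by (rule lext_superset[OF b fA, symmetric]) (use cA in auto)
  finally show "lext phi (a \<oplus>\<^bsub>free_mod R X\<^esub> b) l = (lext phi a \<oplus>\<^bsub>free_mod R Y\<^esub> lext phi b) l"
  by (rule trans[OF _ free_mod_add[symmetric]])
 qed
next
 have phic: "phi k l : carrier R" if "k : X" for k l using free_modD(1)[OF phi[OF that]] .
 fix r a assume r: "r : carrier R" and a: "a : carrier (free_mod R X)"
 note aD = free_modD[OF a]
 interpret F: Module.module R "free_mod R X" by (rule module_free_mod)
 show "lext phi (r \<odot>\<^bsub>free_mod R X\<^esub> a) = r \<odot>\<^bsub>free_mod R Y\<^esub> lext phi a"
 proof
  fix l
  let ?A = "{k. a k ~= \<zero>}"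
  have ra: "r \<odot>\<^bsub>free_mod R X\<^esub> a : carrier (free_mod R X)" using a r by simp
  have cA: "phi k l : carrier R" if "k : ?A" for k using phic aD(3) that by blast
  have "lext phi (r \<odot>\<^bsub>free_mod R X\<^esub> a) l = (\<Oplus>k\<in>?A. (r \<odot>\<^bsub>free_mod R X\<^esub> a) k \<otimes> phi k l)"
  by (rule lext_superset[OF ra aD(2)]) (use r cA in "auto simp: free_mod_smult")
  also have "... = (\<Oplus>k\<in>?A. r \<otimes> (a k \<otimes> phi k l))"
  by (rule finsum_cong') (use cA aD(1) r in "auto simp: free_mod_smult m_assoc")
  also have "... = r \<otimes> (\<Oplus>k\<in>?A. a k \<otimes> phi k l)"
  by (rule finsum_rdistr[symmetric]) (use cA aD r in auto)
  finally show "lext phi (r \<odot>\<^bsub>free_mod R X\<^esub> a) l = (r \<odot>\<^bsub>free_mod R Y\<^esub> lext phi a) l"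
  by (simp add: free_mod_smult lext_def)
 qed
qed

lemma lext_single:
 assumes "!!l. phi k l : carrier R" shows "lext phi (single R k) = phi k"
proof
 fix l
 have s: "single R k : carrier (free_mod R {k})" by (rule single_in) simp
 have "lext phi (single R k) l = (\<Oplus>j\<in>{k}. single R k j \<otimes> phi j l)"
  by (rule lext_superset[OF s]) (use assms in "auto simp: single_def")
 also have "... = phi k l" using assms by (simp add: single_def)
 finally show "lext phi (single R k) l = phi k l" .
qed

lemma zpow_zero: "[(n::int)] \<cdot> \<zero> = \<zero>" "[(0::int)] \<cdot> a = \<zero>"
 by (rule add.int_pow_one) (simp add: add_pow_def)

lemma gen_act_superset:
 assumes a: "a : carrier (free_mod R X)" and A: "finite A" "{k. a k ~= \<zero>} \<subseteq> A" and C: "finite Cs" "Poly_Mapping.keys c \<subseteq> Cs"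
 shows "gen_act R pre c a l = (\<Oplus>p\<in>A \<times> Cs. if pre (fst p) (snd p) = l then [Poly_Mapping.lookup c (snd p)] \<cdot> a (fst p) else \<zero>)"
proof -
 have cl: "[n] \<cdot> a k : carrier R" for n :: int and k using free_modD(1)[OF a] by simp
 have "gen_act R pre c a l = (\<Oplus>p\<in>{p. a (fst p) ~= \<zero> & snd p : Poly_Mapping.keys c & pre (fst p) (snd p) = l}.
  if pre (fst p) (snd p) = l then [Poly_Mapping.lookup c (snd p)] \<cdot> a (fst p) else \<zero>)"
  unfolding gen_act_def by (rule finsum_cong') (use cl in auto)
 also have "... = (\<Oplus>p\<in>A \<times> Cs. if pre (fst p) (snd p) = l then [Poly_Mapping.lookup c (snd p)] \<cdot> a (fst p) else \<zero>)"
 proof (rule finsum_superset)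
  fix p assume "p : A \<times> Cs - {p. a (fst p) ~= \<zero> & snd p : Poly_Mapping.keys c & pre (fst p) (snd p) = l}"
  then consider "a (fst p) = \<zero>" | "Poly_Mapping.lookup c (snd p) = 0" | "pre (fst p) (snd p) ~= l"
  by (auto simp: in_keys_iff)
  then show "(if pre (fst p) (snd p) = l then [Poly_Mapping.lookup c (snd p)] \<cdot> a (fst p) else \<zero>) = \<zero>"
  by cases (auto simp: zpow_zero)
 qed (use A C cl in auto)
 finally show ?thesis .
qed

lemma gen_act_linear:
 assumes pre: "!!b f. [|b : X; f : Poly_Mapping.keys c|] ==> pre b f : Y"
 shows "gen_act R pre c : linear_maps R (free_mod R X) (free_mod R Y)"
proof (rule linear_mapsI)
 interpret F: Module.module R "free_mod R X" by (rule module_free_mod)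
 let ?K = "Poly_Mapping.keys c"
 have fK: "finite ?K" by simp
 fix a assume a: "a : carrier (free_mod R X)"
 note aD = free_modD[OF a]
 let ?A = "{k. a k ~= \<zero>}"
 have cl: "[n] \<cdot> a k : carrier R" for n :: int and k using aD(1) by simp
 show "gen_act R pre c a : carrier (free_mod R Y)"
 proof (rule free_modI)
  show "gen_act R pre c a l : carrier R" for l unfolding gen_act_def using cl by (intro finsum_closed) auto
  show "finite ((\<lambda>(b, f). pre b f) ` (?A \<times> ?K))" using aD(2) by simp
  show "(\<lambda>(b, f). pre b f) ` (?A \<times> ?K) \<subseteq> Y" using pre aD(3) by auto
  fix l assume "l \<notin> (\<lambda>(b, f). pre b f) ` (?A \<times> ?K)"
  then have e: "{p. a (fst p) ~= \<zero> & snd p : ?K & pre (fst p) (snd p) = l} = {}" by force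
  show "gen_act R pre c a l = \<zero>" unfolding gen_act_def e by simp
 qed
 fix b assume b: "b : carrier (free_mod R X)"
 note bD = free_modD[OF b]
 show "gen_act R pre c (a \<oplus>\<^bsub>free_mod R X\<^esub> b) = gen_act R pre c a \<oplus>\<^bsub>free_mod R Y\<^esub> gen_act R pre c b"
 proof
  fix l
  let ?AB = "{k. a k ~= \<zero>} \<union> {k. b k ~= \<zero>}"
  have ab: "a \<oplus>\<^bsub>free_mod R X\<^esub> b : carrier (free_mod R X)" using a b by simp
  have fA: "finite ?AB" using aD(2) bD(2) by simp
  let ?t = "%a p. if pre (fst p) (snd p) = l then [Poly_Mapping.lookup c (snd p)] \<cdot> a (fst p) else \<zero>"
  have "gen_act R pre c (a \<oplus>\<^bsub>free_mod R X\<^esub> b) l = (\<Oplus>p\<in>?AB \<times> ?K. ?t (a \<oplus>\<^bsub>free_mod R X\<^esub> b) p)"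
  by (rule gen_act_superset[OF ab fA _ fK]) (auto simp: free_mod_add)
  also have "... = (\<Oplus>p\<in>?AB \<times> ?K. ?t a p \<oplus> ?t b p)"
  by (rule finsum_cong') (use aD(1) bD(1) in "auto simp: free_mod_add add.int_pow_distrib")
  also have "... = (\<Oplus>p\<in>?AB \<times> ?K. ?t a p) \<oplus> (\<Oplus>p\<in>?AB \<times> ?K. ?t b p)"
  by (rule finsum_addf) (use aD(1) bD(1) in auto)
  also have "(\<Oplus>p\<in>?AB \<times> ?K. ?t a p) = gen_act R pre c a l"
  by (rule gen_act_superset[OF a fA _ fK, symmetric]) auto
  also have "(\<Oplus>p\<in>?AB \<times> ?K. ?t b p) = gen_act R pre c b l"
  by (rule gen_act_superset[OF b fA _ fK, symmetric]) auto
  finally show "gen_act R pre c (a \<oplus>\<^bsub>free_mod R X\<^esub> b) l = (gen_act R pre c a \<oplus>\<^bsub>free_mod R Y\<^esub> gen_act R pre c b) l"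
  by (rule trans[OF _ free_mod_add[symmetric]])
 qed
next
 interpret F: Module.module R "free_mod R X" by (rule module_free_mod)
 let ?K = "Poly_Mapping.keys c"
 have fK: "finite ?K" by simp
 fix r a assume r: "r : carrier R" and a: "a : carrier (free_mod R X)"
 note aD = free_modD[OF a]
 let ?A = "{k. a k ~= \<zero>}"
 show "gen_act R pre c (r \<odot>\<^bsub>free_mod R X\<^esub> a) = r \<odot>\<^bsub>free_mod R Y\<^esub> gen_act R pre c a"
 proof
  fix l
  have ra: "r \<odot>\<^bsub>free_mod R X\<^esub> a : carrier (free_mod R X)" using a r by simp
  let ?t = "%a p. if pre (fst p) (snd p) = l then [Poly_Mapping.lookup c (snd p)] \<cdot> a (fst p) else \<zero>"
  have "gen_act R pre c (r \<odot>\<^bsub>free_mod R X\<^esub> a) l = (\<Oplus>p\<in>?A \<times> ?K. ?t (r \<odot>\<^bsub>free_mod R X\<^esub> a) p)"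
  by (rule gen_act_superset[OF ra aD(2) _ fK]) (use r in "auto simp: free_mod_smult")
  also have "... = (\<Oplus>p\<in>?A \<times> ?K. r \<otimes> ?t a p)"
  by (rule finsum_cong') (use aD(1) r in "auto simp: free_mod_smult add_pow_rdistr_int")
  also have "... = r \<otimes> (\<Oplus>p\<in>?A \<times> ?K. ?t a p)"
  by (rule finsum_rdistr[symmetric]) (use aD r in auto)
  also have "(\<Oplus>p\<in>?A \<times> ?K. ?t a p) = gen_act R pre c a l"
  by (rule gen_act_superset[OF a aD(2) _ fK, symmetric]) auto
  finally show "gen_act R pre c (r \<odot>\<^bsub>free_mod R X\<^esub> a) l = (r \<odot>\<^bsub>free_mod R Y\<^esub> gen_act R pre c a) l"
  by (rule trans[OF _ free_mod_smult[symmetric]])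
 qed
qed

lemma gen_act_add:
 assumes a: "a : carrier (free_mod R X)"
 shows "gen_act R pre (c + c') a l = gen_act R pre c a l \<oplus> gen_act R pre c' a l"
proof -
 note aD = free_modD[OF a]
 let ?A = "{k. a k ~= \<zero>}" and ?K = "Poly_Mapping.keys c \<union> Poly_Mapping.keys c'"
 let ?t = "%c p. if pre (fst p) (snd p) = l then [Poly_Mapping.lookup c (snd p)] \<cdot> a (fst p) else \<zero>"
 have fK: "finite ?K" by simp
 have "gen_act R pre (c + c') a l = (\<Oplus>p\<in>?A \<times> ?K. ?t (c + c') p)"
  by (rule gen_act_superset[OF a aD(2) subset_refl fK]) (rule Poly_Mapping.keys_add)
 also have "... = (\<Oplus>p\<in>?A \<times> ?K. ?t c p \<oplus> ?t c' p)"
  by (rule finsum_cong') (use aD(1) in "auto simp: lookup_add add.int_pow_mult")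
 also have "... = (\<Oplus>p\<in>?A \<times> ?K. ?t c p) \<oplus> (\<Oplus>p\<in>?A \<times> ?K. ?t c' p)"
  by (rule finsum_addf) (use aD(1) in auto)
 also have "(\<Oplus>p\<in>?A \<times> ?K. ?t c p) = gen_act R pre c a l"
  by (rule gen_act_superset[OF a aD(2) subset_refl fK, symmetric]) simp
 also have "(\<Oplus>p\<in>?A \<times> ?K. ?t c' p) = gen_act R pre c' a l"
  by (rule gen_act_superset[OF a aD(2) subset_refl fK, symmetric]) simp
 finally show ?thesis .
qed

lemma gen_act_single: "gen_act R pre (frag_of f) (single R b) = single R (pre b f)"
proof
 fix l
 have s: "single R b : carrier (free_mod R {b})" by (rule single_in) simp
 have "gen_act R pre (frag_of f) (single R b) l =
  (\<Oplus>p\<in>{b} \<times> {f}. if pre (fst p) (snd p) = l then [Poly_Mapping.lookup (frag_of f) (snd p)] \<cdot> single R b (fst p) else \<zero>)"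
  by (rule gen_act_superset[OF s]) (auto simp: single_def)
 also have "... = single R (pre b f) l" by (auto simp: single_def)
 finally show "gen_act R pre (frag_of f) (single R b) l = single R (pre b f) l" .
qed

end

section \<open>Presheaves of sets and the free modules on them\<close>

locale category =
 fixes C :: "('o, 'k) cat"
 assumes id_in: "x : Obj C ==> Id C x : Hom C x x"
  and comp_in: "[|x : Obj C; y : Obj C; z : Obj C; f : Hom C x y; g : Hom C y z|] ==> Comp C x g f : Hom C x z"
  and comp_id: "[|x : Obj C; z : Obj C; f : Hom C x z|] ==> Comp C x f (Id C x) = f"
  and comp_assoc: "[|x : Obj C; y : Obj C; z : Obj C; w : Obj C; f : Hom C x y; g : Hom C y z; h : Hom C z w|]
  ==> Comp C x (Comp C y h g) f = Comp C x h (Comp C x g f)"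

text \<open>A contravariant set-valued functor, \<open>pre x b f\<close> being the restriction of
  \<open>b\<close> along \<open>f\<close>. Hom functors and their finite sums are both of this kind,
  so one construction of free modules serves for both.\<close>

definition presheaf :: "('o, 'k) cat => ('o => 'b set) => ('o => 'b => 'k => 'b) => bool"
 where "presheaf C B pre \<longleftrightarrow>
  (\<forall>x\<in>Obj C. \<forall>y\<in>Obj C. \<forall>f\<in>Hom C x y. \<forall>b\<in>B y. pre x b f : B x) &
  (\<forall>x\<in>Obj C. \<forall>b\<in>B x. pre x b (Id C x) = b) &
  (\<forall>x\<in>Obj C. \<forall>y\<in>Obj C. \<forall>z\<in>Obj C. \<forall>f\<in>Hom C x y. \<forall>g\<in>Hom C y z. \<forall>b\<in>B z.
  pre x b (Comp C x g f) = pre x (pre y b g) f)"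

definition free_cat_module ::
  "('r, 'x) ring_scheme => ('o => 'b set) => ('o => 'b => 'k => 'b) => ('o, 'k, 'r, 'b => 'r) cat_module"
 where "free_cat_module R B pre =
  \<lparr>Fib = (%x. free_mod R (B x)), Act = (%x y c a. gen_act R (pre x) c a)\<rparr>"

lemma rep_module_eq: "rep_module R C z = free_cat_module R (%x. Hom C x z) (Comp C)"
 by (simp add: rep_module_def free_cat_module_def gen_act_def fun_eq_iff)

lemma lin_hom_iff: "c : lin_hom C x y \<longleftrightarrow> Poly_Mapping.keys c \<subseteq> Hom C x y"
 by (simp add: lin_hom_def)

lemma frag_extend_add_fun: "frag_extend (%g. u g + v g) d = frag_extend u d + frag_extend v d"
 by (simp add: frag_extend_def frag_cmul_distrib2 sum.distrib)

lemma lin_comp_add: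
 "lin_comp C x d (c + c') = lin_comp C x d c + lin_comp C x d c'"
 "lin_comp C x (d + d') c = lin_comp C x d c + lin_comp C x d' c"
 by (simp_all add: lin_comp_def frag_extend_add frag_extend_add_fun)

lemma lin_comp_of: "lin_comp C x (frag_of g) (frag_of f) = frag_of (Comp C x g f)"
 by (simp add: lin_comp_def)

lemma (in category) lin_comp_in:
 assumes "x : Obj C" "y : Obj C" "z : Obj C" "c : lin_hom C x y" "d : lin_hom C y z"
 shows "lin_comp C x d c : lin_hom C x z"
proof -
 have k: "Poly_Mapping.keys (frag_extend (%f. frag_of (Comp C x g f)) c) \<subseteq> Hom C x z"
  if "g : Poly_Mapping.keys d" for g
 proof (rule order_trans[OF keys_frag_extend])
  have "Comp C x g f : Hom C x z" if "f : Poly_Mapping.keys c" for f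
  by (rule comp_in[of x y z]) (use assms \<open>g : _\<close> that in "auto simp: lin_hom_iff")
  then show "(\<Union>f\<in>Poly_Mapping.keys c. Poly_Mapping.keys (frag_of (Comp C x g f))) \<subseteq> Hom C x z" by auto
 qed
 show ?thesis unfolding lin_hom_iff lin_comp_def
  by (rule order_trans[OF keys_frag_extend]) (use k in blast)
qed

lemma cat_moduleD:
 assumes "is_cat_module R C M"
 shows "x : Obj C ==> Module.module R (Fib M x)"
  and "[|x : Obj C; y : Obj C; c : lin_hom C x y|] ==> Act M x y c : linear_maps R (Fib M y) (Fib M x)"
  and "[|x : Obj C; y : Obj C; c : lin_hom C x y; c' : lin_hom C x y; a : carrier (Fib M y)|]
  ==> Act M x y (c + c') a = Act M x y c a \<oplus>\<^bsub>Fib M x\<^esub> Act M x y c' a"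
  and "[|x : Obj C; a : carrier (Fib M x)|] ==> Act M x x (frag_of (Id C x)) a = a"
  and "[|x : Obj C; y : Obj C; z : Obj C; c : lin_hom C x y; d : lin_hom C y z; a : carrier (Fib M z)|]
  ==> Act M x z (lin_comp C x d c) a = Act M x y c (Act M y z d a)"
 using assms by (auto simp: is_cat_module_def)

lemma cat_module_homD:
 assumes "t : cat_module_hom R C M N"
 shows "x : Obj C ==> t x : linear_maps R (Fib M x) (Fib N x)"
  and "[|x : Obj C; y : Obj C; c : lin_hom C x y; a : carrier (Fib M y)|] ==> t x (Act M x y c a) = Act N x y c (t y a)"
 using assms by (auto simp: cat_module_hom_def)

lemma frag_of_lin_hom: "f : Hom C x y ==> frag_of f : lin_hom C x y"
 by (simp add: lin_hom_iff)

text \<open>By additivity, functoriality has to be checked on morphisms of \<open>C\<close> only.\<close>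

lemma (in category) is_cat_moduleI:
 assumes mod: "!!x. x : Obj C ==> Module.module R (Fib M x)"
  and lin: "!!x y c. [|x : Obj C; y : Obj C; c : lin_hom C x y|] ==> Act M x y c : linear_maps R (Fib M y) (Fib M x)"
  and add: "!!x y c c' a. [|x : Obj C; y : Obj C; c : lin_hom C x y; c' : lin_hom C x y; a : carrier (Fib M y)|]
  ==> Act M x y (c + c') a = Act M x y c a \<oplus>\<^bsub>Fib M x\<^esub> Act M x y c' a"
  and id: "!!x a. [|x : Obj C; a : carrier (Fib M x)|] ==> Act M x x (frag_of (Id C x)) a = a"
  and comp: "!!x y z f g a. [|x : Obj C; y : Obj C; z : Obj C; f : Hom C x y; g : Hom C y z; a : carrier (Fib M z)|]
  ==> Act M x z (frag_of (Comp C x g f)) a = Act M x y (frag_of f) (Act M y z (frag_of g) a)"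
 shows "is_cat_module R C M"
proof -
 have "Act M x z (lin_comp C x d c) a = Act M x y c (Act M y z d a)"
  if o: "x : Obj C" "y : Obj C" "z : Obj C" and c: "c : lin_hom C x y" and d: "d : lin_hom C y z" and a: "a : carrier (Fib M z)"
  for x y z c d a
 proof -
  interpret X: Module.module R "Fib M x" by (rule mod[OF o(1)])
  have cl: "Act M x y c a : carrier (Fib M x)" if "x : Obj C" "y : Obj C" "c : lin_hom C x y" "a : carrier (Fib M y)" for x y c a
  using lin[OF that(1-3)] that(4) by (auto simp: linear_maps_def)
  have la: "Act M x y c (a \<oplus>\<^bsub>Fib M y\<^esub> b) = Act M x y c a \<oplus>\<^bsub>Fib M x\<^esub> Act M x y c b"
  if "x : Obj C" "y : Obj C" "c : lin_hom C x y" "a : carrier (Fib M y)" "b : carrier (Fib M y)" for x y c a b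
  using lin[OF that(1-3)] that(4,5) by (auto simp: linear_maps_def)
  note lc = lin_comp_in[OF o]
  have gen: "Act M x z (lin_comp C x (frag_of g) c) a = Act M x y c (Act M y z (frag_of g) a)" if g: "g : Hom C y z" for g
  proof (rule frag_additive_eq[OF X.abelian_group_axioms, of c "Hom C x y"])
  show "Act M x z (lin_comp C x (frag_of g) (frag_of f)) a = Act M x y (frag_of f) (Act M y z (frag_of g) a)"
  if "f : Hom C x y" for f using comp[OF o that g a] by (simp add: lin_comp_of)
  qed (use c o a g in "simp_all add: lin_hom_iff[symmetric] lin_comp_add(1) add lc cl frag_of_lin_hom")
  show ?thesis
  proof (rule frag_additive_eq[OF X.abelian_group_axioms, of d "Hom C y z"])
  show "Act M x z (lin_comp C x (frag_of g) c) a = Act M x y c (Act M y z (frag_of g) a)" if "g : Hom C y z" for g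
  by (rule gen[OF that])
  qed (use c d o a in "simp_all add: lin_hom_iff[symmetric] lin_comp_add(2) add lc cl la")
 qed
 then show ?thesis unfolding is_cat_module_def using mod lin add id by blast
qed

lemma presheafD:
 assumes "presheaf C B pre"
 shows "[|x : Obj C; y : Obj C; f : Hom C x y; b : B y|] ==> pre x b f : B x"
  and "[|x : Obj C; b : B x|] ==> pre x b (Id C x) = b"
  and "[|x : Obj C; y : Obj C; z : Obj C; f : Hom C x y; g : Hom C y z; b : B z|]
  ==> pre x b (Comp C x g f) = pre x (pre y b g) f"
 using assms by (auto simp: presheaf_def)

lemma (in category) presheaf_Hom: "z : Obj C ==> presheaf C (%x. Hom C x z) (Comp C)"
 unfolding presheaf_def by (auto simp: comp_in comp_id comp_assoc)

locale cat_ring = cring R + category C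
 for R :: "('r, 'x) ring_scheme" (structure) and C :: "('o, 'k) cat"
begin

lemma free_cat_simps [simp]:
 "Fib (free_cat_module R B pre) x = free_mod R (B x)" "Act (free_cat_module R B pre) x y c = gen_act R (pre x) c"
 by (simp_all add: free_cat_module_def fun_eq_iff)

lemma gen_act_pre:
 assumes "presheaf C B pre" "x : Obj C" "y : Obj C" "c : lin_hom C x y"
 shows "gen_act R (pre x) c : linear_maps R (free_mod R (B y)) (free_mod R (B x))"
 by (rule gen_act_linear) (use presheafD(1)[OF assms(1-3)] assms(4) in "auto simp: lin_hom_iff")

lemma id_linear: "(%x. x) : linear_maps R M M" by (simp add: linear_maps_def)

lemma free_cat_module: assumes B: "presheaf C B pre" shows "is_cat_module R C (free_cat_module R B pre)"
proof (rule is_cat_moduleI)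
 note gp = gen_act_pre[OF B]
 show "Act (free_cat_module R B pre) x y c : linear_maps R (Fib (free_cat_module R B pre) y) (Fib (free_cat_module R B pre) x)"
  if "x : Obj C" "y : Obj C" "c : lin_hom C x y" for x y c using gp[OF that] by simp
 show "Act (free_cat_module R B pre) x y (c + c') a =
  Act (free_cat_module R B pre) x y c a \<oplus>\<^bsub>Fib (free_cat_module R B pre) x\<^esub> Act (free_cat_module R B pre) x y c' a"
  if "a : carrier (Fib (free_cat_module R B pre) y)" for x y c c' a
  by (rule ext) (use gen_act_add[of a "B y"] that in "simp add: free_mod_add")
 show "Act (free_cat_module R B pre) x x (frag_of (Id C x)) a = a"
  if x: "x : Obj C" and a: "a : carrier (Fib (free_cat_module R B pre) x)" for x a
 proof -
  have "gen_act R (pre x) (frag_of (Id C x)) a = a"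
  by (rule linear_maps_free_eq[OF module_free_mod gp[OF x x] id_linear])
  (use x a id_in in "auto simp: gen_act_single presheafD(2)[OF B] intro: frag_of_lin_hom")
  then show ?thesis by simp
 qed
 show "Act (free_cat_module R B pre) x z (frag_of (Comp C x g f)) a =
  Act (free_cat_module R B pre) x y (frag_of f) (Act (free_cat_module R B pre) y z (frag_of g) a)"
  if o: "x : Obj C" "y : Obj C" "z : Obj C" and f: "f : Hom C x y" and g: "g : Hom C y z"
  and a: "a : carrier (Fib (free_cat_module R B pre) z)" for x y z f g a
 proof -
  have "gen_act R (pre x) (frag_of (Comp C x g f)) a = gen_act R (pre x) (frag_of f) (gen_act R (pre y) (frag_of g) a)"
  by (rule linear_maps_free_eq[OF module_free_mod gp[OF o(1,3)]
  linear_maps_comp[OF gp[OF o(2,3)] gp[OF o(1,2)]]])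
  (use o f g a comp_in[OF o f g] in "auto simp: gen_act_single presheafD(3)[OF B o f g] intro: frag_of_lin_hom")
  then show ?thesis by simp
 qed
qed (simp add: module_free_mod)

lemma rep_cat_module: "z : Obj C ==> is_cat_module R C (rep_module R C z)"
 unfolding rep_module_eq by (rule free_cat_module[OF presheaf_Hom])

lemma regular_simps [simp]:
 "carrier (regular_mod R) = carrier R" "\<zero>\<^bsub>regular_mod R\<^esub> = \<zero>" "x \<oplus>\<^bsub>regular_mod R\<^esub> y = x \<oplus> y" "x \<odot>\<^bsub>regular_mod R\<^esub> y = x \<otimes> y"
 by (simp_all add: regular_mod_def)

lemma module_regular: "Module.module R (regular_mod R)"
proof (rule moduleI)
 show "abelian_group (regular_mod R)"
  by (rule abelian_groupI) (auto simp: a_ac intro: l_neg bexI[of _ "\<ominus> _"])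
qed (auto simp: is_cring l_distr r_distr m_assoc)

lemma const_cat_module: "is_cat_module R C (const_module R)"
proof (rule is_cat_moduleI)
 show "Act (const_module R) x y c : linear_maps R (Fib (const_module R) y) (Fib (const_module R) x)" for x y c
  by (rule linear_mapsI) (simp_all add: const_module_def add.int_pow_distrib add_pow_rdistr_int)
qed (simp_all add: const_module_def module_regular lookup_sum_additive add.int_pow_mult)

text \<open>Additivity reduces naturality to morphisms of the category, and linearity reduces it to
  basis elements.\<close>

lemma free_cat_hom:
 assumes B: "presheaf C B pre" and N: "is_cat_module R C N"
  and lin: "!!x. x : Obj C ==> t x : linear_maps R (free_mod R (B x)) (Fib N x)"
  and nat: "!!x y f b. [|x : Obj C; y : Obj C; f : Hom C x y; b : B y|]
  ==> t x (single R (pre x b f)) = Act N x y (frag_of f) (t y (single R b))"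
 shows "t : cat_module_hom R C (free_cat_module R B pre) N"
proof -
 have "t x (gen_act R (pre x) c a) = Act N x y c (t y a)"
  if o: "x : Obj C" "y : Obj C" and c: "c : lin_hom C x y" and a: "a : carrier (free_mod R (B y))" for x y c a
 proof (rule linear_maps_free_eq[OF cat_moduleD(1)[OF N o(1)] linear_maps_comp[OF gen_act_pre[OF B o c] lin[OF o(1)]]
  linear_maps_comp[OF lin[OF o(2)] cat_moduleD(2)[OF N o c]] _ a])
  fix b assume b: "b : B y"
  interpret X: Module.module R "Fib N x" by (rule cat_moduleD(1)[OF N o(1)])
  note gc = linear_mapsD(1)[OF gen_act_pre[OF B o] single_in[OF b]]
  show "t x (gen_act R (pre x) c (single R b)) = Act N x y c (t y (single R b))"
  proof (rule frag_additive_eq[OF X.abelian_group_axioms, of c "Hom C x y"])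
  show "t x (gen_act R (pre x) (frag_of f) (single R b)) = Act N x y (frag_of f) (t y (single R b))" if "f : Hom C x y" for f
  using nat[OF o that b] by (simp add: gen_act_single)
  fix c c' :: "'k \<Rightarrow>\<^sub>0 int" assume cc: "Poly_Mapping.keys c \<subseteq> Hom C x y" "Poly_Mapping.keys c' \<subseteq> Hom C x y"
  then have cc: "c : lin_hom C x y" "c' : lin_hom C x y" by (simp_all add: lin_hom_iff)
  have "gen_act R (pre x) (c + c') (single R b) = gen_act R (pre x) c (single R b) \<oplus>\<^bsub>free_mod R (B x)\<^esub> gen_act R (pre x) c' (single R b)"
  by (rule ext) (simp add: gen_act_add[OF single_in[OF b]] free_mod_add)
  then show "t x (gen_act R (pre x) (c + c') (single R b)) =
  t x (gen_act R (pre x) c (single R b)) \<oplus>\<^bsub>Fib N x\<^esub> t x (gen_act R (pre x) c' (single R b))"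
  using linear_mapsD(2)[OF lin[OF o(1)] gc[OF cc(1)] gc[OF cc(2)]] by simp
  show "Act N x y (c + c') (t y (single R b)) = Act N x y c (t y (single R b)) \<oplus>\<^bsub>Fib N x\<^esub> Act N x y c' (t y (single R b))"
  by (rule cat_moduleD(3)[OF N o cc linear_mapsD(1)[OF lin[OF o(2)] single_in[OF b]]])
  next
  fix c :: "'k \<Rightarrow>\<^sub>0 int" assume "Poly_Mapping.keys c \<subseteq> Hom C x y"
  then have c: "c : lin_hom C x y" by (simp add: lin_hom_iff)
  show "t x (gen_act R (pre x) c (single R b)) : carrier (Fib N x)"
  by (rule linear_mapsD(1)[OF lin[OF o(1)] gc[OF c]])
  show "Act N x y c (t y (single R b)) : carrier (Fib N x)"
  by (rule linear_mapsD(1)[OF cat_moduleD(2)[OF N o c] linear_mapsD(1)[OF lin[OF o(2)] single_in[OF b]]])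
  qed (use c in "simp add: lin_hom_iff")
 qed
 then show ?thesis unfolding cat_module_hom_def using lin by simp
qed

end

text \<open>The direct sum of the modules \<open>R \<otimes> Hom(-, z i)\<close>, \<open>i < n\<close>, with elements in
  \<^typ>\<open>'k list \<Rightarrow> 'r\<close>: the basis element \<open>k\<close> of the \<open>i\<close>-th summand is coded as a list of
  \<open>Suc i\<close> copies of \<open>k\<close>.\<close>

definition copies :: "nat => 'k => 'k list" where "copies i k = replicate (Suc i) k"

definition sum_basis :: "('o, 'k) cat => nat => (nat => 'o) => 'o => 'k list set"
 where "sum_basis C n z x = {copies i k | i k. i < n & k : Hom C x (z i)}"

definition sum_pre :: "('o, 'k) cat => 'o => 'k list => 'k => 'k list"
 where "sum_pre C x l f = map (%k. Comp C x k f) l"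

lemma sum_pre_copies [simp]: "sum_pre C x (copies i k) f = copies i (Comp C x k f)"
 by (simp add: sum_pre_def copies_def)

lemma copies_simps [simp]: "copies i k = copies j k' \<longleftrightarrow> i = j & k = k'" "length (copies i k) = Suc i" "hd (copies i k) = k"
 unfolding copies_def by (metis length_replicate nat.inject replicate_Suc list.inject) simp_all

lemma sum_basisI: "[|i < n; k : Hom C x (z i)|] ==> copies i k : sum_basis C n z x"
 unfolding sum_basis_def by blast

lemma sum_basisE:
 assumes "l : sum_basis C n z x"
 obtains i k where "i < n" "k : Hom C x (z i)" "l = copies i k"
 using assms unfolding sum_basis_def by blast

abbreviation sum_module :: "('r, 'x) ring_scheme => ('o, 'k) cat => nat => (nat => 'o) => ('o, 'k, 'r, 'k list => 'r) cat_module"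
 where "sum_module R C n z \<equiv> free_cat_module R (sum_basis C n z) (sum_pre C)"

lemma (in category) presheaf_sum:
 assumes z: "z : {..<n} \<rightarrow> Obj C" shows "presheaf C (sum_basis C n z) (sum_pre C)"
 unfolding presheaf_def
proof (intro conjI ballI)
 have zi: "z i : Obj C" if "i < n" for i using z that by auto
 show "sum_pre C x b f : sum_basis C n z x"
  if "x : Obj C" "y : Obj C" "f : Hom C x y" "b : sum_basis C n z y" for x y f b
  using that(4) by (rule sum_basisE) (use that zi in "auto intro!: sum_basisI comp_in[of x y]")
 show "sum_pre C x b (Id C x) = b" if "x : Obj C" "b : sum_basis C n z x" for x b
  using that(2) by (rule sum_basisE) (use that zi in "auto intro: comp_id")
 show "sum_pre C x b (Comp C x g f) = sum_pre C x (sum_pre C y b g) f"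
  if "x : Obj C" "y : Obj C" "w : Obj C" "f : Hom C x y" "g : Hom C y w" "b : sum_basis C n z w" for x y w f g b
  using that(6)
 proof (rule sum_basisE)
  fix i k assume "i < n" "k : Hom C w (z i)" "b = copies i k"
  then show ?thesis using comp_assoc[OF that(1-3) zi[of i] that(4,5), of k] by (simp)
 qed
qed

lemma direct_sum_simps:
 "Fib (direct_sum I M) x = direct_sum_mod I (%i. Fib (M i) x)"
 "Act (direct_sum I M) x y c s = (\<lambda>i\<in>I. Act (M i) x y c (s i))"
 by (simp_all add: direct_sum_def)

lemma direct_sum_mod_finite:
 assumes "finite I"
 shows "carrier (direct_sum_mod I M) = (\<Pi>\<^sub>E i\<in>I. carrier (M i))"
 using assms by (auto simp: direct_sum_mod_def)

context cat_ring
begin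

text \<open>The index set is left open because \<open>fin_generated\<close> asks for an initial
  segment of the naturals, while \<open>projective\<close> asks for a set of a prescribed
  type.\<close>

lemma sum_module_split:
 fixes I :: "'i set"
 assumes z: "z : {..<n} \<rightarrow> Obj C" and p: "bij_betw p I {..<n}"
 shows "\<exists>s\<in>cat_module_hom R C (sum_module R C n z) (direct_sum I (%i. rep_module R C (z (p i)))).
  \<exists>r\<in>cat_module_hom R C (direct_sum I (%i. rep_module R C (z (p i)))) (sum_module R C n z).
  \<forall>x\<in>Obj C. (\<forall>a\<in>carrier (Fib (sum_module R C n z) x). r x (s x a) = a) &
  (\<forall>b\<in>carrier (Fib (direct_sum I (%i. rep_module R C (z (p i)))) x).
  r x b : carrier (Fib (sum_module R C n z) x) & s x (r x b) = b)"
proof -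
 let ?P = "sum_module R C n z" and ?D = "direct_sum I (%i. rep_module R C (z (p i)))"
 have fI: "finite I" using p bij_betw_finite by blast
 have pI: "p i < n" if "i : I" for i using p that by (auto simp: bij_betw_def)
 have pre: "presheaf C (sum_basis C n z) (sum_pre C)" by (rule presheaf_sum[OF z])
 have zi: "z (p i) : Obj C" if "i : I" for i using z pI[OF that] by auto
 have D: "carrier (Fib ?D x) = (\<Pi>\<^sub>E i\<in>I. carrier (free_mod R (Hom C x (z (p i)))))"
  "a \<oplus>\<^bsub>Fib ?D x\<^esub> b = (\<lambda>i\<in>I. a i \<oplus>\<^bsub>free_mod R (Hom C x (z (p i)))\<^esub> b i)"
  "r \<odot>\<^bsub>Fib ?D x\<^esub> b = (\<lambda>i\<in>I. r \<odot>\<^bsub>free_mod R (Hom C x (z (p i)))\<^esub> b i)" for x a b r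
  by (simp add: direct_sum_simps rep_module_eq direct_sum_mod_finite[OF fI])
  (simp_all add: direct_sum_simps rep_module_eq direct_sum_mod_def)
 define s where "s x a = (\<lambda>i\<in>I. %k. a (copies (p i) k))" for x :: 'o and a :: "'k list => 'r"
 define q where "q = inv_into I p"
 have q: "q m : I" "p (q m) = m" if "m < n" for m
  using p that unfolding q_def by (auto simp: bij_betw_def inv_into_into f_inv_into_f)
 have qp: "q (p i) = i" if "i : I" for i using p that unfolding q_def by (auto simp: bij_betw_def)
 define r where "r x b l = (if l : sum_basis C n z x then b (q (length l - 1)) (hd l) else \<zero>)"
  for x :: 'o and b :: "'i => 'k => 'r" and l
 have s_comp: "(%a k. a (copies (p i) k)) : linear_maps R (free_mod R (sum_basis C n z x)) (free_mod R (Hom C x (z (p i))))"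
  if "i : I" for x i
 proof (rule linear_mapsI)
  fix a assume a: "a : carrier (free_mod R (sum_basis C n z x))"
  show "(%k. a (copies (p i) k)) : carrier (free_mod R (Hom C x (z (p i))))"
  proof (rule free_modI[of _ "hd ` {l. a l ~= \<zero>} \<inter> Hom C x (z (p i))"])
  show "finite (hd ` {l. a l ~= \<zero>} \<inter> Hom C x (z (p i)))" using free_modD(2)[OF a] by simp
  fix k assume k: "k \<notin> hd ` {l. a l ~= \<zero>} \<inter> Hom C x (z (p i))"
  show "a (copies (p i) k) = \<zero>"
  proof (rule ccontr)
  assume a0: "a (copies (p i) k) ~= \<zero>"
  then have "copies (p i) k : sum_basis C n z x" using free_modD(3)[OF a] by blast
  then have "k : Hom C x (z (p i))" by (rule sum_basisE) (simp)
  moreover have "k = hd (copies (p i) k)" by simp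
  ultimately show False using k a0 by blast
  qed
  qed (use free_modD(1)[OF a] in auto)
 qed (simp_all add: free_mod_def)
 have sl: "s x : linear_maps R (Fib ?P x) (Fib ?D x)" for x
 proof (rule linear_mapsI)
  show "s x a : carrier (Fib ?D x)" if "a : carrier (Fib ?P x)" for a
  using linear_mapsD(1)[OF s_comp] that unfolding D s_def by auto
 qed (auto simp: D s_def free_mod_add free_mod_smult free_mod_def intro!: restrict_ext)
 have s_nat: "s : cat_module_hom R C ?P ?D"
  unfolding cat_module_hom_def
 proof (intro CollectI conjI ballI sl)
  fix x y c a assume o: "x : Obj C" "y : Obj C" and c: "c : lin_hom C x y" and a: "a : carrier (Fib ?P y)"
  have "(%k. gen_act R (sum_pre C x) c a (copies (p i) k)) = Act (rep_module R C (z (p i))) x y c (%k. a (copies (p i) k))"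
  if i: "i : I" for i
  proof -
  have "(%x a k. a (copies (p i) k)) : cat_module_hom R C ?P (rep_module R C (z (p i)))"
  proof (rule free_cat_hom[OF pre rep_cat_module[OF zi[OF i]]])
  show "(%a k. a (copies (p i) k)) : linear_maps R (free_mod R (sum_basis C n z x)) (Fib (rep_module R C (z (p i))) x)" for x
  using s_comp[OF i] by (simp add: rep_module_eq)
  fix x y f b assume o: "x : Obj C" "y : Obj C" and f: "f : Hom C x y" and b: "b : sum_basis C n z y"
  from b obtain j k where b: "j < n" "k : Hom C y (z j)" "b = copies j k" by (rule sum_basisE)
  have *: "(%k'. single R (copies j k) (copies (p i) k')) = (if j = p i then single R k else (%_. \<zero>))" for k
  by (auto simp: single_def)
  have z0: "gen_act R (Comp C x) (frag_of f) (%_. \<zero>) = (%_. \<zero>)" for x f by (rule ext) (simp add: gen_act_def)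
  show "(%k. single R (sum_pre C x b f) (copies (p i) k)) =
  Act (rep_module R C (z (p i))) x y (frag_of f) (%k. single R b (copies (p i) k))"
  unfolding b(3) sum_pre_copies * rep_module_eq free_cat_simps by (simp add: z0 gen_act_single)
  qed
  from cat_module_homD(2)[OF this o c a] show ?thesis by simp
  qed
  then show "s x (Act ?P x y c a) = Act ?D x y c (s y a)"
  by (auto simp: s_def direct_sum_simps intro!: restrict_ext)
 qed
 have rc: "r x b : carrier (Fib ?P x)" if b: "b : carrier (Fib ?D x)" for x b
 proof -
  have bi: "b i : carrier (free_mod R (Hom C x (z (p i))))" if "i : I" for i using b that by (auto simp: D)
  have "r x b : carrier (free_mod R (sum_basis C n z x))"
  proof (rule free_modI[of _ "(\<Union>i\<in>I. copies (p i) ` {k. b i k ~= \<zero>})"])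
  show "r x b l : carrier R" for l
  proof (cases "l : sum_basis C n z x")
  case True
  then obtain m k where m: "m < n" "l = copies m k" by (rule sum_basisE)
  show ?thesis using free_modD(1)[OF bi[OF q(1)[OF m(1)]], of k] True m(2) by (simp add: r_def)
  qed (simp add: r_def)
  show "finite (\<Union>i\<in>I. copies (p i) ` {k. b i k ~= \<zero>})" using fI free_modD(2)[OF bi] by simp
  show "(\<Union>i\<in>I. copies (p i) ` {k. b i k ~= \<zero>}) \<subseteq> sum_basis C n z x"
  using free_modD(3)[OF bi] pI by (auto intro!: sum_basisI)
  fix l assume l: "l \<notin> (\<Union>i\<in>I. copies (p i) ` {k. b i k ~= \<zero>})"
  show "r x b l = \<zero>"
  proof (cases "l : sum_basis C n z x")
  case True
  then obtain m k where m: "m < n" "l = copies m k" by (rule sum_basisE)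
  have "b (q m) k = \<zero>"
  proof (rule ccontr)
  assume "b (q m) k ~= \<zero>"
  then have "l : copies (p (q m)) ` {k. b (q m) k ~= \<zero>}" unfolding q(2)[OF m(1)] m(2) by (intro imageI CollectI)
  then show False using l q(1)[OF m(1)] by blast
  qed
  then show ?thesis using m by (simp add: r_def)
  qed (simp add: r_def)
  qed
  then show ?thesis by simp
 qed
 have rs: "r x (s x a) = a" if a: "a : carrier (Fib ?P x)" for x a
 proof
  fix l
  show "r x (s x a) l = a l"
  proof (cases "l : sum_basis C n z x")
  case True
  then obtain m k where m: "m < n" "l = copies m k" by (rule sum_basisE)
  have "r x (s x a) l = s x a (q m) k" using True unfolding m(2) by (simp add: r_def)
  also have "... = a (copies (p (q m)) k)" unfolding s_def using q(1)[OF m(1)] by simp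
  finally show ?thesis unfolding q(2)[OF m(1)] m(2) .
  next
  case False
  then show ?thesis using a free_modD(4)[of a "sum_basis C n z x" l] by (simp add: r_def)
  qed
 qed
 have sr: "s x (r x b) = b" if b: "b : carrier (Fib ?D x)" for x b
 proof
  fix i
  show "s x (r x b) i = b i"
  proof (cases "i : I")
  case True
  have bi: "b i : carrier (free_mod R (Hom C x (z (p i))))" using b True by (auto simp: D)
  have "r x b (copies (p i) k) = b i k" for k
  proof (cases "k : Hom C x (z (p i))")
  case k: True
  have "copies (p i) k : sum_basis C n z x" by (rule sum_basisI) (rule pI[OF True], rule k)
  then show ?thesis unfolding r_def copies_simps diff_Suc_1 qp[OF True] by (rule if_P)
  next
  case False
  have "copies (p i) k \<notin> sum_basis C n z x"
  proof
  assume "copies (p i) k : sum_basis C n z x"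
  then show False by (rule sum_basisE) (use False in "simp")
  qed
  then show ?thesis using free_modD(4)[OF bi False] by (simp add: r_def)
  qed
  then show ?thesis using True by (simp add: s_def)
  next
  case False
  then show ?thesis using b by (auto simp: s_def D PiE_def extensional_def)
  qed
 qed
 have Dact: "Act ?D x y c b : carrier (Fib ?D x)"
  if o: "x : Obj C" "y : Obj C" and c: "c : lin_hom C x y" and b: "b : carrier (Fib ?D y)" for x y c b
 proof -
  have "Act (rep_module R C (z (p i))) x y c (b i) : carrier (free_mod R (Hom C x (z (p i))))" if i: "i : I" for i
  proof -
  have "b i : carrier (Fib (rep_module R C (z (p i))) y)" using b[unfolded D] i unfolding rep_module_eq by auto
  from linear_mapsD(1)[OF cat_moduleD(2)[OF rep_cat_module[OF zi[OF i]] o c] this] show ?thesis by (simp add: rep_module_eq)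
  qed
  then show ?thesis by (auto simp: D direct_sum_simps(2))
 qed
 have r_nat: "r : cat_module_hom R C ?D ?P"
  unfolding cat_module_hom_def
 proof (intro CollectI conjI ballI)
  show "r x : linear_maps R (Fib ?D x) (Fib ?P x)" if "x : Obj C" for x
  proof (rule linear_mapsI)
  show "r x b : carrier (Fib ?P x)" if "b : carrier (Fib ?D x)" for b by (rule rc[OF that])
  next
  fix a b assume a: "a : carrier (Fib ?D x)" and b: "b : carrier (Fib ?D x)"
  show "r x (a \<oplus>\<^bsub>Fib ?D x\<^esub> b) = r x a \<oplus>\<^bsub>Fib ?P x\<^esub> r x b"
  proof
  fix l
  show "r x (a \<oplus>\<^bsub>Fib ?D x\<^esub> b) l = (r x a \<oplus>\<^bsub>Fib ?P x\<^esub> r x b) l"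
  proof (cases "l : sum_basis C n z x")
  case True
  then obtain m k where m: "m < n" "l = copies m k" by (rule sum_basisE)
  show ?thesis using True m q(1)[OF m(1)] by (simp add: r_def D free_mod_add)
  qed (simp add: r_def free_mod_add)
  qed
  next
  fix c b assume c: "c : carrier R" and b: "b : carrier (Fib ?D x)"
  show "r x (c \<odot>\<^bsub>Fib ?D x\<^esub> b) = c \<odot>\<^bsub>Fib ?P x\<^esub> r x b"
  proof
  fix l
  show "r x (c \<odot>\<^bsub>Fib ?D x\<^esub> b) l = (c \<odot>\<^bsub>Fib ?P x\<^esub> r x b) l"
  proof (cases "l : sum_basis C n z x")
  case True
  then obtain m k where m: "m < n" "l = copies m k" by (rule sum_basisE)
  show ?thesis using True m q(1)[OF m(1)] by (simp add: r_def D free_mod_smult)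
  qed (simp add: r_def free_mod_smult c)
  qed
  qed
  fix x y c b assume o: "x : Obj C" "y : Obj C" and c: "c : lin_hom C x y" and b: "b : carrier (Fib ?D y)"
  note P = free_cat_module[OF pre]
  \<comment> \<open>Naturality of \<open>r\<close> is inherited from its inverse
    \<open>s\<close>.\<close>
  have "Act ?P x y c (r y b) = r x (s x (Act ?P x y c (r y b)))"
  by (rule rs[symmetric]) (rule linear_mapsD(1)[OF cat_moduleD(2)[OF P o c] rc[OF b]])
  also have "s x (Act ?P x y c (r y b)) = Act ?D x y c b"
  using cat_module_homD(2)[OF s_nat o c rc[OF b]] sr[OF b] by simp
  finally show "r x (Act ?D x y c b) = Act ?P x y c (r y b)" by simp
 qed
 show ?thesis using s_nat r_nat rs rc sr by blast
qed

lemma sum_module_fin_generated: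
 assumes z: "z : {..<n} \<rightarrow> Obj C" shows "fin_generated R C (sum_module R C n z)"
proof -
 have "bij_betw (%i. i) {..<n} {..<n}" by (simp add: bij_betw_def)
 from sum_module_split[OF z this] obtain s r where sr:
  "s : cat_module_hom R C (sum_module R C n z) (direct_sum {..<n} (%i. rep_module R C (z i)))"
  "r : cat_module_hom R C (direct_sum {..<n} (%i. rep_module R C (z i))) (sum_module R C n z)"
  "!!x a. x : Obj C ==> a : carrier (Fib (sum_module R C n z) x) ==> r x (s x a) = a"
  by blast
 have "r x ` carrier (Fib (direct_sum {..<n} (%i. rep_module R C (z i))) x) = carrier (Fib (sum_module R C n z) x)"
  if x: "x : Obj C" for x
 proof (intro equalityI image_subsetI subsetI)
  show "r x b : carrier (Fib (sum_module R C n z) x)" if "b : carrier (Fib (direct_sum {..<n} (%i. rep_module R C (z i))) x)" for b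
  by (rule linear_mapsD(1)[OF cat_module_homD(1)[OF sr(2) x] that])
  fix a assume a: "a : carrier (Fib (sum_module R C n z) x)"
  show "a : r x ` carrier (Fib (direct_sum {..<n} (%i. rep_module R C (z i))) x)"
  by (rule image_eqI[where x = "s x a"]) (rule sr(3)[OF x a, symmetric], rule linear_mapsD(1)[OF cat_module_homD(1)[OF sr(1) x] a])
 qed
 then show ?thesis unfolding fin_generated_def using z sr(2) by blast
qed

lemma sum_module_projective:
 assumes z: "z : {..<n} \<rightarrow> Obj C" and one: "\<one> ~= \<zero>" shows "projective R C (sum_module R C n z)"
proof -
 \<comment> \<open>The naturals embedded in the index type of \<open>projective\<close>, by
   functions that test the length of a list. Injectivity rests on
   \<open>\<one> \<noteq> \<zero>\<close>.\<close>
 define \<iota> :: "nat => 'o \<times> ('k list => 'r)" where "\<iota> i = (undefined, %l. if length l = i then \<one> else \<zero>)" for i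
 have inj: "inj \<iota>"
 proof (rule injI)
  fix i j assume "\<iota> i = \<iota> j"
  then have "snd (\<iota> i) (replicate i undefined) = snd (\<iota> j) (replicate i undefined)" by simp
  then have "i = j \<or> \<one> = \<zero>" by (simp add: \<iota>_def split: if_splits)
  then show "i = j" using one by simp
 qed
 have bij: "bij_betw (inv_into UNIV \<iota>) (\<iota> ` {..<n}) {..<n}"
  by (rule bij_betw_byWitness[of _ \<iota>]) (use inj in auto)
 have zI: "(%i. z (inv_into UNIV \<iota> i)) : \<iota> ` {..<n} \<rightarrow> Obj C" using z inj by auto
 have cm: "is_cat_module R C (sum_module R C n z)" by (rule free_cat_module[OF presheaf_sum[OF z]])
 show ?thesis unfolding projective_def
  by (intro conjI cm exI[of _ "\<iota> ` {..<n}"] exI[of _ "%i. z (inv_into UNIV \<iota> i)"] zI) (use sum_module_split[OF z bij] in blast)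
qed

end

section \<open>The cellular resolution of the line\<close>

lemma (in abelian_group) minus_add_minus:
 "[|a : carrier G; b : carrier G; c : carrier G|] ==> (a \<ominus> b) \<oplus> (b \<ominus> c) = a \<ominus> c"
 by (simp add: minus_eq a_assoc r_neg1)

lemma (in abelian_group) a_inv_zero: "\<ominus> \<zero> = \<zero>"
 using r_neg[of \<zero>] by simp

lemma (in abelian_group) minus_minus_eq:
 "[|a : carrier G; b : carrier G|] ==> \<ominus> (a \<ominus> b) = b \<ominus> a"
 by (simp add: minus_eq minus_add a_comm)

lemma (in Module.module) minus_smult_step:
 assumes "a : carrier M" "k : carrier M" "v : carrier M" "l : carrier R" "r : carrier R"
 shows "(a \<oplus>\<^bsub>M\<^esub> r \<odot>\<^bsub>M\<^esub> k) \<ominus>\<^bsub>M\<^esub> (l \<oplus> r) \<odot>\<^bsub>M\<^esub> v = (a \<ominus>\<^bsub>M\<^esub> l \<odot>\<^bsub>M\<^esub> v) \<oplus>\<^bsub>M\<^esub> r \<odot>\<^bsub>M\<^esub> (k \<ominus>\<^bsub>M\<^esub> v)"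
proof -
 have "\<ominus>\<^bsub>M\<^esub> ((l \<oplus> r) \<odot>\<^bsub>M\<^esub> v) = \<ominus>\<^bsub>M\<^esub> (l \<odot>\<^bsub>M\<^esub> v) \<oplus>\<^bsub>M\<^esub> \<ominus>\<^bsub>M\<^esub> (r \<odot>\<^bsub>M\<^esub> v)"
  using assms by (simp add: smult_l_distr M.minus_add)
 moreover have "r \<odot>\<^bsub>M\<^esub> (k \<ominus>\<^bsub>M\<^esub> v) = r \<odot>\<^bsub>M\<^esub> k \<oplus>\<^bsub>M\<^esub> \<ominus>\<^bsub>M\<^esub> (r \<odot>\<^bsub>M\<^esub> v)"
  using assms by (simp add: smult_r_distr smult_r_minus M.minus_eq)
 ultimately show ?thesis using assms by (simp add: M.minus_eq M.a_ac)
qed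

context cring
begin

text \<open>The augmentation, written as a linear extension to the free module on one point so that
  linearity comes from \<open>lext_linear\<close>.\<close>

definition lsum :: "('k => 'a) => 'a" where "lsum a = lext (%_. single R ()) a ()"

lemma lsum_linear: "lsum : linear_maps R (free_mod R X) (regular_mod R)"
proof -
 have "(%a. a ()) : linear_maps R (free_mod R {()}) (regular_mod R)"
  by (simp add: linear_maps_def free_mod_def regular_mod_def)
 from linear_maps_comp[OF lext_linear[of X "%_. single R ()" "{()}"] this] show ?thesis
  by (simp add: single_in lsum_def[abs_def])
qed

lemma lsum_single [simp]: "lsum (single R k) = \<one>"
 unfolding lsum_def by (subst lext_single) (simp_all add: single_def)

end

definition head :: "int => int" where "head m = (if m mod 4 = 1 then m + 1 else m - 1)"
definition tail :: "int => int" where "tail m = (if m mod 4 = 1 then m - 1 else m + 1)"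

lemma head_tail_even: "odd m ==> even (head m)" "odd m ==> even (tail m)"
 by (auto simp: head_def tail_def)

text \<open>These maps preserve the residues 0 and 2 modulo 4 of even numbers, so even a reflection
  takes heads to heads and the boundary is natural without signs.\<close>

lemma head_tail_affine:
 assumes "odd m" "\<sigma> = 1 \<or> \<sigma> = - 1"
 shows "head (\<sigma> * m + 4 * q) = \<sigma> * head m + 4 * q" "tail (\<sigma> * m + 4 * q) = \<sigma> * tail m + 4 * q"
proof -
 have "m mod 4 = 1 \<or> m mod 4 = 3" using assms(1) by presburger
 moreover have "m mod 4 = 1 ==> - m mod 4 = 3" "m mod 4 = 3 ==> - m mod 4 = 1" by presburger+
 ultimately show "head (\<sigma> * m + 4 * q) = \<sigma> * head m + 4 * q" "tail (\<sigma> * m + 4 * q) = \<sigma> * tail m + 4 * q"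
  using assms(2) by (auto simp: head_def tail_def)
qed

text \<open>The cellular chain complex of the line: its vertices are the even integers, its edges the odd
  ones. Every edge is oriented towards its end that is \<open>2\<close> modulo \<open>4\<close>, which is invariant under the
  maps \<open>m \<mapsto> \<plusminus>m + 4q\<close>. The complex at \<open>x\<close> is the part fixed by \<open>x\<close>, the whole line or a vertex.\<close>

locale line_complex = cat_ring R C
 for R :: "('r, 'x) ring_scheme" (structure) and C :: "('o, 'k) cat" +
 fixes n0 n1 :: nat and z0 z1 :: "nat => 'o" and lv0 lv1 :: "'o => 'k list => int" and fp :: "'o => int set"
 assumes one_neq: "\<one> ~= \<zero>"
  and z0: "z0 : {..<n0} \<rightarrow> Obj C" and z1: "z1 : {..<n1} \<rightarrow> Obj C"
  and fp: "x : Obj C ==> fp x = UNIV \<or> (EX j. fp x = {2 * j})"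
  and bij0: "x : Obj C ==> bij_betw (lv0 x) (sum_basis C n0 z0 x) {m : fp x. even m}"
  and bij1: "x : Obj C ==> bij_betw (lv1 x) (sum_basis C n1 z1 x) {m : fp x. odd m}"
  and level: "[|x : Obj C; y : Obj C; f : Hom C x y|] ==>
  \<exists>\<sigma> q. (\<sigma> = 1 \<or> \<sigma> = - 1) &
  (\<forall>v\<in>sum_basis C n0 z0 y. lv0 x (sum_pre C x v f) = \<sigma> * lv0 y v + 4 * q) &
  (\<forall>v\<in>sum_basis C n1 z1 y. lv1 x (sum_pre C x v f) = \<sigma> * lv1 y v + 4 * q)"
begin

abbreviation "V \<equiv> sum_basis C n0 z0"
abbreviation "E \<equiv> sum_basis C n1 z1"
abbreviation "MV x \<equiv> free_mod R (V x)"
abbreviation "ME x \<equiv> free_mod R (E x)"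

definition vx :: "'o => int => 'k list" where "vx x = inv_into (V x) (lv0 x)"

abbreviation dif :: "'o => int => int => 'k list => 'r"
 where "dif x m m' \<equiv> single R (vx x m) \<ominus>\<^bsub>MV x\<^esub> single R (vx x m')"

definition bd :: "'o => 'k list => 'k list => 'r"
 where "bd x e = dif x (head (lv1 x e)) (tail (lv1 x e))"

context
 fixes x assumes x: "x : Obj C"
begin

interpretation MV: Module.module R "MV x" by (rule module_free_mod)
interpretation ME: Module.module R "ME x" by (rule module_free_mod)

lemma vx_in: assumes "m : fp x" "even m" shows "vx x m : V x" "lv0 x (vx x m) = m"
proof -
 have "m : lv0 x ` V x" using bij0[OF x] assms by (simp add: bij_betw_def)
 then show "vx x m : V x" "lv0 x (vx x m) = m" unfolding vx_def by (rule inv_into_into, rule f_inv_into_f)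
qed

lemma vx_lv: assumes "v : V x" shows "vx x (lv0 x v) = v"
 unfolding vx_def by (rule inv_into_f_f[OF bij_betw_imp_inj_on[OF bij0[OF x]] assms])

lemma lv0_fp: "v : V x ==> lv0 x v : fp x & even (lv0 x v)"
 using bij_betwE[OF bij0[OF x]] by blast

lemma fp_even: "EX m. m : fp x & even m"
 using fp[OF x]
proof (elim disjE exE)
 assume "fp x = UNIV"
 then show ?thesis by (intro exI[of _ 0]) simp
next
 fix j assume "fp x = {2 * j}"
 then show ?thesis by (intro exI[of _ "2 * j"]) simp
qed

lemma edge: assumes "e : E x" shows "odd (lv1 x e)" "fp x = UNIV"
proof -
 have "lv1 x e : lv1 x ` E x" using assms by (rule imageI)
 then have l: "lv1 x e : fp x" "odd (lv1 x e)" using bij1[OF x] by (simp_all add: bij_betw_def)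
 then have "fp x ~= {2 * j}" for j by auto
 then show "odd (lv1 x e)" "fp x = UNIV" using l(2) fp[OF x] by blast+
qed

lemma single_vx: "[|m : fp x; even m|] ==> single R (vx x m) : carrier (MV x)"
 by (rule single_in[OF vx_in(1)])

lemma bd_in: assumes "e : E x" shows "bd x e : carrier (MV x)"
 unfolding bd_def by (rule MV.minus_closed; rule single_vx) (use edge[OF assms] head_tail_even in simp_all)

lemma bd_linear: "lext (bd x) : linear_maps R (ME x) (MV x)"
 by (rule lext_linear) (rule bd_in)

lemma bd_single: "e : E x ==> lext (bd x) (single R e) = bd x e"
 by (rule lext_single) (rule free_modD(1)[OF bd_in])

lemma lsum_minus: "[|a : carrier (MV x); b : carrier (MV x)|] ==> lsum (a \<ominus>\<^bsub>MV x\<^esub> b) = lsum a \<ominus> lsum b"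
proof -
 assume a: "a : carrier (MV x)" and b: "b : carrier (MV x)"
 have l: "lsum a : carrier R" if "a : carrier (MV x)" for a using linear_mapsD(1)[OF lsum_linear that] by simp
 have "lsum ((\<ominus> \<one>) \<odot>\<^bsub>MV x\<^esub> b) = (\<ominus> \<one>) \<otimes> lsum b"
  using linear_mapsD(3)[OF lsum_linear _ b, of "\<ominus> \<one>"] by simp
 also have "... = \<ominus> lsum b" using l[OF b] by (simp add: l_minus)
 also have "(\<ominus> \<one>) \<odot>\<^bsub>MV x\<^esub> b = \<ominus>\<^bsub>MV x\<^esub> b" using b by (simp add: MV.smult_l_minus)
 finally show "lsum (a \<ominus>\<^bsub>MV x\<^esub> b) = lsum a \<ominus> lsum b"
  using linear_mapsD(2)[OF lsum_linear a, of "\<ominus>\<^bsub>MV x\<^esub> b"] b by (simp add: MV.minus_eq minus_eq)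
qed

lemma lsum_bd: assumes "a : carrier (ME x)" shows "lsum (lext (bd x) a) = \<zero>"
proof (rule linear_maps_free_eq[OF module_regular linear_maps_comp[OF bd_linear lsum_linear] _ _ assms])
 show "(%_. \<zero>) : linear_maps R (ME x) (regular_mod R)" by (rule linear_mapsI) simp_all
 fix e assume e: "e : E x"
 then have "lsum (bd x e) = \<one> \<ominus> \<one>"
  unfolding bd_def using single_vx edge[OF e] head_tail_even by (simp add: lsum_minus)
 then show "lsum (lext (bd x) (single R e)) = \<zero>" using bd_single[OF e] by (simp add: minus_eq r_neg)
qed

abbreviation "Bnd \<equiv> lext (bd x) ` carrier (ME x)"

lemma Bnd_add: assumes "a : Bnd" "b : Bnd" shows "a \<oplus>\<^bsub>MV x\<^esub> b : Bnd"
proof -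
 obtain a' b' where "a' : carrier (ME x)" "a = lext (bd x) a'" "b' : carrier (ME x)" "b = lext (bd x) b'"
  using assms by (elim imageE)
 then show ?thesis using linear_mapsD(2)[OF bd_linear, of a' b'] by (auto intro!: image_eqI[of _ _ "a' \<oplus>\<^bsub>ME x\<^esub> b'"])
qed

lemma Bnd_smult: assumes "a : Bnd" "r : carrier R" shows "r \<odot>\<^bsub>MV x\<^esub> a : Bnd"
proof -
 obtain a' where "a' : carrier (ME x)" "a = lext (bd x) a'" using assms by (elim imageE)
 then show ?thesis using linear_mapsD(3)[OF bd_linear assms(2), of a'] assms(2) by (auto intro!: image_eqI[of _ _ "r \<odot>\<^bsub>ME x\<^esub> a'"])
qed

lemma Bnd_zero: "\<zero>\<^bsub>MV x\<^esub> : Bnd"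
 by (rule image_eqI[of _ _ "\<zero>\<^bsub>ME x\<^esub>"])
  (rule linear_maps_zero[OF module_free_mod module_free_mod bd_linear, symmetric], rule ME.zero_closed)

lemma Bnd_minus: assumes "a : Bnd" shows "\<ominus>\<^bsub>MV x\<^esub> a : Bnd"
proof -
 obtain a' where "a' : carrier (ME x)" "a = lext (bd x) a'" using assms by (elim imageE)
 then have a: "a : carrier (MV x)" using linear_mapsD(1)[OF bd_linear] by simp
 have "(\<ominus> \<one>) \<odot>\<^bsub>MV x\<^esub> a = \<ominus>\<^bsub>MV x\<^esub> a" using a by (simp add: MV.smult_l_minus)
 then show ?thesis using Bnd_smult[OF assms, of "\<ominus> \<one>"] by simp
qed

lemma dif_step: assumes U: "fp x = UNIV" shows "dif x (2 * (j + 1)) (2 * j) : Bnd"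
proof -
 have "2 * j + 1 : lv1 x ` E x" using bij1[OF x] U by (simp add: bij_betw_def)
 then obtain e where e: "e : E x" "lv1 x e = 2 * j + 1" by (rule imageE) simp
 have bd: "bd x e : Bnd" by (rule image_eqI[of _ _ "single R e"]) (simp_all add: bd_single e single_in)
 have s: "single R (vx x (2 * i)) : carrier (MV x)" for i using single_vx U by simp
 show ?thesis
 proof (cases "(2 * j + 1) mod 4 = 1")
  case True
  then show ?thesis using bd by (simp add: bd_def e head_def tail_def algebra_simps)
 next
  case False
  then have "bd x e = dif x (2 * j) (2 * (j + 1))" by (simp add: bd_def e head_def tail_def algebra_simps)
  then have "dif x (2 * (j + 1)) (2 * j) = \<ominus>\<^bsub>MV x\<^esub> bd x e"
  using MV.minus_minus_eq[OF s[of j] s[of "j + 1"]] by simp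
  then show ?thesis using Bnd_minus[OF bd] by simp
 qed
qed

text \<open>If \<open>x\<close> fixes the line, two vertices are joined by a path and the boundaries
  of its edges, up to sign, add up to their difference. If \<open>x\<close> fixes one vertex, the
  two coincide.\<close>

lemma dif_Bnd: assumes v: "v : V x" "v' : V x" shows "single R v \<ominus>\<^bsub>MV x\<^esub> single R v' : Bnd"
proof (cases "fp x = UNIV")
 case True
 have s: "single R (vx x (2 * i)) : carrier (MV x)" for i using single_vx True by simp
 obtain i j where ij: "lv0 x v = 2 * i" "lv0 x v' = 2 * j" using lv0_fp v by (meson evenE)
 have "dif x (2 * i) (2 * j) : Bnd"
 proof (induction i rule: int_induct[of _ j])
  case base
  then show ?case using Bnd_zero s by (simp add: MV.minus_eq MV.r_neg)
 next
  case (step1 i)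
  then show ?case using Bnd_add[OF dif_step[OF True, of i] step1(2)] MV.minus_add_minus[OF s[of "i + 1"] s[of i] s[of j]] by simp
 next
  case (step2 i)
  have "\<ominus>\<^bsub>MV x\<^esub> dif x (2 * (i - 1 + 1)) (2 * (i - 1)) = dif x (2 * (i - 1)) (2 * i)"
  using MV.minus_minus_eq[OF s[of i] s[of "i - 1"]] by simp
  then have "dif x (2 * (i - 1)) (2 * i) : Bnd" using Bnd_minus[OF dif_step[OF True, of "i - 1"]] by simp
  from Bnd_add[OF this step2(2)] show ?case unfolding MV.minus_add_minus[OF s[of "i - 1"] s[of i] s[of j]] .
 qed
 then show ?thesis using vx_lv[OF v(1)] vx_lv[OF v(2)] ij by simp
next
 case False
 then obtain j where "fp x = {2 * j}" using fp[OF x] by blast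
 then have "lv0 x v = lv0 x v'" using lv0_fp[OF v(1)] lv0_fp[OF v(2)] by simp
 then have "vx x (lv0 x v) = vx x (lv0 x v')" by (rule arg_cong)
 then have "v = v'" unfolding vx_lv[OF v(1)] vx_lv[OF v(2)] .
 then show ?thesis using Bnd_zero single_in[OF v(1)] by (simp add: MV.minus_eq MV.r_neg)
qed

text \<open>Modulo boundaries every chain \<open>a\<close> equals \<open>lsum a\<close> times one
  fixed vertex, by induction on \<open>a\<close>.\<close>

lemma ker_lsum: "Bnd = {a : carrier (MV x). lsum a = \<zero>}"
proof (intro equalityI subsetI CollectI conjI)
 fix a assume "a : Bnd"
 then obtain a' where "a' : carrier (ME x)" "a = lext (bd x) a'" by (elim imageE)
 then show "a : carrier (MV x)" "lsum a = \<zero>" using lsum_bd linear_mapsD(1)[OF bd_linear] by auto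
next
 fix a assume "a : {a : carrier (MV x). lsum a = \<zero>}"
 then have a: "a : carrier (MV x)" "lsum a = \<zero>" by auto
 have "EX m. m : fp x & even m" by (rule fp_even)
 then obtain v where v: "v : V x" using vx_in(1) by blast
 have sv: "single R v : carrier (MV x)" by (rule single_in[OF v])
 have lc: "lsum b : carrier R" if "b : carrier (MV x)" for b using linear_mapsD(1)[OF lsum_linear that] by simp
 have "a \<ominus>\<^bsub>MV x\<^esub> lsum a \<odot>\<^bsub>MV x\<^esub> single R v : Bnd" using a(1)
 proof (induction rule: free_mod_induct)
  case zero
  have "lsum \<zero>\<^bsub>MV x\<^esub> = \<zero>" using linear_maps_zero[OF module_free_mod module_regular lsum_linear] by simp
  then show ?case using Bnd_zero sv by (simp add: MV.minus_eq MV.a_inv_zero)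
 next
  case (step a r k)
  have st: "a : carrier (MV x)" "a \<ominus>\<^bsub>MV x\<^esub> lsum a \<odot>\<^bsub>MV x\<^esub> single R v : Bnd" "r : carrier R" "k : V x"
  by (fact step)+
  have sk: "single R k : carrier (MV x)" by (rule single_in[OF st(4)])
  have ls: "lsum (a \<oplus>\<^bsub>MV x\<^esub> r \<odot>\<^bsub>MV x\<^esub> single R k) = lsum a \<oplus> r"
  proof -
  have "lsum (a \<oplus>\<^bsub>MV x\<^esub> r \<odot>\<^bsub>MV x\<^esub> single R k) = lsum a \<oplus> lsum (r \<odot>\<^bsub>MV x\<^esub> single R k)"
  using linear_mapsD(2)[OF lsum_linear st(1) MV.smult_closed[OF st(3) sk]] unfolding regular_simps .
  moreover have "lsum (r \<odot>\<^bsub>MV x\<^esub> single R k) = r \<otimes> \<one>"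
  using linear_mapsD(3)[OF lsum_linear st(3) sk] unfolding regular_simps lsum_single .
  ultimately show ?thesis using st(3) by simp
  qed
  have eq: "(a \<oplus>\<^bsub>MV x\<^esub> r \<odot>\<^bsub>MV x\<^esub> single R k) \<ominus>\<^bsub>MV x\<^esub> lsum (a \<oplus>\<^bsub>MV x\<^esub> r \<odot>\<^bsub>MV x\<^esub> single R k) \<odot>\<^bsub>MV x\<^esub> single R v =
  (a \<ominus>\<^bsub>MV x\<^esub> lsum a \<odot>\<^bsub>MV x\<^esub> single R v) \<oplus>\<^bsub>MV x\<^esub> r \<odot>\<^bsub>MV x\<^esub> (single R k \<ominus>\<^bsub>MV x\<^esub> single R v)"
  unfolding ls by (rule MV.minus_smult_step[OF st(1) sk sv lc[OF st(1)] st(3)])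
  show ?case unfolding eq by (rule Bnd_add[OF st(2) Bnd_smult[OF dif_Bnd[OF st(4) v] st(3)]])
 qed
 then show "a : Bnd" unfolding a(2) MV.smult_l_null[OF sv] MV.minus_eq MV.a_inv_zero MV.r_zero[OF a(1)] .
qed

text \<open>The rightmost edge \<open>e\<close> of the support has a right end that no other edge of
  the support touches, so the boundary has there the coefficient \<open>a e\<close> up to
  sign.\<close>

lemma bd_inj: assumes a: "a : carrier (ME x)" and 0: "lext (bd x) a = \<zero>\<^bsub>MV x\<^esub>" shows "a = \<zero>\<^bsub>ME x\<^esub>"
proof (rule ccontr)
 assume "a ~= \<zero>\<^bsub>ME x\<^esub>"
 then have ne: "{e. a e ~= \<zero>} ~= {}" by (auto simp: free_mod_def)
 note aD = free_modD[OF a]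
 have "Max (lv1 x ` {e. a e ~= \<zero>}) : lv1 x ` {e. a e ~= \<zero>}" by (rule Max_in) (use ne aD(2) in auto)
 then obtain e where e: "a e ~= \<zero>" "lv1 x e = Max (lv1 x ` {e. a e ~= \<zero>})" by (rule imageE) simp
 have mx: "lv1 x e' <= lv1 x e" if "a e' ~= \<zero>" for e' unfolding e(2) by (rule Max_ge) (use aD(2) that in auto)
 have eE: "e' : E x" if "a e' ~= \<zero>" for e' using aD(3) that by blast
 let ?v = "vx x (lv1 x e + 1)"
 have U: "fp x = UNIV" and oe: "odd (lv1 x e)" using edge[OF eE[OF e(1)]] by auto
 have vx_eq: "single R (vx x m) ?v = (if m = lv1 x e + 1 then \<one> else \<zero>)" if "even m" for m
  using vx_in(2)[of m] vx_in(2)[of "lv1 x e + 1"] U oe that by (auto simp: single_def)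
 have bd_v: "bd x e' ?v = (if head (lv1 x e') = lv1 x e + 1 then \<one> else \<zero>) \<ominus> (if tail (lv1 x e') = lv1 x e + 1 then \<one> else \<zero>)"
  if "a e' ~= \<zero>" for e'
 proof -
  note h = edge[OF eE[OF that]]
  have "single R (vx x (tail (lv1 x e'))) : carrier (MV x)" using single_vx h head_tail_even by simp
  then have "bd x e' ?v = single R (vx x (head (lv1 x e'))) ?v \<ominus> single R (vx x (tail (lv1 x e'))) ?v"
  unfolding bd_def MV.minus_eq free_mod_add by (simp add: free_mod_minus minus_eq)
  then show ?thesis using h head_tail_even by (simp add: vx_eq)
 qed
 have other: "bd x e' ?v = \<zero>" if e': "a e' ~= \<zero>" "e' ~= e" for e'
 proof -
  have "inj_on (lv1 x) (E x)" using bij1[OF x] by (simp add: bij_betw_def)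
  then have "lv1 x e' ~= lv1 x e" using inj_onD eE e' e(1) by metis
  then have "lv1 x e' < lv1 x e" using mx[OF e'(1)] by simp
  then have "head (lv1 x e') ~= lv1 x e + 1" "tail (lv1 x e') ~= lv1 x e + 1" by (auto simp: head_def tail_def)
  then show ?thesis using bd_v[OF e'(1)] by (simp add: minus_eq)
 qed
 have own: "bd x e ?v = \<one> \<or> bd x e ?v = \<ominus> \<one>"
  using bd_v[OF e(1)] by (auto simp: head_def tail_def minus_eq)
 have bc: "bd x e' ?v : carrier R" if "a e' ~= \<zero>" for e' by (rule free_modD(1)[OF bd_in[OF eE[OF that]]])
 have "lext (bd x) a ?v = (\<Oplus>e'\<in>{e}. a e' \<otimes> bd x e' ?v)"
  unfolding lext_def by (rule finsum_superset[symmetric]) (use aD(1,2) e other bc in auto)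
 also have "... = a e \<otimes> bd x e ?v" using aD(1) bc[OF e(1)] by simp
 finally have "a e \<otimes> bd x e ?v = \<zero>" using 0 by (simp add: free_mod_zero)
 then have "a e = \<zero> \<or> \<ominus> a e = \<zero>" using own aD(1)[of e] by (auto simp: r_minus)
 moreover have "a e = \<ominus> (\<ominus> a e)" using aD(1) by simp
 ultimately have "a e = \<zero>" by auto
 then show False using e(1) by simp
qed

end

lemma vx_pre:
 assumes o: "x : Obj C" "y : Obj C" and f: "f : Hom C x y" and m: "m : fp y" "even m"
  and l: "!!v. v : V y ==> lv0 x (sum_pre C x v f) = \<sigma> * lv0 y v + 4 * q"
 shows "sum_pre C x (vx y m) f = vx x (\<sigma> * m + 4 * q)"
proof -
 note v = vx_in[OF o(2) m]
 have "sum_pre C x (vx y m) f : V x" using presheafD(1)[OF presheaf_sum[OF z0] o f v(1)] .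
 then show ?thesis using vx_lv[OF o(1), of "sum_pre C x (vx y m) f"] l[OF v(1)] v(2) by simp
qed

text \<open>A morphism acts on the levels of vertices and of edges by the same affine map, and this
  map respects heads and tails.\<close>

lemma bd_hom: "(%x. lext (bd x)) : cat_module_hom R C (sum_module R C n1 z1) (sum_module R C n0 z0)"
proof (rule free_cat_hom[OF presheaf_sum[OF z1] free_cat_module[OF presheaf_sum[OF z0]]])
 show "lext (bd x) : linear_maps R (ME x) (Fib (sum_module R C n0 z0) x)" if "x : Obj C" for x
  using bd_linear[OF that] by simp
 fix x y f e assume o: "x : Obj C" "y : Obj C" and f: "f : Hom C x y" and e: "e : E y"
 obtain \<sigma> q where \<sigma>: "\<sigma> = 1 \<or> \<sigma> = - 1" and l0: "!!v. v : V y ==> lv0 x (sum_pre C x v f) = \<sigma> * lv0 y v + 4 * q"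
  and l1: "!!v. v : E y ==> lv1 x (sum_pre C x v f) = \<sigma> * lv1 y v + 4 * q"
  using level[OF o f] by blast
 let ?m = "lv1 y e"
 note ed = edge[OF o(2) e]
 have ht: "head ?m : fp y" "even (head ?m)" "tail ?m : fp y" "even (tail ?m)" using ed head_tail_even by auto
 have pv: "sum_pre C x (vx y m) f = vx x (\<sigma> * m + 4 * q)" if "m : fp y" "even m" for m
  by (rule vx_pre[OF o f that]) (rule l0)
 have pe: "sum_pre C x e f : E x" by (rule presheafD(1)[OF presheaf_sum[OF z1] o f e])
 have "gen_act R (sum_pre C x) (frag_of f) (bd y e) =
  gen_act R (sum_pre C x) (frag_of f) (single R (vx y (head ?m))) \<ominus>\<^bsub>MV x\<^esub> gen_act R (sum_pre C x) (frag_of f) (single R (vx y (tail ?m)))"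
  unfolding bd_def
  by (rule linear_maps_minus[OF module_free_mod module_free_mod gen_act_pre[OF presheaf_sum[OF z0] o frag_of_lin_hom[OF f]]])
  (use single_vx[OF o(2)] ht in auto)
 also have "... = dif x (\<sigma> * head ?m + 4 * q) (\<sigma> * tail ?m + 4 * q)"
  unfolding gen_act_single pv[OF ht(1,2)] pv[OF ht(3,4)] ..
 also have "... = bd x (sum_pre C x e f)"
  unfolding bd_def l1[OF e] head_tail_affine[OF ed(1) \<sigma>] ..
 finally show "lext (bd x) (single R (sum_pre C x e f)) = Act (sum_module R C n0 z0) x y (frag_of f) (lext (bd y) (single R e))"
  using bd_single[OF o(1) pe] bd_single[OF o(2) e] by simp
qed

lemma lsum_hom: "(%x. lsum) : cat_module_hom R C (sum_module R C n0 z0) (const_module R)"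
proof (rule free_cat_hom[OF presheaf_sum[OF z0] const_cat_module])
 show "lsum : linear_maps R (MV x) (Fib (const_module R) x)" for x
  using lsum_linear by (simp add: const_module_def)
qed (simp add: const_module_def)

theorem line_resolution: "type_FP R C" "cat_cd R C <= 1"
proof -
 \<comment> \<open>From degree two on there are no summands, so the modules vanish and the
   resolution has length one.\<close>
 define nn where "nn i = (if i = 0 then n0 else if i = 1 then n1 else 0)" for i :: nat
 define zz where "zz i = (if i = 0 then z0 else z1)" for i :: nat
 let ?P = "%i. sum_module R C (nn i) (zz i)"
 let ?d = "\<lambda>i::nat. if i = 0 then (%x. lext (bd x)) else (%x a k. \<zero>)"
 have zz: "zz i : {..<nn i} \<rightarrow> Obj C" for i using z0 z1 by (simp add: zz_def nn_def)
 have empty: "sum_basis C (nn (Suc (Suc i))) (zz j) x = {}" for i j x by (simp add: sum_basis_def nn_def)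
 have c0: "carrier (free_mod R {}) = {%k. \<zero>}" by (auto simp: free_mod_def)
 have dhom: "?d i : cat_module_hom R C (?P (Suc i)) (?P i)" for i
 proof (cases i)
  case 0
  then show ?thesis using bd_hom by (simp add: nn_def zz_def)
 next
  case (Suc j)
  have "(%x a k. \<zero>) : cat_module_hom R C (?P (Suc (Suc j))) (?P (Suc j))"
  proof (rule free_cat_hom[OF presheaf_sum[OF zz] free_cat_module[OF presheaf_sum[OF zz]]])
  show "(%a k. \<zero>) : linear_maps R (free_mod R (sum_basis C (nn (Suc (Suc j))) (zz (Suc (Suc j))) x)) (Fib (?P (Suc j)) x)" for x
  by (simp add: linear_maps_def free_mod_def)
  qed (simp add: empty)
  then show ?thesis using Suc by simp
 qed
 have res: "proj_resolution R C ?P ?d (%x. lsum)"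
  unfolding proj_resolution_def
 proof (intro conjI allI ballI)
  show "projective R C (?P i)" for i by (rule sum_module_projective[OF zz one_neq])
  show "?d i : cat_module_hom R C (?P (Suc i)) (?P i)" for i by (rule dhom)
  show "(%x. lsum) : cat_module_hom R C (?P 0) (const_module R)" using lsum_hom by (simp add: nn_def zz_def)
  fix x assume x: "x : Obj C"
  interpret MV: Module.module R "MV x" by (rule module_free_mod)
  have "lsum ` carrier (MV x) = carrier R"
  proof (intro equalityI image_subsetI subsetI)
  show "lsum a : carrier R" if "a : carrier (MV x)" for a using linear_mapsD(1)[OF lsum_linear that] by simp
  fix r assume r: "r : carrier R"
  have "EX m. m : fp x & even m" by (rule fp_even[OF x])
  then obtain v where v: "single R v : carrier (MV x)" using single_vx[OF x] by blast
  show "r : lsum ` carrier (MV x)"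
  by (rule image_eqI[of _ _ "r \<odot>\<^bsub>MV x\<^esub> single R v"]) (use r v linear_mapsD(3)[OF lsum_linear r v] in simp_all)
  qed
  then show "lsum ` carrier (Fib (?P 0) x) = carrier R" by (simp add: nn_def zz_def)
  show "?d 0 x ` carrier (Fib (?P 1) x) = {a : carrier (Fib (?P 0) x). lsum a = \<zero>}"
  using ker_lsum[OF x] by (simp add: nn_def zz_def)
  fix i
  show "?d (Suc i) x ` carrier (Fib (?P (i + 2)) x) = {a : carrier (Fib (?P (Suc i)) x). ?d i x a = \<zero>\<^bsub>Fib (?P i) x\<^esub>}"
  proof (cases i)
  case 0
  have z: "\<zero>\<^bsub>ME x\<^esub> = (%k. \<zero>)" "\<zero>\<^bsub>MV x\<^esub> = (%k. \<zero>)" by (simp_all add: free_mod_def)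
  have "(%k. \<zero>) : carrier (ME x)" by (simp add: free_mod_def)
  moreover have "lext (bd x) (%k. \<zero>) = \<zero>\<^bsub>MV x\<^esub>"
  using linear_maps_zero[OF module_free_mod module_free_mod bd_linear[OF x]] by (simp add: z)
  ultimately have "{a : carrier (ME x). lext (bd x) a = \<zero>\<^bsub>MV x\<^esub>} = {%k. \<zero>}"
  using bd_inj[OF x] unfolding z by auto
  then show ?thesis using 0 empty[of 0 2 x] by (simp add: c0 nn_def zz_def numeral_2_eq_2)
  next
  case (Suc j)
  then show ?thesis using empty[of "Suc j" "Suc (Suc (Suc j))" x] empty[of j "Suc (Suc j)" x] by (simp add: c0) (simp add: free_mod_def)
  qed
 qed
 have zero: "zero_mod (Fib (?P i) x)" if i: "i > 1" for i x
 proof -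
  obtain j where "i = Suc (Suc j)" using i less_imp_Suc_add[of 1 i] by auto
  then show ?thesis using empty[of j i x] by (simp add: zero_mod_def c0) (simp add: free_mod_def)
 qed
 have "cat_cd R C <= enat 1" unfolding cat_cd_def
  by (rule Inf_lower, rule CollectI, rule exI[of _ 1], rule conjI[OF refl])
  (intro exI conjI allI impI ballI, rule res, rule zero)
 then show cd: "cat_cd R C <= 1" by (simp add: one_enat_def)
 have "cat_cd R C < \<infinity>" using cd by (rule le_less_trans) simp
 then show "type_FP R C" unfolding type_FP_def using res sum_module_fin_generated[OF zz] by blast
qed

end

section \<open>The orbit category\<close>

lemma orbit_cat_simps:
 "Obj (orbit_cat G) = {lcosets\<^bsub>G\<^esub> H | H. subgroup H G & finite H}"
 "Hom (orbit_cat G) X Y = {f : X \<rightarrow>\<^sub>E Y. \<forall>g\<in>carrier G. \<forall>A\<in>X. f (g <#\<^bsub>G\<^esub> A) = g <#\<^bsub>G\<^esub> f A}"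
 "Id (orbit_cat G) X = (\<lambda>A\<in>X. A)" "Comp (orbit_cat G) X g f = compose X g f"
 by (simp_all add: orbit_cat_def)

lemma Hom_orbitD:
 assumes "f : Hom (orbit_cat G) X Y"
 shows "A : X ==> f A : Y" "f : extensional X" "[|g : carrier G; A : X|] ==> f (g <#\<^bsub>G\<^esub> A) = g <#\<^bsub>G\<^esub> f A"
 using assms by (auto simp: orbit_cat_simps(2) PiE_def)

context group
begin

lemma lcosetI: "a : carrier G ==> a <# H : lcosets H" unfolding LCOSETS_def by blast

lemma lcosetE: assumes "A : lcosets H" obtains a where "a : carrier G" "A = a <# H"
 using assms unfolding LCOSETS_def by blast

lemma subgroup_lcoset: assumes "subgroup H G" shows "H : lcosets H"
 using lcosetI[OF one_closed, of H] coset_join3[OF one_closed assms subgroup.one_closed[OF assms]] by simp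

lemma lcoset_transl: assumes H: "subgroup H G" and A: "A : lcosets H" and g: "g : carrier G" shows "g <# A : lcosets H"
proof -
 obtain a where a: "a : carrier G" "A = a <# H" using A by (rule lcosetE)
 have "g <# A = (g \<otimes> a) <# H" unfolding a(2) by (rule lcos_m_assoc[OF subgroup.subset[OF H] g a(1)])
 then show ?thesis using lcosetI[of "g \<otimes> a" H] g a(1) by simp
qed

text \<open>An object is only the set of cosets; the subgroup is recovered as the coset that
  contains the identity.\<close>

definition base :: "'a set set => 'a set" where "base X = (THE A. A : X & \<one> : A)"

lemma base_lcosets [simp]: assumes H: "subgroup H G" shows "base (lcosets H) = H"
 unfolding base_def
proof (rule the_equality)
 show "H : lcosets H & \<one> : H" using subgroup_lcoset[OF H] subgroup.one_closed[OF H] by simp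
 fix A assume A: "A : lcosets H & \<one> : A"
 then obtain a where a: "a : carrier G" "A = a <# H" using lcosetE by blast
 then obtain h where h: "h : H" "\<one> = a \<otimes> h" using A unfolding l_coset_def by blast
 have hG: "h : carrier G" using subgroup.subset[OF H] h(1) by (rule subsetD)
 have "a = inv h" using inv_unique'[OF a(1) hG] h(2) inv_equality[of a h] a(1) hG by simp
 then have "a : H" using subgroup.m_inv_closed[OF H h(1)] by simp
 then show "A = H" unfolding a(2) by (rule coset_join3[OF a(1) H])
qed

lemma category_orbit_cat: "category (orbit_cat G)"
proof
 fix X assume "X : Obj (orbit_cat G)"
 then obtain H where H: "subgroup H G" "X = lcosets H" unfolding orbit_cat_simps by blast
 show "Id (orbit_cat G) X : Hom (orbit_cat G) X X"
  unfolding orbit_cat_simps using lcoset_transl[OF H(1)] H(2) by auto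
next
 fix X Y Z f g assume o: "X : Obj (orbit_cat G)" and f: "f : Hom (orbit_cat G) X Y" and g: "g : Hom (orbit_cat G) Y Z"
 obtain H where H: "subgroup H G" "X = lcosets H" using o unfolding orbit_cat_simps by blast
 note fD = Hom_orbitD[OF f] and gD = Hom_orbitD[OF g]
 have "compose X g f : X \<rightarrow>\<^sub>E Z" using fD(1) gD(1) by (auto simp: compose_def)
 moreover have "compose X g f (y <# A) = y <# compose X g f A" if "y : carrier G" "A : X" for y A
 proof -
  have "y <# A : X" using lcoset_transl[OF H(1)] that H(2) by simp
  then show ?thesis using that fD(3)[OF that] gD(3)[OF that(1) fD(1)[OF that(2)]] by (simp add: compose_def)
 qed
 ultimately show "Comp (orbit_cat G) X g f : Hom (orbit_cat G) X Z" unfolding orbit_cat_simps by blast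
next
 fix X Z f assume f: "f : Hom (orbit_cat G) X Z"
 show "Comp (orbit_cat G) X f (Id (orbit_cat G) X) = f"
  unfolding orbit_cat_simps by (rule extensionalityI[of _ X]) (use Hom_orbitD(2)[OF f] in "auto simp: compose_def")
next
 fix X Y Z W f g h assume f: "f : Hom (orbit_cat G) X Y"
 show "Comp (orbit_cat G) X (Comp (orbit_cat G) Y h g) f = Comp (orbit_cat G) X h (Comp (orbit_cat G) X g f)"
  unfolding orbit_cat_simps by (rule extensionalityI[of _ X]) (use Hom_orbitD(1)[OF f] in "auto simp: compose_def")
qed

lemma category_group_cat: "category (group_cat G)"
 by unfold_locales (auto simp: group_cat_def m_assoc)

end

section \<open>The action on the line\<close>

context group
begin

lemma conj_int_pow: assumes "g : carrier G" "x : carrier G" shows "g \<otimes> x [^] (k::int) \<otimes> inv g = (g \<otimes> x \<otimes> inv g) [^] k"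
proof -
 have "(%x. g \<otimes> x \<otimes> inv g) : hom G G"
 proof (rule homI)
  fix x y assume xy: "x : carrier G" "y : carrier G"
  have "g \<otimes> x \<otimes> inv g \<otimes> (g \<otimes> y \<otimes> inv g) = g \<otimes> x \<otimes> (inv g \<otimes> g) \<otimes> y \<otimes> inv g"
  using xy assms(1) by (simp only: m_assoc inv_closed m_closed)
  also have "... = g \<otimes> (x \<otimes> y) \<otimes> inv g" using xy assms(1) by (simp add: m_assoc)
  finally show "g \<otimes> (x \<otimes> y) \<otimes> inv g = g \<otimes> x \<otimes> inv g \<otimes> (g \<otimes> y \<otimes> inv g)" by simp
 qed (use assms in simp)
 then interpret h: group_hom G G "%x. g \<otimes> x \<otimes> inv g" by unfold_locales
 show ?thesis by (rule h.hom_int_pow[OF assms(2)])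
qed

lemma conj_mult:
 assumes "g : carrier G" "h : carrier G" "x : carrier G"
 shows "(g \<otimes> h) \<otimes> x \<otimes> inv (g \<otimes> h) = g \<otimes> (h \<otimes> x \<otimes> inv h) \<otimes> inv g"
 using assms by (simp add: inv_mult_group m_assoc)

lemma r_cancel: "[|x : carrier G; y : carrier G|] ==> x \<otimes> (inv x \<otimes> y) = y" "[|x : carrier G; y : carrier G|] ==> inv x \<otimes> (x \<otimes> y) = y"
 by (simp_all add: m_assoc[symmetric])

text \<open>A suitable power \<open>u\<close> of \<open>t\<close> generates a normal subgroup.
  Conjugation by \<open>g\<close> and by its inverse then raise \<open>u\<close> to integer
  exponents with product 1, hence to the power 1 or -1.\<close>

lemma virt_cyclic_normal:
 assumes "virt_cyclic G"
 obtains u F where "u : carrier G" "finite F" "F \<subseteq> carrier G" "!!n::int. u [^] n = \<one> ==> n = 0"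
  "!!x. x : carrier G ==> \<exists>n::int. \<exists>f\<in>F. x = u [^] n \<otimes> f"
  "!!g. g : carrier G ==> g \<otimes> u \<otimes> inv g = u \<or> g \<otimes> u \<otimes> inv g = inv u"
proof -
 obtain t F where tF: "t : carrier G" "finite F" "F \<subseteq> carrier G" "\<forall>n::int. t [^] n = \<one> --> n = 0"
  "\<forall>x\<in>carrier G. \<exists>n::int. \<exists>f\<in>F. x = t [^] n \<otimes> f" using assms by (rule virt_cyclicD)
 note t = tF(1)
 have tp: "t [^] (a + b) = t [^] a \<otimes> t [^] b" for a b :: int using t by (rule int_pow_mult)
 have tpp: "(t [^] a) [^] b = t [^] (a * b)" for a b :: int using t by (simp add: int_pow_pow)
 have tinj: "a = b" if "t [^] a = t [^] b" for a b :: int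
  using inj_pow[OF t] tF(4) that by (auto simp: inj_def)
 have Fin: "f : carrier G" if "f : F" for f using tF(3) that by blast
 have ex_m: "\<exists>m>0. \<exists>k::int. g \<otimes> t [^] (m::int) \<otimes> inv g = t [^] k" if g: "g : carrier G" for g
 proof -
  \<comment> \<open>By pigeonhole two elements \<open>g \<otimes> t [^] k\<close> share their
    representative in \<open>F\<close>. Their quotient conjugates a positive power of
    \<open>t\<close> into a power of \<open>t\<close>.\<close>
  have "\<forall>k::nat. EX n. EX f. f : F & g \<otimes> t [^] int k = t [^] (n::int) \<otimes> f" using tF(5) g t by (metis int_pow_closed m_closed)
  then obtain n f where nf: "!!k. f k : F" "!!k::nat. g \<otimes> t [^] int k = t [^] (n k :: int) \<otimes> f k" by metis
  have "\<not> inj f"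
  proof
  assume "inj f"
  moreover have "finite (range f)" using finite_subset[OF _ tF(2)] nf(1) by blast
  ultimately show False using finite_imageD infinite_UNIV_nat by blast
  qed
  then obtain k l where kl: "k < l" "f k = f l" unfolding inj_def by (metis nat_neq_iff)
  have fk: "f k : carrier G" using Fin nf(1) by blast
  have "g \<otimes> t [^] (int l - int k) \<otimes> inv g = (g \<otimes> t [^] int l) \<otimes> inv (g \<otimes> t [^] int k)"
  using g t by (simp add: int_pow_diff inv_mult_group m_assoc)
  also have "... = t [^] n l \<otimes> f k \<otimes> inv (t [^] n k \<otimes> f k)" by (simp only: nf(2) kl(2))
  also have "... = t [^] n l \<otimes> (f k \<otimes> inv (f k)) \<otimes> inv (t [^] n k)"
  using t fk by (simp add: inv_mult_group m_assoc r_cancel)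
  also have "... = t [^] (n l - n k)" using t fk by (simp add: int_pow_diff)
  finally show ?thesis using kl(1) by (intro exI[of _ "int l - int k"]) auto
 qed
 then have "\<forall>f\<in>F. \<exists>m>0. \<exists>k::int. f \<otimes> t [^] (m::int) \<otimes> inv f = t [^] k" using Fin by blast
 then have "EX m. \<forall>f\<in>F. m f > 0 & (\<exists>k::int. f \<otimes> t [^] (m f::int) \<otimes> inv f = t [^] k)" by (rule bchoice)
 then obtain m where m: "!!f. f : F ==> m f > 0 & (\<exists>k::int. f \<otimes> t [^] (m f::int) \<otimes> inv f = t [^] k)" by blast
 \<comment> \<open>One exponent for all \<open>g\<close>: it works for the representatives in
   \<open>F\<close>, and the factor of \<open>g\<close> that is a power of \<open>t\<close> does not
   matter for conjugating within the powers of \<open>t\<close>.\<close>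
 define N where "N = (\<Prod>f\<in>F. m f)"
 have N0: "N > 0" unfolding N_def by (rule prod_pos) (use m in blast)
 have N: "\<exists>k::int. g \<otimes> t [^] N \<otimes> inv g = t [^] k" if g: "g : carrier G" for g
 proof -
  obtain n f where nf: "f : F" "g = t [^] (n::int) \<otimes> f" using tF(5) g by blast
  obtain a :: int where a: "f \<otimes> t [^] m f \<otimes> inv f = t [^] a" using m[OF nf(1)] by blast
  have "m f dvd N" unfolding N_def by (rule dvd_prodI[OF tF(2) nf(1)])
  then obtain c where c: "N = m f * c" by (rule dvdE)
  have "f \<otimes> t [^] N \<otimes> inv f = t [^] (a * c)"
  unfolding c tpp[symmetric] using conj_int_pow[OF Fin[OF nf(1)], of "t [^] m f" c] t by (simp add: a tpp)
  then have "g \<otimes> t [^] N \<otimes> inv g = t [^] n \<otimes> t [^] (a * c) \<otimes> inv (t [^] n)"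
  unfolding nf(2) using conj_mult[of "t [^] n" f "t [^] N"] t Fin[OF nf(1)] by simp
  also have "... = t [^] (n + a * c + - n)" using t by (simp only: tp int_pow_neg)
  finally show ?thesis by blast
 qed
 \<comment> \<open>The least such \<open>n\<close> is taken. If a conjugate of
   \<open>t [^] n\<close> were \<open>t [^] k\<close> with \<open>n\<close> not dividing
   \<open>k\<close>, the remainder of \<open>k\<close> would be a smaller exponent of the same
   kind.\<close>
 define S where "S n \<longleftrightarrow> n > 0 & (\<forall>g\<in>carrier G. \<exists>k::int. g \<otimes> t [^] int n \<otimes> inv g = t [^] k)" for n :: nat
 have "S (nat N)" using N N0 by (simp add: S_def)
 then have SL: "S (LEAST n. S n)" by (rule LeastI)
 define n where "n = (LEAST n. S n)"
 have n0: "n > 0" and nk: "!!g. g : carrier G ==> \<exists>k::int. g \<otimes> t [^] int n \<otimes> inv g = t [^] k"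
  using SL by (auto simp: S_def n_def)
 have least: "\<not> S r" if "r < n" for r using that not_less_Least unfolding n_def by blast
 let ?u = "t [^] int n"
 have u: "?u : carrier G" using t by simp
 have ex_c: "\<exists>c::int. g \<otimes> ?u \<otimes> inv g = ?u [^] c" if g: "g : carrier G" for g
 proof -
  obtain k :: int where k: "g \<otimes> ?u \<otimes> inv g = t [^] k" using nk[OF g] by blast
  let ?r = "k mod int n" and ?d = "k div int n"
  have "\<not> S (nat ?r)" by (rule least) (use n0 in "simp add: nat_less_iff")
  moreover have "\<exists>j::int. h \<otimes> t [^] ?r \<otimes> inv h = t [^] j" if h: "h : carrier G" for h
  proof -
  obtain a :: int where a: "h \<otimes> g \<otimes> ?u \<otimes> inv (h \<otimes> g) = t [^] a" using nk[of "h \<otimes> g"] g h by blast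
  obtain b :: int where b: "h \<otimes> ?u \<otimes> inv h = t [^] b" using nk[OF h] by blast
  have a': "h \<otimes> t [^] k \<otimes> inv h = t [^] a" using a conj_mult[OF h g u] k by simp
  have b': "h \<otimes> t [^] (int n * - ?d) \<otimes> inv h = t [^] (b * - ?d)"
  unfolding tpp[symmetric] using conj_int_pow[OF h u, of "- ?d"] b by simp
  have "t [^] ?r = t [^] k \<otimes> t [^] (int n * - ?d)"
  unfolding tp[symmetric] by (simp add: minus_div_mult_eq_mod[symmetric] mult.commute)
  then have "h \<otimes> t [^] ?r \<otimes> inv h = (h \<otimes> t [^] k \<otimes> inv h) \<otimes> (h \<otimes> t [^] (int n * - ?d) \<otimes> inv h)"
  using h t by (simp add: m_assoc r_cancel)
  also have "... = t [^] (a + b * - ?d)" unfolding a' b' tp ..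
  finally show ?thesis by blast
  qed
  moreover have "?r >= 0" using n0 by simp
  ultimately have r0: "?r = 0" unfolding S_def by fastforce
  have "k = int n * ?d" using mult_div_mod_eq[of "int n" k] unfolding r0 add_0_right by (rule sym)
  then have "t [^] k = ?u [^] ?d" unfolding tpp by (rule arg_cong)
  then show ?thesis unfolding k by (rule exI)
 qed
 have pm: "g \<otimes> ?u \<otimes> inv g = ?u \<or> g \<otimes> ?u \<otimes> inv g = inv ?u" if g: "g : carrier G" for g
 proof -
  obtain c :: int where c: "g \<otimes> ?u \<otimes> inv g = ?u [^] c" using ex_c[OF g] by blast
  from ex_c[OF inv_closed[OF g]] obtain d :: int where d: "inv g \<otimes> ?u \<otimes> inv (inv g) = ?u [^] d" ..
  have "?u = g \<otimes> inv g \<otimes> ?u \<otimes> inv (g \<otimes> inv g)" unfolding r_inv[OF g] inv_one l_one[OF u] r_one[OF u] ..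
  also have "... = g \<otimes> (inv g \<otimes> ?u \<otimes> inv (inv g)) \<otimes> inv g" by (rule conj_mult[OF g inv_closed[OF g] u])
  also have "... = g \<otimes> ?u [^] d \<otimes> inv g" by (rule arg_cong[OF d, of "%x. g \<otimes> x \<otimes> inv g"])
  also have "... = (g \<otimes> ?u \<otimes> inv g) [^] d" by (rule conj_int_pow[OF g u])
  also have "... = (?u [^] c) [^] d" by (rule arg_cong[OF c, of "%x. x [^] d"])
  finally have "t [^] int n = t [^] (int n * c * d)" unfolding tpp .
  then have "int n = int n * c * d" by (rule tinj)
  then have "c * d = 1" using n0 by (simp add: mult.assoc)
  then have "c = 1 \<or> c = - 1" by (simp add: zmult_eq_1_iff) blast
  then show ?thesis
  proof
  assume "c = 1"
  then show ?thesis unfolding c using int_pow_1[OF u] by simp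
  next
  assume "c = - 1"
  then show ?thesis unfolding c using int_pow_neg[OF u, of 1] int_pow_1[OF u] by simp
  qed
 qed
 \<comment> \<open>Representatives for the powers of \<open>?u\<close> are obtained from those of
   \<open>t\<close> by adding remainders of the exponents modulo \<open>n\<close>.\<close>
 define F' where "F' = (\<lambda>(r, f). t [^] r \<otimes> f) ` ({0..<int n} \<times> F)"
 show ?thesis
 proof (rule that[of ?u F'])
  show "finite F'" unfolding F'_def using tF(2) by simp
  show "F' \<subseteq> carrier G" unfolding F'_def using t Fin by auto
  show "k = 0" if "?u [^] (k::int) = \<one>" for k using that tF(4) n0 by (auto simp: tpp)
  show "\<exists>k::int. \<exists>f\<in>F'. x = ?u [^] k \<otimes> f" if x: "x : carrier G" for x
  proof -
  obtain k f where kf: "f : F" "x = t [^] (k::int) \<otimes> f" using tF(5) x by blast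
  have "t [^] k = ?u [^] (k div int n) \<otimes> t [^] (k mod int n)" unfolding tpp tp[symmetric] by simp
  then have "x = ?u [^] (k div int n) \<otimes> (t [^] (k mod int n) \<otimes> f)" using kf t Fin by (simp add: m_assoc)
  moreover have "t [^] (k mod int n) \<otimes> f : F'" unfolding F'_def
  by (rule image_eqI[of _ _ "(k mod int n, f)"]) (use kf n0 in auto)
  ultimately show ?thesis by blast
  qed
 qed (use u pm in auto)
qed

end

text \<open>A virtually cyclic group acts on \<open>\<int>\<close> with finite stabilisers: \<open>sgm\<close> is the action by
  conjugation on the normal subgroup generated by \<open>t\<close>, and \<open>tr\<close> is the transfer to it.\<close>

locale normal_cyclic = inf_cyclic +
 fixes F
 assumes F: "finite F" "F \<subseteq> carrier G" and cover: "x : carrier G ==> \<exists>n::int. \<exists>f\<in>F. x = t [^] n \<otimes> f"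
  and conj: "g : carrier G ==> g \<otimes> t \<otimes> inv g = t \<or> g \<otimes> t \<otimes> inv g = inv t"
begin

definition sgm :: "'a => int" where "sgm g = (if g \<otimes> t \<otimes> inv g = t then 1 else - 1)"

lemma sgm_cases: "sgm g = 1 \<or> sgm g = - 1" by (simp add: sgm_def)

lemma comm_pw: assumes g: "g : carrier G" shows "g \<otimes> pw k = pw (sgm g * k) \<otimes> g"
proof -
 have "g \<otimes> t \<otimes> inv g = pw (sgm g)" using conj[OF g] by (auto simp: sgm_def int_pow_neg)
 then have "g \<otimes> pw k \<otimes> inv g = pw (sgm g * k)" using conj_int_pow[OF g t_in, of k] by (simp add: int_pow_pow)
 then have "g \<otimes> pw k \<otimes> inv g \<otimes> g = pw (sgm g * k) \<otimes> g" by simp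
 then show ?thesis using g by (simp add: m_assoc)
qed

definition "T = rep ` carrier G"

lemma T_fin: "finite T"
proof -
 have "T \<subseteq> rep ` F"
 proof
  fix y assume "y : T"
  then obtain x where x: "x : carrier G" "y = rep x" unfolding T_def by (rule imageE)
  obtain n f where nf: "f : F" "x = pw n \<otimes> f" using cover[OF x(1)] by blast
  then have "y = rep f" using F(2) x(2) by auto
  then show "y : rep ` F" using nf(1) by (rule image_eqI)
 qed
 then show ?thesis by (rule finite_subset) (simp add: F(1))
qed

lemma T_in: "x : T ==> x : carrier G" unfolding T_def by auto

lemma rep_T: "x : carrier G ==> rep x : T" unfolding T_def by simp

lemma rep_rep [simp]: assumes "x : carrier G" shows "rep (rep x) = rep x"
proof -
 obtain k where "rep x = pw k \<otimes> x" using rep_ex by blast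
 then show ?thesis using assms rep_pw by metis
qed

lemma T_rep: "x : T ==> rep x = x" unfolding T_def by auto

lemma T_nu: assumes "x : T" shows "nu x = 0"
 by (rule nu_eqI) (use T_in[OF assms] T_rep[OF assms] in auto)

definition tr :: "'a => int" where "tr g = (\<Sum>x\<in>T. nu (g \<otimes> x))"

lemma mult_rep:
 assumes "g : carrier G" "x : carrier G"
 shows "g \<otimes> x = pw (sgm g * nu x) \<otimes> (g \<otimes> rep x)"
proof -
 have "g \<otimes> x = g \<otimes> (pw (nu x) \<otimes> rep x)" using nu_rep[OF assms(2)] by simp
 also have "... = (g \<otimes> pw (nu x)) \<otimes> rep x" using assms by (simp add: m_assoc)
 also have "... = pw (sgm g * nu x) \<otimes> (g \<otimes> rep x)" unfolding comm_pw[OF assms(1)] using assms by (simp add: m_assoc)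
 finally show ?thesis .
qed

lemma rep_mult: assumes "g : carrier G" "x : carrier G" shows "rep (g \<otimes> x) = rep (g \<otimes> rep x)"
 by (subst mult_rep[OF assms]) (use assms in simp)

lemma nu_mult: assumes "g : carrier G" "x : carrier G" shows "nu (g \<otimes> x) = sgm g * nu x + nu (g \<otimes> rep x)"
 by (subst mult_rep[OF assms]) (use assms in simp)

lemma T_bij: assumes h: "h : carrier G" shows "bij_betw (%x. rep (h \<otimes> x)) T T"
proof (rule bij_betw_byWitness[of _ "%x. rep (inv h \<otimes> x)"])
 have *: "rep (inv g \<otimes> rep (g \<otimes> x)) = x" if "x : T" "g : carrier G" for g x
  using rep_mult[of "inv g" "g \<otimes> x"] T_in[OF that(1)] that(2) T_rep[OF that(1)] by (simp add: m_assoc[symmetric])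
 show "\<forall>a\<in>T. rep (inv h \<otimes> rep (h \<otimes> a)) = a" using * h by blast
 show "\<forall>a\<in>T. rep (h \<otimes> rep (inv h \<otimes> a)) = a" using *[of _ "inv h"] h by simp
 show "(%x. rep (h \<otimes> x)) ` T \<subseteq> T" "(%x. rep (inv h \<otimes> x)) ` T \<subseteq> T" using h T_in rep_T by auto
qed

lemma sgm_mult: assumes "g : carrier G" "h : carrier G" shows "sgm (g \<otimes> h) = sgm g * sgm h"
proof -
 have "pw (sgm (g \<otimes> h)) \<otimes> (g \<otimes> h) = g \<otimes> h \<otimes> pw 1" using comm_pw[of "g \<otimes> h" 1] assms by simp
 also have "... = g \<otimes> (h \<otimes> pw 1)" using assms by (simp add: m_assoc)
 also have "... = (g \<otimes> pw (sgm h)) \<otimes> h" unfolding comm_pw[OF assms(2)] using assms by (simp add: m_assoc)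
 also have "... = pw (sgm g * sgm h) \<otimes> (g \<otimes> h)" unfolding comm_pw[OF assms(1)] using assms by (simp add: m_assoc)
 finally show ?thesis using pw_inj[of "g \<otimes> h"] assms by simp
qed

text \<open>The transfer computation: left multiplication by \<open>h\<close> permutes the
  transversal \<open>T\<close> up to powers of \<open>t\<close>, and moving these powers past
  \<open>g\<close> contributes the sign. This is the composition law of affine maps.\<close>

lemma tr_mult: assumes "g : carrier G" "h : carrier G" shows "tr (g \<otimes> h) = sgm g * tr h + tr g"
proof -
 have "tr (g \<otimes> h) = (\<Sum>x\<in>T. sgm g * nu (h \<otimes> x) + nu (g \<otimes> rep (h \<otimes> x)))"
  unfolding tr_def by (rule sum.cong) (use assms T_in nu_mult[of g "h \<otimes> _"] in "auto simp: m_assoc")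
 also have "... = sgm g * tr h + (\<Sum>x\<in>T. nu (g \<otimes> rep (h \<otimes> x)))"
  by (simp add: sum.distrib sum_distrib_left tr_def)
 also have "(\<Sum>x\<in>T. nu (g \<otimes> rep (h \<otimes> x))) = tr g"
  unfolding tr_def by (rule sum.reindex_bij_betw[OF T_bij[OF assms(2)]])
 finally show ?thesis .
qed

text \<open>The factor 4 confines the action to maps that preserve the parity separating vertices
  from edges and the orientation of edges by residues modulo 4.\<close>

definition act :: "'a => int => int" where "act g m = sgm g * m + 4 * tr g"

lemma act_mult: "[|g : carrier G; h : carrier G|] ==> act (g \<otimes> h) m = act g (act h m)"
 by (simp add: act_def sgm_mult tr_mult algebra_simps)

lemma sgm_one [simp]: "sgm \<one> = 1" by (simp add: sgm_def)

lemma tr_one [simp]: "tr \<one> = 0" unfolding tr_def by (rule sum.neutral) (use T_in T_nu in auto)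

lemma act_one [simp]: "act \<one> m = m" by (simp add: act_def)

lemma act_inv: assumes "g : carrier G" shows "act (inv g) (act g m) = m" "act g (act (inv g) m) = m"
 using act_mult[of "inv g" g m] act_mult[of g "inv g" m] assms by simp_all

lemma act_pw: "act (pw k) m = m + 4 * (k * int (card T))"
proof -
 have "pw k \<otimes> t \<otimes> inv (pw k) = pw (k + 1 + - k)" by (simp only: pw_add int_pow_neg[OF t_in] int_pow_1[OF t_in])
 then have "sgm (pw k) = 1" by (simp add: sgm_def)
 moreover have "tr (pw k) = (\<Sum>x\<in>T. k)" unfolding tr_def by (rule sum.cong) (use T_in T_nu in auto)
 ultimately show ?thesis by (simp add: act_def)
qed

lemma card_T: "card T > 0" using T_fin rep_T[OF one_closed] by (auto simp: card_gt_0_iff)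

lemma act_even [simp]: "even (act g m) = even m" using sgm_cases[of g] by (auto simp: act_def)

definition "Stab m = {g : carrier G. act g m = m}"

lemma Stab_subgroup: "subgroup (Stab m) G"
proof
 show "inv x : Stab m" if "x : Stab m" for x using that act_inv(1)[of x m] by (simp add: Stab_def)
qed (auto simp: Stab_def act_mult)

text \<open>Nontrivial powers of \<open>t\<close> act by nonzero translations, so a stabiliser meets
  each of the finitely many cosets of these powers at most once.\<close>

lemma Stab_finite: "finite (Stab m)"
proof (rule finite_imageD)
 show "finite (rep ` Stab m)" by (rule finite_subset[OF _ T_fin]) (auto simp: Stab_def rep_T)
 show "inj_on rep (Stab m)"
 proof (rule inj_onI)
  fix g h assume gh: "g : Stab m" "h : Stab m" "rep g = rep h"
  then have c: "g : carrier G" "h : carrier G" and a: "act g m = m" "act h m = m" by (auto simp: Stab_def)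
  have r: "rep h : carrier G" using c by simp
  have "act (pw (nu g)) (act (rep h) m) = m" "act (pw (nu h)) (act (rep h) m) = m"
  using act_mult[OF pw_in r, of "nu g" m] act_mult[OF pw_in r, of "nu h" m] nu_rep[OF c(1)] nu_rep[OF c(2)] gh(3) a by simp_all
  then have "nu g * int (card T) = nu h * int (card T)" unfolding act_pw by linarith
  then have "nu g = nu h" using card_T by simp
  then have "pw (nu g) \<otimes> rep g = pw (nu h) \<otimes> rep h" unfolding gh(3) by (rule arg_cong)
  then show "g = h" unfolding nu_rep[OF c(1)] nu_rep[OF c(2)] .
 qed
qed

definition "Fix H = {m. \<forall>h\<in>H. act h m = m}"

text \<open>On the powers of \<open>h\<close> the transfer is multiplication of the exponent by
  \<open>tr h\<close>, while \<open>h\<close> has only finitely many powers.\<close>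

lemma torsion_translation:
 assumes H: "subgroup H G" "finite H" and h: "h : H" "sgm h = 1" shows "tr h = 0"
proof -
 have hG: "h : carrier G" using subgroup.subset[OF H(1)] h(1) by blast
 have p: "h [^] k : H & sgm (h [^] k) = 1 & tr (h [^] k) = int k * tr h" for k :: nat
 proof (induction k)
  case 0
  then show ?case using subgroup.one_closed[OF H(1)] by simp
 next
  case (Suc k)
  then show ?case using subgroup.m_closed[OF H(1)] h hG by (simp add: sgm_mult tr_mult algebra_simps)
 qed
 have "\<not> inj (\<lambda>k::nat. h [^] k)"
 proof
  assume "inj (\<lambda>k::nat. h [^] k)"
  moreover have "finite (range (\<lambda>k::nat. h [^] k))" by (rule finite_subset[OF _ H(2)]) (use p in blast)
  ultimately show False using finite_imageD infinite_UNIV_nat by blast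
 qed
 then obtain k l :: nat where "h [^] k = h [^] l" "k ~= l" unfolding inj_def by blast
 then show ?thesis using p[of k] p[of l] by simp
qed

text \<open>An element \<open>h0\<close> of sign -1 reflects the line about
  \<open>2 * tr h0\<close>, an even number and so a vertex. The product of two such elements of
  \<open>H\<close> is a translation of finite order, hence trivial, so all of them have the same
  fixed point.\<close>

lemma Fix_cases:
 assumes H: "subgroup H G" "finite H" shows "Fix H = UNIV \<or> (EX j. Fix H = {2 * j})"
proof (cases "\<forall>h\<in>H. sgm h = 1")
 case True
 then show ?thesis using torsion_translation[OF H] by (auto simp: Fix_def act_def)
next
 case False
 then obtain h0 where h0: "h0 : H" "sgm h0 = - 1" using sgm_cases by blast
 have HG: "h : carrier G" if "h : H" for h using subgroup.subset[OF H(1)] that by blast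
 have fx: "act h (2 * tr h0) = 2 * tr h0" if h: "h : H" for h
 proof (cases "sgm h = 1")
  case True
  then show ?thesis using torsion_translation[OF H h] by (simp add: act_def)
 next
  case False
  then have s: "sgm h = - 1" using sgm_cases by blast
  have "tr (h \<otimes> h0) = 0"
  by (rule torsion_translation[OF H subgroup.m_closed[OF H(1) h h0(1)]]) (use s h0 HG h in "simp add: sgm_mult")
  then have "tr h = tr h0" using tr_mult[of h h0] HG h h0 s by simp
  then show ?thesis using s by (simp add: act_def)
 qed
 have "m = 2 * tr h0" if "act h0 m = m" for m using that h0(2) by (simp add: act_def)
 then have "Fix H = {2 * tr h0}" unfolding Fix_def using fx h0(1) by blast
 then show ?thesis by blast
qed

text \<open>The powers of \<open>t\<close> act as translations by multiples of
  \<open>c = 4 * int (card T)\<close>, so every orbit meets a finite interval. The choice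
  \<open>w m\<close> is made from the orbit and therefore is the same for all its points.\<close>

lemma orbit_reps:
 "\<exists>(n::nat) v. (\<forall>i<n. even (v i) = b) &
  (\<forall>i<n. \<forall>j<n. \<forall>g\<in>carrier G. \<forall>h\<in>carrier G. act g (v i) = act h (v j) --> i = j) &
  (ALL m. even m = b --> (\<exists>i<n. \<exists>g\<in>carrier G. act g (v i) = m))"
proof -
 define orb where "orb m = {act g m | g. g : carrier G}" for m
 define c where "c = 4 * int (card T)"
 have c0: "c > 0" using card_T by (simp add: c_def)
 have orb_eq: "orb m = orb m'" if mm: "act g m = act h m'" "g : carrier G" "h : carrier G" for m m' g h
 proof -
  have sub: "orb m \<subseteq> orb m'" if "act g m = act h m'" "g : carrier G" "h : carrier G" for m m' g h
  proof
  fix x assume "x : orb m"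
  then obtain y where y: "y : carrier G" "x = act y m" unfolding orb_def by blast
  have "x = act (y \<otimes> inv g \<otimes> h) m'" using y that act_inv(1)[of g m] by (simp add: act_mult)
  then show "x : orb m'" unfolding orb_def using y that by blast
  qed
  show ?thesis using sub[OF mm] sub[OF mm(1)[symmetric] mm(3,2)] by blast
 qed
 define w where "w m = (SOME x. x : orb m \<inter> {0..<c})" for m
 have w: "w m : orb m \<inter> {0..<c}" for m
  unfolding w_def
 proof (rule someI)
  have "act (pw (- (m div c))) m = m mod c"
  unfolding act_pw c_def[symmetric] by (simp add: c_def minus_div_mult_eq_mod[symmetric] algebra_simps)
  then show "m mod c : orb m \<inter> {0..<c}" unfolding orb_def using c0 by (auto intro!: exI[of _ "pw (- (m div c))"])
 qed
 obtain \<gamma> where \<gamma>: "!!m. \<gamma> m : carrier G & w m = act (\<gamma> m) m" using w unfolding orb_def by (simp add: Int_iff) metis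
 define Rp where "Rp = w ` {m. even m = b}"
 have "finite Rp" by (rule finite_subset[of _ "{0..<c}"]) (use w in "auto simp: Rp_def")
 then obtain v where v: "bij_betw v {0..<card Rp} Rp" using ex_bij_betw_nat_finite by blast
 have vR: "EX m. even m = b & v i = w m" if "i < card Rp" for i
 proof -
  have "v i : v ` {0..<card Rp}" by (rule imageI) (use that in simp)
  then have "v i : Rp" unfolding bij_betw_imp_surj_on[OF v] .
  then show ?thesis unfolding Rp_def by (rule imageE) blast
 qed
 show ?thesis
 proof (rule exI[of _ "card Rp"], rule exI[of _ v], intro conjI allI impI ballI)
  fix i assume i: "i < card Rp"
  obtain m where m: "even m = b" "v i = w m" using vR[OF i] by blast
  then show "even (v i) = b" using \<gamma>[of m] by simp
  fix j g h assume j: "j < card Rp" and g: "g : carrier G" and h: "h : carrier G" and e: "act g (v i) = act h (v j)"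
  obtain m' where m': "v j = w m'" using vR[OF j] by blast
  have "act (g \<otimes> \<gamma> m) m = act (h \<otimes> \<gamma> m') m'" using e m m' \<gamma> g h by (simp add: act_mult)
  then have "orb m = orb m'" by (rule orb_eq) (use \<gamma> g h in auto)
  then have "v i = v j" unfolding m(2) m' w_def by simp
  then show "i = j" using v i j by (auto simp: bij_betw_def inj_on_def)
 next
  fix m :: int assume m: "even m = b"
  then have "w m : v ` {0..<card Rp}" using v by (auto simp: bij_betw_def Rp_def)
  then obtain i where i: "i < card Rp" "w m = v i" by auto
  have "act (inv (\<gamma> m)) (act (\<gamma> m) m) = m" by (rule act_inv(1)) (use \<gamma>[of m] in simp)
  then have "act (inv (\<gamma> m)) (v i) = m" using \<gamma>[of m] i(2) by simp
  then show "\<exists>i<card Rp. \<exists>g\<in>carrier G. act g (v i) = m" using i \<gamma>[of m] by blast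
 qed
qed

end

section \<open>Equivariant maps to orbits of the line\<close>

context normal_cyclic
begin

abbreviation "OC \<equiv> orbit_cat G"

text \<open>Cosets of the stabiliser of \<open>v\<close> correspond to points of its orbit, which
  lets cosets be handled through points of the line.\<close>

lemma coset_Stab: assumes y: "y : carrier G" shows "y <# Stab v = {x : carrier G. act x v = act y v}"
proof (intro equalityI subsetI)
 fix x assume "x : y <# Stab v"
 then obtain s where "s : Stab v" "x = y \<otimes> s" unfolding l_coset_def by blast
 then show "x : {x : carrier G. act x v = act y v}" using y by (simp add: Stab_def act_mult)
next
 fix x assume "x : {x : carrier G. act x v = act y v}"
 then have x: "x : carrier G" "act x v = act y v" by auto
 have "inv y \<otimes> x : Stab v" using x y act_inv(1)[OF y, of v] by (simp add: Stab_def act_mult)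
 moreover have "x = y \<otimes> (inv y \<otimes> x)" using x(1) y by (simp add: r_cancel)
 ultimately show "x : y <# Stab v" unfolding l_coset_def by blast
qed

lemma Hom_Stab:
 assumes H: "subgroup H G" and k: "k : Hom OC (lcosets H) (lcosets (Stab v))"
 obtains g where "g : carrier G" "\<forall>a\<in>carrier G. k (a <# H) = {x : carrier G. act x v = act (a \<otimes> g) v}"
  "k H = {x : carrier G. act x v = act g v}"
proof -
 have kH: "k H : lcosets (Stab v)" by (rule Hom_orbitD(1)[OF k subgroup_lcoset[OF H]])
 obtain g where g: "g : carrier G" "k H = g <# Stab v" using kH by (rule lcosetE)
 show ?thesis
 proof (rule that[OF g(1)])
  show "k H = {x : carrier G. act x v = act g v}" unfolding g(2) by (rule coset_Stab[OF g(1)])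
  show "\<forall>a\<in>carrier G. k (a <# H) = {x : carrier G. act x v = act (a \<otimes> g) v}"
  proof
  fix a assume a: "a : carrier G"
  have "k (a <# H) = a <# (g <# Stab v)" using Hom_orbitD(3)[OF k a subgroup_lcoset[OF H]] g(2) by simp
  also have "... = (a \<otimes> g) <# Stab v" by (rule lcos_m_assoc[OF subgroup.subset[OF Stab_subgroup] a g(1)])
  also have "... = {x : carrier G. act x v = act (a \<otimes> g) v}" by (rule coset_Stab) (use a g in simp)
  finally show "k (a <# H) = {x : carrier G. act x v = act (a \<otimes> g) v}" .
  qed
 qed
qed

text \<open>A \<open>G\<close>-map from the cosets of \<open>H\<close> to those of
  \<open>Stab v\<close> is determined by the point \<open>act g v\<close> with \<open>g\<close> in
  the image of \<open>H\<close>, and this point is fixed by \<open>H\<close>. The length of the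
  coding list tells which orbit representative is meant.\<close>

definition lv :: "(nat => int) => 'a set set => ('a set => 'a set) list => int"
 where "lv vs X l = act (SOME g. g : hd l (base X)) (vs (length l - 1))"

lemma lv_eq:
 assumes H: "subgroup H G" and k: "k : Hom OC (lcosets H) (lcosets (Stab (vs i)))" and g: "g : k H"
 shows "lv vs (lcosets H) (copies i k) = act g (vs i)"
proof -
 obtain g0 where "g0 : carrier G" "\<forall>a\<in>carrier G. k (a <# H) = {x : carrier G. act x (vs i) = act (a \<otimes> g0) (vs i)}"
  and g0: "k H = {x : carrier G. act x (vs i) = act g0 (vs i)}" by (rule Hom_Stab[OF H k])
 have "(SOME g. g : k H) : k H" using g by (rule someI)
 then have "act (SOME g. g : k H) (vs i) = act g (vs i)" using g unfolding g0 by simp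
 then show ?thesis unfolding lv_def by (simp add: H)
qed

abbreviation "orb_obj vs \<equiv> (%i. lcosets (Stab (vs i)))"

lemma lv_bij:
 assumes H: "subgroup H G"
  and dist: "!!i j g h. [|i < n; j < n; g : carrier G; h : carrier G; act g (vs i) = act h (vs j)|] ==> i = j"
 shows "bij_betw (lv vs (lcosets H)) (sum_basis OC n (orb_obj vs) (lcosets H))
  {m : Fix H. \<exists>i<n. \<exists>g\<in>carrier G. act g (vs i) = m}"
 unfolding bij_betw_def
proof (intro conjI equalityI subsetI)
 have HG: "h : carrier G" if "h : H" for h using subgroup.subset[OF H] that by (rule subsetD)
 show "inj_on (lv vs (lcosets H)) (sum_basis OC n (orb_obj vs) (lcosets H))"
 proof (rule inj_onI)
  fix l l' assume l: "l : sum_basis OC n (orb_obj vs) (lcosets H)" and l': "l' : sum_basis OC n (orb_obj vs) (lcosets H)"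
  and eq: "lv vs (lcosets H) l = lv vs (lcosets H) l'"
  obtain i k where i: "i < n" and k: "k : Hom OC (lcosets H) (lcosets (Stab (vs i)))" and lk: "l = copies i k" using l by (rule sum_basisE)
  obtain j k' where j: "j < n" and k': "k' : Hom OC (lcosets H) (lcosets (Stab (vs j)))" and lk': "l' = copies j k'" using l' by (rule sum_basisE)
  obtain g where g: "g : carrier G" "\<forall>a\<in>carrier G. k (a <# H) = {x : carrier G. act x (vs i) = act (a \<otimes> g) (vs i)}"
  "k H = {x : carrier G. act x (vs i) = act g (vs i)}" by (rule Hom_Stab[OF H k])
  obtain g' where g': "g' : carrier G" "\<forall>a\<in>carrier G. k' (a <# H) = {x : carrier G. act x (vs j) = act (a \<otimes> g') (vs j)}"
  "k' H = {x : carrier G. act x (vs j) = act g' (vs j)}" by (rule Hom_Stab[OF H k'])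
  have "lv vs (lcosets H) l = act g (vs i)" unfolding lk by (rule lv_eq[where vs = vs and i = i, OF H k]) (simp add: g)
  moreover have "lv vs (lcosets H) l' = act g' (vs j)" unfolding lk' by (rule lv_eq[where vs = vs and i = j, OF H k']) (simp add: g')
  ultimately have e: "act g (vs i) = act g' (vs j)" using eq by simp
  then have ij: "i = j" by (rule dist[OF i j g(1) g'(1)])
  have "k = k'"
  proof (rule extensionalityI[OF Hom_orbitD(2)[OF k] Hom_orbitD(2)[OF k']])
  fix A assume "A : lcosets H"
  then obtain a where a: "a : carrier G" "A = a <# H" by (rule lcosetE)
  show "k A = k' A" unfolding a(2) g(2)[rule_format, OF a(1)] g'(2)[rule_format, OF a(1)] using e ij a(1) g(1) g'(1) by (simp add: act_mult)
  qed
  then show "l = l'" unfolding lk lk' ij by simp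
 qed
 fix m assume "m : lv vs (lcosets H) ` sum_basis OC n (orb_obj vs) (lcosets H)"
 then obtain l where l: "l : sum_basis OC n (orb_obj vs) (lcosets H)" and m: "m = lv vs (lcosets H) l" by (rule imageE)
 obtain i k where i: "i < n" and k: "k : Hom OC (lcosets H) (lcosets (Stab (vs i)))" and lk: "l = copies i k" using l by (rule sum_basisE)
 obtain g where g: "g : carrier G" "\<forall>a\<in>carrier G. k (a <# H) = {x : carrier G. act x (vs i) = act (a \<otimes> g) (vs i)}"
  "k H = {x : carrier G. act x (vs i) = act g (vs i)}" by (rule Hom_Stab[OF H k])
 have mg: "m = act g (vs i)" unfolding m lk by (rule lv_eq[where vs = vs and i = i, OF H k]) (simp add: g)
 have "act h m = m" if h: "h : H" for h
 proof -
  have e: "k (h <# H) = k H" using coset_join3[OF HG[OF h] H h] by simp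
  have "h \<otimes> g : k (h <# H)" unfolding g(2)[rule_format, OF HG[OF h]] using HG[OF h] g(1) by simp
  then have "h \<otimes> g : k H" unfolding e .
  then have "act (h \<otimes> g) (vs i) = act g (vs i)" unfolding g(3) by simp
  then show ?thesis unfolding mg using HG[OF h] g(1) by (simp add: act_mult)
 qed
 then show "m : {m : Fix H. \<exists>i<n. \<exists>g\<in>carrier G. act g (vs i) = m}" unfolding Fix_def using i g(1) mg by blast
next
 have HG: "h : carrier G" if "h : H" for h using subgroup.subset[OF H] that by (rule subsetD)
 fix m assume "m : {m : Fix H. \<exists>i<n. \<exists>g\<in>carrier G. act g (vs i) = m}"
 then obtain i g where fx: "!!h. h : H ==> act h m = m" and i: "i < n" and g: "g : carrier G" "act g (vs i) = m"
  unfolding Fix_def by blast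
 \<comment> \<open>The map belonging to a fixed point \<open>m\<close> of \<open>H\<close> sends the
   coset of \<open>a\<close> to the set of elements that carry \<open>vs i\<close> to
   \<open>act a m\<close>; this depends on the coset only because \<open>H\<close> fixes
   \<open>m\<close>.\<close>
 define k where "k = (\<lambda>A\<in>lcosets H. {x : carrier G. act x (vs i) = act (SOME a. a : A) m})"
 have kA: "k (a <# H) = (a \<otimes> g) <# Stab (vs i)" if a: "a : carrier G" for a
 proof -
  have "(SOME b. b : a <# H) : a <# H" by (rule someI) (rule lcos_self[OF a H])
  then obtain h where h: "h : H" "(SOME b. b : a <# H) = a \<otimes> h" unfolding l_coset_def by blast
  have "act (SOME b. b : a <# H) m = act a m" unfolding h(2) using act_mult[OF a HG[OF h(1)]] fx[OF h(1)] by simp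
  then show ?thesis unfolding k_def using lcosetI[OF a, of H] coset_Stab[of "a \<otimes> g" "vs i"] a g by (simp add: act_mult)
 qed
 have k: "k : Hom OC (lcosets H) (lcosets (Stab (vs i)))"
  unfolding orbit_cat_simps
 proof (intro CollectI conjI ballI)
  show "k : lcosets H \<rightarrow>\<^sub>E lcosets (Stab (vs i))"
  proof (rule PiE_I)
  fix A assume "A : lcosets H"
  then obtain a where a: "a : carrier G" "A = a <# H" by (rule lcosetE)
  show "k A : lcosets (Stab (vs i))" unfolding a(2) kA[OF a(1)] by (rule lcosetI) (use a g in simp)
  qed (simp add: k_def)
  fix y A assume y: "y : carrier G" and "A : lcosets H"
  then obtain a where a: "a : carrier G" "A = a <# H" using lcosetE by blast
  have "y <# A = (y \<otimes> a) <# H" unfolding a(2) by (rule lcos_m_assoc[OF subgroup.subset[OF H] y a(1)])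
  then have "k (y <# A) = (y \<otimes> (a \<otimes> g)) <# Stab (vs i)" using kA[of "y \<otimes> a"] y a(1) g(1) by (simp add: m_assoc)
  also have "... = y <# k A" unfolding a(2) kA[OF a(1)]
  by (rule lcos_m_assoc[OF subgroup.subset[OF Stab_subgroup] y, symmetric]) (use a g in simp)
  finally show "k (y <# A) = y <# k A" .
 qed
 have "k H = g <# Stab (vs i)" using kA[OF one_closed] coset_join3[OF one_closed H subgroup.one_closed[OF H]] g(1) by simp
 then have "g : k H" using lcos_self[OF g(1) Stab_subgroup] by simp
 then have "lv vs (lcosets H) (copies i k) = m" using lv_eq[where vs = vs and i = i, OF H k] g(2) by simp
 then show "m : lv vs (lcosets H) ` sum_basis OC n (orb_obj vs) (lcosets H)"
  using sum_basisI[of i n k OC "lcosets H" "orb_obj vs"] i k by (auto intro!: image_eqI[of _ _ "copies i k"])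
qed

text \<open>A morphism that sends the coset \<open>H\<close> to the coset of \<open>y\<close> acts
  on levels as \<open>y\<close> acts on the line, hence by one affine map for vertices and
  edges.\<close>

lemma lv_pre:
 assumes H: "subgroup H G" and K: "subgroup K G" and o: "lcosets H : Obj OC" "lcosets K : Obj OC" "orb_obj vs : {..<n} \<rightarrow> Obj OC"
  and f: "f : Hom OC (lcosets H) (lcosets K)" and y: "y : f H" and l: "l : sum_basis OC n (orb_obj vs) (lcosets K)"
 shows "lv vs (lcosets H) (sum_pre OC (lcosets H) l f) = act y (lv vs (lcosets K) l)"
proof -
 interpret category OC by (rule category_orbit_cat)
 obtain i k where i: "i < n" and k: "k : Hom OC (lcosets K) (lcosets (Stab (vs i)))" and lk: "l = copies i k" using l by (rule sum_basisE)
 obtain g where g: "g : carrier G" "\<forall>a\<in>carrier G. k (a <# K) = {x : carrier G. act x (vs i) = act (a \<otimes> g) (vs i)}"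
  "k K = {x : carrier G. act x (vs i) = act g (vs i)}" by (rule Hom_Stab[OF K k])
 have "f H : lcosets K" by (rule Hom_orbitD(1)[OF f subgroup_lcoset[OF H]])
 then obtain b where b: "b : carrier G" "f H = b <# K" by (rule lcosetE)
 obtain \<kappa> where \<kappa>: "\<kappa> : K" "y = b \<otimes> \<kappa>" using y unfolding b(2) l_coset_def by blast
 have \<kappa>G: "\<kappa> : carrier G" using subgroup.subset[OF K] \<kappa>(1) by (rule subsetD)
 have yG: "y : carrier G" using b \<kappa> \<kappa>G by simp
 have "y <# K = b <# (\<kappa> <# K)" unfolding \<kappa>(2) by (rule lcos_m_assoc[OF subgroup.subset[OF K] b(1) \<kappa>G, symmetric])
 then have fy: "f H = y <# K" unfolding b(2) using coset_join3[OF \<kappa>G K \<kappa>(1)] by simp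
 have c: "Comp OC (lcosets H) k f : Hom OC (lcosets H) (lcosets (Stab (vs i)))"
  by (rule comp_in[OF o(1,2) _ f k]) (use o(3) i in auto)
 have "y \<otimes> g : k (y <# K)" unfolding g(2)[rule_format, OF yG] using yG g(1) by simp
 then have "y \<otimes> g : Comp OC (lcosets H) k f H"
  unfolding orbit_cat_simps compose_def using subgroup_lcoset[OF H] fy by simp
 then have "lv vs (lcosets H) (copies i (Comp OC (lcosets H) k f)) = act (y \<otimes> g) (vs i)" by (rule lv_eq[where vs = vs and i = i, OF H c])
 moreover have "lv vs (lcosets K) l = act g (vs i)" unfolding lk by (rule lv_eq[where vs = vs and i = i, OF K k]) (simp add: g)
 ultimately show ?thesis unfolding lk using act_mult[OF yG g(1)] by simp
qed

theorem orbit_cat_FP: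
 assumes R: "cring R" "\<one>\<^bsub>R\<^esub> ~= \<zero>\<^bsub>R\<^esub>" shows "type_FP R OC" "cat_cd R OC <= 1"
proof -
 obtain n0 :: nat and v0 where v0: "\<forall>i<n0. even (v0 i) = True"
  "\<forall>i<n0. \<forall>j<n0. \<forall>g\<in>carrier G. \<forall>h\<in>carrier G. act g (v0 i) = act h (v0 j) --> i = j"
  "ALL m. even m = True --> (\<exists>i<n0. \<exists>g\<in>carrier G. act g (v0 i) = m)" using orbit_reps[of True] by (elim exE conjE)
 obtain n1 :: nat and v1 where v1: "\<forall>i<n1. even (v1 i) = False"
  "\<forall>i<n1. \<forall>j<n1. \<forall>g\<in>carrier G. \<forall>h\<in>carrier G. act g (v1 i) = act h (v1 j) --> i = j"
  "ALL m. even m = False --> (\<exists>i<n1. \<exists>g\<in>carrier G. act g (v1 i) = m)" using orbit_reps[of False] by (elim exE conjE)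
 have objE: "EX H. subgroup H G & finite H & X = lcosets H" if "X : Obj OC" for X using that unfolding orbit_cat_simps by blast
 have orb: "orb_obj vs : {..<n} \<rightarrow> Obj OC" for vs n
  unfolding orbit_cat_simps using Stab_subgroup Stab_finite by blast
 interpret R: cring R by fact
 interpret line_complex R OC n0 n1 "orb_obj v0" "orb_obj v1" "lv v0" "lv v1" "%X. Fix (base X)"
 proof (intro line_complex.intro line_complex_axioms.intro cat_ring.intro R(1) category_orbit_cat R(2) orb)
  fix X assume "X : Obj OC"
  then obtain H where H: "subgroup H G" "finite H" "X = lcosets H" using objE by blast
  show "Fix (base X) = UNIV \<or> (EX j. Fix (base X) = {2 * j})" unfolding H(3) base_lcosets[OF H(1)] by (rule Fix_cases[OF H(1,2)])
  have "{m : Fix H. \<exists>i<n0. \<exists>g\<in>carrier G. act g (v0 i) = m} = {m : Fix H. even m}"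
  by (rule Collect_cong) (use v0(1,3) in auto)
  then show "bij_betw (lv v0 X) (sum_basis OC n0 (orb_obj v0) X) {m : Fix (base X). even m}"
  using lv_bij[OF H(1), of n0 v0] v0(2) unfolding H(3) base_lcosets[OF H(1)] by simp
  have "{m : Fix H. \<exists>i<n1. \<exists>g\<in>carrier G. act g (v1 i) = m} = {m : Fix H. odd m}"
  by (rule Collect_cong) (use v1(1,3) in auto)
  then show "bij_betw (lv v1 X) (sum_basis OC n1 (orb_obj v1) X) {m : Fix (base X). odd m}"
  using lv_bij[OF H(1), of n1 v1] v1(2) unfolding H(3) base_lcosets[OF H(1)] by simp
 next
  fix X Y f assume X: "X : Obj OC" and Y: "Y : Obj OC" and f: "f : Hom OC X Y"
  obtain H where H: "subgroup H G" "X = lcosets H" using objE[OF X] by blast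
  obtain K where K: "subgroup K G" "Y = lcosets K" using objE[OF Y] by blast
  have "f H : lcosets K" using Hom_orbitD(1)[OF f] subgroup_lcoset[OF H(1)] unfolding H(2) K(2) by blast
  then obtain y where "y : carrier G" "f H = y <# K" by (rule lcosetE)
  then have y: "y : f H" using lcos_self K(1) by simp
  note p = lv_pre[OF H(1) K(1) X[unfolded H(2)] Y[unfolded K(2)] orb f[unfolded H(2) K(2)] y]
  show "\<exists>\<sigma> q. (\<sigma> = 1 \<or> \<sigma> = - 1) &
  (\<forall>v\<in>sum_basis OC n0 (orb_obj v0) Y. lv v0 X (sum_pre OC X v f) = \<sigma> * lv v0 Y v + 4 * q) &
  (\<forall>v\<in>sum_basis OC n1 (orb_obj v1) Y. lv v1 X (sum_pre OC X v f) = \<sigma> * lv v1 Y v + 4 * q)"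
  by (intro exI[of _ "sgm y"] exI[of _ "tr y"] conjI sgm_cases ballI)
  (use p in "simp_all add: H(2) K(2) act_def")
 qed
 show "type_FP R OC" "cat_cd R OC <= 1" by (rule line_resolution)+
qed

end

section \<open>Finiteness for the orbit category and for the infinite cyclic group\<close>

lemma (in group) virt_cyclic_FP:
 assumes "virt_cyclic G" "cring R" "\<one>\<^bsub>R\<^esub> ~= \<zero>\<^bsub>R\<^esub>"
 shows "type_FP R (orbit_cat G)" "cat_cd R (orbit_cat G) <= 1"
proof -
 obtain u F where "normal_cyclic G u F"
  using assms(1)
 proof (rule virt_cyclic_normal)
  fix u F assume "u : carrier G" "finite F" "F \<subseteq> carrier G" "!!n::int. u [^] n = \<one> ==> n = 0"
  "!!x. x : carrier G ==> \<exists>n::int. \<exists>f\<in>F. x = u [^] n \<otimes> f"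
  "!!g. g : carrier G ==> g \<otimes> u \<otimes> inv g = u \<or> g \<otimes> u \<otimes> inv g = inv u"
  then have "normal_cyclic G u F"
  by (intro normal_cyclic.intro normal_cyclic_axioms.intro inf_cyclic.intro inf_cyclic_axioms.intro is_group)
  then show ?thesis by (rule that)
 qed
 then show "type_FP R (orbit_cat G)" "cat_cd R (orbit_cat G) <= 1"
  by (rule normal_cyclic.orbit_cat_FP[OF _ assms(2,3)])+
qed

text \<open>The generator translates the line by 4, so there are two free orbits of vertices and two
  of edges: the circle is divided into two edges to fit the levels modulo 4 of
  \<open>line_complex\<close>.\<close>

lemma (in inf_cyclic) group_cat_FP:
 assumes all: "carrier G = range pw" and R: "cring R" "\<one>\<^bsub>R\<^esub> ~= \<zero>\<^bsub>R\<^esub>"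
 shows "type_FP R (group_cat G)"
proof -
 define ex where "ex g = (THE k. g = pw k)" for g
 have ex: "ex (pw k) = k" for k
  unfolding ex_def by (rule the_equality) (use pw_inj[OF one_closed] in auto)
 have exm: "ex (a \<otimes> b) = ex a + ex b" if a: "a : carrier G" and b: "b : carrier G" for a b
 proof -
  obtain i j where ij: "a = pw i" "b = pw j" using a b unfolding all by blast
  show ?thesis unfolding ij pw_add[symmetric] ex ..
 qed
 have H: "Hom (group_cat G) x y = carrier G" "Comp (group_cat G) x a b = a \<otimes> b" "Obj (group_cat G) = {()}" for x y a b
  by (simp_all add: group_cat_def)
 \<comment> \<open>The list length selects one of the two orbits; \<open>c = 0\<close> gives the
   even levels of vertices and \<open>c = 1\<close> the odd levels of edges.\<close>
 define lvl where "lvl c x l = 4 * ex (hd l) + 2 * int (length l - 1) + c" for c and x :: unit and l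
 have bij: "bij_betw (lvl c x) (sum_basis (group_cat G) 2 (%_. ()) x) {m. even (m - c)}" for c x
  unfolding bij_betw_def
 proof (intro conjI equalityI subsetI inj_onI)
  fix l l' assume l: "l : sum_basis (group_cat G) 2 (%_. ()) x" and l': "l' : sum_basis (group_cat G) 2 (%_. ()) x"
  and e: "lvl c x l = lvl c x l'"
  obtain i a where i: "i < 2" "a : carrier G" "l = copies i a" using l by (rule sum_basisE) (simp add: H)
  obtain j b where j: "j < 2" "b : carrier G" "l' = copies j b" using l' by (rule sum_basisE) (simp add: H)
  obtain p q where pq: "a = pw p" "b = pw q" using i(2) j(2) unfolding all by blast
  have "4 * p + 2 * int i = 4 * q + 2 * int j" using e by (simp add: lvl_def i j pq ex)
  then have "i = j & p = q" using i(1) j(1) by presburger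
  then show "l = l'" using i j pq by simp
 next
  fix m assume "m : lvl c x ` sum_basis (group_cat G) 2 (%_. ()) x"
  then show "m : {m. even (m - c)}" by (rule imageE) (simp add: lvl_def)
 next
  fix m assume "m : {m. even (m - c)}"
  then have m: "even (m - c)" by simp
  define i k where "i = nat (((m - c) mod 4) div 2)" and "k = (m - c) div 4"
  have i2: "i < 2" unfolding i_def by (simp add: nat_less_iff)
  have ii: "int i = (m - c) mod 4 div 2" unfolding i_def by simp
  have "m - c = 4 * ((m - c) div 4) + 2 * ((m - c) mod 4 div 2)" using m by presburger
  then have mk: "m = 4 * k + 2 * int i + c" unfolding ii k_def by linarith
  have "copies i (pw k) : sum_basis (group_cat G) 2 (%_. ()) x" by (rule sum_basisI[OF i2]) (simp add: H)
  moreover have "m = lvl c x (copies i (pw k))" unfolding lvl_def by (simp add: ex mk)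
  ultimately show "m : lvl c x ` sum_basis (group_cat G) 2 (%_. ()) x" by (rule rev_image_eqI)
 qed
 have lvl_pre: "lvl c x (sum_pre (group_cat G) x l f) = lvl c y l + 4 * ex f"
  if l: "l : sum_basis (group_cat G) 2 (%_. ()) y" and f: "f : carrier G" for c x y l f
 proof -
  obtain i a where i: "i < 2" "a : carrier G" "l = copies i a" using l by (rule sum_basisE) (simp add: H)
  show ?thesis unfolding i(3) lvl_def using exm[OF i(2) f] by (simp add: H)
 qed
 interpret R: cring R by fact
 interpret line_complex R "group_cat G" 2 2 "%_. ()" "%_. ()" "lvl 0" "lvl 1" "%_. UNIV"
 proof (intro line_complex.intro line_complex_axioms.intro cat_ring.intro R(1) category_group_cat R(2))
  show "bij_betw (lvl 0 x) (sum_basis (group_cat G) 2 (%_. ()) x) {m : UNIV. even m}" for x using bij[of 0 x] by simp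
  show "bij_betw (lvl 1 x) (sum_basis (group_cat G) 2 (%_. ()) x) {m : UNIV. odd m}" for x using bij[of 1 x] by simp
  fix x y f assume "f : Hom (group_cat G) x y"
  then have f: "f : carrier G" by (simp add: H)
  show "\<exists>\<sigma> q. (\<sigma> = 1 \<or> \<sigma> = - 1) &
  (\<forall>v\<in>sum_basis (group_cat G) 2 (%_. ()) y. lvl 0 x (sum_pre (group_cat G) x v f) = \<sigma> * lvl 0 y v + 4 * q) &
  (\<forall>v\<in>sum_basis (group_cat G) 2 (%_. ()) y. lvl 1 x (sum_pre (group_cat G) x v f) = \<sigma> * lvl 1 y v + 4 * q)"
  by (rule exI[of _ 1], rule exI[of _ "ex f"]) (use lvl_pre f in simp)
 qed (simp_all add: H)
 show ?thesis by (rule line_resolution)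
qed

section \<open>Projective modules evaluated at the free orbit\<close>

text \<open>Modules over the orbit category, evaluated at the free orbit, are modules over the group;
  \<open>kx H x\<close> is the \<open>G\<close>-map from \<open>G\<close> to \<open>G/H\<close> that sends \<open>1\<close> to \<open>xH\<close>.\<close>

context group
begin

definition orb1 :: "'a set set" where "orb1 = lcosets {\<one>}"

definition kx :: "'a set => 'a => 'a set => 'a set"
 where "kx H x = (\<lambda>A\<in>orb1. (the_elem A \<otimes> x) <# H)"

abbreviation "rho \<equiv> kx {\<one>}"

lemma coset_one: "a : carrier G ==> a <# {\<one>} = {a}" by (simp add: l_coset_def)

lemma singleton_orbit: "a : carrier G ==> {a} : orb1"
 unfolding orb1_def using lcosetI[of a "{\<one>}"] by (simp add: coset_one)

lemma orb1E: assumes "A : orb1" obtains a where "a : carrier G" "A = {a}"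
proof -
 obtain a where "a : carrier G" "A = a <# {\<one>}" using assms unfolding orb1_def by (rule lcosetE)
 then show ?thesis using that coset_one by simp
qed

lemma triv: "subgroup {\<one>} G" by (rule triv_subgroup)

lemma orb1_obj: "orb1 : Obj (orbit_cat G)"
 unfolding orbit_cat_simps orb1_def using triv by blast

lemma kx_single: "a : carrier G ==> kx H x {a} = (a \<otimes> x) <# H"
 unfolding kx_def using singleton_orbit by simp

lemma transl_single: "[|g : carrier G; a : carrier G|] ==> g <# {a} = {g \<otimes> a}" by (simp add: l_coset_def)

lemma kx_in: assumes H: "subgroup H G" and x: "x : carrier G" shows "kx H x : Hom (orbit_cat G) orb1 (lcosets H)"
 unfolding orbit_cat_simps
proof (intro CollectI conjI ballI)
 show "kx H x : orb1 \<rightarrow>\<^sub>E lcosets H"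
 proof (rule PiE_I)
  fix A assume "A : orb1"
  then obtain a where a: "a : carrier G" "A = {a}" by (rule orb1E)
  show "kx H x A : lcosets H" unfolding a(2) kx_single[OF a(1)] by (rule lcosetI) (use a x in simp)
 qed (simp add: kx_def)
 fix g A assume g: "g : carrier G" and A: "A : orb1"
 obtain a where a: "a : carrier G" "A = {a}" using A by (rule orb1E)
 have "kx H x (g <# A) = (g \<otimes> a \<otimes> x) <# H"
  unfolding a(2) transl_single[OF g a(1)] by (rule kx_single) (use g a in simp)
 also have "... = g <# kx H x A"
  unfolding a(2) kx_single[OF a(1)] using lcos_m_assoc[OF subgroup.subset[OF H] g, of "a \<otimes> x"] g a x by (simp add: m_assoc)
 finally show "kx H x (g <# A) = g <# kx H x A" .
qed

lemma kx_ext: assumes k: "k : Hom (orbit_cat G) orb1 Y" and k': "k' : Hom (orbit_cat G) orb1 Y" and e: "k {\<one>} = k' {\<one>}"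
 shows "k = k'"
proof (rule extensionalityI[OF Hom_orbitD(2)[OF k] Hom_orbitD(2)[OF k']])
 fix A assume "A : orb1"
 then obtain a where a: "a : carrier G" "A = {a}" by (rule orb1E)
 have "{a} = a <# {\<one>}" using a(1) by (simp add: coset_one)
 then show "k A = k' A" unfolding a(2)
  using Hom_orbitD(3)[OF k a(1) singleton_orbit[OF one_closed]] Hom_orbitD(3)[OF k' a(1) singleton_orbit[OF one_closed]] e by simp
qed

lemma kx_one: "x : carrier G ==> kx H x {\<one>} = x <# H" by (simp add: kx_single)

lemma kx_ex: assumes H: "subgroup H G" and k: "k : Hom (orbit_cat G) orb1 (lcosets H)"
 obtains x where "x : carrier G" "k = kx H x"
proof -
 have "k {\<one>} : lcosets H" by (rule Hom_orbitD(1)[OF k singleton_orbit[OF one_closed]])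
 then obtain x where x: "x : carrier G" "k {\<one>} = x <# H" by (rule lcosetE)
 have "k = kx H x" by (rule kx_ext[OF k kx_in[OF H x(1)]]) (simp add: kx_one x)
 then show ?thesis by (rule that[OF x(1)])
qed

lemma kx_invariant: assumes H: "subgroup H G" and x: "x : carrier G" and h: "h : H" shows "kx H (x \<otimes> h) = kx H x"
proof (rule kx_ext[OF kx_in[OF H] kx_in[OF H x]])
 have hG: "h : carrier G" using subgroup.subset[OF H] h by (rule subsetD)
 show "x \<otimes> h : carrier G" using x hG by simp
 have "(x \<otimes> h) <# H = x <# (h <# H)" by (rule lcos_m_assoc[OF subgroup.subset[OF H] x hG, symmetric])
 then show "kx H (x \<otimes> h) {\<one>} = kx H x {\<one>}" using x hG coset_join3[OF hG H h] by (simp add: kx_one)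
qed

lemma rho_in: "g : carrier G ==> rho g : Hom (orbit_cat G) orb1 orb1"
 using kx_in[OF triv] unfolding orb1_def .

text \<open>Precomposition with \<open>rho g\<close> multiplies the parameter on the left. So
  \<open>rho\<close> reverses products, and the contravariant action \<open>ac\<close> built from it
  is a left action.\<close>

lemma kx_rho: assumes H: "subgroup H G" and x: "x : carrier G" and g: "g : carrier G"
 shows "Comp (orbit_cat G) orb1 (kx H x) (rho g) = kx H (g \<otimes> x)"
proof (rule kx_ext)
 interpret category "orbit_cat G" by (rule category_orbit_cat)
 have "kx H x : Hom (orbit_cat G) orb1 (lcosets H)" by (rule kx_in[OF H x])
 have o: "orb1 : Obj (orbit_cat G)" by (rule orb1_obj)
 show "Comp (orbit_cat G) orb1 (kx H x) (rho g) : Hom (orbit_cat G) orb1 (lcosets H)"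
  unfolding orbit_cat_simps(4)
 proof -
  have "compose orb1 (kx H x) (rho g) : orb1 \<rightarrow>\<^sub>E lcosets H"
  using Hom_orbitD(1)[OF rho_in[OF g]] Hom_orbitD(1)[OF kx_in[OF H x]] by (auto simp: compose_def)
  moreover have "compose orb1 (kx H x) (rho g) (y <# A) = y <# compose orb1 (kx H x) (rho g) A"
  if y: "y : carrier G" and A: "A : orb1" for y A
  proof -
  have "y <# A : orb1" using lcoset_transl[OF triv _ y] A unfolding orb1_def by blast
  then show ?thesis
  using A Hom_orbitD(3)[OF rho_in[OF g] y A] Hom_orbitD(3)[OF kx_in[OF H x] y Hom_orbitD(1)[OF rho_in[OF g] A]] by (simp add: compose_def)
  qed
  ultimately show "compose orb1 (kx H x) (rho g) : Hom (orbit_cat G) orb1 (lcosets H)"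
  unfolding orbit_cat_simps(2) by blast
 qed
 show "kx H (g \<otimes> x) : Hom (orbit_cat G) orb1 (lcosets H)" by (rule kx_in[OF H]) (use g x in simp)
 show "Comp (orbit_cat G) orb1 (kx H x) (rho g) {\<one>} = kx H (g \<otimes> x) {\<one>}"
  unfolding orbit_cat_simps(4) compose_def using singleton_orbit[OF one_closed] g x by (simp add: kx_single coset_one)
qed

end

context ring_group
begin

abbreviation "OC \<equiv> orbit_cat G"

lemma cat_ring_OC: "cat_ring R OC"
 by (intro cat_ring.intro R.is_cring category_orbit_cat)

definition ac :: "('g set set, 'g set => 'g set, 'r, 'c) cat_module => 'g => 'c => 'c"
 where "ac M g = Act M orb1 orb1 (frag_of (rho g))"

text \<open>An element \<open>a\<close> of the free module on the cosets of \<open>H\<close> is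
  viewed as the function \<open>a (kx H x)\<close> of \<open>x\<close>, which is invariant under
  \<open>H\<close> on the right. In this form \<open>ac\<close> is left translation.\<close>

lemma hat_act:
 assumes H: "subgroup H G" and x: "x : carrier G" and g: "g : carrier G"
  and a: "a : carrier (free_mod R (Hom OC orb1 (lcosets H)))"
 shows "ac (rep_module R OC (lcosets H)) g a (kx H x) = a (kx H (inv g \<otimes> x))"
proof -
 interpret cat_ring R OC by (rule cat_ring_OC)
 let ?Y = "Hom OC orb1 (lcosets H)" and ?f = "gen_act R (Comp OC orb1) (frag_of (rho g))"
 have ev: "(%a. a k) : linear_maps R (free_mod R ?Y) (regular_mod R)" for k
  by (simp add: linear_maps_def free_mod_def regular_mod_def)
 have comp: "Comp OC orb1 k (rho g) : ?Y" if k: "k : ?Y" for k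
  using k
 proof (rule kx_ex[OF H])
  fix y assume "y : carrier G" "k = kx H y"
  then show ?thesis using kx_rho[OF H _ g] kx_in[OF H] g by simp
 qed
 have lin: "?f : linear_maps R (free_mod R ?Y) (free_mod R ?Y)"
  by (rule R.gen_act_linear) (use comp in simp)
 have "?f a (kx H x) = a (kx H (inv g \<otimes> x))"
 proof (rule R.linear_maps_free_eq[OF module_regular R.linear_maps_comp[OF lin ev] ev _ a])
  fix k assume "k : ?Y"
  then obtain y where y: "y : carrier G" "k = kx H y" by (rule kx_ex[OF H])
  have "kx H x = kx H (g \<otimes> y) \<longleftrightarrow> kx H (inv g \<otimes> x) = kx H y"
  proof
  assume "kx H x = kx H (g \<otimes> y)"
  then have "Comp OC orb1 (kx H x) (rho (inv g)) = Comp OC orb1 (kx H (g \<otimes> y)) (rho (inv g))" by simp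
  then show "kx H (inv g \<otimes> x) = kx H y" using x g y(1) by (simp add: kx_rho[OF H] m_assoc[symmetric])
  next
  assume "kx H (inv g \<otimes> x) = kx H y"
  then have "Comp OC orb1 (kx H (inv g \<otimes> x)) (rho g) = Comp OC orb1 (kx H y) (rho g)" by simp
  then show "kx H x = kx H (g \<otimes> y)" using x g y(1) by (simp add: kx_rho[OF H] m_assoc[symmetric])
  qed
  then show "?f (single R k) (kx H x) = single R k (kx H (inv g \<otimes> x))"
  unfolding R.gen_act_single y(2) kx_rho[OF H y(1) g] by (simp add: single_def)
 qed
 then show ?thesis unfolding ac_def by (simp add: rep_module_eq)
qed

text \<open>Each coset in the support of \<open>a\<close> has only finitely many elements, since
  \<open>H\<close> is finite.\<close>

lemma hat_support:
 assumes H: "subgroup H G" "finite H" and a: "a : carrier (free_mod R (Hom OC orb1 (lcosets H)))"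
 shows "finite {x : carrier G. a (kx H x) ~= \<zero>\<^bsub>R\<^esub>}"
proof (rule finite_subset)
 show "{x : carrier G. a (kx H x) ~= \<zero>\<^bsub>R\<^esub>} \<subseteq> (\<Union>k\<in>{k. a k ~= \<zero>\<^bsub>R\<^esub>}. k {\<one>})"
 proof
  fix x assume x: "x : {x : carrier G. a (kx H x) ~= \<zero>\<^bsub>R\<^esub>}"
  then have "x : kx H x {\<one>}" using lcos_self[of x H] H(1) by (simp add: kx_one)
  then show "x : (\<Union>k\<in>{k. a k ~= \<zero>\<^bsub>R\<^esub>}. k {\<one>})" using x by blast
 qed
 have "finite (k {\<one>})" if "a k ~= \<zero>\<^bsub>R\<^esub>" for k
 proof -
  have "k : Hom OC orb1 (lcosets H)" using R.free_modD(3)[OF a] that by blast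
  then obtain x where x: "x : carrier G" "k = kx H x" by (rule kx_ex[OF H(1)])
  show ?thesis unfolding x(2) kx_one[OF x(1)] using H(2) by (simp add: l_coset_eq_set_mult set_mult_def)
 qed
 then show "finite (\<Union>k\<in>{k. a k ~= \<zero>\<^bsub>R\<^esub>}. k {\<one>})" using R.free_modD(2)[OF a] by simp
qed

lemma orb1_eqI:
 assumes H: "subgroup H G" and a: "a : carrier (free_mod R (Hom OC orb1 (lcosets H)))"
  and b: "b : carrier (free_mod R (Hom OC orb1 (lcosets H)))"
  and eq: "!!x. x : carrier G ==> a (kx H x) = b (kx H x)"
 shows "a = b"
proof
 fix k show "a k = b k"
 proof (cases "k : Hom OC orb1 (lcosets H)")
  case True
  then obtain x where "x : carrier G" "k = kx H x" by (rule kx_ex[OF H])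
  then show ?thesis using eq by simp
 next
  case False
  then show ?thesis using R.free_modD(4)[OF a False] R.free_modD(4)[OF b False] by simp
 qed
qed

text \<open>The way back, from functions on \<open>G\<close> that are invariant under
  \<open>H\<close> on the right to functions on the cosets.\<close>

definition from_hat :: "'g set => ('g => 'r) => ('g set => 'g set) => 'r"
 where "from_hat H v k = (if k : Hom OC orb1 (lcosets H) then v (SOME x. x : carrier G & k = kx H x) else \<zero>\<^bsub>R\<^esub>)"

lemma from_hat:
 assumes H: "subgroup H G" and v: "!!x. x : carrier G ==> v x : carrier R" "finite {x : carrier G. v x ~= \<zero>\<^bsub>R\<^esub>}"
  and inv: "!!x h. [|x : carrier G; h : H|] ==> v (x \<otimes> h) = v x"
 shows "from_hat H v : carrier (free_mod R (Hom OC orb1 (lcosets H)))"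
  "x : carrier G ==> from_hat H v (kx H x) = v x"
proof -
 show val: "from_hat H v (kx H x) = v x" if x: "x : carrier G" for x
 proof -
  let ?y = "SOME y. y : carrier G & kx H x = kx H y"
  have y: "?y : carrier G & kx H x = kx H ?y" by (rule someI[of _ x]) (simp add: x)
  then have "x <# H = ?y <# H" using kx_one[OF x, of H] kx_one[of ?y H] by simp
  then have "x : ?y <# H" using lcos_self[OF x H] by simp
  then obtain h where "h : H" "x = ?y \<otimes> h" unfolding l_coset_def by blast
  then have "v x = v ?y" using inv[of ?y h] y by simp
  then show ?thesis unfolding from_hat_def using kx_in[OF H x] by simp
 qed
 show "from_hat H v : carrier (free_mod R (Hom OC orb1 (lcosets H)))"
 proof (rule R.free_modI[of _ "kx H ` {x : carrier G. v x ~= \<zero>\<^bsub>R\<^esub>}"])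
  show "from_hat H v k : carrier R" for k
  proof (cases "k : Hom OC orb1 (lcosets H)")
  case True
  then obtain x where "x : carrier G" "k = kx H x" by (rule kx_ex[OF H])
  then show ?thesis using val v(1) by simp
  qed (simp add: from_hat_def)
  show "finite (kx H ` {x : carrier G. v x ~= \<zero>\<^bsub>R\<^esub>})" using v(2) by simp
  show "kx H ` {x : carrier G. v x ~= \<zero>\<^bsub>R\<^esub>} \<subseteq> Hom OC orb1 (lcosets H)" using kx_in[OF H] by blast
  fix k assume k: "k \<notin> kx H ` {x : carrier G. v x ~= \<zero>\<^bsub>R\<^esub>}"
  show "from_hat H v k = \<zero>\<^bsub>R\<^esub>"
  proof (cases "k : Hom OC orb1 (lcosets H)")
  case True
  then obtain x where x: "x : carrier G" "k = kx H x" by (rule kx_ex[OF H])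
  then have "v x = \<zero>\<^bsub>R\<^esub>" using k by blast
  then show ?thesis using val[OF x(1)] x(2) by simp
  qed (simp add: from_hat_def)
 qed
qed

end

text \<open>Coordinates on a projective module, evaluated at the free orbit: a family \<open>S p i\<close>, \<open>i \<in> I\<close>,
  of elements of the group ring, of which \<open>S p i\<close> is invariant under \<open>H i\<close> on the right.\<close>

locale coordinates = ring_group R G
 for R :: "('r, 'x) ring_scheme" and G :: "('g, 'y) monoid_scheme" (structure) +
 fixes P :: "('g set set, 'g set => 'g set, 'r, 'c) cat_module" and I :: "'i set" and H :: "'i => 'g set" and S :: "'c => 'i => 'g => 'r"
 assumes H_subgroup: "i : I ==> subgroup (H i) G"
  and S_fin: "p : carrier (Fib P orb1) ==> finite {i : I. \<exists>x\<in>carrier G. S p i x ~= \<zero>\<^bsub>R\<^esub>}"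
  and S_supp: "[|p : carrier (Fib P orb1); i : I|] ==> finite {x : carrier G. S p i x ~= \<zero>\<^bsub>R\<^esub>}"
  and S_in: "[|p : carrier (Fib P orb1); i : I|] ==> S p i x : carrier R"
  and S_ac: "[|p : carrier (Fib P orb1); i : I; x : carrier G; g : carrier G|] ==> S (ac P g p) i x = S p i (inv g \<otimes> x)"
  and S_add: "[|p : carrier (Fib P orb1); q : carrier (Fib P orb1); i : I|]
  ==> S (p \<oplus>\<^bsub>Fib P orb1\<^esub> q) i x = S p i x \<oplus>\<^bsub>R\<^esub> S q i x"
  and S_H: "[|p : carrier (Fib P orb1); i : I; x : carrier G; h : H i|] ==> S p i (x \<otimes> h) = S p i x"
  and S_zero: "[|p : carrier (Fib P orb1); !!i x. [|i : I; x : carrier G|] ==> S p i x = \<zero>\<^bsub>R\<^esub>|] ==> p = \<zero>\<^bsub>Fib P orb1\<^esub>"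
  and S_inner: "[|!!i x. [|i : I; x : carrier G|] ==> v i x : carrier R; !!i. i : I ==> finite {x : carrier G. v i x ~= \<zero>\<^bsub>R\<^esub>};
  finite {i : I. \<exists>x\<in>carrier G. v i x ~= \<zero>\<^bsub>R\<^esub>}; !!i x h. [|i : I; x : carrier G; h : H i|] ==> v i (x \<otimes> h) = v i x|]
  ==> \<exists>w\<in>carrier (Fib P orb1). \<forall>g\<in>carrier G. \<forall>p\<in>carrier (Fib P orb1).
  (\<forall>i\<in>I. \<forall>x\<in>carrier G. S p i x \<oplus>\<^bsub>R\<^esub> v i x = v i (inv g \<otimes> x)) --> p \<oplus>\<^bsub>Fib P orb1\<^esub> w = ac P g w"

context ring_group
begin

text \<open>\<open>P\<close> is a retract of a free module: the inclusion \<open>s\<close> supplies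
  the coordinates. For \<open>S_inner\<close> a family \<open>v\<close> need not come from
  \<open>P\<close>; it defines an element of the free module, and the retraction \<open>r\<close>
  carries the equation between coordinates to \<open>P\<close>.\<close>

lemma projective_coordinates:
 fixes P :: "('g set set, 'g set => 'g set, 'r, 'c) cat_module"
 assumes P: "projective R OC P"
 shows "\<exists>(I :: ('g set set \<times> 'c) set) H S. coordinates R G P I H S"
proof -
 interpret cat_ring R OC by (rule cat_ring_OC)
 have cm: "is_cat_module R OC P" using P unfolding projective_def by blast
 from P obtain I :: "('g set set \<times> 'c) set" and z where z: "z : I \<rightarrow> Obj OC"
  and ex: "\<exists>s\<in>cat_module_hom R OC P (direct_sum I (%i. rep_module R OC (z i))).
  \<exists>r\<in>cat_module_hom R OC (direct_sum I (%i. rep_module R OC (z i))) P.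
  \<forall>x\<in>Obj OC. \<forall>a\<in>carrier (Fib P x). r x (s x a) = a"
  unfolding projective_def by blast
 obtain s r where s: "s : cat_module_hom R OC P (direct_sum I (%i. rep_module R OC (z i)))"
  and r: "r : cat_module_hom R OC (direct_sum I (%i. rep_module R OC (z i))) P"
  and rs: "!!x a. [|x : Obj OC; a : carrier (Fib P x)|] ==> r x (s x a) = a" using ex by blast
 have "\<forall>i\<in>I. EX H. subgroup H G & finite H & z i = lcosets H" using z unfolding orbit_cat_simps by blast
 then have "EX H. \<forall>i\<in>I. subgroup (H i) G & finite (H i) & z i = lcosets (H i)" by (rule bchoice)
 then obtain H where H: "!!i. i : I ==> subgroup (H i) G & finite (H i) & z i = lcosets (H i)" by blast
 note o = orb1_obj
 let ?P = "Fib P orb1" and ?D = "direct_sum I (%i. rep_module R OC (z i))"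
 let ?F = "%i. free_mod R (Hom OC orb1 (lcosets (H i)))"
 interpret MP: Module.module R ?P by (rule cat_moduleD(1)[OF cm o])
 have rho_lin: "frag_of (rho g) : lin_hom OC orb1 orb1" if "g : carrier G" for g
  by (rule frag_of_lin_hom[OF rho_in[OF that]])
 have zF: "free_mod R (Hom OC orb1 (z i)) = ?F i" if "i : I" for i using H[OF that] by simp
 have Dc: "carrier (Fib ?D orb1) = {t : (\<Pi>\<^sub>E i\<in>I. carrier (?F i)). finite {i\<in>I. t i ~= (%_. \<zero>\<^bsub>R\<^esub>)}}"
 proof -
  have "(\<Pi>\<^sub>E i\<in>I. carrier (free_mod R (Hom OC orb1 (z i)))) = (\<Pi>\<^sub>E i\<in>I. carrier (?F i))"
  by (rule PiE_cong) (simp add: zF)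
  then show ?thesis by (simp add: direct_sum_simps direct_sum_mod_def rep_module_eq) (simp add: free_mod_def)
 qed
 have sl: "s orb1 : linear_maps R ?P (Fib ?D orb1)" by (rule cat_module_homD(1)[OF s o])
 have rl: "r orb1 : linear_maps R (Fib ?D orb1) ?P" by (rule cat_module_homD(1)[OF r o])
 have sD: "s orb1 p : carrier (Fib ?D orb1)" if "p : carrier ?P" for p by (rule R.linear_mapsD(1)[OF sl that])
 have sF: "s orb1 p i : carrier (?F i)" if "p : carrier ?P" "i : I" for p i
  using sD[OF that(1)] that(2) unfolding Dc by (auto dest: PiE_mem)
 define S where "S p i x = s orb1 p i (kx (H i) x)" for p i x
 have add: "s orb1 (p \<oplus>\<^bsub>?P\<^esub> q) = (\<lambda>i\<in>I. s orb1 p i \<oplus>\<^bsub>free_mod R (Hom OC orb1 (z i))\<^esub> s orb1 q i)"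
  if "p : carrier ?P" "q : carrier ?P" for p q
  using R.linear_mapsD(2)[OF sl that] by (simp add: direct_sum_simps direct_sum_mod_def rep_module_eq)
 have act_comp: "s orb1 (ac P g p) i = ac (rep_module R OC (lcosets (H i))) g (s orb1 p i)"
  if p: "p : carrier ?P" and i: "i : I" and g: "g : carrier G" for p i g
  using cat_module_homD(2)[OF s o o rho_lin[OF g] p] i H[OF i] unfolding ac_def by (simp add: direct_sum_simps)
 have "coordinates R G P I H S"
 proof (intro coordinates.intro coordinates_axioms.intro ring_group_axioms)
  show "subgroup (H i) G" if "i : I" for i using H[OF that] by blast
  show "finite {i : I. \<exists>x\<in>carrier G. S p i x ~= \<zero>\<^bsub>R\<^esub>}" if p: "p : carrier ?P" for p
  proof (rule finite_subset)
  show "finite {i\<in>I. s orb1 p i ~= (%_. \<zero>\<^bsub>R\<^esub>)}" using sD[OF p] unfolding Dc by blast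
  show "{i : I. \<exists>x\<in>carrier G. S p i x ~= \<zero>\<^bsub>R\<^esub>} \<subseteq> {i\<in>I. s orb1 p i ~= (%_. \<zero>\<^bsub>R\<^esub>)}" unfolding S_def by auto
  qed
  show "finite {x : carrier G. S p i x ~= \<zero>\<^bsub>R\<^esub>}" if "p : carrier ?P" "i : I" for p i
  unfolding S_def by (rule hat_support[OF _ _ sF[OF that]]) (use H[OF that(2)] in blast)+
  show "S p i x : carrier R" if "p : carrier ?P" "i : I" for p i x
  unfolding S_def by (rule R.free_modD(1)[OF sF[OF that]])
  show "S (ac P g p) i x = S p i (inv g \<otimes> x)" if "p : carrier ?P" "i : I" "x : carrier G" "g : carrier G" for p i x g
  unfolding S_def act_comp[OF that(1,2,4)] by (rule hat_act[OF _ that(3,4) sF[OF that(1,2)]]) (use H[OF that(2)] in blast)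
  show "S (p \<oplus>\<^bsub>?P\<^esub> q) i x = S p i x \<oplus>\<^bsub>R\<^esub> S q i x" if "p : carrier ?P" "q : carrier ?P" "i : I" for p q i x
  unfolding S_def add[OF that(1,2)] using that(3) by (simp only: restrict_apply' R.free_mod_add)
  show "S p i (x \<otimes> h) = S p i x" if "p : carrier ?P" "i : I" "x : carrier G" "h : H i" for p i x h
  unfolding S_def using kx_invariant[OF _ that(3,4)] H[OF that(2)] by simp
  show "p = \<zero>\<^bsub>?P\<^esub>" if p: "p : carrier ?P" and S0: "!!i x. [|i : I; x : carrier G|] ==> S p i x = \<zero>\<^bsub>R\<^esub>" for p
  proof -
  \<comment> \<open>Zero enters as a zero multiple of \<open>p\<close>, so that linearity of
    \<open>s\<close> alone computes its image in the direct sum.\<close>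
  have "s orb1 p = s orb1 (\<zero>\<^bsub>R\<^esub> \<odot>\<^bsub>?P\<^esub> p)"
  proof (rule ext)
  fix i
  show "s orb1 p i = s orb1 (\<zero>\<^bsub>R\<^esub> \<odot>\<^bsub>?P\<^esub> p) i"
  proof (cases "i : I")
  case i: True
  have e: "s orb1 (\<zero>\<^bsub>R\<^esub> \<odot>\<^bsub>?P\<^esub> p) i = \<zero>\<^bsub>R\<^esub> \<odot>\<^bsub>?F i\<^esub> s orb1 p i"
  using R.linear_mapsD(3)[OF sl R.zero_closed p] i zF[OF i] by (simp add: direct_sum_simps direct_sum_mod_def rep_module_eq del: MP.smult_l_null)
  have "s orb1 p i = (%_. \<zero>\<^bsub>R\<^esub>)"
  by (rule orb1_eqI[OF _ sF[OF p i]]) (use H[OF i] S0[OF i] in "auto simp: S_def free_mod_def")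
  then show ?thesis unfolding e by (simp add: free_mod_def)
  next
  case False
  have n: "s orb1 q i = undefined" if "q : carrier ?P" for q
  proof -
  have "s orb1 q : (\<Pi>\<^sub>E i\<in>I. carrier (?F i))" using sD[OF that, unfolded Dc] by (elim CollectE conjE)
  then show ?thesis using False by (rule PiE_arb)
  qed
  show ?thesis unfolding n[OF p] n[OF MP.smult_closed[OF R.zero_closed p]] ..
  qed
  qed
  then have "r orb1 (s orb1 p) = r orb1 (s orb1 (\<zero>\<^bsub>R\<^esub> \<odot>\<^bsub>?P\<^esub> p))" by (rule arg_cong[of _ _ "r orb1"])
  then show ?thesis unfolding rs[OF o p] rs[OF o MP.smult_closed[OF R.zero_closed p]] by (rule trans[OF _ MP.smult_l_null[OF p]])
  qed
  fix v assume v: "!!i x. [|i : I; x : carrier G|] ==> v i x : carrier R" "!!i. i : I ==> finite {x : carrier G. v i x ~= \<zero>\<^bsub>R\<^esub>}"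
  and vf: "finite {i : I. \<exists>x\<in>carrier G. v i x ~= \<zero>\<^bsub>R\<^esub>}"
  and vi: "!!i x h. [|i : I; x : carrier G; h : H i|] ==> v i (x \<otimes> h) = v i x"
  define b where "b = (\<lambda>i\<in>I. from_hat (H i) (v i))"
  have fh1: "from_hat (H i) (v i) : carrier (?F i)" if i: "i : I" for i
  proof (rule from_hat(1))
  show "subgroup (H i) G" using H[OF i] by blast
  show "v i x : carrier R" if "x : carrier G" for x by (rule v(1)[OF i that])
  show "finite {x : carrier G. v i x ~= \<zero>\<^bsub>R\<^esub>}" by (rule v(2)[OF i])
  show "v i (x \<otimes> h) = v i x" if "x : carrier G" "h : H i" for x h by (rule vi[OF i that])
  qed
  have fh2: "from_hat (H i) (v i) (kx (H i) x) = v i x" if i: "i : I" and x: "x : carrier G" for i x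
  proof (rule from_hat(2)[OF _ _ _ _ x])
  show "subgroup (H i) G" using H[OF i] by blast
  show "v i x : carrier R" if "x : carrier G" for x by (rule v(1)[OF i that])
  show "finite {x : carrier G. v i x ~= \<zero>\<^bsub>R\<^esub>}" by (rule v(2)[OF i])
  show "v i (x \<otimes> h) = v i x" if "x : carrier G" "h : H i" for x h by (rule vi[OF i that])
  qed
  note fh = fh1 fh2
  have bP: "b : (\<Pi>\<^sub>E i\<in>I. carrier (?F i))" unfolding b_def restrict_PiE_iff using fh1 by (rule ballI)
  have bfin: "finite {i\<in>I. b i ~= (%_. \<zero>\<^bsub>R\<^esub>)}"
  proof (rule finite_subset[OF _ vf], rule subsetI)
  fix i assume i: "i : {i\<in>I. b i ~= (%_. \<zero>\<^bsub>R\<^esub>)}"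
  have "\<exists>x\<in>carrier G. v i x ~= \<zero>\<^bsub>R\<^esub>"
  proof (rule ccontr)
  assume n: "\<not> (\<exists>x\<in>carrier G. v i x ~= \<zero>\<^bsub>R\<^esub>)"
  have iI: "i : I" using i by simp
  have "from_hat (H i) (v i) = (%_. \<zero>\<^bsub>R\<^esub>)"
  proof (rule orb1_eqI[OF _ fh1[OF iI]])
  show "subgroup (H i) G" using H[OF iI] by blast
  show "(%_. \<zero>\<^bsub>R\<^esub>) : carrier (?F i)" by (simp add: free_mod_def)
  fix x assume x: "x : carrier G"
  show "from_hat (H i) (v i) (kx (H i) x) = \<zero>\<^bsub>R\<^esub>" unfolding fh2[OF iI x] using n x by blast
  qed
  then show False using i iI by (simp add: b_def)
  qed
  then show "i : {i : I. \<exists>x\<in>carrier G. v i x ~= \<zero>\<^bsub>R\<^esub>}" using i by blast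
  qed
  have b: "b : carrier (Fib ?D orb1)" unfolding Dc by (rule CollectI, rule conjI, rule bP, rule bfin)
  let ?w = "r orb1 b"
  have w: "?w : carrier ?P" by (rule R.linear_mapsD(1)[OF rl b])
  have main: "p \<oplus>\<^bsub>?P\<^esub> ?w = ac P g ?w"
  if g: "g : carrier G" and p: "p : carrier ?P" and eq: "\<forall>i\<in>I. \<forall>x\<in>carrier G. S p i x \<oplus>\<^bsub>R\<^esub> v i x = v i (inv g \<otimes> x)" for g p
  proof -
  have "s orb1 p \<oplus>\<^bsub>Fib ?D orb1\<^esub> b = Act ?D orb1 orb1 (frag_of (rho g)) b"
  proof (rule ext)
  fix i
  show "(s orb1 p \<oplus>\<^bsub>Fib ?D orb1\<^esub> b) i = Act ?D orb1 orb1 (frag_of (rho g)) b i"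
  proof (cases "i : I")
  case i: True
  interpret F: Module.module R "?F i" by (rule R.module_free_mod)
  have Hi: "subgroup (H i) G" using H[OF i] by blast
  have bF: "b i : carrier (?F i)" unfolding b_def using fh1[OF i] i by simp
  have zi: "z i = lcosets (H i)" using H[OF i] by blast
  have Ho: "lcosets (H i) : Obj OC" unfolding orbit_cat_simps using H[OF i] by blast
  have FF: "Fib (rep_module R OC (lcosets (H i))) orb1 = ?F i" by (simp add: rep_module_eq)
  have e: "s orb1 p i \<oplus>\<^bsub>?F i\<^esub> b i = ac (rep_module R OC (lcosets (H i))) g (b i)"
  proof (rule orb1_eqI[OF Hi])
  show "s orb1 p i \<oplus>\<^bsub>?F i\<^esub> b i : carrier (?F i)" by (rule F.a_closed[OF sF[OF p i] bF])
  show "ac (rep_module R OC (lcosets (H i))) g (b i) : carrier (?F i)"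
  unfolding ac_def FF[symmetric]
  by (rule R.linear_mapsD(1)[OF cat_moduleD(2)[OF rep_cat_module[OF Ho] o o rho_lin[OF g]]]) (unfold FF, rule bF)
  fix x assume x: "x : carrier G"
  have "ac (rep_module R OC (lcosets (H i))) g (b i) (kx (H i) x) = b i (kx (H i) (inv g \<otimes> x))"
  by (rule hat_act[OF Hi x g bF])
  also have "... = v i (inv g \<otimes> x)" unfolding b_def restrict_apply'[OF i] by (rule fh2[OF i]) (use x g in simp)
  also have "... = S p i x \<oplus>\<^bsub>R\<^esub> v i x" by (rule eq[rule_format, OF i x, symmetric])
  also have "... = (s orb1 p i \<oplus>\<^bsub>?F i\<^esub> b i) (kx (H i) x)"
  unfolding R.free_mod_add S_def using fh(2)[OF i x] i by (simp add: b_def)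
  finally show "(s orb1 p i \<oplus>\<^bsub>?F i\<^esub> b i) (kx (H i) x) = ac (rep_module R OC (lcosets (H i))) g (b i) (kx (H i) x)" by (rule sym)
  qed
  have l: "(s orb1 p \<oplus>\<^bsub>Fib ?D orb1\<^esub> b) i = s orb1 p i \<oplus>\<^bsub>Fib (rep_module R OC (z i)) orb1\<^esub> b i"
  using i by (simp add: direct_sum_simps(1) direct_sum_mod_def)
  have rr: "Act ?D orb1 orb1 (frag_of (rho g)) b i = Act (rep_module R OC (z i)) orb1 orb1 (frag_of (rho g)) (b i)"
  using i by (simp add: direct_sum_simps(2))
  show ?thesis unfolding l rr zi FF using e unfolding ac_def .
  next
  case False
  then show ?thesis by (simp add: direct_sum_simps direct_sum_mod_def)
  qed
  qed
  then have "r orb1 (s orb1 p \<oplus>\<^bsub>Fib ?D orb1\<^esub> b) = r orb1 (Act ?D orb1 orb1 (frag_of (rho g)) b)" by (rule arg_cong[of _ _ "r orb1"])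
  then show ?thesis
  unfolding R.linear_mapsD(2)[OF rl sD[OF p] b] rs[OF o p] cat_module_homD(2)[OF r o o rho_lin[OF g] b] ac_def .
  qed
  show "\<exists>w\<in>carrier ?P. \<forall>g\<in>carrier G. \<forall>p\<in>carrier ?P.
  (\<forall>i\<in>I. \<forall>x\<in>carrier G. S p i x \<oplus>\<^bsub>R\<^esub> v i x = v i (inv g \<otimes> x)) --> p \<oplus>\<^bsub>?P\<^esub> w = ac P g w"
  proof (rule bexI[OF _ w], intro ballI impI)
  fix g p assume "g : carrier G" "p : carrier ?P" "\<forall>i\<in>I. \<forall>x\<in>carrier G. S p i x \<oplus>\<^bsub>R\<^esub> v i x = v i (inv g \<otimes> x)"
  then show "p \<oplus>\<^bsub>?P\<^esub> ?w = ac P g ?w" by (rule main)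
  qed
 qed
 then show ?thesis by blast
qed

end

section \<open>Invariant elements and inner derivations\<close>

context coordinates
begin

abbreviation "PX \<equiv> Fib P orb1"

lemma transitive: assumes "x : carrier G" "y : carrier G" obtains g where "g : carrier G" "inv g \<otimes> x = y"
proof (rule that[of "x \<otimes> inv y"])
 show "inv (x \<otimes> inv y) \<otimes> x = y" using assms by (simp add: inv_mult_group m_assoc)
qed (use assms in simp)

text \<open>The coordinates of a fixed element are constant functions on \<open>G\<close>, and a
  constant of finite support on an infinite group is zero.\<close>

lemma invariant_zero:
 assumes inf: "infinite (carrier G)" and p: "p : carrier PX" and fx: "!!g. g : carrier G ==> ac P g p = p"
 shows "p = \<zero>\<^bsub>PX\<^esub>"
proof (rule S_zero[OF p])
 fix i x assume i: "i : I" and x: "x : carrier G"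
 show "S p i x = \<zero>\<^bsub>R\<^esub>"
 proof (rule ccontr)
  assume n: "S p i x ~= \<zero>\<^bsub>R\<^esub>"
  have "S p i y = S p i x" if y: "y : carrier G" for y
  using x y
  proof (rule transitive)
  fix g assume g: "g : carrier G" "inv g \<otimes> x = y"
  show ?thesis using S_ac[OF p i x g(1)] unfolding fx[OF g(1)] g(2) by (rule sym)
  qed
  then have "{y : carrier G. S p i y ~= \<zero>\<^bsub>R\<^esub>} = carrier G" using n by auto
  then show False using S_supp[OF p i] inf by simp
 qed
qed

text \<open>On all functions \<open>G \<rightarrow> R\<close> the derivation is inner, and if almost invariant functions are almost
  constant, then the functions can be corrected by constants to have finite support. If infinitely
  many of them were nonzero, then \<open>G\<close> would be an increasing union of finite stabilisers.\<close>

lemma derivation_inner: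
 assumes inf: "infinite (carrier G)" and one: "\<one>\<^bsub>R\<^esub> ~= \<zero>\<^bsub>R\<^esub>"
  and triv: "!!f. f : almost_inv R G ==> almost_const R G f"
  and p: "!!g. g : carrier G ==> p g : carrier PX"
  and acp: "!!g h. [|g : carrier G; h : carrier G|] ==> ac P g (p h) : carrier PX"
  and der: "!!g h. [|g : carrier G; h : carrier G|] ==> p (g \<otimes> h) = p g \<oplus>\<^bsub>PX\<^esub> ac P g (p h)"
 shows "\<exists>w\<in>carrier PX. \<forall>g\<in>carrier G. p g \<oplus>\<^bsub>PX\<^esub> w = ac P g w"
proof -
 define D where "D i g x = S (p g) i x" for i g x
 have Dc: "D i g x : carrier R" if "i : I" "g : carrier G" for i g x unfolding D_def by (rule S_in[OF p[OF that(2)] that(1)])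
 \<comment> \<open>The potential of the derivation: in
   \<open>D i g x \<oplus> v i x = v i (inv g \<otimes> x)\<close> take \<open>g = x\<close> and
   normalise \<open>v i \<one>\<close> to zero.\<close>
 define v where "v i x = \<ominus>\<^bsub>R\<^esub> D i x x" for i x
 have vc: "v i x : carrier R" if "i : I" "x : carrier G" for i x unfolding v_def using Dc that by simp
 have ring_id: "\<ominus>\<^bsub>R\<^esub> b = a \<oplus>\<^bsub>R\<^esub> \<ominus>\<^bsub>R\<^esub> (a \<oplus>\<^bsub>R\<^esub> b)" if "a : carrier R" "b : carrier R" for a b
  using that by (simp add: R.minus_add R.r_neg2)
 have vD: "v i (inv g \<otimes> x) = D i g x \<oplus>\<^bsub>R\<^esub> v i x" if i: "i : I" and x: "x : carrier G" and g: "g : carrier G" for i x g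
 proof -
  let ?y = "inv g \<otimes> x"
  have y: "?y : carrier G" using x g by simp
  have "p x = p g \<oplus>\<^bsub>PX\<^esub> ac P g (p ?y)" using der[OF g y] x g by (simp add: m_assoc[symmetric])
  then have "D i x x = D i g x \<oplus>\<^bsub>R\<^esub> D i ?y ?y"
  unfolding D_def using S_add[OF p[OF g] acp[OF g y] i] S_ac[OF p[OF y] i x g] by simp
  then show ?thesis unfolding v_def using ring_id[OF Dc[OF i g] Dc[OF i y]] by simp
 qed
 have vAI: "v i : almost_inv R G" if i: "i : I" for i
 proof (rule AI_I)
  fix g assume g: "g : carrier G"
  have "{x : carrier G. \<not> v i (g \<otimes> x) = v i x} \<subseteq> {x : carrier G. S (p (inv g)) i x ~= \<zero>\<^bsub>R\<^esub>}"
  proof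
  fix x assume x: "x : {x : carrier G. \<not> v i (g \<otimes> x) = v i x}"
  then have "v i (g \<otimes> x) = D i (inv g) x \<oplus>\<^bsub>R\<^esub> v i x" using vD[OF i, of x "inv g"] g by simp
  then show "x : {x : carrier G. S (p (inv g)) i x ~= \<zero>\<^bsub>R\<^esub>}" using x vc[OF i] by (auto simp: D_def)
  qed
  moreover have "finite {x : carrier G. S (p (inv g)) i x ~= \<zero>\<^bsub>R\<^esub>}" by (rule S_supp[OF p i]) (use g in simp)
  ultimately show "eventually (%x. v i (g \<otimes> x) = v i x) (cofin G)" unfolding eventually_cofin by (rule finite_subset)
 qed (rule vc[OF i])
 have "\<forall>i\<in>I. EX c. c : carrier R & eventually (%x. v i x = c) (cofin G)"
  using triv[OF vAI] unfolding almost_const_def by blast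
 then have "EX c. \<forall>i\<in>I. c i : carrier R & eventually (%x. v i x = c i) (cofin G)" by (rule bchoice)
 then obtain c where c: "!!i. i : I ==> c i : carrier R" "!!i. i : I ==> eventually (%x. v i x = c i) (cofin G)" by blast
 \<comment> \<open>Subtracting a constant keeps the equation for the derivation and leaves a
   function of finite support.\<close>
 define u where "u i x = v i x \<ominus>\<^bsub>R\<^esub> c i" for i x
 have uc: "u i x : carrier R" if "i : I" "x : carrier G" for i x unfolding u_def using vc c(1) that by simp
 have u_ev: "eventually (%x. u i x = \<zero>\<^bsub>R\<^esub>) (cofin G)" if i: "i : I" for i
  using c(2)[OF i] by (rule eventually_mono) (use c(1)[OF i] in "simp add: u_def R.minus_eq R.r_neg")
 have u_fin: "finite {x : carrier G. u i x ~= \<zero>\<^bsub>R\<^esub>}" if "i : I" for i using u_ev[OF that] unfolding eventually_cofin .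
 have uD: "D i g x \<oplus>\<^bsub>R\<^esub> u i x = u i (inv g \<otimes> x)" if i: "i : I" and x: "x : carrier G" and g: "g : carrier G" for i x g
  unfolding u_def vD[OF that] using Dc[OF i g] vc[OF i x] c(1)[OF i] by (simp add: R.minus_eq R.a_assoc)
 \<comment> \<open>Since the derivation is invariant under \<open>h\<close> on the right, the
   difference between \<open>u i (x \<otimes> h)\<close> and \<open>u i x\<close> is the same at all
   points. Far away both terms vanish.\<close>
 have u_H: "u i (x \<otimes> h) = u i x" if i: "i : I" and x: "x : carrier G" and h: "h : H i" for i x h
 proof -
  have hG: "h : carrier G" using subgroup.subset[OF H_subgroup[OF i]] h by (rule subsetD)
  have "eventually (%y. u i y = \<zero>\<^bsub>R\<^esub> & u i (y \<otimes> h) = \<zero>\<^bsub>R\<^esub>) (cofin G)"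
  using u_ev[OF i] eventually_cofin_right[OF u_ev[OF i] hG] by (rule eventually_conj)
  then obtain y where y: "y : carrier G" "u i y = \<zero>\<^bsub>R\<^esub> & u i (y \<otimes> h) = \<zero>\<^bsub>R\<^esub>"
  using eventually_cofin_happens[OF inf subset_refl] by blast
  obtain g where g: "g : carrier G" "inv g \<otimes> x = y" using x y(1) by (rule transitive)
  have "D i g (x \<otimes> h) \<oplus>\<^bsub>R\<^esub> u i (x \<otimes> h) = u i (y \<otimes> h)"
  using uD[OF i m_closed[OF x hG] g(1)] g x hG by (simp add: m_assoc[symmetric])
  moreover have "D i g x \<oplus>\<^bsub>R\<^esub> u i x = u i y" using uD[OF i x g(1)] g(2) by simp
  moreover have "D i g (x \<otimes> h) = D i g x" unfolding D_def by (rule S_H[OF p[OF g(1)] i x h])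
  ultimately have "D i g x \<oplus>\<^bsub>R\<^esub> u i (x \<otimes> h) = D i g x \<oplus>\<^bsub>R\<^esub> u i x" using y(2) by simp
  then have "\<ominus>\<^bsub>R\<^esub> D i g x \<oplus>\<^bsub>R\<^esub> (D i g x \<oplus>\<^bsub>R\<^esub> u i (x \<otimes> h)) = \<ominus>\<^bsub>R\<^esub> D i g x \<oplus>\<^bsub>R\<^esub> (D i g x \<oplus>\<^bsub>R\<^esub> u i x)" by (rule arg_cong)
  then show ?thesis unfolding R.r_neg1[OF Dc[OF i g(1)] uc[OF i m_closed[OF x hG]]] R.r_neg1[OF Dc[OF i g(1)] uc[OF i x]] .
 qed
 have "finite {i : I. \<exists>x\<in>carrier G. u i x ~= \<zero>\<^bsub>R\<^esub>}"
 proof (rule ccontr)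
  assume "infinite {i : I. \<exists>x\<in>carrier G. u i x ~= \<zero>\<^bsub>R\<^esub>}"
  then obtain e :: "nat => 'i" where e: "inj e" "range e \<subseteq> {i : I. \<exists>x\<in>carrier G. u i x ~= \<zero>\<^bsub>R\<^esub>}"
  using infinite_countable_subset by blast
  have eI: "e n : I" and ex: "\<exists>x\<in>carrier G. u (e n) x ~= \<zero>\<^bsub>R\<^esub>" for n using e(2) by blast+
  \<comment> \<open>The elements that fix all \<open>u (e n)\<close> with \<open>n \<ge> N\<close>.
    This subgroup is finite because it permutes the nonempty finite support of
    \<open>u (e N)\<close>; the subgroups exhaust \<open>G\<close> because each
    \<open>p (inv g)\<close> has finitely many nonzero coordinates.\<close>
  define B where "B N = {g : carrier G. \<forall>n\<ge>N. \<forall>x\<in>carrier G. u (e n) (g \<otimes> x) = u (e n) x}" for N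
  have BG: "g : carrier G" and BD: "[|n >= N; x : carrier G|] ==> u (e n) (g \<otimes> x) = u (e n) x" if "g : B N" for g N n x
  using that unfolding B_def by auto
  have fin: "finite (B N)" for N
  proof -
  obtain x where x: "x : carrier G" "u (e N) x ~= \<zero>\<^bsub>R\<^esub>" using ex by blast
  have "B N \<subseteq> (%y. y \<otimes> inv x) ` {y : carrier G. u (e N) y ~= \<zero>\<^bsub>R\<^esub>}"
  proof
  fix g assume g: "g : B N"
  have "g = g \<otimes> x \<otimes> inv x" using BG[OF g] x(1) by (simp add: m_assoc)
  moreover have "g \<otimes> x : {y : carrier G. u (e N) y ~= \<zero>\<^bsub>R\<^esub>}" using BD[OF g order_refl x(1)] BG[OF g] x by simp
  ultimately show "g : (%y. y \<otimes> inv x) ` {y : carrier G. u (e N) y ~= \<zero>\<^bsub>R\<^esub>}" by (rule image_eqI)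
  qed
  then show ?thesis by (rule finite_subset) (rule finite_imageI[OF u_fin[OF eI]])
  qed
  have sub: "subgroup (B N) G" for N
  proof
  show "B N \<subseteq> carrier G" using BG by blast
  show "\<one> : B N" by (simp add: B_def)
  fix g assume g: "g : B N"
  have "u (e n) (inv g \<otimes> x) = u (e n) x" if "n >= N" "x : carrier G" for n x
  using BD[OF g that(1), of "inv g \<otimes> x"] that(2) BG[OF g] by (simp add: r_cancel)
  then show "inv g : B N" using BG[OF g] by (simp add: B_def)
  fix h assume h: "h : B N"
  have "u (e n) (g \<otimes> h \<otimes> x) = u (e n) x" if "n >= N" "x : carrier G" for n x
  using BD[OF g that(1), of "h \<otimes> x"] BD[OF h that] that(2) BG[OF g] BG[OF h] by (simp add: m_assoc)
  then show "g \<otimes> h : B N" using BG[OF g] BG[OF h] by (simp add: B_def)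
  qed
  have mono: "B n \<subseteq> B (Suc n)" for n unfolding B_def by auto
  have un: "(\<Union>n. B n) = carrier G"
  proof (intro equalityI subsetI)
  fix g assume g: "g : carrier G"
  have "finite (e -` {i : I. \<exists>x\<in>carrier G. S (p (inv g)) i x ~= \<zero>\<^bsub>R\<^esub>})"
  by (rule finite_vimageI[OF S_fin[OF p[OF inv_closed[OF g]]] e(1)])
  then have "EX N. \<forall>n\<in>e -` {i : I. \<exists>x\<in>carrier G. S (p (inv g)) i x ~= \<zero>\<^bsub>R\<^esub>}. n < N"
  by (rule finite_nat_set_iff_bounded[THEN iffD1])
  then obtain N where N0: "\<forall>n\<in>e -` {i : I. \<exists>x\<in>carrier G. S (p (inv g)) i x ~= \<zero>\<^bsub>R\<^esub>}. n < N" by (rule exE)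
  note N = bspec[OF N0]
  have "u (e n) (g \<otimes> x) = u (e n) x" if n: "n >= N" and x: "x : carrier G" for n x
  proof -
  have "D (e n) (inv g) x = \<zero>\<^bsub>R\<^esub>" 
  proof (rule ccontr)
  assume "D (e n) (inv g) x ~= \<zero>\<^bsub>R\<^esub>"
  then have "S (p (inv g)) (e n) x ~= \<zero>\<^bsub>R\<^esub>" unfolding D_def .
  then have ne: "\<exists>x\<in>carrier G. S (p (inv g)) (e n) x ~= \<zero>\<^bsub>R\<^esub>" using x by (rule bexI)
  have "e n : {i : I. \<exists>x\<in>carrier G. S (p (inv g)) i x ~= \<zero>\<^bsub>R\<^esub>}"
  by (rule CollectI, rule conjI, rule eI, rule ne)
  then have "n : e -` {i : I. \<exists>x\<in>carrier G. S (p (inv g)) i x ~= \<zero>\<^bsub>R\<^esub>}" by (rule vimageI2)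
  then have "n < N" by (rule N)
  then show False using n by simp
  qed
  then show ?thesis using uD[OF eI x inv_closed[OF g], of n] g uc[OF eI x, of n] by simp
  qed
  then show "g : (\<Union>n. B n)" unfolding B_def using g by blast
  qed (use BG in blast)
  obtain l :: "'g => nat" where l: "infinite (l ` carrier G)"
  "!!Q. (%x. if Q (l x) then \<one>\<^bsub>R\<^esub> else \<zero>\<^bsub>R\<^esub>) : almost_inv R G"
  using AI_level[OF fin sub mono un] inf by blast
  obtain f :: "nat => nat" where f: "inj f" "range f \<subseteq> l ` carrier G"
  using infinite_countable_subset[OF l(1)] by blast
  \<comment> \<open>Levels with even and with odd index in the sequence \<open>f\<close>: the
    indicator of the even ones takes both values infinitely often, so it is not almost
    constant.\<close>
  define X where "X j = {x : carrier G. EX k. l x = f (2 * k + j)}" for j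
  have X_inf: "infinite (X j)" for j
  proof
  assume "finite (X j)"
  then have fl: "finite (l ` X j)" by (rule finite_imageI)
  have "range (%k. f (2 * k + j)) \<subseteq> l ` X j"
  proof
  fix y assume "y : range (%k. f (2 * k + j))"
  then obtain k where k: "y = f (2 * k + j)" by (rule rangeE)
  then have "y : l ` carrier G" using f(2) by blast
  then obtain x where "y = l x" "x : carrier G" by (rule imageE)
  then show "y : l ` X j" using k unfolding X_def by blast
  qed
  then have "finite (range (%k. f (2 * k + j)))" using fl by (rule finite_subset)
  moreover have "inj (%k. f (2 * k + j))"
  proof (rule injI)
  fix a b assume "f (2 * a + j) = f (2 * b + j)"
  then have "2 * a + j = 2 * b + j" by (rule injD[OF f(1)])
  then show "a = b" by simp
  qed
  ultimately show False using finite_imageD infinite_UNIV_nat by blast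
  qed
  obtain c0 where c0: "eventually (%x. (if EX k. l x = f (2 * k) then \<one>\<^bsub>R\<^esub> else \<zero>\<^bsub>R\<^esub>) = c0) (cofin G)"
  using triv[OF l(2)[of "%y. EX k. y = f (2 * k)"]] unfolding almost_const_def by blast
  have XG: "X j \<subseteq> carrier G" for j unfolding X_def by blast
  obtain x where x: "x : X 0" "(if EX k. l x = f (2 * k) then \<one>\<^bsub>R\<^esub> else \<zero>\<^bsub>R\<^esub>) = c0"
  using eventually_cofin_happens[OF X_inf XG c0] by blast
  obtain y where y: "y : X 1" "(if EX k. l y = f (2 * k) then \<one>\<^bsub>R\<^esub> else \<zero>\<^bsub>R\<^esub>) = c0"
  using eventually_cofin_happens[OF X_inf XG c0] by blast
  have "EX k. l x = f (2 * k)" using x(1) unfolding X_def by auto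
  then have c1: "c0 = \<one>\<^bsub>R\<^esub>" using x(2) by simp
  obtain k where k: "l y = f (2 * k + 1)" using y(1) unfolding X_def by blast
  have "\<not> (EX k. l y = f (2 * k))"
  proof
  assume "EX k. l y = f (2 * k)"
  then obtain k' where "l y = f (2 * k')" by (rule exE)
  then have "f (2 * k + 1) = f (2 * k')" unfolding k .
  then have "2 * k + 1 = 2 * k'" by (rule injD[OF f(1)])
  then show False by presburger
  qed
  then have "c0 = \<zero>\<^bsub>R\<^esub>" using y(2) by simp
  then show False using c1 one by simp
 qed
 from S_inner[of u, OF uc u_fin this u_H]
 obtain w where w: "w : carrier PX" "!!g q. [|g : carrier G; q : carrier PX; \<forall>i\<in>I. \<forall>x\<in>carrier G. S q i x \<oplus>\<^bsub>R\<^esub> u i x = u i (inv g \<otimes> x)|]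
  ==> q \<oplus>\<^bsub>PX\<^esub> w = ac P g w" by blast
 have "p g \<oplus>\<^bsub>PX\<^esub> w = ac P g w" if g: "g : carrier G" for g
  by (rule w(2)[OF g p[OF g]]) (use uD g in "simp add: D_def")
 then show ?thesis using w(1) by blast
qed

end

section \<open>Resolutions of length at most one\<close>

lemma (in abelian_group) eq_if_minus_zero:
 assumes "a : carrier G" "b : carrier G" "a \<ominus> b = \<zero>" shows "a = b"
proof -
 have "a = (a \<ominus> b) \<oplus> b" using assms(1,2) by (simp add: minus_eq a_assoc l_neg)
 then show ?thesis using assms by simp
qed

lemma (in abelian_group) minus_cancel_sum:
 assumes "a : carrier G" "b : carrier G" "c : carrier G" shows "a \<ominus> ((a \<ominus> b) \<oplus> c) = b \<ominus> c"
proof -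
 have "a \<ominus> ((a \<ominus> b) \<oplus> c) = a \<oplus> (\<ominus> a \<oplus> (b \<oplus> \<ominus> c))" using assms by (simp add: minus_eq minus_add a_assoc)
 then show ?thesis using assms by (simp add: r_neg2 minus_eq)
qed

context ring_group
begin

text \<open>The hypothesis \<open>alt\<close> treats length one and length zero together. For a
  preimage \<open>a0\<close> of one under the augmentation, the differences of translates
  \<open>ac (P 0) g a0\<close> and \<open>a0\<close> lift to elements \<open>p g\<close> of the next
  module. In either case \<open>p\<close> is inner, by \<open>derivation_inner\<close> or because
  the module is zero.\<close>

lemma short_resolution:
 fixes P :: "nat => ('g set set, 'g set => 'g set, 'r, 'c) cat_module"
 assumes inf: "infinite (carrier G)" and one: "\<one>\<^bsub>R\<^esub> ~= \<zero>\<^bsub>R\<^esub>"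
  and res: "proj_resolution R OC P d e"
  and zero: "!!i x. [|i > 1; x : Obj OC|] ==> zero_mod (Fib (P i) x)"
  and alt: "(\<forall>f\<in>almost_inv R G. almost_const R G f) \<or> zero_mod (Fib (P 1) orb1)"
 shows False
proof -
 interpret cat_ring R OC by (rule cat_ring_OC)
 note o = orb1_obj
 have proj: "projective R OC (P i)" for i using res unfolding proj_resolution_def by blast
 have cm: "is_cat_module R OC (P i)" for i using proj unfolding projective_def by blast
 have dh: "d 0 : cat_module_hom R OC (P 1) (P 0)" using res unfolding proj_resolution_def by (metis One_nat_def)
 have eh: "e : cat_module_hom R OC (P 0) (const_module R)" using res unfolding proj_resolution_def by blast
 let ?M0 = "Fib (P 0) orb1" and ?M1 = "Fib (P 1) orb1" and ?M2 = "Fib (P 2) orb1"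
 let ?e = "e orb1" and ?d = "d 0 orb1"
 have surj: "?e ` carrier ?M0 = carrier R"
  and ker0: "?d ` carrier ?M1 = {a : carrier ?M0. ?e a = \<zero>\<^bsub>R\<^esub>}"
  and ker1: "d (Suc 0) orb1 ` carrier (Fib (P (0 + 2)) orb1) = {a : carrier (Fib (P (Suc 0)) orb1). ?d a = \<zero>\<^bsub>?M0\<^esub>}"
  using res o unfolding proj_resolution_def by blast+
 interpret M0: Module.module R ?M0 by (rule cat_moduleD(1)[OF cm o])
 interpret M1: Module.module R ?M1 by (rule cat_moduleD(1)[OF cm o])
 interpret RM: Module.module R "regular_mod R" by (rule module_regular)
 have dl: "?d : linear_maps R ?M1 ?M0" by (rule cat_module_homD(1)[OF dh o])
 have el: "?e : linear_maps R ?M0 (regular_mod R)" using cat_module_homD(1)[OF eh o] by (simp add: const_module_def)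
 note dc = R.linear_mapsD(1)[OF dl]
 have rho_lin: "frag_of (rho g) : lin_hom OC orb1 orb1" if "g : carrier G" for g by (rule frag_of_lin_hom[OF rho_in[OF that]])
 have acl: "ac (P i) g : linear_maps R (Fib (P i) orb1) (Fib (P i) orb1)" if "g : carrier G" for i g
  unfolding ac_def by (rule cat_moduleD(2)[OF cm o o rho_lin[OF that]])
 note acc = R.linear_mapsD(1)[OF acl]
 have ac_mult: "ac (P i) (g \<otimes> h) a = ac (P i) g (ac (P i) h a)"
  if "g : carrier G" "h : carrier G" "a : carrier (Fib (P i) orb1)" for i g h a
  using cat_moduleD(5)[OF cm o o o rho_lin[OF that(1)] rho_lin[OF that(2)] that(3)]
  unfolding ac_def lin_comp_of kx_rho[OF triv that(2,1)] .
 have d_ac: "?d (ac (P 1) g a) = ac (P 0) g (?d a)" if "g : carrier G" "a : carrier ?M1" for g a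
  unfolding ac_def by (rule cat_module_homD(2)[OF dh o o rho_lin[OF that(1)] that(2)])
 have e_ac: "?e (ac (P 0) g a) = ?e a" if g: "g : carrier G" and a: "a : carrier ?M0" for g a
  using cat_module_homD(2)[OF eh o o rho_lin[OF g] a] R.linear_mapsD(1)[OF el a] by (simp add: ac_def const_module_def)
 have e_minus: "?e (a \<ominus>\<^bsub>?M0\<^esub> b) = ?e a \<ominus>\<^bsub>regular_mod R\<^esub> ?e b" if "a : carrier ?M0" "b : carrier ?M0" for a b
  by (rule R.linear_maps_minus[OF cat_moduleD(1)[OF cm o] module_regular el that])
 have "\<one>\<^bsub>R\<^esub> : ?e ` carrier ?M0" unfolding surj by simp
 then obtain a0 where a0: "a0 : carrier ?M0" "?e a0 = \<one>\<^bsub>R\<^esub>" by (rule imageE) simp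
 have "\<forall>g\<in>carrier G. EX p. p : carrier ?M1 & ?d p = ac (P 0) g a0 \<ominus>\<^bsub>?M0\<^esub> a0"
 proof
  fix g assume g: "g : carrier G"
  have "?e (ac (P 0) g a0 \<ominus>\<^bsub>?M0\<^esub> a0) = \<zero>\<^bsub>R\<^esub>"
  unfolding e_minus[OF acc[OF g a0(1)] a0(1)] e_ac[OF g a0(1)] a0(2) using RM.r_neg[of "\<one>\<^bsub>R\<^esub>"] by (simp add: RM.minus_eq)
  then have "ac (P 0) g a0 \<ominus>\<^bsub>?M0\<^esub> a0 : ?d ` carrier ?M1" unfolding ker0 using acc[OF g a0(1)] a0(1) by simp
  then obtain p where "ac (P 0) g a0 \<ominus>\<^bsub>?M0\<^esub> a0 = ?d p" "p : carrier ?M1" by (rule imageE)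
  then show "EX p. p : carrier ?M1 & ?d p = ac (P 0) g a0 \<ominus>\<^bsub>?M0\<^esub> a0" by (intro exI[of _ p]) simp
 qed
 then have "EX p. \<forall>g\<in>carrier G. p g : carrier ?M1 & ?d (p g) = ac (P 0) g a0 \<ominus>\<^bsub>?M0\<^esub> a0" by (rule bchoice)
 then obtain p where p: "!!g. g : carrier G ==> p g : carrier ?M1" "!!g. g : carrier G ==> ?d (p g) = ac (P 0) g a0 \<ominus>\<^bsub>?M0\<^esub> a0" by blast
 have "\<exists>w\<in>carrier ?M1. \<forall>g\<in>carrier G. p g \<oplus>\<^bsub>?M1\<^esub> w = ac (P 1) g w"
  using alt
 proof
  assume z: "zero_mod ?M1"
  then have z: "a = \<zero>\<^bsub>?M1\<^esub>" if "a : carrier ?M1" for a using that unfolding zero_mod_def by simp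
  show ?thesis
  proof (intro bexI[of _ "\<zero>\<^bsub>?M1\<^esub>"] ballI)
  fix g assume g: "g : carrier G"
  show "p g \<oplus>\<^bsub>?M1\<^esub> \<zero>\<^bsub>?M1\<^esub> = ac (P 1) g \<zero>\<^bsub>?M1\<^esub>"
  unfolding z[OF acc[OF g M1.zero_closed]] z[OF p(1)[OF g]] by (rule M1.r_zero[OF M1.zero_closed])
  qed (rule M1.zero_closed)
 next
  assume triv: "\<forall>f\<in>almost_inv R G. almost_const R G f"
  obtain I :: "('g set set \<times> 'c) set" and H S where "coordinates R G (P 1) I H S" using projective_coordinates[OF proj] by blast
  then interpret K: coordinates R G "P 1" I H S .
  have inj: "a = b" if a: "a : carrier ?M1" and b: "b : carrier ?M1" and ab: "?d a = ?d b" for a b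
  proof -
  have "?d (a \<ominus>\<^bsub>?M1\<^esub> b) = \<zero>\<^bsub>?M0\<^esub>"
  unfolding R.linear_maps_minus[OF cat_moduleD(1)[OF cm o] cat_moduleD(1)[OF cm o] dl a b] ab M0.minus_eq by (rule M0.r_neg[OF dc[OF b]])
  then have "a \<ominus>\<^bsub>?M1\<^esub> b : d (Suc 0) orb1 ` carrier (Fib (P (0 + 2)) orb1)" unfolding ker1 using M1.minus_closed[OF a b] by simp
  moreover have "carrier (Fib (P (0 + 2)) orb1) = {\<zero>\<^bsub>Fib (P (0 + 2)) orb1\<^esub>}" using zero[of "0 + 2", OF _ o] unfolding zero_mod_def by simp
  moreover have "\<zero>\<^bsub>?M1\<^esub> : d (Suc 0) orb1 ` carrier (Fib (P (0 + 2)) orb1)"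
  unfolding ker1 using R.linear_maps_zero[OF cat_moduleD(1)[OF cm o] cat_moduleD(1)[OF cm o] dl] M1.zero_closed by simp
  ultimately have "a \<ominus>\<^bsub>?M1\<^esub> b = \<zero>\<^bsub>?M1\<^esub>" by auto
  then show ?thesis by (rule M1.eq_if_minus_zero[OF a b])
  qed
  have der: "p (g \<otimes> h) = p g \<oplus>\<^bsub>?M1\<^esub> ac (P 1) g (p h)" if g: "g : carrier G" and h: "h : carrier G" for g h
  proof (rule inj)
  have gh: "g \<otimes> h : carrier G" using g h by simp
  have A: "ac (P 0) g a0 : carrier ?M0" "ac (P 0) h a0 : carrier ?M0" "ac (P 0) g (ac (P 0) h a0) : carrier ?M0"
  using acc g h a0(1) by blast+
  show "p (g \<otimes> h) : carrier ?M1" by (rule p(1)[OF gh])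
  show "p g \<oplus>\<^bsub>?M1\<^esub> ac (P 1) g (p h) : carrier ?M1" by (rule M1.a_closed[OF p(1)[OF g] acc[OF g p(1)[OF h]]])
  have "?d (p g \<oplus>\<^bsub>?M1\<^esub> ac (P 1) g (p h)) = (ac (P 0) g a0 \<ominus>\<^bsub>?M0\<^esub> a0) \<oplus>\<^bsub>?M0\<^esub> (ac (P 0) g (ac (P 0) h a0) \<ominus>\<^bsub>?M0\<^esub> ac (P 0) g a0)"
  unfolding R.linear_mapsD(2)[OF dl p(1)[OF g] acc[OF g p(1)[OF h]]] p(2)[OF g] d_ac[OF g p(1)[OF h]] p(2)[OF h]
  R.linear_maps_minus[OF cat_moduleD(1)[OF cm o] cat_moduleD(1)[OF cm o] acl[OF g] A(2) a0(1)] ..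
  also have "... = (ac (P 0) g (ac (P 0) h a0) \<ominus>\<^bsub>?M0\<^esub> ac (P 0) g a0) \<oplus>\<^bsub>?M0\<^esub> (ac (P 0) g a0 \<ominus>\<^bsub>?M0\<^esub> a0)"
  by (rule M0.a_comm) (use A a0(1) in simp_all)
  also have "... = ac (P 0) g (ac (P 0) h a0) \<ominus>\<^bsub>?M0\<^esub> a0" by (rule M0.minus_add_minus[OF A(3,1) a0(1)])
  also have "... = ?d (p (g \<otimes> h))" unfolding p(2)[OF gh] ac_mult[OF g h a0(1)] ..
  finally show "?d (p (g \<otimes> h)) = ?d (p g \<oplus>\<^bsub>?M1\<^esub> ac (P 1) g (p h))" by (rule sym)
  qed
  show ?thesis
  proof (rule K.derivation_inner[OF inf one])
  show "almost_const R G f" if "f : almost_inv R G" for f using triv that by (rule bspec)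
  show "p g : carrier ?M1" if "g : carrier G" for g by (rule p(1)[OF that])
  show "ac (P 1) g (p h) : carrier ?M1" if "g : carrier G" "h : carrier G" for g h by (rule acc[OF that(1) p(1)[OF that(2)]])
  show "p (g \<otimes> h) = p g \<oplus>\<^bsub>?M1\<^esub> ac (P 1) g (p h)" if "g : carrier G" "h : carrier G" for g h by (rule der[OF that])
  qed
 qed
 then obtain w where w: "w : carrier ?M1" "!!g. g : carrier G ==> p g \<oplus>\<^bsub>?M1\<^esub> w = ac (P 1) g w" by blast
 \<comment> \<open>Correcting \<open>a0\<close> by the boundary of \<open>w\<close> makes it
   invariant and leaves its augmentation one, while \<open>invariant_zero\<close> makes it
   zero.\<close>
 define b where "b = a0 \<ominus>\<^bsub>?M0\<^esub> ?d w"
 have b: "b : carrier ?M0" unfolding b_def using a0(1) dc[OF w(1)] by simp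
 have "ac (P 0) g b = b" if g: "g : carrier G" for g
 proof -
  have "ac (P 0) g b = ac (P 0) g a0 \<ominus>\<^bsub>?M0\<^esub> ac (P 0) g (?d w)"
  unfolding b_def by (rule R.linear_maps_minus[OF cat_moduleD(1)[OF cm o] cat_moduleD(1)[OF cm o] acl[OF g] a0(1) dc[OF w(1)]])
  also have "ac (P 0) g (?d w) = (ac (P 0) g a0 \<ominus>\<^bsub>?M0\<^esub> a0) \<oplus>\<^bsub>?M0\<^esub> ?d w"
  unfolding d_ac[OF g w(1), symmetric] w(2)[OF g, symmetric] R.linear_mapsD(2)[OF dl p(1)[OF g] w(1)] p(2)[OF g] ..
  also have "ac (P 0) g a0 \<ominus>\<^bsub>?M0\<^esub> ... = b"
  unfolding b_def by (rule M0.minus_cancel_sum[OF acc[OF g a0(1)] a0(1) dc[OF w(1)]])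
  finally show ?thesis .
 qed
 moreover obtain I :: "('g set set \<times> 'c) set" and H S where "coordinates R G (P 0) I H S" using projective_coordinates[OF proj] by blast
 ultimately have b0: "b = \<zero>\<^bsub>?M0\<^esub>" using coordinates.invariant_zero[OF _ inf b] by blast
 have "?d w : ?d ` carrier ?M1" using w(1) by (rule imageI)
 then have "?e (?d w) = \<zero>\<^bsub>R\<^esub>" unfolding ker0 by blast
 then have "?e b = \<one>\<^bsub>R\<^esub>"
  unfolding b_def e_minus[OF a0(1) dc[OF w(1)]] a0(2) using RM.a_inv_zero by (simp add: RM.minus_eq)
 moreover have "?e b = \<zero>\<^bsub>R\<^esub>" unfolding b0 using R.linear_maps_zero[OF cat_moduleD(1)[OF cm o] module_regular el] by simp
 ultimately show False using one by simp
qed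

end

text \<open>Extended naturals are well ordered, so a nonempty set of them contains its
  infimum.\<close>

lemma cat_cd_attained:
 fixes C :: "('o, 'k) cat"
 assumes "cat_cd R C = enat n"
 obtains P :: "nat => ('o, 'k, 'r, 'k list => 'r) cat_module" and d e where "proj_resolution R C P d e"
  "!!i x. [|i > n; x : Obj C|] ==> zero_mod (Fib (P i) x)"
proof -
 define A where "A = {enat n | n. \<exists>(P :: nat => ('o, 'k, 'r, 'k list => 'r) cat_module) d e.
  proj_resolution R C P d e & (\<forall>i>n. \<forall>x\<in>Obj C. zero_mod (Fib (P i) x))}"
 have A: "Inf A = enat n" using assms unfolding cat_cd_def A_def .
 then have "A ~= {}" by (auto simp: Inf_enat_def)
 then have "EX x. x : A" and "Inf A = (LEAST x. x : A)" by (auto simp: Inf_enat_def)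
 then have "Inf A : A" using LeastI_ex[of "%x. x : A"] by simp
 then have "enat n : A" unfolding A .
 then have "\<exists>(P :: nat => ('o, 'k, 'r, 'k list => 'r) cat_module) d e.
  proj_resolution R C P d e & (\<forall>i>n. \<forall>x\<in>Obj C. zero_mod (Fib (P i) x))" unfolding A_def by auto
 then show ?thesis using that by blast
qed

section \<open>Bredon dimension of infinite groups and the equivalence\<close>

context ring_group
begin

lemma cat_cd_neq_0: assumes "infinite (carrier G)" "\<one>\<^bsub>R\<^esub> ~= \<zero>\<^bsub>R\<^esub>" shows "cat_cd R OC ~= 0"
proof
 assume "cat_cd R OC = 0"
 then have "cat_cd R OC = enat 0" by (simp add: zero_enat_def)
 then show False
 proof (rule cat_cd_attained)
  fix P :: "nat => ('g set set, 'g set => 'g set, 'r, ('g set => 'g set) list => 'r) cat_module" and d e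
  assume res: "proj_resolution R OC P d e" and zero: "!!i x. [|i > 0; x : Obj OC|] ==> zero_mod (Fib (P i) x)"
  show False by (rule short_resolution[OF assms res zero disjI2[OF zero]]) (simp_all add: orb1_obj)
 qed
qed

lemma cat_cd_neq_1:
 assumes "infinite (carrier G)" "\<one>\<^bsub>R\<^esub> ~= \<zero>\<^bsub>R\<^esub>" "\<forall>f\<in>almost_inv R G. almost_const R G f" shows "cat_cd R OC ~= 1"
proof
 assume "cat_cd R OC = 1"
 then have "cat_cd R OC = enat 1" by (simp add: one_enat_def)
 then show False
 proof (rule cat_cd_attained)
  fix P :: "nat => ('g set set, 'g set => 'g set, 'r, ('g set => 'g set) list => 'r) cat_module" and d e
  assume res: "proj_resolution R OC P d e" and zero: "!!i x. [|i > 1; x : Obj OC|] ==> zero_mod (Fib (P i) x)"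
  show False by (rule short_resolution[OF assms(1,2) res zero disjI1[OF assms(3)]])
 qed
qed

text \<open>Cohomological vanishing is available for the Weyl group of the trivial subgroup, whereas
  \<open>cat_cd_neq_1\<close> concerns functions on \<open>G\<close>.\<close>

lemma almost_const_iso:
 fixes W :: "('h, 'z) monoid_scheme"
 assumes W: "group W" and phi: "phi : iso G W" and triv: "!!f. f : almost_inv R W ==> almost_const R W f"
  and f: "f : almost_inv R G"
 shows "almost_const R G f"
proof -
 interpret W: ring_group R W by (intro ring_group.intro R.is_cring W)
 have bij: "bij_betw phi (carrier G) (carrier W)" and hom: "!!x y. [|x : carrier G; y : carrier G|] ==> phi (x \<otimes> y) = phi x \<otimes>\<^bsub>W\<^esub> phi y"
  using phi by (auto simp: iso_def hom_def)
 have inj: "inj_on phi (carrier G)" and surj: "phi ` carrier G = carrier W" using bij by (auto simp: bij_betw_def)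
 define psi where "psi = inv_into (carrier G) phi"
 have psi: "psi (phi x) = x" if "x : carrier G" for x unfolding psi_def by (rule inv_into_f_f[OF inj that])
 have ev: "eventually Q (cofin W) \<longleftrightarrow> eventually (%x. Q (phi x)) (cofin G)" for Q
 proof -
  have "{y : carrier W. \<not> Q y} = phi ` {x : carrier G. \<not> Q (phi x)}" unfolding surj[symmetric] by blast
  moreover have "inj_on phi {x : carrier G. \<not> Q (phi x)}" by (rule inj_on_subset[OF inj]) blast
  ultimately show ?thesis unfolding eventually_cofin by (simp add: finite_image_iff)
 qed
 have W_elem: "\<exists>x\<in>carrier G. y = phi x" if "y : carrier W" for y using that unfolding surj[symmetric] by blast
 have "(%y. f (psi y)) : almost_inv R W"
 proof (rule W.AI_I)
  show "f (psi y) : carrier R" if "y : carrier W" for y using W_elem[OF that] psi AI_closed[OF f] by auto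
  fix h assume "h : carrier W"
  then obtain g where g: "g : carrier G" "h = phi g" using W_elem by blast
  show "eventually (%y. f (psi (h \<otimes>\<^bsub>W\<^esub> y)) = f (psi y)) (cofin W)"
  unfolding ev using eventually_conj[OF AI_ev[OF f g(1)] eventually_cofin_carrier]
  proof (rule eventually_mono)
  fix x assume x: "f (g \<otimes> x) = f x & x : carrier G"
  then have "psi (h \<otimes>\<^bsub>W\<^esub> phi x) = g \<otimes> x" unfolding g(2) using hom[OF g(1), of x, symmetric] psi[of "g \<otimes> x"] g(1) by simp
  then show "f (psi (h \<otimes>\<^bsub>W\<^esub> phi x)) = f (psi (phi x))" using x psi by simp
  qed
 qed
 then obtain c where c: "c : carrier R" "eventually (%x. f (psi (phi x)) = c) (cofin G)"
  using triv unfolding almost_const_def ev by blast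
 have "eventually (%x. f x = c) (cofin G)"
  using eventually_conj[OF c(2) eventually_cofin_carrier] by (rule eventually_mono) (use psi in auto)
 then show ?thesis unfolding almost_const_def using c(1) by blast
qed

lemma virt_cyclic_iso:
 assumes W: "group W" and phi: "phi : iso G W" and vc: "virt_cyclic W" shows "virt_cyclic G"
proof -
 interpret W: group W by (rule W)
 have psi: "inv_into (carrier G) phi : iso W G" by (rule iso_set_sym[OF phi])
 then have bij: "bij_betw (inv_into (carrier G) phi) (carrier W) (carrier G)" and hom: "inv_into (carrier G) phi : hom W G"
  by (auto simp: iso_def)
 show ?thesis
 proof (rule virt_cyclic_image[OF _ _ _ vc])
  show "group_hom W G (inv_into (carrier G) phi)" by (intro group_hom.intro group_hom_axioms.intro W is_group hom)
  show "inv_into (carrier G) phi ` carrier W = carrier G" using bij by (simp add: bij_betw_def)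
  show "finite (kernel W G (inv_into (carrier G) phi))"
  proof (rule finite_imageD)
  show "finite (inv_into (carrier G) phi ` kernel W G (inv_into (carrier G) phi))"
  by (rule finite_subset[of _ "{\<one>}"]) (auto simp: kernel_def)
  show "inj_on (inv_into (carrier G) phi) (kernel W G (inv_into (carrier G) phi))"
  by (rule inj_on_subset[OF bij_betw_imp_inj_on[OF bij]]) (auto simp: kernel_def)
  qed
 qed
qed

theorem virt_cyclic_if_duality:
 assumes inf: "infinite (carrier G)" and one: "\<one>\<^bsub>R\<^esub> ~= \<zero>\<^bsub>R\<^esub>"
  and bpd: "bredon_poincare_duality R G" and cd: "bredon_cd R G = 1"
 shows "virt_cyclic G"
proof -
 let ?W = "weyl_group G {\<one>}" and ?phi = "%x. {x}"
 have W: "group ?W" by (rule group_weyl_group[OF triv])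
 have phi: "?phi : iso G ?W" by (rule weyl_group_trivial)
 interpret W: ring_group R ?W by (intro ring_group.intro R.is_cring W)
 have infW: "infinite (carrier ?W)" using phi inf bij_betw_finite by (auto simp: iso_def)
 obtain d where d: "cohomology_concentrated R ?W d" using bpd triv unfolding bredon_poincare_duality_def by blast
 have "d = 1"
 proof (rule ccontr)
  assume "d ~= 1"
  then have "zero_mod (cohomology_group_ring R ?W 1)" using d unfolding cohomology_concentrated_def by metis
  then have "almost_const R G f" if "f : almost_inv R G" for f
  using almost_const_iso[OF W phi W.AI_trivial that] by blast
  then show False using cat_cd_neq_1[OF inf one] cd unfolding bredon_cd_def by blast
 qed
 then have "mod_isomorphic R (cohomology_group_ring R ?W 1) (regular_mod R)" using d unfolding cohomology_concentrated_def by blast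
 then have "virt_cyclic ?W" by (rule W.virt_cyclic_if_H1_free[OF infW one])
 then show ?thesis by (rule virt_cyclic_iso[OF W phi])
qed

text \<open>A Weyl group of a finite subgroup has its cohomology in degree 1 if it is virtually
  infinite cyclic and in degree 0 if it is finite. The line bounds the dimension by one, and
  \<open>cat_cd_neq_0\<close> excludes zero.\<close>

theorem duality_if_virt_cyclic:
 assumes inf: "infinite (carrier G)" and one: "\<one>\<^bsub>R\<^esub> ~= \<zero>\<^bsub>R\<^esub>" and vc: "virt_cyclic G"
 shows "bredon_poincare_duality R G" "bredon_cd R G = 1"
proof -
 note fp = virt_cyclic_FP[OF vc R.is_cring one]
 have "EX d. cohomology_concentrated R (weyl_group G H) d" if H: "subgroup H G" "finite H" for H
 proof -
  interpret W: ring_group R "weyl_group G H" by (intro ring_group.intro R.is_cring group_weyl_group[OF H(1)])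
  show ?thesis using weyl_group_cases[OF vc H]
  proof
  assume "virt_cyclic (weyl_group G H)"
  then show ?thesis using W.virt_cyclic_concentrated by blast
  next
  assume "finite (carrier (weyl_group G H))"
  then show ?thesis using W.finite_concentrated by blast
  qed
 qed
 then show "bredon_poincare_duality R G" unfolding bredon_poincare_duality_def using fp(1) by blast
 obtain n where n: "cat_cd R OC = enat n" "n <= 1" using fp(2) enat_ile[of "cat_cd R OC" 1] by (auto simp: one_enat_def)
 moreover have "n ~= 0" using cat_cd_neq_0[OF inf one] n(1) by (auto simp: zero_enat_def)
 ultimately have "n = 1" by simp
 then show "bredon_cd R G = 1" unfolding bredon_cd_def n(1) by (simp add: one_enat_def)
qed

end

lemma (in group) poincare_duality_if_infinite_cyclic:
 assumes "infinite_cyclic G" "cring R" "\<one>\<^bsub>R\<^esub> ~= \<zero>\<^bsub>R\<^esub>"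
 shows "poincare_duality R G 1"
proof -
 obtain x where x: "x : carrier G" "carrier G = range (\<lambda>n::int. x [^] n)" "infinite (carrier G)"
  using assms(1) cyclic_group by (auto simp: infinite_cyclic_def)
 have ord: "n = 0" if "x [^] (n::int) = \<one>" for n using infinite_order[OF x(1) _ that] x(2,3) by simp
 interpret inf_cyclic G x by (intro inf_cyclic.intro inf_cyclic_axioms.intro is_group x(1)) (rule ord)
 interpret ring_group R G by (intro ring_group.intro assms(2) is_group)
 have "virt_cyclic G"
 proof (rule virt_cyclicI[of x _ "{\<one>}"])
  fix y assume "y : carrier G"
  then obtain n :: int where "y = x [^] n" unfolding x(2) by (rule rangeE)
  then show "\<exists>n::int. \<exists>f\<in>{\<one>}. y = x [^] n \<otimes> f" by (intro exI[of _ n]) simp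
 qed (use x(1) ord in simp_all)
 then show ?thesis unfolding poincare_duality_def
  using virt_cyclic_concentrated group_cat_FP[OF x(2) assms(2,3)] by blast
qed

theorem mainTheorem19:
  fixes R :: "('r, 'x) ring_scheme" and G :: "('g, 'y) monoid_scheme"
  assumes "cring R" and "\<one>\<^bsub>R\<^esub> \<noteq> \<zero>\<^bsub>R\<^esub>"
    and "group G" and "infinite (carrier G)"
  shows "(bredon_poincare_duality R G \<and> bredon_cd R G = 1 \<longleftrightarrow> virtually infinite_cyclic G)
       \<and> (virtually infinite_cyclic G \<longleftrightarrow> virtually (\<lambda>\<Gamma>. poincare_duality R \<Gamma> 1) G)"
proof -
 interpret ring_group R G by (intro ring_group.intro assms)
 have "virtually (%\<Gamma>. poincare_duality R \<Gamma> 1) G" if v: "virtually infinite_cyclic G"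
 proof -
  obtain H where H: "subgroup H G" "finite (rcosets\<^bsub>G\<^esub> H)" "infinite_cyclic (G\<lparr>carrier := H\<rparr>)"
  using v unfolding virtually_def by blast
  have "poincare_duality R (G\<lparr>carrier := H\<rparr>) 1"
  by (rule group.poincare_duality_if_infinite_cyclic[OF subgroup_imp_group[OF H(1)] H(3) assms(1,2)])
  then show ?thesis unfolding virtually_def using H(1,2) by blast
 qed
 moreover have "virt_cyclic G" if v: "virtually (%\<Gamma>. poincare_duality R \<Gamma> 1) G"
 proof -
  obtain H where H: "subgroup H G" "finite (rcosets\<^bsub>G\<^esub> H)" "poincare_duality R (G\<lparr>carrier := H\<rparr>) 1"
  using v unfolding virtually_def by blast
  interpret H: ring_group R "G\<lparr>carrier := H\<rparr>" by (intro ring_group.intro assms(1) subgroup_imp_group[OF H(1)])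
  have "infinite H" by (rule infinite_finite_index[OF assms(4) H(1,2)])
  then have "virt_cyclic (G\<lparr>carrier := H\<rparr>)"
  using H.virt_cyclic_if_H1_free[OF _ assms(2)] H(3) unfolding poincare_duality_def cohomology_concentrated_def by simp
  then show ?thesis by (rule virt_cyclic_finite_index[OF H(1,2)])
 qed
 ultimately show ?thesis
  using virtually_infinite_cyclic_iff virt_cyclic_if_duality[OF assms(4,2)] duality_if_virt_cyclic[OF assms(4,2)] by blast
qed

end
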